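(* Let $X=U/G$ be the resonant square fourfold, with $\mathfrak g=H^0(X,\Theta_X)$, the linear functional $\ell:\mathfrak g\to\mathbb C$, the Čech class $\eta\in H^1(X,\Theta_X)$, and $\xi_1,\xi_2\in G^\vee$ as defined in the context. For $$\alpha=V_1\otimes\xi_1+V_2\otimes\xi_2+s\eta\in H^1(X,\Theta_X)=(\mathfrak g\otimes G^\vee)\oplus\mathbb C\eta,\qquad V_1,V_2\in\mathfrak g,\ s\in\mathbb C,$$ the primary obstruction, with Čech degree placed before group degree, is $$\operatorname{ob}_2(\alpha)=[V_1,V_2]\otimes\xi_1\wedge\xi_2-s\,\eta\otimes\bigl(\ell(V_1)\xi_1+\ell(V_2)\xi_2\bigr)$$ in $H^2(X,\Theta_X)=(\mathfrak g\otimes\Lambda^2G^\vee)\oplus(\mathbb C\eta\otimes G^\vee)$. Consequently $\alpha$ lifts to second order if and only if $$[V_1,V_2]=0,\qquad s\,\ell(V_1)=s\,\ell(V_2)=0 .$$ This full-rank square example has obstructed infinitesimal deformations. Its normalized diagonal family has Kodaira–Spencer rank $8$ and cokernel dimension $11$.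
   Context: The resonant square. Let $q_0=e^{-2\pi}$, coordinates $(x,y,u,v)=(z_1,z_3,z_2,z_4)$ on $\mathbb C^4$, $U=(\mathbb C^2_{x,y}\setminus0)\times(\mathbb C^2_{u,v}\setminus0)$, and let $G=2\pi i\mathbb Z^2$, with generators acting on $U$ by $$g_1(x,y,u,v)=(q_0x,q_0y,u,q_0^2v),\qquad g_2(x,y,u,v)=(x,y,q_0u,q_0v).$$ $X=U/G$ is a compact complex fourfold. It is the LVM manifold (the quotient of $\{[z]\in\mathbb P^6:0\in\operatorname{conv}\{\Lambda_i:z_i\ne0\}\}$ by the $\mathbb C^2$-action $[z_i]\mapsto[e^{\langle\Lambda_i,T\rangle}z_i]$) of the weights $c$, $c+(1,0)$, $c+(0,1)$, $c+iV_j$ ($1\le j\le4$), with $c=(-\frac15-\frac{3i}{100},-\frac15-\frac i{100})$ and $V_1=(1,0)$, $V_2=(0,1)$, $V_3=(1,0)$, $V_4=(2,1)$. Its visible complex is the four-cycle with maximal faces $12,14,23,34$. The normalized diagonal family: $C_0$ is the $4\times2$ matrix with rows $iV_j$; for $C$ in a small polydisk $S\subset\operatorname{Mat}_{4\times2}(\mathbb C)$ about $C_0$ the fibre is the quotient of $U$ by the group generated by $z_i\mapsto e^{2\pi iC_{i\mu}}z_i$, $\mu=1,2$ (so $N=4$, $m=2$, $\dim S=8$); its Kodaira–Spencer map is taken at $C_0$. Global fields: every $V\in\mathfrak g=H^0(X,\Theta_X)$ is uniquely $$V=\Bigl(M\tbinom xy\Bigr)\cdot\tbinom{\partial_x}{\partial_y}+b\,u\partial_u+c\,v\partial_v+P(x,y)\,u\partial_v$$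 with $M\in\operatorname{Mat}_{2\times2}(\mathbb C)$, $b,c\in\mathbb C$, $P$ a homogeneous quadratic polynomial; put $\ell(V)=-\operatorname{tr}M-b+c$. Cohomology conventions. $G^\vee=\operatorname{Hom}_{\mathbb Z}(G,\mathbb C)$ has basis $\xi_1,\xi_2$ dual to the two generators of $G$. $H^\bullet(X,\Theta_X)$ is computed by the total complex of the Koszul complex on the deck generators with coefficients in the normalized Čech complex of $\Theta_U$ for the ordered cover of $U$ by the charts $U_\sigma=\{z\in U:z_j\ne0\text{ for }j\notin\sigma\}$, $\sigma=12,14,23,34$; on Čech degree $a$, $d_{\mathrm{tot}}(c\otimes\omega)=\delta_{\check C}c\otimes\omega+(-1)^a\sum_\mu(g_\mu^*-1)c\otimes\xi_\mu\wedge\omega$, where $g^*V=(dg)^{-1}(V\circ g)$. Put $W=\frac{v}{xy}\partial_u$; assign the four charts the scalars $0,0,1,1$ and let $c_{ij}$ be the value at $j$ minus the value at $i$. Then $\eta$ is the class of the Čech one-cocycle $(c_{ij}W)$. A class $V\otimes\xi_\mu$ or $V\otimes\xi_1\wedge\xi_2$ with $V\in\mathfrak g$ is represented by $V$ in Čech degree $0$; $\eta\otimes\xi_\mu$ is represented by $(c_{ij}W)\otimes\xi_\mu$. The displayed decompositions of $H^1$ and $H^2$ hold with these representatives. Primary obstruction. $\operatorname{ob}_2(\alpha)\in H^2(X,\Theta_X)$ is the obstruction to lifting the first-order deformation $\alpha$ from $\mathbb C[\epsilon]/(\epsilon^2)$ to $\mathbb C[\epsilon]/(\epsilon^3)$,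 normalized by $\operatorname{ob}_2(\alpha)=\frac12[\alpha,\alpha]$. Explicitly, write deck maps and chart transitions to second order as $F_{\mu,j}=g_\mu\circ\exp(-\epsilon V_\mu-\epsilon^2A_{\mu,j})$ on chart $j$ and $T_{ij}=\exp(-\epsilon sc_{ij}W-\epsilon^2B_{ij})$ from chart $i$ to chart $j$ (point maps composed right to left). The relations $F_{\mu,j}F_{\nu,j}=F_{\nu,j}F_{\mu,j}$, $F_{\mu,j}T_{ij}=T_{ij}F_{\mu,i}$ and the triple-overlap relation for $T$ modulo $\epsilon^3$ take the form $(g_\mu^*-1)A_{\nu,j}-(g_\nu^*-1)A_{\mu,j}=O^{0,2}_{\mu\nu,j}$, $A_{\mu,j}-A_{\mu,i}-(g_\mu^*-1)B_{ij}=O^{1,1}_{\mu,ij}$, $\delta_{\check C}B=O^{2,0}$, i.e. $d_{\mathrm{tot}}(A+B)=O$ with $O$ depending only on the first-order data; $\operatorname{ob}_2(\alpha)$ is the class of $O$. The deformation $\alpha$ lifts to second order if such a lift to $\mathbb C[\epsilon]/(\epsilon^3)$ exists. *)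

theory Defs
  imports
    "HOL-Analysis.Analysis"
    "HOL-Library.Function_Algebras"
    "HOL-Library.Landau_Symbols"
begin

section \<open>The open set, the deck transformations and the charts\<close>

text \<open>A point is written in the coordinates $(z_1,z_2,z_3,z_4)=(x,u,y,v)$, so that
  \<^term>\<open>z $ 1\<close>, \<^term>\<open>z $ 3\<close>, \<^term>\<open>z $ 2\<close>, \<^term>\<open>z $ 4\<close> are $x,y,u,v$. A vector field
  $\sum_k V_k\,\partial_{z_k}$ is the function $z\mapsto(V_1(z),\dots,V_4(z))$.\<close>

type_synonym point = "complex ^ 4"
type_synonym vfield = "point \<Rightarrow> point"

definition UU :: "point set" where
  "UU = {z. (z $ 1, z $ 3) \<noteq> (0, 0) \<and> (z $ 2, z $ 4) \<noteq> (0, 0)}"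

definition q0 :: complex where
  "q0 = of_real (exp (- 2 * pi))"

text \<open>The deck generator \<open>g\<^sub>\<mu>\<close> multiplies \<open>z\<^sub>i\<close> by \<open>q0\<close> to the power \<open>deck_weight \<mu> $ i\<close>.
  Only \<open>\<mu> = 1, 2\<close> matter.\<close>

definition deck_weight :: "nat \<Rightarrow> nat ^ 4" where
  "deck_weight \<mu> = (if \<mu> = 1 then vector [1, 0, 1, 2] else vector [0, 1, 0, 1])"

definition deck :: "nat \<Rightarrow> point \<Rightarrow> point" where
  "deck \<mu> z = (\<chi> i. q0 ^ (deck_weight \<mu> $ i) * z $ i)"

text \<open>\<open>(dg)\<^sup>-\<^sup>1 (V \<circ> g)\<close>; the linear diagonal map \<open>g = deck \<mu>\<close> is its own differential.\<close>

definition inv_deck :: "nat \<Rightarrow> point \<Rightarrow> point" where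
  "inv_deck \<mu> w = (\<chi> i. w $ i / q0 ^ (deck_weight \<mu> $ i))"

definition pullback :: "nat \<Rightarrow> vfield \<Rightarrow> vfield" where
  "pullback \<mu> V = (\<lambda>z. inv_deck \<mu> (V (deck \<mu> z)))"

text \<open>The charts are numbered \<open>1, 2, 3, 4\<close> in the order 12, 14, 23, 34.\<close>

definition face :: "nat \<Rightarrow> 4 set" where
  "face j = (if j = 1 then {1, 2} else if j = 2 then {1, 4} else if j = 3 then {2, 3} else {3, 4})"

definition chart :: "nat \<Rightarrow> point set" where
  "chart j = {z \<in> UU. \<forall>i. i \<notin> face j \<longrightarrow> z $ i \<noteq> 0}"

definition overlap :: "nat set \<Rightarrow> point set" where
  "overlap I = {z \<in> UU. \<forall>j\<in>I. z \<in> chart j}"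


section \<open>Holomorphic vector fields\<close>

definition holomorphic_vf :: "point set \<Rightarrow> vfield \<Rightarrow> bool" where
  "holomorphic_vf D V \<longleftrightarrow>
     (\<forall>z\<in>D. \<exists>L. (V has_derivative L) (at z) \<and> (\<forall>c w. L (c *s w) = c *s L w))"

text \<open>Functions in HOL are total: a section over an open set \<open>D\<close> is represented by its
  extension by zero, so that equality of sections is equality of functions.\<close>

definition Theta :: "point set \<Rightarrow> vfield set" where
  "Theta D = {V. holomorphic_vf D V \<and> (\<forall>z. z \<notin> D \<longrightarrow> V z = 0)}"

definition restrict_vf :: "point set \<Rightarrow> vfield \<Rightarrow> vfield" where
  "restrict_vf D V = (\<lambda>z. if z \<in> D then V z else 0)"

definition lie_bracket :: "vfield \<Rightarrow> vfield \<Rightarrow> vfield" where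
  "lie_bracket V W = restrict_vf UU
     (\<lambda>z. frechet_derivative W (at z) (V z) - frechet_derivative V (at z) (W z))"

text \<open>\<open>H\<^sup>0(X, \<Theta>\<^sub>X)\<close> for \<open>X = U/G\<close>: the invariant vector fields on \<open>U\<close>.\<close>

definition global_fields :: "vfield set" where
  "global_fields = {V \<in> Theta UU. \<forall>\<mu>\<in>{1, 2}. pullback \<mu> V = V}"

text \<open>\<open>(M (x,y)) \<cdot> (\<partial>\<^sub>x,\<partial>\<^sub>y) + b u \<partial>\<^sub>u + c v \<partial>\<^sub>v + P(x,y) u \<partial>\<^sub>v\<close> with
  \<open>P = p\<^sub>1 x\<^sup>2 + p\<^sub>2 x y + p\<^sub>3 y\<^sup>2\<close>.\<close>

definition normal_field ::
    "complex ^ 2 ^ 2 \<Rightarrow> complex \<Rightarrow> complex \<Rightarrow> complex ^ 3 \<Rightarrow> vfield" where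
  "normal_field M b c p = restrict_vf UU (\<lambda>z.
     let x = z $ 1; y = z $ 3; u = z $ 2; v = z $ 4 in
       vector [M $ 1 $ 1 * x + M $ 1 $ 2 * y,
               b * u,
               M $ 2 $ 1 * x + M $ 2 $ 2 * y,
               c * v + (p $ 1 * x ^ 2 + p $ 2 * x * y + p $ 3 * y ^ 2) * u])"

definition ell :: "vfield \<Rightarrow> complex" where
  "ell V = (THE l. \<exists>M b c p. V = normal_field M b c p \<and> l = - trace M - b + c)"


section \<open>The total complex\<close>

text \<open>A cochain assigns to a set \<open>I\<close> of charts and a set \<open>K\<close> of deck generators a vector field on
  the overlap of the charts in \<open>I\<close>: the coefficient of \<open>\<xi>\<^sub>K\<close> (the wedge product of the \<open>\<xi>\<^sub>\<mu>\<close>,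
  \<open>\<mu> \<in> K\<close>, in increasing order) in the value of the normalized cochain on the increasing
  enumeration of \<open>I\<close>. The pair \<open>(I, K)\<close> has Cech degree \<open>card I - 1\<close> and group degree \<open>card K\<close>.
  The cochains of all degrees live in one type.\<close>

type_synonym cochain = "nat set \<Rightarrow> nat set \<Rightarrow> vfield"

definition index_pair :: "nat set \<Rightarrow> nat set \<Rightarrow> bool" where
  "index_pair I K \<longleftrightarrow> I \<noteq> {} \<and> I \<subseteq> {1..4} \<and> K \<subseteq> {1, 2}"

definition cochains :: "cochain set" where
  "cochains = {c. \<forall>I K. if index_pair I K then c I K \<in> Theta (overlap I) else c I K = 0}"

definition cochains_deg :: "nat \<Rightarrow> cochain set" where
  "cochains_deg k = {c \<in> cochains. \<forall>I K. card I + card K \<noteq> k + 1 \<longrightarrow> c I K = 0}"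

definition d_tot :: "cochain \<Rightarrow> cochain" where
  "d_tot c = (\<lambda>I K z.
     if index_pair I K \<and> z \<in> overlap I then
       (\<Sum>i\<in>I. (-1) ^ card {j \<in> I. j < i} *s c (I - {i}) K z)
       + (-1) ^ (card I - 1) *s
           (\<Sum>\<mu>\<in>K. (-1) ^ card {\<nu> \<in> K. \<nu> < \<mu>} *s
              (pullback \<mu> (c I (K - {\<mu>})) z - c I (K - {\<mu>}) z))
     else 0)"

definition cscale :: "complex \<Rightarrow> cochain \<Rightarrow> cochain" where
  "cscale a c = (\<lambda>I K z. a *s c I K z)"

definition coboundaries :: "cochain set" where
  "coboundaries = d_tot ` cochains"

definition cocycles :: "nat \<Rightarrow> cochain set" where
  "cocycles k = {c \<in> cochains_deg k. d_tot c = 0}"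

lemma bounded_linear_vec_scale: "bounded_linear (\<lambda>v::point. a *s v)"
proof -
  have "linear (\<lambda>v::point. a *s v)"
    by (intro linearI)
       (simp_all add: vec_eq_iff algebra_simps)
  then show ?thesis
    by (simp add: linear_conv_bounded_linear)
qed

lemma Theta_lincomb:
  assumes "V \<in> Theta D" "W \<in> Theta D"
  shows "(\<lambda>z. a *s V z + b *s W z) \<in> Theta D"
proof -
  have "\<exists>L. ((\<lambda>z. a *s V z + b *s W z) has_derivative L) (at z) \<and>
            (\<forall>c w. L (c *s w) = c *s L w)" if "z \<in> D" for z
  proof -
    from that assms obtain L M where
      L: "(V has_derivative L) (at z)" "\<forall>c w. L (c *s w) = c *s L w" and
      M: "(W has_derivative M) (at z)" "\<forall>c w. M (c *s w) = c *s M w"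
      unfolding Theta_def holomorphic_vf_def by blast
    have "((\<lambda>z. a *s V z + b *s W z) has_derivative (\<lambda>w. a *s L w + b *s M w)) (at z)"
      by (intro has_derivative_add bounded_linear.has_derivative[OF bounded_linear_vec_scale] L M)
    moreover have "\<forall>c w. a *s L (c *s w) + b *s M (c *s w) = c *s (a *s L w + b *s M w)"
      using L(2) M(2) by (simp add: vec_eq_iff algebra_simps)
    ultimately show ?thesis by blast
  qed
  then show ?thesis
    using assms by (simp add: Theta_def holomorphic_vf_def)
qed

lemma zero_in_cochains: "0 \<in> cochains"
  by (auto simp: cochains_def Theta_def holomorphic_vf_def zero_fun_def
      intro!: exI[of _ "\<lambda>_. 0"])

lemma cochains_lincomb:
  assumes "c \<in> cochains" "e \<in> cochains"
  shows "cscale a c + cscale b e \<in> cochains"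
proof -
  have "(cscale a c + cscale b e) I K \<in> Theta (overlap I)" if "index_pair I K" for I K
    using assms that Theta_lincomb[of "c I K" "overlap I" "e I K" a b]
    by (auto simp: cochains_def cscale_def plus_fun_def)
  moreover have "(cscale a c + cscale b e) I K = 0" if "\<not> index_pair I K" for I K
    using assms that by (auto simp: cochains_def cscale_def plus_fun_def zero_fun_def)
  ultimately show ?thesis by (auto simp: cochains_def)
qed

lemma d_tot_lincomb: "d_tot (cscale a c + cscale b e) = cscale a (d_tot c) + cscale b (d_tot e)"
proof -
  have p: "pullback \<mu> (\<lambda>x. a *s V x + b *s W x) z = a *s pullback \<mu> V z + b *s pullback \<mu> W z"
    for \<mu> V W z
    by (simp add: pullback_def inv_deck_def vec_eq_iff add_divide_distrib)
  show ?thesis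
    by (intro ext, simp add: d_tot_def cscale_def plus_fun_def p vec_eq_iff algebra_simps
        sum.distrib sum_subtractf sum_distrib_left)
qed

lemma coboundaries_lincomb:
  assumes "c \<in> coboundaries" "e \<in> coboundaries"
  shows "cscale a c + cscale b e \<in> coboundaries"
  using assms cochains_lincomb unfolding coboundaries_def
  by (auto simp flip: d_tot_lincomb)

lemma cscale_simps:
  "cscale 1 c = c" "cscale 0 c = 0" "cscale (-1) c = - c"
  "cscale a (cscale b c) = cscale (a * b) c"
  "cscale (a + b) c = cscale a c + cscale b c"
  "cscale a (c + e) = cscale a c + cscale a e"
  "cscale a (c - e) = cscale a c - cscale a e"
  by (simp_all add: cscale_def fun_eq_iff vec_eq_iff algebra_simps)

lemma coboundaries_zero: "0 \<in> coboundaries"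
  using d_tot_lincomb[of 0 0 0 0] zero_in_cochains
  unfolding coboundaries_def by (force simp: cscale_simps)

lemma coboundaries_add: "c \<in> coboundaries \<Longrightarrow> e \<in> coboundaries \<Longrightarrow> c + e \<in> coboundaries"
  using coboundaries_lincomb[of c e 1 1] by (simp add: cscale_simps)

lemma coboundaries_scale: "c \<in> coboundaries \<Longrightarrow> cscale a c \<in> coboundaries"
  using coboundaries_lincomb[of c c a 0] by (simp add: cscale_simps)

lemma coboundaries_uminus: "c \<in> coboundaries \<Longrightarrow> - c \<in> coboundaries"
  using coboundaries_scale[of c "-1"] by (simp add: cscale_simps)


section \<open>Cohomology\<close>

text \<open>\<open>coh\<close> is the quotient of all functions of type \<^typ>\<open>cochain\<close> by the coboundaries of the total
  complex; the cohomology groups are the subspaces \<open>HH k\<close> of classes of cocycles of degree \<open>k\<close>.\<close>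

quotient_type coh = cochain / "\<lambda>c e. c - e \<in> coboundaries"
  morphisms rep_coh cls
proof (rule equivpI)
  show "reflp (\<lambda>c e. c - e \<in> coboundaries)"
    by (simp add: reflp_def coboundaries_zero)
  show "symp (\<lambda>c e. c - e \<in> coboundaries)"
    unfolding symp_def using coboundaries_uminus by fastforce
  show "transp (\<lambda>c e. c - e \<in> coboundaries)"
    unfolding transp_def using coboundaries_add by fastforce
qed

instantiation coh :: ab_group_add
begin

lift_definition zero_coh :: coh is 0 .

lift_definition plus_coh :: "coh \<Rightarrow> coh \<Rightarrow> coh" is "(+)"
  by (metis add_diff_add coboundaries_add)

lift_definition uminus_coh :: "coh \<Rightarrow> coh" is uminus
  by (metis coboundaries_uminus minus_diff_minus)

lift_definition minus_coh :: "coh \<Rightarrow> coh \<Rightarrow> coh" is "(-)"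
  by (metis (no_types, lifting) add_diff_add coboundaries_add coboundaries_uminus
      diff_conv_add_uminus minus_diff_minus)

instance
  by standard (transfer, simp add: algebra_simps coboundaries_zero)+

end

lift_definition coh_scale :: "complex \<Rightarrow> coh \<Rightarrow> coh" (infixr "*\<^sub>H" 75) is cscale
  by (metis coboundaries_scale cscale_simps(7))

interpretation coh: vector_space coh_scale
  by standard (transfer, simp add: cscale_simps coboundaries_zero)+

definition HH :: "nat \<Rightarrow> coh set" where
  "HH k = cls ` cocycles k"

text \<open>The quotient of \<open>V\<close> by a subspace \<open>W\<close> has dimension \<open>n\<close>: some \<open>n\<close> vectors of \<open>V\<close> become a basis
  of the quotient.\<close>

definition quotient_dim :: "coh set \<Rightarrow> coh set \<Rightarrow> nat \<Rightarrow> bool" where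
  "quotient_dim V W n \<longleftrightarrow> coh.subspace V \<and> coh.subspace W \<and> W \<subseteq> V \<and>
     (\<exists>B. finite B \<and> card B = n \<and> B \<subseteq> V \<and> V = coh.span (W \<union> B) \<and>
        (\<forall>a. (\<Sum>h\<in>B. a h *\<^sub>H h) \<in> W \<longrightarrow> (\<forall>h\<in>B. a h = 0)))"


section \<open>The standard classes\<close>

definition WW :: vfield where
  "WW z = vector [0, z $ 4 / (z $ 1 * z $ 3), 0, 0]"

definition chart_scalar :: "nat \<Rightarrow> complex" where
  "chart_scalar j = (if j = 1 \<or> j = 2 then 0 else 1)"

text \<open>\<open>V \<otimes> \<xi>\<^sub>K\<close> with \<open>V\<close> in Cech degree 0, and \<open>(c\<^sub>i\<^sub>j W) \<otimes> \<xi>\<^sub>K\<close>; here \<open>\<xi>\<close> of the empty set is 1 and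
  \<open>\<xi>\<close> of \<open>{1, 2}\<close> is \<open>\<xi>\<^sub>1 \<and> \<xi>\<^sub>2\<close>.\<close>

definition vf_cochain :: "vfield \<Rightarrow> nat set \<Rightarrow> cochain" where
  "vf_cochain V K' = (\<lambda>I K.
     if K = K' \<and> (\<exists>j\<in>{1..4}. I = {j}) then restrict_vf (overlap I) V else 0)"

definition eta_cochain :: "nat set \<Rightarrow> cochain" where
  "eta_cochain K' = (\<lambda>I K.
     if K = K' \<and> I \<subseteq> {1..4} \<and> card I = 2
     then restrict_vf (overlap I) (\<lambda>z. (chart_scalar (Max I) - chart_scalar (Min I)) *s WW z)
     else 0)"

definition vf_class :: "vfield \<Rightarrow> nat set \<Rightarrow> coh" where
  "vf_class V K = cls (vf_cochain V K)"

definition eta_class :: "nat set \<Rightarrow> coh" where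
  "eta_class K = cls (eta_cochain K)"

text \<open>The representative of \<open>V\<^sub>1 \<otimes> \<xi>\<^sub>1 + V\<^sub>2 \<otimes> \<xi>\<^sub>2 + s \<eta>\<close>.\<close>

definition alpha_cocycle :: "vfield \<Rightarrow> vfield \<Rightarrow> complex \<Rightarrow> cochain" where
  "alpha_cocycle V1 V2 s =
     vf_cochain V1 {1} + vf_cochain V2 {2} + cscale s (eta_cochain {})"


section \<open>Second-order lifts and the primary obstruction\<close>

text \<open>Let \<open>a\<close> be a 1-cocycle and \<open>A\<close> a 1-cochain, whose components \<open>A {j} {\<mu>}\<close> and \<open>A {i, j} {}\<close>
  are the second-order data on charts and on double overlaps. \<open>exp2 V Y \<epsilon>\<close> is the point map
  \<open>exp (- \<epsilon> V - \<epsilon>\<^sup>2 Y)\<close> modulo \<open>\<epsilon>\<^sup>3\<close>: if \<open>X = - \<epsilon> V - \<epsilon>\<^sup>2 Y\<close>, then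
  \<open>exp X z = z + X z + 1/2 DX(z)(X z) + ...\<close>, and modulo \<open>\<epsilon>\<^sup>3\<close> the last term is
  \<open>\<epsilon>\<^sup>2/2 DV(z)(V z)\<close>.\<close>

definition exp2 :: "vfield \<Rightarrow> vfield \<Rightarrow> complex \<Rightarrow> point \<Rightarrow> point" where
  "exp2 V Y \<epsilon> z =
     z - \<epsilon> *s V z - \<epsilon>\<^sup>2 *s Y z + (\<epsilon>\<^sup>2 / 2) *s frechet_derivative V (at z) (V z)"

definition deck_lift :: "cochain \<Rightarrow> cochain \<Rightarrow> nat \<Rightarrow> nat \<Rightarrow> complex \<Rightarrow> point \<Rightarrow> point" where
  "deck_lift a A \<mu> j \<epsilon> = deck \<mu> \<circ> exp2 (a {j} {\<mu>}) (A {j} {\<mu>}) \<epsilon>"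

definition transition_lift :: "cochain \<Rightarrow> cochain \<Rightarrow> nat \<Rightarrow> nat \<Rightarrow> complex \<Rightarrow> point \<Rightarrow> point" where
  "transition_lift a A i j \<epsilon> = exp2 (a {i, j} {}) (A {i, j} {}) \<epsilon>"

definition eq_mod_eps3 ::
    "(complex \<Rightarrow> point \<Rightarrow> point) \<Rightarrow> (complex \<Rightarrow> point \<Rightarrow> point) \<Rightarrow> point \<Rightarrow> bool" where
  "eq_mod_eps3 F F' z \<longleftrightarrow> (\<lambda>\<epsilon>. norm (F \<epsilon> z - F' \<epsilon> z)) \<in> O[at 0](\<lambda>\<epsilon>. norm \<epsilon> ^ 3)"

definition deck_relation :: "cochain \<Rightarrow> cochain \<Rightarrow> nat \<Rightarrow> point \<Rightarrow> bool" where
  "deck_relation a A j z \<longleftrightarrow> eq_mod_eps3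
     (\<lambda>\<epsilon>. deck_lift a A 1 j \<epsilon> \<circ> deck_lift a A 2 j \<epsilon>)
     (\<lambda>\<epsilon>. deck_lift a A 2 j \<epsilon> \<circ> deck_lift a A 1 j \<epsilon>) z"

definition mixed_relation :: "cochain \<Rightarrow> cochain \<Rightarrow> nat \<Rightarrow> nat \<Rightarrow> nat \<Rightarrow> point \<Rightarrow> bool" where
  "mixed_relation a A \<mu> i j z \<longleftrightarrow> eq_mod_eps3
     (\<lambda>\<epsilon>. deck_lift a A \<mu> j \<epsilon> \<circ> transition_lift a A i j \<epsilon>)
     (\<lambda>\<epsilon>. transition_lift a A i j \<epsilon> \<circ> deck_lift a A \<mu> i \<epsilon>) z"

definition triple_relation :: "cochain \<Rightarrow> cochain \<Rightarrow> nat \<Rightarrow> nat \<Rightarrow> nat \<Rightarrow> point \<Rightarrow> bool" where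
  "triple_relation a A i j k z \<longleftrightarrow> eq_mod_eps3
     (\<lambda>\<epsilon>. transition_lift a A j k \<epsilon> \<circ> transition_lift a A i j \<epsilon>)
     (transition_lift a A i k) z"

definition lifts_to_second_order :: "cochain \<Rightarrow> bool" where
  "lifts_to_second_order a \<longleftrightarrow> (\<exists>A \<in> cochains_deg 1.
     (\<forall>j\<in>{1..4}. \<forall>z\<in>overlap {j}. deck_relation a A j z) \<and>
     (\<forall>\<mu>\<in>{1, 2}. \<forall>i\<in>{1..4}. \<forall>j\<in>{1..4}. i < j \<longrightarrow>
        (\<forall>z\<in>overlap {i, j}. mixed_relation a A \<mu> i j z)) \<and>
     (\<forall>i\<in>{1..4}. \<forall>j\<in>{1..4}. \<forall>k\<in>{1..4}. i < j \<and> j < k \<longrightarrow>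
        (\<forall>z\<in>overlap {i, j, k}. triple_relation a A i j k z)))"

text \<open>\<open>Ob\<close> is the cochain for which the relations for the second-order data \<open>A\<close> take the form
  \<open>d_tot A = Ob\<close>. Requiring this pointwise and for all \<open>A\<close> determines \<open>Ob\<close>, whether or not a
  lift exists.\<close>

definition obstruction_cochain :: "cochain \<Rightarrow> cochain \<Rightarrow> bool" where
  "obstruction_cochain a Ob \<longleftrightarrow> Ob \<in> cochains_deg 2 \<and> (\<forall>A \<in> cochains_deg 1.
     (\<forall>j\<in>{1..4}. \<forall>z\<in>overlap {j}.
        deck_relation a A j z \<longleftrightarrow> d_tot A {j} {1, 2} z = Ob {j} {1, 2} z) \<and>
     (\<forall>\<mu>\<in>{1, 2}. \<forall>i\<in>{1..4}. \<forall>j\<in>{1..4}. i < j \<longrightarrow>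
        (\<forall>z\<in>overlap {i, j}.
           mixed_relation a A \<mu> i j z \<longleftrightarrow> d_tot A {i, j} {\<mu>} z = Ob {i, j} {\<mu>} z)) \<and>
     (\<forall>i\<in>{1..4}. \<forall>j\<in>{1..4}. \<forall>k\<in>{1..4}. i < j \<and> j < k \<longrightarrow>
        (\<forall>z\<in>overlap {i, j, k}.
           triple_relation a A i j k z \<longleftrightarrow> d_tot A {i, j, k} {} z = Ob {i, j, k} {} z)))"

definition ob2 :: "cochain \<Rightarrow> coh" where
  "ob2 a = cls (THE Ob. obstruction_cochain a Ob)"


section \<open>The normalized diagonal family\<close>

definition C0 :: "complex ^ 2 ^ 4" where
  "C0 = vector [vector [\<i>, 0], vector [0, \<i>], vector [\<i>, 0], vector [2 * \<i>, \<i>]]"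

definition family_deck :: "complex ^ 2 ^ 4 \<Rightarrow> nat \<Rightarrow> point \<Rightarrow> point" where
  "family_deck C \<mu> z = (\<chi> i. exp (2 * pi * \<i> * C $ i $ of_nat \<mu>) * z $ i)"

lemma family_deck_C0: "\<mu> \<in> {1, 2} \<Longrightarrow> family_deck C0 \<mu> = deck \<mu>"
proof -
  have e: "exp (- (2 * complex_of_real pi)) = q0"
    by (simp add: q0_def flip: exp_of_real)
  have e2: "exp (- (4 * complex_of_real pi)) = q0\<^sup>2"
    by (simp add: power2_eq_square flip: e exp_add)
  assume "\<mu> \<in> {1, 2}"
  then show ?thesis
    using e e2
    by (auto simp: mult.assoc family_deck_def deck_def C0_def deck_weight_def fun_eq_iff vec_eq_iff
        forall_4 forall_2 vector_def)
qed

text \<open>The family \<open>C0 + \<epsilon> C'\<close> has deck maps \<open>g\<^sub>\<mu> \<circ> exp (- \<epsilon> V\<^sub>\<mu>)\<close> modulo \<open>\<epsilon>\<^sup>2\<close>, hence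
  \<open>V\<^sub>\<mu> = - (dg\<^sub>\<mu>)\<^sup>-\<^sup>1\<close> applied to the derivative of the deck map at \<open>\<epsilon> = 0\<close>; the chart
  transitions are constant.\<close>

definition KS_field :: "complex ^ 2 ^ 4 \<Rightarrow> nat \<Rightarrow> vfield" where
  "KS_field C' \<mu> z =
     - inv_deck \<mu> (\<chi> i. deriv (\<lambda>\<epsilon>. family_deck (\<chi> k l. C0 $ k $ l + \<epsilon> * C' $ k $ l) \<mu> z $ i) 0)"

definition KS :: "complex ^ 2 ^ 4 \<Rightarrow> coh" where
  "KS C' = vf_class (KS_field C' 1) {1} + vf_class (KS_field C' 2) {2}"

end

theory Submission
  imports Defs "HOL-Complex_Analysis.Cauchy_Integral_Formula"
begin

text \<open>A holomorphic field on an overlap of charts has an absolutely convergent Laurent expansion on the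
  open set where its inverted coordinates do not vanish, so the total complex splits into one finite
  complex for each monomial field. If a deck generator acts on the monomial with nonzero weight, the Koszul
  differential is invertible with a bound uniform in the monomial, and the primitives sum up to a
  holomorphic cochain. Of the finitely many kinds of monomials of weight zero, those without negative
  exponents give the global fields, those with $x$ and $y$ both in the denominator see the Cech
  complex of the four-cycle and only $W$ contributes the class $\eta$, and for all others the Cech complex
  is a cone. For the obstruction, both sides of each relation are expanded to second order: the deck relation
  gives the Lie bracket, the mixed relation gives $c_{ij}\,s$ times
  $DV_\mu(W)-DW(V_\mu)=-\ell(V_\mu)\,W+R_x+R_y$, where $R_x$ has poles only along $x=0$ and $R_y$ only along
  $y=0$. Since $c_{ij}$ is the difference of the chart scalars $0,0,1,1$, the terms $c_{ij}R_x$ and $c_{ij}R_y$ are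
  coboundaries of $\sigma R_x$ and $(\sigma-1)R_y$, each holomorphic on every chart.\<close>

section \<open>Laurent series in one variable\<close>

text \<open>Every overlap of charts is a product of planes and punctured planes, so restriction to a
  smaller overlap keeps all Laurent coefficients; this is what makes one coefficient family per
  monomial meaningful. The shape of the answer comes from weights. The field W = v/(xy) d/du is the
  only monomial field of weight zero with x and y in the denominator and u not; with u there as
  well, the class dies because charts 1 and 3 together do not invert u. The number ell(V) is the
  weight of W under the diagonal part of V: v contributes c, 1/(xy) contributes - tr M, and d/du
  contributes - b. A separate obstacle is that the obstruction cochain is given by a definite
  description quantified over all second-order data, so its uniqueness must be proved even where no
  lift exists. Constant fields supply enough data: each coordinate field has nonzero weight under at
  least one deck generator.\<close>

lemma contour_integral_circlepath_eq:
  assumes "h holomorphic_on - {0}" "r > 0" "s > 0"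
  shows "contour_integral (circlepath 0 r) h = contour_integral (circlepath 0 s) h"
proof (rule Cauchy_theorem_homotopic_loops)
  show "homotopic_loops (- {0}) (circlepath 0 r) (circlepath 0 s)"
  proof (rule homotopic_loops_linear)
    fix t x :: real
    \<comment> \<open>Points of the two circles with the same parameter lie on one ray from 0, and a
      convex combination of the two radii is positive.\<close>
    show "closed_segment (circlepath 0 r t) (circlepath 0 s t) \<subseteq> - {0}"
    proof
      fix z assume "z \<in> closed_segment (circlepath 0 r t) (circlepath 0 s t)"
      then obtain u where u: "0 \<le> u" "u \<le> 1"
        "z = (1 - u) *\<^sub>R circlepath 0 r t + u *\<^sub>R circlepath 0 s t"
        by (auto simp: closed_segment_def)
      then have "z = of_real ((1 - u) * r + u * s) * exp (2 * of_real pi * \<i> * of_real t)"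
        by (simp add: circlepath scaleR_conv_of_real algebra_simps)
      moreover have "(1 - u) * r + u * s > 0"
        using u assms by (cases "u = 0") (auto intro: add_nonneg_pos)
      ultimately show "z \<in> - {0}" by (auto simp del: of_real_add of_real_mult)
    qed
  qed simp_all
qed (use assms in auto)

text \<open>The radius is fixed so that parameter integrals run over one compact circle; for
  functions holomorphic off 0 every radius gives the same value.\<close>

definition laurent_coeff :: "(complex \<Rightarrow> complex) \<Rightarrow> int \<Rightarrow> complex" where
  "laurent_coeff f n = contour_integral (circlepath 0 1) (\<lambda>w. f w * w powi (- n - 1)) / (2 * pi * \<i>)"

text \<open>On the punctured plane the power has the primitive w^(n+1)/(n+1) unless n + 1 =
  0.\<close>

lemma contour_integral_powi:
  assumes "r > 0"
  shows "contour_integral (circlepath 0 r) (\<lambda>w. w powi n) = (if n = -1 then 2 * pi * \<i> else 0)"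
proof (cases "n = -1")
  case True
  then show ?thesis
    using contour_integral_circlepath[OF assms, of 0] by (simp add: power_int_minus divide_inverse)
next
  case False
  have "((\<lambda>w. w powi n) has_contour_integral
      (pathfinish (circlepath 0 r) powi (n + 1) / of_int (n + 1)
       - pathstart (circlepath 0 r) powi (n + 1) / of_int (n + 1))) (circlepath 0 r)"
  proof (rule contour_integral_primitive)
    fix x assume "x \<in> - {0 :: complex}"
    moreover have "of_int (n + 1) \<noteq> (0 :: complex)"
      using False by (metis add.commute add_eq_0_iff of_int_eq_0_iff)
    ultimately show "((\<lambda>w. w powi (n + 1) / of_int (n + 1)) has_field_derivative x powi n)
        (at x within - {0})"
      by (auto intro!: derivative_eq_intros)
  qed (use assms in auto)
  then show ?thesis using False by (simp add: contour_integral_unique)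
qed

lemma holomorphic_mult_powi:
  assumes "f holomorphic_on - {0}"
  shows "(\<lambda>w. f w * w powi n) holomorphic_on - {0}"
  using assms by (intro holomorphic_intros) auto

lemma norm_contour_integral_circle_le:
  fixes h :: "complex \<Rightarrow> complex"
  assumes "continuous_on (sphere 0 r) h" "r > 0" "B \<ge> 0" "\<And>w. norm w = r \<Longrightarrow> norm (h w) \<le> B"
  shows "norm (contour_integral (circlepath 0 r) h) \<le> B * (2 * pi * r)"
proof (rule has_contour_integral_bound_circlepath)
  show "(h has_contour_integral contour_integral (circlepath 0 r) h) (circlepath 0 r)"
    using assms by (intro has_contour_integral_integral contour_integrable_continuous_circlepath) auto
qed (use assms in auto)

lemma laurent_coeff_radius:
  assumes "f holomorphic_on - {0}" "r > 0"
  shows "laurent_coeff f n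
    = contour_integral (circlepath 0 r) (\<lambda>w. f w * w powi (- n - 1)) / (2 * pi * \<i>)"
proof -
  have "contour_integral (circlepath 0 1) (\<lambda>w. f w * w powi (- n - 1))
    = contour_integral (circlepath 0 r) (\<lambda>w. f w * w powi (- n - 1))"
    by (rule contour_integral_circlepath_eq[OF holomorphic_mult_powi]) (use assms in auto)
  then show ?thesis by (simp add: laurent_coeff_def)
qed

text \<open>Cauchy's estimate. The radius stays free: large radii control the coefficients with n >=
  0, small radii those with n < 0.\<close>

lemma norm_laurent_coeff_le:
  assumes "f holomorphic_on - {0}" "r > 0" "\<And>w. norm w = r \<Longrightarrow> norm (f w) \<le> M"
  shows "norm (laurent_coeff f n) \<le> M * r powi (- n)"
proof -
  have "norm (f (of_real r)) \<le> M" using assms(2,3) by simp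
  then have "M \<ge> 0" using norm_ge_zero order_trans by blast
  have "norm (contour_integral (circlepath 0 r) (\<lambda>w. f w * w powi (- n - 1)))
      \<le> M * r powi (- n - 1) * (2 * pi * r)"
  proof (rule norm_contour_integral_circle_le)
    show "continuous_on (sphere 0 r) (\<lambda>w. f w * w powi (- n - 1))"
      using assms(2) by (intro continuous_on_subset[OF holomorphic_on_imp_continuous_on
          [OF holomorphic_mult_powi[OF assms(1)]]]) auto
  qed (use assms \<open>M \<ge> 0\<close> in \<open>auto simp: norm_mult norm_power_int intro!: mult_right_mono\<close>)
  also have "r powi (- n - 1) * (2 * pi * r) = r powi (- n) * (2 * pi)"
    using assms(2) by (simp add: power_int_diff)
  then have "M * r powi (- n - 1) * (2 * pi * r) = M * r powi (- n) * (2 * pi)"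
    by (metis mult.assoc)
  finally show ?thesis
    by (subst laurent_coeff_radius[OF assms(1,2)]) (simp add: norm_divide norm_mult field_simps)
qed

text \<open>A geometric sum with ratio z/w. Of the two boundary terms one is small inside the circle
  |w| = |z| and the other outside it, which is why they are later integrated over different
  circles.\<close>

lemma sum_powi_telescope:
  fixes w z :: complex
  assumes "w \<noteq> 0" "z \<noteq> 0"
  shows "(\<Sum>n = - int N..int N. z powi n * w powi (- n - 1)) * (w - z)
    = (w / z) ^ N - (z / w) ^ (N + 1)"
proof (induction N)
  case 0
  show ?case using assms by (simp add: power_int_minus field_simps)
next
  case (Suc N)
  have *: "{- int (Suc N)..int (Suc N)} = insert (- int (Suc N)) (insert (int (Suc N)) {- int N..int N})"
    by auto
  have e: "z powi (- int (Suc N)) * w powi (int (Suc N) - 1) = w ^ N / z ^ Suc N"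
  proof -
    have "int (Suc N) - 1 = int N" by simp
    then show ?thesis using assms by (simp only: power_int_minus power_int_of_nat divide_inverse mult.commute)
  qed
  have e2: "z powi int (Suc N) * w powi (- int (Suc N) - 1) = z ^ Suc N / w ^ (N + 2)"
  proof -
    have "- int (Suc N) - 1 = - int (N + 2)" by simp
    then show ?thesis using assms by (simp only: power_int_minus power_int_of_nat divide_inverse)
  qed
  have "(\<Sum>n = - int (Suc N)..int (Suc N). z powi n * w powi (- n - 1)) * (w - z)
    = (w ^ N / z ^ Suc N) * (w - z) + (z ^ Suc N / w ^ (N + 2)) * (w - z)
      + ((w / z) ^ N - (z / w) ^ (N + 1))"
    unfolding Suc.IH[symmetric]
    apply (subst *)
    apply (subst sum.insert, simp, simp)
    apply (subst sum.insert, simp, simp)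
    using e e2 by (simp add: algebra_simps)
  also have "\<dots> = (w / z) ^ Suc N - (z / w) ^ (Suc N + 1)"
    using assms by (simp add: field_simps)
  finally show ?case .
qed

text \<open>With $g(w)=(f(w)-f(z))/(w-z)$, the error of the symmetric partial sum at $z$ is the integral of
  $g(w)((w/z)^N-(z/w)^{N+1})$; the two terms decay geometrically on the circles of radius
  $|z|/2$ and $2|z|$.\<close>

lemma laurent_partial_sums:
  assumes f: "f holomorphic_on - {0}" and z: "z \<noteq> 0"
  shows "(\<lambda>N. \<Sum>n = - int N..int N. laurent_coeff f n * z powi n) \<longlonglongrightarrow> f z"
proof -
  \<comment> \<open>The removable singularity at z is filled in, so a circle may be moved across z
    without changing the integrals of g times a power.\<close>
  define g where "g = (\<lambda>w. if w = z then deriv f z else (f w - f z) / (w - z))"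
  have g: "g holomorphic_on - {0}"
    unfolding g_def by (rule pole_lemma_open) (use f in auto)
  have contg: "continuous_on (sphere 0 r) g" if "r > 0" for r
    by (rule continuous_on_subset[OF holomorphic_on_imp_continuous_on[OF g]]) (use that in auto)
  define R where "R = 2 * norm z"
  define r where "r = norm z / 2"
  have pos: "R > 0" "r > 0" using z by (auto simp: R_def r_def)
  obtain B1 where B1: "\<And>w. norm w = R \<Longrightarrow> norm (g w) \<le> B1"
    using compact_imp_bounded[OF compact_continuous_image[OF contg[OF pos(1)] compact_sphere]]
    unfolding bounded_iff by fastforce
  obtain B2 where B2: "\<And>w. norm w = r \<Longrightarrow> norm (g w) \<le> B2"
    using compact_imp_bounded[OF compact_continuous_image[OF contg[OF pos(2)] compact_sphere]]
    unfolding bounded_iff by fastforce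
  have B0: "B1 \<ge> 0" "B2 \<ge> 0"
    using order_trans[OF norm_ge_zero B1[of "of_real R"]] order_trans[OF norm_ge_zero B2[of "of_real r"]] pos
    by auto
  define I where "I = contour_integral (circlepath 0 R)"
  have integrable: "h contour_integrable_on circlepath 0 s" if "h holomorphic_on - {0}" "s > 0" for h s
    using that by (intro contour_integrable_continuous_circlepath
        continuous_on_subset[OF holomorphic_on_imp_continuous_on[OF that(1)]]) auto
  have hpow: "(\<lambda>w. g w * (w / z) ^ N) holomorphic_on - {0}"
    "(\<lambda>w. g w * (z / w) ^ N) holomorphic_on - {0}" for N
    using g z by (auto intro!: holomorphic_intros)
  have err: "norm ((\<Sum>n = - int N..int N. laurent_coeff f n * z powi n) - f z)
      \<le> (B1 * R + B2 * r) * (1 / 2) ^ N" for N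
  proof -
    define D where "D = (\<lambda>w. \<Sum>n = - int N..int N. z powi n * w powi (- n - 1))"
    have D: "D holomorphic_on - {0}" unfolding D_def by (intro holomorphic_intros) auto
    have hn: "(\<lambda>w. z powi n * (f w * w powi (- n - 1))) holomorphic_on - {0}"
      "(\<lambda>w. f w * w powi (- n - 1)) holomorphic_on - {0}"
      "(\<lambda>w. z powi n * w powi (- n - 1)) holomorphic_on - {0}"
      "(\<lambda>w. w powi (- n - 1)) holomorphic_on - {0}" for n
      using f by (auto intro!: holomorphic_intros)
    note ih = integrable[OF _ pos(1)]
    have "(\<Sum>n = - int N..int N. laurent_coeff f n * z powi n)
       = (\<Sum>n = - int N..int N. I (\<lambda>w. z powi n * (f w * w powi (- n - 1))) / (2 * pi * \<i>))"
      unfolding I_def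
      by (intro sum.cong refl, subst contour_integral_lmul[OF ih[OF hn(2)]])
         (simp add: laurent_coeff_radius[OF f pos(1)])
    also have "\<dots> = I (\<lambda>w. \<Sum>n = - int N..int N. z powi n * (f w * w powi (- n - 1))) / (2 * pi * \<i>)"
      unfolding I_def
      by (subst contour_integral_sum) (simp_all add: ih[OF hn(1)] sum_divide_distrib)
    also have "(\<lambda>w. \<Sum>n = - int N..int N. z powi n * (f w * w powi (- n - 1))) = (\<lambda>w. f w * D w)"
      by (simp add: D_def sum_distrib_left mult_ac)
    finally have S: "(\<Sum>n = - int N..int N. laurent_coeff f n * z powi n) = I (\<lambda>w. f w * D w) / (2 * pi * \<i>)" .
    \<comment> \<open>Only the term n = 0 of the truncated kernel has a residue, so the kernel
      integrates to exactly 2 pi i for every N.\<close>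
    have "I D = (\<Sum>n = - int N..int N. I (\<lambda>w. z powi n * w powi (- n - 1)))"
      unfolding I_def D_def by (intro contour_integral_sum ih hn) simp
    also have "\<dots> = (\<Sum>n = - int N..int N. if n = 0 then 2 * pi * \<i> else 0)"
      unfolding I_def
      by (intro sum.cong refl, subst contour_integral_lmul[OF ih[OF hn(4)]])
         (simp add: contour_integral_powi[OF pos(1)])
    finally have ID: "I D = 2 * pi * \<i>" by simp
    have hfD: "(\<lambda>w. f w * D w) holomorphic_on - {0}" "(\<lambda>w. f z * D w) holomorphic_on - {0}"
      using f D by (auto intro!: holomorphic_intros)
    have "f z * I D = I (\<lambda>w. f z * D w)"
      unfolding I_def by (rule contour_integral_lmul[OF ih[OF D], symmetric])
    then have "I (\<lambda>w. f w * D w) - f z * I D = I (\<lambda>w. f w * D w - f z * D w)"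
      unfolding I_def using contour_integral_diff[OF ih[OF hfD(1)] ih[OF hfD(2)]] by simp
    also have "\<dots> = I (\<lambda>w. (f w - f z) * D w)"
      by (simp add: left_diff_distrib)
    also have "\<dots> = I (\<lambda>w. g w * (w / z) ^ N - g w * (z / w) ^ (N + 1))"
      unfolding I_def
    proof (rule contour_integral_cong)
      fix w assume "w \<in> path_image (circlepath 0 R)"
      then have w: "w \<noteq> 0" "w \<noteq> z" using pos z by (auto simp: R_def)
      have "(f w - f z) * D w = g w * (D w * (w - z))" using w by (simp add: g_def)
      then show "(f w - f z) * D w = g w * (w / z) ^ N - g w * (z / w) ^ (N + 1)"
        unfolding D_def by (subst (asm) sum_powi_telescope) (use w z in \<open>auto simp: algebra_simps\<close>)
    qed simp
    also have "\<dots> = I (\<lambda>w. g w * (w / z) ^ N) - I (\<lambda>w. g w * (z / w) ^ (N + 1))"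
      unfolding I_def by (intro contour_integral_diff integrable hpow pos)
    also have "I (\<lambda>w. g w * (w / z) ^ N) = contour_integral (circlepath 0 r) (\<lambda>w. g w * (w / z) ^ N)"
      unfolding I_def using hpow pos by (intro contour_integral_circlepath_eq)
    finally have eq: "I (\<lambda>w. f w * D w) - f z * I D
      = contour_integral (circlepath 0 r) (\<lambda>w. g w * (w / z) ^ N) - I (\<lambda>w. g w * (z / w) ^ (N + 1))" .
    have b1: "norm (contour_integral (circlepath 0 r) (\<lambda>w. g w * (w / z) ^ N))
        \<le> B2 * (1 / 2) ^ N * (2 * pi * r)"
    proof (rule norm_contour_integral_circle_le)
      show "continuous_on (sphere 0 r) (\<lambda>w. g w * (w / z) ^ N)"
        by (rule continuous_on_subset[OF holomorphic_on_imp_continuous_on[OF hpow(1)]]) (use pos in auto)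
      fix w :: complex assume "norm w = r"
      then show "norm (g w * (w / z) ^ N) \<le> B2 * (1 / 2) ^ N"
        using B2[of w] z unfolding norm_mult norm_power norm_divide
        by (intro mult_mono power_mono) (auto simp: r_def B0)
    qed (use pos B0 in auto)
    have b2: "norm (I (\<lambda>w. g w * (z / w) ^ (N + 1))) \<le> B1 * (1 / 2) ^ N * (2 * pi * R)"
      unfolding I_def
    proof (rule norm_contour_integral_circle_le)
      show "continuous_on (sphere 0 R) (\<lambda>w. g w * (z / w) ^ (N + 1))"
        by (rule continuous_on_subset[OF holomorphic_on_imp_continuous_on[OF hpow(2)]]) (use pos in auto)
      fix w :: complex assume w: "norm w = R"
      have "norm (z / w) ^ (N + 1) = (1 / 2) ^ (N + 1)"
        using w z by (simp add: norm_divide R_def)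
      also have "\<dots> \<le> (1 / 2) ^ N" by simp
      finally show "norm (g w * (z / w) ^ (N + 1)) \<le> B1 * (1 / 2) ^ N"
        using B1[OF w] B0 unfolding norm_mult norm_power by (intro mult_mono) auto
    qed (use pos B0 in auto)
    have "(\<Sum>n = - int N..int N. laurent_coeff f n * z powi n) - f z
        = (I (\<lambda>w. f w * D w) - f z * I D) / (2 * pi * \<i>)"
      unfolding S ID by (simp add: field_simps)
    then have "norm ((\<Sum>n = - int N..int N. laurent_coeff f n * z powi n) - f z)
        = norm (I (\<lambda>w. f w * D w) - f z * I D) / (2 * pi)"
      by (simp add: norm_divide norm_mult)
    also have "\<dots> \<le> (B2 * (1 / 2) ^ N * (2 * pi * r) + B1 * (1 / 2) ^ N * (2 * pi * R)) / (2 * pi)"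
      unfolding eq by (intro divide_right_mono order_trans[OF norm_triangle_ineq4] add_mono b1 b2) auto
    also have "\<dots> = (B1 * R + B2 * r) * (1 / 2) ^ N" by (simp add: field_simps)
    finally show ?thesis .
  qed
  have "(\<lambda>N. (\<Sum>n = - int N..int N. laurent_coeff f n * z powi n) - f z) \<longlonglongrightarrow> 0"
  proof (rule Lim_null_comparison)
    show "\<forall>\<^sub>F N in sequentially. norm ((\<Sum>n = - int N..int N. laurent_coeff f n * z powi n) - f z)
      \<le> (B1 * R + B2 * r) * (1 / 2) ^ N" using err by simp
    show "(\<lambda>N. (B1 * R + B2 * r) * (1 / 2) ^ N) \<longlonglongrightarrow> 0"
      by (intro tendsto_mult_right_zero LIMSEQ_power_zero) simp
  qed
  then show ?thesis by (simp add: LIM_zero_iff)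
qed

lemma summable_half_abs: "(\<lambda>n :: int. (1 / 2 :: real) ^ nat \<bar>n\<bar>) summable_on UNIV"
proof -
  have geo: "(\<lambda>n :: nat. (1 / 2 :: real) ^ n) summable_on UNIV"
    by (subst summable_on_UNIV_nonneg_real_iff) (auto simp: summable_geometric)
  have "(\<lambda>n :: int. (1 / 2 :: real) ^ nat \<bar>n\<bar>) summable_on {0..}"
    using geo by (subst summable_on_reindex_bij_witness[of _ int nat UNIV "\<lambda>n. (1 / 2) ^ n"]) auto
  moreover have "(\<lambda>n :: int. (1 / 2 :: real) ^ nat \<bar>n\<bar>) summable_on {..0}"
    using geo by (subst summable_on_reindex_bij_witness[of _ "\<lambda>n. - int n" "\<lambda>n. nat (- n)" UNIV "\<lambda>n. (1 / 2) ^ n"]) auto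
  ultimately have "(\<lambda>n :: int. (1 / 2 :: real) ^ nat \<bar>n\<bar>) summable_on ({0..} \<union> {..0})"
    by (rule summable_on_union)
  moreover have "{0..} \<union> {..0} = (UNIV :: int set)" by auto
  ultimately show ?thesis by simp
qed

text \<open>Cauchy estimates at the radii 2|z| and |z|/2 dominate the terms by a multiple of
  2^(-|n|), so the family is summable in any order; the symmetric partial sums then identify its
  value.\<close>

lemma laurent_has_sum:
  assumes f: "f holomorphic_on - {0}" and z: "z \<noteq> 0"
  shows "((\<lambda>n. laurent_coeff f n * z powi n) has_sum f z) UNIV"
proof -
  have bdd: "\<exists>M. \<forall>w. norm w = s \<longrightarrow> norm (f w) \<le> M" if "s > 0" for s :: real
  proof -
    have "continuous_on (sphere 0 s) f"
      by (rule continuous_on_subset[OF holomorphic_on_imp_continuous_on[OF f]]) (use that in auto)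
    from compact_imp_bounded[OF compact_continuous_image[OF this compact_sphere]]
    obtain M where "\<forall>x\<in>f ` sphere 0 s. norm x \<le> M" unfolding bounded_iff by blast
    then show ?thesis by (intro exI[of _ M]) auto
  qed
  have nz: "norm z > 0" using z by simp
  obtain M1 where M1: "\<And>w. norm w = 2 * norm z \<Longrightarrow> norm (f w) \<le> M1" using bdd[of "2 * norm z"] nz by (meson mult_pos_pos zero_less_numeral)
  obtain M2 where M2: "\<And>w. norm w = norm z / 2 \<Longrightarrow> norm (f w) \<le> M2" using bdd[of "norm z / 2"] nz by (meson half_gt_zero)
  define M where "M = max (max M1 M2) 0"
  have bound: "norm (laurent_coeff f n * z powi n) \<le> M * (1 / 2) ^ nat \<bar>n\<bar>" for n
  proof (cases "n \<ge> 0")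
    case True
    have "norm (laurent_coeff f n) \<le> M * (2 * norm z) powi (- n)"
      by (rule norm_laurent_coeff_le[OF f]) (use nz M1 in \<open>auto simp: M_def le_max_iff_disj\<close>)
    then have "norm (laurent_coeff f n * z powi n) \<le> M * (2 * norm z) powi (- n) * norm z powi n"
      by (simp add: norm_mult norm_power_int mult_right_mono)
    also have "\<dots> = M * (1 / 2) ^ nat \<bar>n\<bar>"
      using True nz by (simp add: power_int_mult_distrib power_int_def field_simps)
    finally show ?thesis .
  next
    case False
    have "norm (laurent_coeff f n) \<le> M * (norm z / 2) powi (- n)"
      by (rule norm_laurent_coeff_le[OF f]) (use nz M2 in \<open>auto simp: M_def le_max_iff_disj\<close>)
    then have "norm (laurent_coeff f n * z powi n) \<le> M * (norm z / 2) powi (- n) * norm z powi n"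
      by (simp add: norm_mult norm_power_int mult_right_mono)
    also have "\<dots> = M * (1 / 2) ^ nat \<bar>n\<bar>"
      using False nz by (simp add: power_int_def field_simps)
    finally show ?thesis .
  qed
  have "(\<lambda>n. M * (1 / 2) ^ nat \<bar>n\<bar>) summable_on (UNIV :: int set)"
    by (intro summable_on_cmult_right summable_half_abs)
  then have "(\<lambda>n. norm (laurent_coeff f n * z powi n)) summable_on UNIV"
    by (rule summable_on_comparison_test) (use bound in auto)
  then have summ: "(\<lambda>n. laurent_coeff f n * z powi n) summable_on UNIV"
    by (rule abs_summable_summable)
  then obtain S where S: "((\<lambda>n. laurent_coeff f n * z powi n) has_sum S) UNIV"
    by (auto simp: summable_on_def)
  \<comment> \<open>Symmetric intervals eventually contain every finite set of integers, so the
    unordered sum is also the limit of the symmetric partial sums.\<close>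
  have "filterlim (\<lambda>N :: nat. {- int N..int N}) (finite_subsets_at_top UNIV) sequentially"
    unfolding filterlim_finite_subsets_at_top
  proof safe
    fix X :: "int set" assume X: "finite X"
    define B where "B = (\<Sum>y\<in>X. nat \<bar>y\<bar>)"
    have B: "x \<le> int N \<and> - int N \<le> x" if "x \<in> X" "B \<le> N" for x N
    proof -
      have "nat \<bar>x\<bar> \<le> B"
        unfolding B_def by (rule member_le_sum) (use X that in auto)
      then show ?thesis using that(2) by linarith
    qed
    show "\<forall>\<^sub>F N in sequentially. finite {- int N..int N} \<and> X \<subseteq> {- int N..int N} \<and> {- int N..int N} \<subseteq> UNIV"
      using eventually_ge_at_top[of B] by eventually_elim (use B in auto)
  qed
  from filterlim_compose[OF S[unfolded has_sum_def] this]
  have "(\<lambda>N. \<Sum>n = - int N..int N. laurent_coeff f n * z powi n) \<longlonglongrightarrow> S" .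
  with laurent_partial_sums[OF f z] have "S = f z" using LIMSEQ_unique by blast
  with S show ?thesis by simp
qed

lemma laurent_coeff_entire:
  assumes "f holomorphic_on UNIV" "n < 0"
  shows "laurent_coeff f n = 0"
proof -
  have "(\<lambda>w. f w * w powi (- n - 1)) holomorphic_on UNIV"
    using assms by (intro holomorphic_intros) auto
  then have "contour_integral (circlepath 0 1) (\<lambda>w. f w * w powi (- n - 1)) = 0"
    by (intro contour_integral_unique Cauchy_theorem_convex_simple[of _ UNIV]) auto
  then show ?thesis by (simp add: laurent_coeff_def)
qed

lemma laurent_has_sum_entire:
  assumes f: "f holomorphic_on UNIV"
  shows "((\<lambda>n. laurent_coeff f n * z powi n) has_sum f z) UNIV"
proof (cases "z = 0")
  case False
  then show ?thesis by (intro laurent_has_sum holomorphic_on_subset[OF f]) auto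
next
  case True
  have "((\<lambda>u. f u / (u - 0)) has_contour_integral 2 * of_real pi * \<i> * f 0) (circlepath 0 1)"
    by (rule Cauchy_integral_circlepath_simple[OF holomorphic_on_subset[OF f]]) simp_all
  moreover have "(\<lambda>w. f w * w powi (- 0 - 1)) = (\<lambda>u. f u / (u - 0))"
    by (simp add: fun_eq_iff field_class.field_divide_inverse)
  ultimately have "laurent_coeff f 0 = 2 * of_real pi * \<i> * f 0 / (2 * pi * \<i>)"
    unfolding laurent_coeff_def by (simp only: contour_integral_unique)
  then have "laurent_coeff f 0 = f 0" by simp
  \<comment> \<open>By convention \<open>0 powi n\<close> is 0 for every n other than 0, negative n
    included.\<close>
  moreover have "((\<lambda>n. laurent_coeff f n * 0 powi n) has_sum laurent_coeff f 0) UNIV"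
    by (rule has_sum_finite_neutralI[of "{0}"]) auto
  ultimately show ?thesis using True by simp
qed

text \<open>Summability at 1 yields a finite set containing n whose tail is below |b n|/2 uniformly
  on the unit circle. The finite partial sum is therefore at most |b n|/2 there, but its integral
  against w^(-n-1) has modulus 2 pi |b n|. No interchange of an infinite sum with an integral is
  needed.\<close>

lemma laurent_unique:
  fixes b :: "int \<Rightarrow> complex"
  assumes "\<And>w. w \<noteq> 0 \<Longrightarrow> ((\<lambda>n. b n * w powi n) has_sum 0) UNIV"
  shows "b n = 0"
proof (rule ccontr)
  assume nz: "b n \<noteq> 0"
  have "(\<lambda>n. b n * 1 powi n) summable_on UNIV"
    by (rule has_sum_imp_summable[OF assms]) simp
  then have "(\<lambda>k. norm (b k)) summable_on UNIV" by (simp add: summable_on_iff_abs_summable_on_complex)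
  then obtain S where S: "((\<lambda>k. norm (b k)) has_sum S) UNIV" by (auto simp: summable_on_def)
  define e where "e = norm (b n) / 2"
  have "e > 0" using nz by (simp add: e_def)
  from S have "\<forall>\<^sub>F F in finite_subsets_at_top UNIV. dist (\<Sum>k\<in>F. norm (b k)) S < e"
    unfolding has_sum_def tendsto_iff using \<open>e > 0\<close> by blast
  then obtain F0 where F0: "finite F0" "\<And>F. finite F \<Longrightarrow> F0 \<subseteq> F \<Longrightarrow> dist (\<Sum>k\<in>F. norm (b k)) S < e"
    unfolding eventually_finite_subsets_at_top by auto
  define F where "F = insert n F0"
  have F: "finite F" "dist (\<Sum>k\<in>F. norm (b k)) S < e"
    by (simp add: F_def F0(1)) (rule F0(2), use F0(1) in \<open>auto simp: F_def\<close>)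
  have tail: "((\<lambda>k. norm (b k)) has_sum (S - (\<Sum>k\<in>F. norm (b k)))) (- F)"
    using has_sum_Diff[OF S has_sum_finite[OF F(1)]] by (simp add: Compl_eq_Diff_UNIV)
  have pw: "norm (\<Sum>k\<in>F. b k * w powi k) \<le> e" if w: "norm w = 1" for w
  proof -
    have "w \<noteq> 0" using w by auto
    have "((\<lambda>k. b k * w powi k) has_sum (0 - (\<Sum>k\<in>F. b k * w powi k))) (- F)"
      using has_sum_Diff[OF assms[OF \<open>w \<noteq> 0\<close>] has_sum_finite[OF F(1)]] by (simp add: Compl_eq_Diff_UNIV)
    moreover have "((\<lambda>k. norm (b k * w powi k)) has_sum (S - (\<Sum>k\<in>F. norm (b k)))) (- F)"
      using tail w by (simp add: norm_mult norm_power_int)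
    ultimately have "norm (0 - (\<Sum>k\<in>F. b k * w powi k)) \<le> S - (\<Sum>k\<in>F. norm (b k))"
      by (intro norm_has_sum_bound)
    with F(2) show ?thesis by (simp add: dist_real_def)
  qed
  have "contour_integral (circlepath 0 1) (\<lambda>w. (\<Sum>k\<in>F. b k * w powi k) * w powi (- n - 1))
      = contour_integral (circlepath 0 1) (\<lambda>w. \<Sum>k\<in>F. b k * w powi (k - n - 1))"
  proof (rule contour_integral_cong)
    fix w :: complex assume "w \<in> path_image (circlepath 0 1)"
    then have "w \<noteq> 0" by auto
    then have "w powi k * w powi (- n - 1) = w powi (k - n - 1)" for k
      by (simp add: algebra_simps flip: power_int_add)
    then show "(\<Sum>k\<in>F. b k * w powi k) * w powi (- n - 1) = (\<Sum>k\<in>F. b k * w powi (k - n - 1))"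
      by (simp add: sum_distrib_right mult.assoc)
  qed simp
  also have "\<dots> = (\<Sum>k\<in>F. contour_integral (circlepath 0 1) (\<lambda>w. b k * w powi (k - n - 1)))"
    by (intro contour_integral_sum F contour_integrable_continuous_circlepath)
       (auto intro!: continuous_intros)
  also have "\<dots> = (\<Sum>k\<in>F. b k * (if k = n then 2 * pi * \<i> else 0))"
    by (intro sum.cong refl, subst contour_integral_lmul)
       (auto simp: contour_integral_powi intro!: contour_integrable_continuous_circlepath continuous_intros)
  also have "\<dots> = b n * (2 * pi * \<i>)" using F(1) by (simp add: F_def if_distrib cong: if_cong)
  finally have "norm (b n) * (2 * pi)
    = norm (contour_integral (circlepath 0 1) (\<lambda>w. (\<Sum>k\<in>F. b k * w powi k) * w powi (- n - 1)))"
    by (simp add: norm_mult)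
  also have "\<dots> \<le> e * (2 * pi * 1)"
    by (rule norm_contour_integral_circle_le)
       (use pw \<open>e > 0\<close> in \<open>auto simp: norm_mult norm_power_int intro!: continuous_intros\<close>)
  finally show False using nz by (simp add: e_def)
qed

section \<open>Laurent coefficients in four variables\<close>

lemma continuous_on_contour_integral_param:
  fixes G :: "'a::topological_space \<Rightarrow> complex \<Rightarrow> complex"
  assumes "continuous_on (Y \<times> path_image g) (\<lambda>(y, w). G y w)" "path g"
    and "continuous_on {0..1} (\<lambda>t. vector_derivative g (at t))"
  shows "continuous_on Y (\<lambda>y. contour_integral g (G y))"
proof -
  have "continuous_on (Y \<times> {0..1}) (\<lambda>p. (fst p, g (snd p)))"
    using continuous_on_compose2[OF assms(2)[unfolded path_def] continuous_on_snd[OF continuous_on_id], of "Y \<times> {0..1}"]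
    by (intro continuous_on_Pair continuous_on_fst continuous_on_id) auto
  then have "continuous_on (Y \<times> {0..1}) (\<lambda>p. case (fst p, g (snd p)) of (y, w) \<Rightarrow> G y w)"
    by (rule continuous_on_compose2[OF assms(1)]) (auto simp: path_image_def)
  moreover have "continuous_on (Y \<times> {0..1}) (\<lambda>p. vector_derivative g (at (snd p)))"
    by (rule continuous_on_compose2[OF assms(3) continuous_on_snd[OF continuous_on_id]]) auto
  ultimately have "continuous_on (Y \<times> {0..1}) (\<lambda>p. G (fst p) (g (snd p)) * vector_derivative g (at (snd p)))"
    by (simp add: continuous_on_mult)
  then have "continuous_on (Y \<times> cbox 0 (1::real)) (\<lambda>(y, t). G y (g t) * vector_derivative g (at t))"
    by (simp add: case_prod_beta)
  from integral_continuous_on_param[OF this] show ?thesis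
    by (simp add: contour_integral_integral)
qed

lemma continuous_vector_derivative_circlepath:
  "continuous_on {0..1} (\<lambda>t. vector_derivative (circlepath z r) (at t))"
  unfolding vector_derivative_circlepath by (intro continuous_intros)

text \<open>Morera's theorem: around a triangle the two integrations may be interchanged, and for
  each fixed point of the circle the triangle integral vanishes by Cauchy's theorem.\<close>

lemma holomorphic_contour_integral_param:
  assumes "open Y" and cont: "continuous_on (Y \<times> sphere 0 1) (\<lambda>(y, w). G y w)"
    and hol: "\<And>w. w \<in> sphere 0 1 \<Longrightarrow> (\<lambda>y. G y w) holomorphic_on Y"
  shows "(\<lambda>y. contour_integral (circlepath 0 1) (G y)) holomorphic_on Y"
proof -
  have "(\<lambda>y. contour_integral (circlepath 0 1) (G y)) analytic_on Y"
  proof (rule Morera_triangle)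
    show contF: "continuous_on Y (\<lambda>y. contour_integral (circlepath 0 1) (G y))"
      using cont by (intro continuous_on_contour_integral_param continuous_vector_derivative_circlepath) auto
    show "convex hull {a, b, c} \<subseteq> Y \<longrightarrow>
        contour_integral (linepath a b) (\<lambda>y. contour_integral (circlepath 0 1) (G y)) +
        contour_integral (linepath b c) (\<lambda>y. contour_integral (circlepath 0 1) (G y)) +
        contour_integral (linepath c a) (\<lambda>y. contour_integral (circlepath 0 1) (G y)) = 0" for a b c
    proof
      assume T: "convex hull {a, b, c} \<subseteq> Y"
      have sub: "closed_segment a b \<subseteq> Y" "closed_segment b c \<subseteq> Y" "closed_segment c a \<subseteq> Y"
        unfolding segment_convex_hull by (rule subset_trans[OF hull_mono T], blast)+
      define E where "E = (\<lambda>p q w. contour_integral (linepath p q) (\<lambda>y. G y w))"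
      have swapped: "contour_integral (linepath p q) (\<lambda>y. contour_integral (circlepath 0 1) (G y))
          = contour_integral (circlepath 0 1) (E p q) \<and> E p q contour_integrable_on (circlepath 0 1)"
        if "closed_segment p q \<subseteq> Y" for p q
      proof
        have c: "continuous_on (path_image (linepath p q) \<times> path_image (circlepath 0 1)) (\<lambda>(y, w). G y w)"
          by (rule continuous_on_subset[OF cont]) (use that in auto)
        show "contour_integral (linepath p q) (\<lambda>y. contour_integral (circlepath 0 1) (G y))
          = contour_integral (circlepath 0 1) (E p q)"
          unfolding E_def
          by (rule contour_integral_swap[OF c])
             (auto simp: continuous_vector_derivative_circlepath)
        have c': "continuous_on (sphere 0 1 \<times> path_image (linepath p q)) (\<lambda>(w, y). G y w)"
        proof -
          have "continuous_on (sphere 0 1 \<times> path_image (linepath p q)) (\<lambda>x. case (snd x, fst x) of (y, w) \<Rightarrow> G y w)"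
            by (rule continuous_on_compose2[OF cont]) (use that in \<open>auto intro!: continuous_intros\<close>)
          then show ?thesis by (simp add: case_prod_beta)
        qed
        have "continuous_on (sphere 0 1) (E p q)"
          unfolding E_def by (rule continuous_on_contour_integral_param[OF c']) auto
        then show "E p q contour_integrable_on (circlepath 0 1)"
          by (intro contour_integrable_continuous_circlepath) simp
      qed
      have zero: "E a b w + E b c w + E c a w = 0" if w: "w \<in> sphere 0 1" for w
      proof -
        have h: "(\<lambda>y. G y w) holomorphic_on convex hull {a, b, c}"
          using hol[OF w] T holomorphic_on_subset by blast
        have ci: "continuous_on (closed_segment p q) (\<lambda>y. G y w)" if "closed_segment p q \<subseteq> Y" for p q
          using hol[OF w] that holomorphic_on_imp_continuous_on continuous_on_subset by blast
        note i = contour_integrable_continuous_linepath[OF ci]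
        have "contour_integral (linepath a b +++ linepath b c +++ linepath c a) (\<lambda>y. G y w) = 0"
          by (rule contour_integral_unique[OF Cauchy_theorem_triangle[OF h]])
        then show ?thesis
          using i[OF sub(1)] i[OF sub(2)] i[OF sub(3)]
          by (simp add: E_def contour_integrable_join contour_integral_join add.assoc)
      qed
      have "contour_integral (circlepath 0 1) (E a b) + contour_integral (circlepath 0 1) (E b c)
          + contour_integral (circlepath 0 1) (E c a)
        = contour_integral (circlepath 0 1) (\<lambda>w. E a b w + E b c w + E c a w)"
        using swapped[OF sub(1)] swapped[OF sub(2)] swapped[OF sub(3)]
        by (simp add: contour_integral_add contour_integrable_add)
      also have "\<dots> = contour_integral (circlepath 0 1) (\<lambda>w. 0)"
        by (rule contour_integral_cong) (use zero in auto)
      finally show "contour_integral (linepath a b) (\<lambda>y. contour_integral (circlepath 0 1) (G y)) +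
        contour_integral (linepath b c) (\<lambda>y. contour_integral (circlepath 0 1) (G y)) +
        contour_integral (linepath c a) (\<lambda>y. contour_integral (circlepath 0 1) (G y)) = 0"
        using swapped[OF sub(1)] swapped[OF sub(2)] swapped[OF sub(3)] by simp
    qed
  qed fact
  then show ?thesis by (rule analytic_imp_holomorphic)
qed

section \<open>Separately holomorphic functions and their partial coefficients\<close>

definition nzdom :: "4 set \<Rightarrow> point set" where
  "nzdom S = {z. \<forall>i\<in>S. z $ i \<noteq> 0}"

definition upd :: "point \<Rightarrow> 4 \<Rightarrow> complex \<Rightarrow> point" where
  "upd z i w = (\<chi> j. if j = i then w else z $ j)"

lemma upd_nth [simp]: "upd z i w $ j = (if j = i then w else z $ j)"
  by (simp add: upd_def)

lemma upd_simps [simp]: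
  "upd (upd z i v) i w = upd z i w" "upd z i (z $ i) = z"
  by (simp_all add: vec_eq_iff)

lemma upd_commute: "i \<noteq> j \<Longrightarrow> upd (upd z i v) j w = upd (upd z j w) i v"
  by (auto simp: vec_eq_iff)

lemma upd_in_nzdom: "z \<in> nzdom S \<Longrightarrow> (i \<in> S \<Longrightarrow> w \<noteq> 0) \<Longrightarrow> upd z i w \<in> nzdom S"
  by (auto simp: nzdom_def)

text \<open>Joint continuity belongs to the notion because it makes the parameter integrals for
  partial coefficients continuous and holomorphic again. Coordinates in \<open>S\<close> range over
  the punctured plane, the others over the whole plane.\<close>

definition sep_holomorphic :: "4 set \<Rightarrow> (point \<Rightarrow> complex) \<Rightarrow> bool" where
  "sep_holomorphic S f \<longleftrightarrow> continuous_on (nzdom S) f \<and>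
     (\<forall>z\<in>nzdom S. \<forall>i. (\<lambda>w. f (upd z i w)) holomorphic_on (if i \<in> S then - {0} else UNIV))"

lemma sep_holomorphicD:
  assumes "sep_holomorphic S f" "z \<in> nzdom S"
  shows "(\<lambda>w. f (upd z i w)) holomorphic_on - {0}"
    and "i \<notin> S \<Longrightarrow> (\<lambda>w. f (upd z i w)) holomorphic_on UNIV"
proof -
  have "(\<lambda>w. f (upd z i w)) holomorphic_on (if i \<in> S then - {0} else UNIV)"
    using assms by (auto simp: sep_holomorphic_def)
  then show "(\<lambda>w. f (upd z i w)) holomorphic_on - {0}"
    "i \<notin> S \<Longrightarrow> (\<lambda>w. f (upd z i w)) holomorphic_on UNIV"
    using holomorphic_on_subset by (auto split: if_splits)
qed

lemma sep_holomorphic_subset: "sep_holomorphic S f \<Longrightarrow> S \<subseteq> S' \<Longrightarrow> sep_holomorphic S' f"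
  unfolding sep_holomorphic_def
proof safe
  assume *: "continuous_on (nzdom S) f" "S \<subseteq> S'"
    "\<forall>z\<in>nzdom S. \<forall>i. (\<lambda>w. f (upd z i w)) holomorphic_on (if i \<in> S then - {0} else UNIV)"
  have sub: "nzdom S' \<subseteq> nzdom S" using *(2) by (auto simp: nzdom_def)
  show "continuous_on (nzdom S') f" by (rule continuous_on_subset[OF *(1) sub])
  fix z i assume "z \<in> nzdom S'"
  with sub * have "(\<lambda>w. f (upd z i w)) holomorphic_on (if i \<in> S then - {0} else UNIV)" by blast
  then show "(\<lambda>w. f (upd z i w)) holomorphic_on (if i \<in> S' then - {0} else UNIV)"
    by (rule holomorphic_on_subset) (use *(2) in auto)
qed

text \<open>The coefficient in one variable is kept as a function of the whole point, although it no
  longer depends on coordinate \<open>i\<close>, so that the operator can be iterated.\<close>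

definition coeff_op :: "(point \<Rightarrow> complex) \<Rightarrow> 4 \<Rightarrow> int \<Rightarrow> point \<Rightarrow> complex" where
  "coeff_op f i n z = laurent_coeff (\<lambda>w. f (upd z i w)) n"

lemma coeff_op_upd_same: "coeff_op f i n (upd z i w) = coeff_op f i n z"
  by (simp add: coeff_op_def)

lemma coeff_op_upd:
  assumes "\<And>z w. f (upd z j w) = f z"
  shows "coeff_op f i n (upd z j w) = coeff_op f i n z"
proof (cases "i = j")
  case False
  then show ?thesis unfolding coeff_op_def by (subst upd_commute) (simp_all add: assms)
qed (simp add: coeff_op_upd_same)

lemma continuous_on_upd2:
  fixes p :: "'a::topological_space \<Rightarrow> point"
  shows "continuous_on A p \<Longrightarrow> continuous_on A q \<Longrightarrow> continuous_on A (\<lambda>x. upd (p x) i (q x))"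
  unfolding upd_def
proof (rule continuous_on_vec_lambda)
  fix j assume "continuous_on A p" "continuous_on A q"
  then show "continuous_on A (\<lambda>x. if j = i then q x else p x $ j)"
    by (cases "j = i") (auto intro!: continuous_intros)
qed

text \<open>In the coordinate \<open>i\<close> itself the result is constant. In another coordinate
  it is a parameter integral over the unit circle, and replacing coordinate \<open>i\<close> by a
  unit complex number never leaves \<open>nzdom S\<close>.\<close>

lemma sep_holomorphic_coeff_op:
  assumes f: "sep_holomorphic S f"
  shows "sep_holomorphic S (coeff_op f i n)"
  unfolding sep_holomorphic_def
proof (intro conjI ballI allI)
  have contf: "continuous_on (nzdom S) f" using f by (simp add: sep_holomorphic_def)
  have "continuous_on (nzdom S \<times> sphere 0 1) (\<lambda>x. f (upd (fst x) i (snd x)) * snd x powi (- n - 1))"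
    by (intro continuous_on_mult continuous_on_compose2[OF contf continuous_on_upd2]
          continuous_on_power_int continuous_on_fst continuous_on_snd continuous_on_id)
       (auto intro!: upd_in_nzdom)
  then have "continuous_on (nzdom S \<times> path_image (circlepath 0 1))
      (\<lambda>(z, w). f (upd z i w) * w powi (- n - 1))" by (simp add: case_prod_beta)
  from continuous_on_contour_integral_param[OF this]
  have "continuous_on (nzdom S) (\<lambda>z. contour_integral (circlepath 0 1) (\<lambda>w. f (upd z i w) * w powi (- n - 1)))"
    by (simp add: continuous_vector_derivative_circlepath)
  then show "continuous_on (nzdom S) (coeff_op f i n)"
    unfolding coeff_op_def laurent_coeff_def by (intro continuous_intros) auto
  fix z j assume z: "z \<in> nzdom S"
  let ?Y = "if j \<in> S then - {0} else UNIV :: complex set"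
  show "(\<lambda>w. coeff_op f i n (upd z j w)) holomorphic_on ?Y"
  proof (cases "i = j")
    case True
    then show ?thesis by (simp add: coeff_op_upd_same)
  next
    case False
    have "(\<lambda>y. contour_integral (circlepath 0 1) (\<lambda>w. f (upd (upd z j y) i w) * w powi (- n - 1)))
        holomorphic_on ?Y"
    proof (rule holomorphic_contour_integral_param)
      have "continuous_on (?Y \<times> sphere 0 1)
          (\<lambda>x. f (upd (upd z j (fst x)) i (snd x)) * snd x powi (- n - 1))"
        by (intro continuous_on_mult continuous_on_compose2[OF contf continuous_on_upd2] continuous_on_upd2
              continuous_on_power_int continuous_on_fst continuous_on_snd continuous_on_id continuous_on_const)
           (use z in \<open>auto intro!: upd_in_nzdom split: if_splits\<close>)
      then show "continuous_on (?Y \<times> sphere 0 1) (\<lambda>(y, w). f (upd (upd z j y) i w) * w powi (- n - 1))"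
        by (simp add: case_prod_beta)
      fix w :: complex assume w: "w \<in> sphere 0 1"
      have "upd z i w \<in> nzdom S" using z w by (intro upd_in_nzdom) auto
      then have "(\<lambda>y. f (upd (upd z i w) j y)) holomorphic_on ?Y"
        using f unfolding sep_holomorphic_def by blast
      then have "(\<lambda>y. f (upd (upd z j y) i w)) holomorphic_on ?Y"
        using upd_commute[OF False] by simp
      then show "(\<lambda>y. f (upd (upd z j y) i w) * w powi (- n - 1)) holomorphic_on ?Y"
        by (intro holomorphic_intros)
    qed auto
    then show ?thesis unfolding coeff_op_def laurent_coeff_def by (intro holomorphic_intros) auto
  qed
qed

text \<open>If \<open>i\<close> lies outside \<open>S\<close>, the coordinate may vanish, and the
  expansion of an entire function has to be used.\<close>

lemma coeff_op_has_sum: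
  assumes "sep_holomorphic S f" "z \<in> nzdom S"
  shows "((\<lambda>n. coeff_op f i n z * z $ i powi n) has_sum f z) UNIV"
proof (cases "i \<in> S")
  case True
  then have "z $ i \<noteq> 0" using assms(2) by (auto simp: nzdom_def)
  from laurent_has_sum[OF sep_holomorphicD(1)[OF assms] this, of i]
  show ?thesis by (simp add: coeff_op_def)
next
  case False
  from laurent_has_sum_entire[OF sep_holomorphicD(2)[OF assms False], of "z $ i"]
  show ?thesis by (simp add: coeff_op_def)
qed

lemma coeff_op_eq_0:
  assumes "sep_holomorphic S f" "z \<in> nzdom S" "i \<notin> S" "n < 0"
  shows "coeff_op f i n z = 0"
  unfolding coeff_op_def by (rule laurent_coeff_entire[OF sep_holomorphicD(2)[OF assms(1-3)] assms(4)])

lemma norm_coeff_op_le: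
  assumes f: "sep_holomorphic UNIV f" and R: "\<And>j. R j > 0"
    and M: "\<And>z. (\<forall>j. norm (z $ j) = R j) \<Longrightarrow> norm (f z) \<le> M"
    and z: "\<forall>j. norm (z $ j) = R j"
  shows "norm (coeff_op f i n z) \<le> M * R i powi (- n)"
  unfolding coeff_op_def
proof (rule norm_laurent_coeff_le)
  have "z $ j \<noteq> 0" for j using z[rule_format, of j] R[of j] by auto
  then have "z \<in> nzdom UNIV" by (simp add: nzdom_def)
  then show "(\<lambda>w. f (upd z i w)) holomorphic_on - {0}" by (rule sep_holomorphicD(1)[OF f])
qed (use R M z in auto)

section \<open>Monomials, rapid decay and absolute convergence\<close>

definition monom_at :: "int ^ 4 \<Rightarrow> point \<Rightarrow> complex" where
  "monom_at m z = (\<Prod>i\<in>UNIV. z $ i powi m $ i)"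

definition deg1 :: "int ^ 4 \<Rightarrow> nat" where
  "deg1 m = (\<Sum>i\<in>UNIV. nat \<bar>m $ i\<bar>)"

text \<open>Decay faster than every exponential in the degree, the growth condition on Laurent
  coefficients of functions holomorphic on the whole torus. It survives termwise bounded operations,
  which is what the homotopies require.\<close>

definition rapid :: "(int ^ 4 \<Rightarrow> complex) \<Rightarrow> bool" where
  "rapid a \<longleftrightarrow> (\<forall>\<rho>\<ge>1. \<exists>C. \<forall>m. norm (a m) * \<rho> ^ deg1 m \<le> C)"

definition neg_set :: "int ^ 4 \<Rightarrow> 4 set" where
  "neg_set m = {i. m $ i < 0}"

definition supported :: "4 set \<Rightarrow> (int ^ 4 \<Rightarrow> complex) \<Rightarrow> bool" where
  "supported S a \<longleftrightarrow> (\<forall>m. a m \<noteq> 0 \<longrightarrow> neg_set m \<subseteq> S)"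

text \<open>Sums over exponent vectors are transported to nested pairs, where they can be iterated
  one variable at a time.\<close>

definition vec4 :: "int \<times> int \<times> int \<times> int \<Rightarrow> int ^ 4" where
  "vec4 = (\<lambda>(a, b, c, d). vector [a, b, c, d])"

lemma vector_4:
  "(vector [a, b, c, d] :: 'a::zero ^ 4) $ 1 = a" "(vector [a, b, c, d] :: 'a ^ 4) $ 2 = b"
  "(vector [a, b, c, d] :: 'a ^ 4) $ 3 = c" "(vector [a, b, c, d] :: 'a ^ 4) $ 4 = d"
  by (simp_all add: vector_def)

lemma vec4_nth [simp]:
  "vec4 (a, b, c, d) $ 1 = a" "vec4 (a, b, c, d) $ 2 = b"
  "vec4 (a, b, c, d) $ 3 = c" "vec4 (a, b, c, d) $ 4 = d"
  by (simp_all add: vec4_def vector_4)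

lemma bij_vec4: "bij vec4"
proof (rule bijI')
  show "vec4 x = vec4 y \<longleftrightarrow> x = y" for x y
    by (cases x; cases y) (simp add: vec_eq_iff forall_4)
  show "\<exists>x. m = vec4 x" for m
    by (rule exI[of _ "(m $ 1, m $ 2, m $ 3, m $ 4)"]) (simp add: vec_eq_iff forall_4)
qed

lemma prod_UNIV_4: "(\<Prod>i\<in>UNIV. f (i :: 4)) = f 1 * f 2 * f 3 * f 4"
  unfolding UNIV_4 by (simp add: mult_ac)

lemma monom_at_4: "monom_at m z = z $ 1 powi m $ 1 * z $ 2 powi m $ 2 * z $ 3 powi m $ 3 * z $ 4 powi m $ 4"
  by (simp add: monom_at_def prod_UNIV_4)

lemma has_sum_vec4_iff: "(f has_sum s) UNIV \<longleftrightarrow> ((\<lambda>x. f (vec4 x)) has_sum s) UNIV"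
  by (subst has_sum_reindex_bij_betw[OF bij_vec4]) simp

lemma summable_vec4_iff: "f summable_on UNIV \<longleftrightarrow> (\<lambda>x. f (vec4 x)) summable_on UNIV"
  unfolding summable_on_def using has_sum_vec4_iff[of f] by auto

lemma summable_on_prod_nonneg:
  fixes f :: "'a \<Rightarrow> real" and g :: "'b \<Rightarrow> real"
  assumes "f summable_on UNIV" "g summable_on UNIV" "\<And>x. f x \<ge> 0" "\<And>y. g y \<ge> 0"
  shows "(\<lambda>p. f (fst p) * g (snd p)) summable_on UNIV"
proof -
  obtain s where s: "(g has_sum s) UNIV" using assms(2) by (auto simp: summable_on_def)
  have "(\<lambda>p. f (fst p) * g (snd p)) summable_on Sigma UNIV (\<lambda>_. UNIV)"
    by (rule summable_on_SigmaI[where g = "\<lambda>x. f x * s"])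
       (auto intro!: has_sum_cmult_right s summable_on_cmult_left assms mult_nonneg_nonneg)
  then show ?thesis by simp
qed

lemma summable_deg1: "(\<lambda>m. (1 / 2 :: real) ^ deg1 m) summable_on UNIV"
proof -
  let ?h = "\<lambda>n :: int. (1 / 2 :: real) ^ nat \<bar>n\<bar>"
  have "(\<lambda>p. ?h (fst p) * (?h (fst (snd p)) * (?h (fst (snd (snd p))) * ?h (snd (snd (snd p))))))
      summable_on UNIV"
    by (rule summable_on_prod_nonneg[OF summable_half_abs, where g = "\<lambda>p. ?h (fst p) * (?h (fst (snd p)) * ?h (snd (snd p)))"],
        rule summable_on_prod_nonneg[OF summable_half_abs, where g = "\<lambda>p. ?h (fst p) * ?h (snd p)"],
        rule summable_on_prod_nonneg[OF summable_half_abs summable_half_abs]) auto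
  moreover have "(1 / 2) ^ deg1 (vec4 p) = ?h (fst p) * (?h (fst (snd p)) * (?h (fst (snd (snd p))) * ?h (snd (snd (snd p)))))"
    for p by (cases p) (simp add: deg1_def sum_4 power_add)
  ultimately show ?thesis by (subst summable_vec4_iff) simp
qed

text \<open>Closed bounded polyannuli that exhaust \<open>nzdom S\<close> as \<open>\<rho>\<close>
  grows.\<close>

definition shell :: "4 set \<Rightarrow> real \<Rightarrow> point set" where
  "shell S \<rho> = {z. (\<forall>i. norm (z $ i) \<le> \<rho>) \<and> (\<forall>i\<in>S. norm (z $ i) \<ge> 1 / \<rho>)}"

lemma norm_powi_le:
  assumes "\<rho> \<ge> 1" "norm w \<le> \<rho>" "n < 0 \<Longrightarrow> norm (w :: complex) \<ge> 1 / \<rho>"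
  shows "norm (w powi n) \<le> \<rho> ^ nat \<bar>n\<bar>"
proof (cases "n \<ge> 0")
  case True
  then show ?thesis using assms by (simp add: power_int_def norm_power power_mono)
next
  case False
  then have "norm w \<ge> 1 / \<rho>" using assms by simp
  then have "inverse (norm w) \<le> \<rho>"
    using assms(1) le_imp_inverse_le[of "1 / \<rho>" "norm w"] by simp
  then show ?thesis using False
    by (simp add: power_int_def norm_power norm_inverse flip: power_inverse) (intro power_mono, auto)
qed

lemma norm_monom_at_le:
  assumes "\<rho> \<ge> 1" "z \<in> shell S \<rho>" "neg_set m \<subseteq> S"
  shows "norm (monom_at m z) \<le> \<rho> ^ deg1 m"
proof -
  have "norm (monom_at m z) = (\<Prod>i\<in>UNIV. norm (z $ i powi m $ i))"
    by (simp add: monom_at_def prod_norm)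
  also have "\<dots> \<le> (\<Prod>i\<in>UNIV. \<rho> ^ nat \<bar>m $ i\<bar>)"
    using assms by (intro prod_mono) (auto simp: shell_def neg_set_def intro!: norm_powi_le)
  finally show ?thesis by (simp add: deg1_def power_sum)
qed

lemma shell_exists:
  assumes "z \<in> nzdom S"
  obtains \<rho> where "\<rho> \<ge> 1" "z \<in> shell S \<rho>"
proof -
  define \<rho> where "\<rho> = 1 + (\<Sum>i\<in>UNIV. norm (z $ i)) + (\<Sum>i\<in>UNIV. inverse (norm (z $ i)))"
  have a: "norm (z $ i) \<le> (\<Sum>i\<in>UNIV. norm (z $ i))" for i by (rule member_le_sum) auto
  have b: "inverse (norm (z $ i)) \<le> (\<Sum>i\<in>UNIV. inverse (norm (z $ i)))" for i
    by (rule member_le_sum[of i UNIV "\<lambda>i. inverse (norm (z $ i))"]) auto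
  have s: "(\<Sum>i\<in>UNIV. norm (z $ i)) \<ge> 0" "(\<Sum>i\<in>UNIV. inverse (norm (z $ i))) \<ge> 0"
    by (auto intro!: sum_nonneg)
  have 1: "\<rho> \<ge> 1" using s by (simp add: \<rho>_def)
  have 2: "norm (z $ i) \<le> \<rho>" for i using a[of i] s by (simp add: \<rho>_def)
  have 3: "inverse (norm (z $ i)) \<le> \<rho>" for i using b[of i] s by (simp add: \<rho>_def)
  have "norm (z $ i) \<ge> 1 / \<rho>" if "i \<in> S" for i
  proof -
    have "norm (z $ i) > 0" using assms that by (auto simp: nzdom_def)
    then show ?thesis using 3[of i] 1 by (simp add: field_simps)
  qed
  with 1 2 show ?thesis by (intro that[of \<rho>]) (auto simp: shell_def)
qed

text \<open>Decay is used at the rate \<open>2 * \<rho>\<close>: one factor \<open>\<rho>\<close> is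
  kept to dominate a monomial, and the spare 2 leaves a summable weight.\<close>

lemma rapid_bound:
  assumes "rapid a" "\<rho> \<ge> 1"
  obtains C where "C \<ge> 0" "\<And>m. norm (a m) * \<rho> ^ deg1 m \<le> C * (1 / 2) ^ deg1 m"
proof -
  obtain C where C: "\<And>m. norm (a m) * (2 * \<rho>) ^ deg1 m \<le> C"
    using assms(1)[unfolded rapid_def, rule_format, of "2 * \<rho>"] assms(2) by auto
  show ?thesis
  proof (rule that[of "\<bar>C\<bar>"])
    fix m
    have "norm (a m) * \<rho> ^ deg1 m = norm (a m) * (2 * \<rho>) ^ deg1 m * (1 / 2) ^ deg1 m"
      by (simp add: power_mult_distrib power_divide)
    also have "\<dots> \<le> \<bar>C\<bar> * (1 / 2) ^ deg1 m"
      using C[of m] by (intro mult_right_mono) auto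
    finally show "norm (a m) * \<rho> ^ deg1 m \<le> \<bar>C\<bar> * (1 / 2) ^ deg1 m" .
  qed simp
qed

lemma abs_summable_rapid:
  assumes "rapid a" "supported S a" "z \<in> nzdom S"
  shows "(\<lambda>m. norm (a m * monom_at m z)) summable_on UNIV"
proof -
  obtain \<rho> where \<rho>: "\<rho> \<ge> 1" "z \<in> shell S \<rho>" using shell_exists[OF assms(3)] .
  obtain C where C: "\<And>m. norm (a m) * \<rho> ^ deg1 m \<le> C * (1 / 2) ^ deg1 m"
    using rapid_bound[OF assms(1) \<rho>(1)] by blast
  have "(\<lambda>m. C * (1 / 2) ^ deg1 m) summable_on UNIV"
    by (intro summable_on_cmult_right summable_deg1)
  then show ?thesis
  proof (rule summable_on_comparison_test)
    fix m
    have "norm (a m * monom_at m z) \<le> norm (a m) * \<rho> ^ deg1 m"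
    proof (cases "a m = 0")
      case False
      then have "neg_set m \<subseteq> S" using assms(2) by (auto simp: supported_def)
      then show ?thesis unfolding norm_mult
        by (intro mult_left_mono norm_monom_at_le[OF \<rho>]) auto
    qed simp
    then show "norm (a m * monom_at m z) \<le> C * (1 / 2) ^ deg1 m" using C[of m] by linarith
  qed auto
qed

definition laurent_sum :: "(int ^ 4 \<Rightarrow> complex) \<Rightarrow> point \<Rightarrow> complex" where
  "laurent_sum a z = infsum (\<lambda>m. a m * monom_at m z) UNIV"

lemma laurent_sum_has_sum:
  assumes "rapid a" "supported S a" "z \<in> nzdom S"
  shows "((\<lambda>m. a m * monom_at m z) has_sum laurent_sum a z) UNIV"
  unfolding laurent_sum_def
  by (rule has_sum_infsum[OF abs_summable_summable[OF abs_summable_rapid[OF assms]]])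

section \<open>Iterated Laurent coefficients and their expansion\<close>

definition coef :: "(point \<Rightarrow> complex) \<Rightarrow> int ^ 4 \<Rightarrow> complex" where
  "coef f m = coeff_op (coeff_op (coeff_op (coeff_op f 1 (m $ 1)) 2 (m $ 2)) 3 (m $ 3)) 4 (m $ 4) (vec 1)"

text \<open>Each coefficient operator removes the dependence on one coordinate, and the later ones
  preserve this; after four of them the function is constant, so the base point in
  \<open>coef\<close> is immaterial.\<close>

lemma coef_any_point:
  "coeff_op (coeff_op (coeff_op (coeff_op f 1 (m $ 1)) 2 (m $ 2)) 3 (m $ 3)) 4 (m $ 4) z = coef f m"
proof -
  define g where "g = coeff_op (coeff_op (coeff_op (coeff_op f 1 (m $ 1)) 2 (m $ 2)) 3 (m $ 3)) 4 (m $ 4)"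
  have 1: "g (upd z 1 w) = g z" for z w
    unfolding g_def by (intro coeff_op_upd coeff_op_upd_same)
  have 2: "g (upd z 2 w) = g z" for z w
    unfolding g_def by (intro coeff_op_upd[of "coeff_op (coeff_op _ _ _) _ _"] coeff_op_upd_same)
  have 3: "g (upd z 3 w) = g z" for z w
    unfolding g_def by (rule coeff_op_upd, rule coeff_op_upd_same)
  have 4: "g (upd z 4 w) = g z" for z w
    unfolding g_def by (rule coeff_op_upd_same)
  have "z = upd (upd (upd (upd (vec 1) 1 (z $ 1)) 2 (z $ 2)) 3 (z $ 3)) 4 (z $ 4)"
    by (simp add: vec_eq_iff forall_4)
  then have "g z = g (vec 1)" using 1 2 3 4 by metis
  then show ?thesis by (simp add: g_def coef_def)
qed

text \<open>Cauchy's estimate is applied in each variable on the torus whose radii are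
  \<open>\<rho>\<close> or \<open>1 / \<rho>\<close> according to the sign of the exponent. Every
  variable then contributes the factor \<open>1 / \<rho>\<close> to the power of the absolute value
  of its exponent, whatever its sign.\<close>

lemma rapid_coef:
  assumes f: "sep_holomorphic UNIV f"
  shows "rapid (coef f)"
  unfolding rapid_def
proof (intro allI impI)
  fix \<rho> :: real assume \<rho>: "\<rho> \<ge> 1"
  have "compact (shell UNIV \<rho>)"
  proof -
    have "closed (shell UNIV \<rho>)"
    proof -
      have "shell UNIV \<rho> = {z. \<forall>i. norm (z $ i) \<le> \<rho> \<and> 1 / \<rho> \<le> norm (z $ i)}"
        by (auto simp: shell_def)
      then show ?thesis
        by (simp only:) (intro closed_Collect_all closed_Collect_conj closed_Collect_le continuous_intros)
    qed
    moreover have "bounded (shell UNIV \<rho>)"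
      unfolding bounded_iff
    proof (intro exI ballI)
      fix z assume "z \<in> shell UNIV \<rho>"
      then have "(\<Sum>i\<in>UNIV. norm (z $ i)) \<le> (\<Sum>i\<in>(UNIV :: 4 set). \<rho>)"
        by (intro sum_mono) (auto simp: shell_def)
      then show "norm z \<le> (\<Sum>i\<in>(UNIV :: 4 set). \<rho>)" unfolding norm_vec_def by (intro order_trans[OF L2_set_le_sum]) auto
    qed
    ultimately show ?thesis by (simp add: compact_eq_bounded_closed)
  qed
  moreover have "shell UNIV \<rho> \<subseteq> nzdom UNIV"
  proof
    fix z assume z: "z \<in> shell UNIV \<rho>"
    have "1 / \<rho> > 0" using \<rho> by simp
    moreover have "1 / \<rho> \<le> norm (z $ i)" for i using z by (simp add: shell_def)
    ultimately have "norm (z $ i) > 0" for i by (meson less_le_trans)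
    then show "z \<in> nzdom UNIV" by (simp add: nzdom_def)
  qed
  then have "continuous_on (shell UNIV \<rho>) f"
    using f unfolding sep_holomorphic_def by (blast intro: continuous_on_subset)
  ultimately have "bounded (f ` shell UNIV \<rho>)" using compact_continuous_image compact_imp_bounded by blast
  then obtain M where M: "\<And>z. z \<in> shell UNIV \<rho> \<Longrightarrow> norm (f z) \<le> M" unfolding bounded_iff by blast
  have "norm (coef f m) * \<rho> ^ deg1 m \<le> M" for m
  proof -
    define R where "R = (\<lambda>j. if m $ j \<ge> 0 then \<rho> else 1 / \<rho>)"
    have Rpos: "R j > 0" for j using \<rho> by (auto simp: R_def)
    have Rsh: "z \<in> shell UNIV \<rho>" if "\<forall>j. norm (z $ j) = R j" for z
    proof -
      have "1 / \<rho> \<le> 1" using \<rho> by simp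
      moreover from this have "1 / \<rho> \<le> \<rho>" using \<rho> by linarith
      ultimately have "R j \<le> \<rho>" "1 / \<rho> \<le> R j" for j by (simp_all add: R_def)
      then show ?thesis using that by (simp add: shell_def)
    qed
    have M0: "norm (f z) \<le> M" if "\<forall>j. norm (z $ j) = R j" for z using M Rsh that by blast
    note s1 = sep_holomorphic_coeff_op[OF f, of 1 "m $ 1"]
    note s2 = sep_holomorphic_coeff_op[OF s1, of 2 "m $ 2"]
    note s3 = sep_holomorphic_coeff_op[OF s2, of 3 "m $ 3"]
    have b1: "norm (coeff_op f 1 (m $ 1) z) \<le> M * R 1 powi (- m $ 1)" if "\<forall>j. norm (z $ j) = R j" for z
      by (rule norm_coeff_op_le[OF f Rpos M0 that])
    have b2: "norm (coeff_op (coeff_op f 1 (m $ 1)) 2 (m $ 2) z) \<le> M * R 1 powi (- m $ 1) * R 2 powi (- m $ 2)" if "\<forall>j. norm (z $ j) = R j" for z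
      by (rule norm_coeff_op_le[OF s1 Rpos b1 that])
    have b3: "norm (coeff_op (coeff_op (coeff_op f 1 (m $ 1)) 2 (m $ 2)) 3 (m $ 3) z) \<le> M * R 1 powi (- m $ 1) * R 2 powi (- m $ 2) * R 3 powi (- m $ 3)" if "\<forall>j. norm (z $ j) = R j" for z
      by (rule norm_coeff_op_le[OF s2 Rpos b2 that])
    have b4: "norm (coeff_op (coeff_op (coeff_op (coeff_op f 1 (m $ 1)) 2 (m $ 2)) 3 (m $ 3)) 4 (m $ 4) z) \<le> M * R 1 powi (- m $ 1) * R 2 powi (- m $ 2) * R 3 powi (- m $ 3) * R 4 powi (- m $ 4)" if "\<forall>j. norm (z $ j) = R j" for z
      by (rule norm_coeff_op_le[OF s3 Rpos b3 that])
    have "\<forall>j. norm ((\<chi> j. complex_of_real (R j)) $ j) = R j" using Rpos by (simp add: less_imp_le)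
    from b4[OF this]
    have "norm (coef f m) \<le> M * R 1 powi (- m $ 1) * R 2 powi (- m $ 2) * R 3 powi (- m $ 3) * R 4 powi (- m $ 4)"
      unfolding coef_any_point by simp
    moreover have "R j powi (- m $ j) = (1 / \<rho>) ^ nat \<bar>m $ j\<bar>" for j
      using \<rho> by (auto simp: R_def power_int_def power_inverse inverse_eq_divide power_one_over)
    moreover have "M * (1 / \<rho>) ^ nat \<bar>m $ 1\<bar> * (1 / \<rho>) ^ nat \<bar>m $ 2\<bar> * (1 / \<rho>) ^ nat \<bar>m $ 3\<bar> * (1 / \<rho>) ^ nat \<bar>m $ 4\<bar>
      = M * (1 / \<rho>) ^ deg1 m" by (simp add: deg1_def sum_4 power_add mult_ac)
    ultimately have "norm (coef f m) \<le> M * (1 / \<rho>) ^ deg1 m" by simp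
    then have "norm (coef f m) * \<rho> ^ deg1 m \<le> M * (1 / \<rho>) ^ deg1 m * \<rho> ^ deg1 m"
      using \<rho> by (intro mult_right_mono) auto
    also have "\<dots> = M" using \<rho> by (simp add: power_one_over)
    finally show ?thesis .
  qed
  then show "\<exists>C. \<forall>m. norm (coef f m) * \<rho> ^ deg1 m \<le> C" by blast
qed

text \<open>A coefficient of negative order in a variable outside \<open>S\<close> vanishes at the
  stage where it is taken, by the entire case, and the later operators map zero to zero.\<close>

lemma supported_coef:
  assumes f: "sep_holomorphic S f"
  shows "supported S (coef f)"
  unfolding supported_def
proof (intro allI impI, rule ccontr)
  fix m assume nz: "coef f m \<noteq> 0" and "\<not> neg_set m \<subseteq> S"
  then obtain i where i: "m $ i < 0" "i \<notin> S" by (auto simp: neg_set_def)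
  note s1 = sep_holomorphic_coeff_op[OF f, of 1 "m $ 1"]
  note s2 = sep_holomorphic_coeff_op[OF s1, of 2 "m $ 2"]
  note s3 = sep_holomorphic_coeff_op[OF s2, of 3 "m $ 3"]
  have 1: "vec 1 \<in> nzdom S" by (simp add: nzdom_def)
  have zero: "coeff_op g j n z = 0" if "\<And>w. w \<noteq> 0 \<Longrightarrow> g (upd z j w) = 0" for g j n z
  proof -
    have "contour_integral (circlepath 0 1) (\<lambda>w. g (upd z j w) * w powi (- n - 1))
      = contour_integral (circlepath 0 1) (\<lambda>w. 0)"
    proof (rule contour_integral_cong)
      fix w :: complex assume "w \<in> path_image (circlepath 0 1)"
      then have "w \<noteq> 0" by auto
      then show "g (upd z j w) * w powi (- n - 1) = 0" by (simp add: that)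
    qed simp
    then show ?thesis by (simp add: coeff_op_def laurent_coeff_def)
  qed
  have zero': "coeff_op g j n z = 0" if "z \<in> nzdom S" "\<And>z. z \<in> nzdom S \<Longrightarrow> g z = 0" for g j n z
    by (rule zero) (use that in \<open>auto intro: upd_in_nzdom\<close>)
  consider "i = 1" | "i = 2" | "i = 3" | "i = 4" using exhaust_4[of i] by blast
  then have "coef f m = 0"
  proof cases
    case 1
    show ?thesis unfolding coef_def
      by (intro zero' coeff_op_eq_0[OF f] \<open>vec 1 \<in> nzdom S\<close>) (use i 1 in auto)
  next
    case 2
    show ?thesis unfolding coef_def
      by (intro zero'[of _ "coeff_op (coeff_op (coeff_op f 1 (m $ 1)) 2 (m $ 2)) 3 (m $ 3)"]
            zero'[of _ "coeff_op (coeff_op f 1 (m $ 1)) 2 (m $ 2)"] coeff_op_eq_0[OF s1] \<open>vec 1 \<in> nzdom S\<close>)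
         (use i 2 in auto)
  next
    case 3
    show ?thesis unfolding coef_def
      by (rule zero'[OF \<open>vec 1 \<in> nzdom S\<close>], rule coeff_op_eq_0[OF s2]) (use i 3 in auto)
  next
    case 4
    show ?thesis unfolding coef_def
      by (rule coeff_op_eq_0[OF s3 \<open>vec 1 \<in> nzdom S\<close>]) (use i 4 in auto)
  qed
  with nz show False by simp
qed

lemma nzdom_antimono: "S \<subseteq> S' \<Longrightarrow> nzdom S' \<subseteq> nzdom S"
  by (auto simp: nzdom_def)

text \<open>The one-variable expansions are nested. The order of summation is harmless because
  absolute summability over all four indices is known beforehand from the decay of the
  coefficients.\<close>

theorem coef_has_sum:
  assumes f: "sep_holomorphic S f" and z: "z \<in> nzdom S"
  shows "((\<lambda>m. coef f m * monom_at m z) has_sum f z) UNIV"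
proof -
  have fU: "sep_holomorphic UNIV f" by (rule sep_holomorphic_subset[OF f]) simp
  define c1 where "c1 = (\<lambda>a. coeff_op f 1 a)"
  define c2 where "c2 = (\<lambda>a b. coeff_op (c1 a) 2 b)"
  define c3 where "c3 = (\<lambda>a b c. coeff_op (c2 a b) 3 c)"
  define c4 where "c4 = (\<lambda>a b c d. coeff_op (c3 a b c) 4 d)"
  have s: "sep_holomorphic S (c1 a)" "sep_holomorphic S (c2 a b)" "sep_holomorphic S (c3 a b c)" for a b c
    unfolding c1_def c2_def c3_def by (intro sep_holomorphic_coeff_op f)+
  define G where "G = (\<lambda>a b c d. c4 a b c d z * z $ 4 powi d * z $ 3 powi c * z $ 2 powi b * z $ 1 powi a)"
  have G: "coef f (vec4 p) * monom_at (vec4 p) z = (case p of (a, b, c, d) \<Rightarrow> G a b c d)" for p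
  proof (cases p)
    case (fields a b c d)
    have "coef f (vec4 (a, b, c, d)) = c4 a b c d z"
      using coef_any_point[of f "vec4 (a, b, c, d)" z] by (simp add: c1_def c2_def c3_def c4_def)
    then show ?thesis by (simp add: fields G_def monom_at_4 mult_ac)
  qed
  \<comment> \<open>Summability of the full family comes first; that of the partial families
    \<open>S1\<close> and \<open>S2\<close> is inherited from it.\<close>
  have "(\<lambda>m. coef f m * monom_at m z) summable_on UNIV"
    by (rule abs_summable_summable[OF abs_summable_rapid[OF rapid_coef[OF fU] supported_coef[OF f] z]])
  then have S0: "(\<lambda>(a, p). case p of (b, c, d) \<Rightarrow> G a b c d) summable_on Sigma UNIV (\<lambda>_. UNIV)"
    by (subst (asm) summable_vec4_iff) (simp add: G case_prod_unfold)
  have S1: "(\<lambda>(b, p). case p of (c, d) \<Rightarrow> G a b c d) summable_on Sigma UNIV (\<lambda>_. UNIV)" for a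
    using summable_on_SigmaD1[OF S0, of a] by (simp add: case_prod_unfold)
  have S2: "(\<lambda>(c, d). G a b c d) summable_on Sigma UNIV (\<lambda>_. UNIV)" for a b
    using summable_on_SigmaD1[OF S1, of b a] by (simp add: case_prod_unfold)
  have H3: "((\<lambda>d. G a b c d) has_sum c3 a b c z * z $ 3 powi c * z $ 2 powi b * z $ 1 powi a) UNIV" for a b c
    unfolding G_def c4_def by (intro has_sum_cmult_left coeff_op_has_sum[OF s(3) z])
  have "((\<lambda>(c, d). G a b c d) has_sum c2 a b z * z $ 2 powi b * z $ 1 powi a) (Sigma UNIV (\<lambda>_. UNIV))" for a b
    by (rule has_sum_SigmaI[where g = "\<lambda>c. c3 a b c z * z $ 3 powi c * z $ 2 powi b * z $ 1 powi a"])
       (use H3 S2 in \<open>auto simp: c3_def intro!: has_sum_cmult_left coeff_op_has_sum[OF s(2) z]\<close>)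
  then have H2: "((\<lambda>(c, d). G a b c d) has_sum c2 a b z * z $ 2 powi b * z $ 1 powi a) UNIV" for a b
    by simp
  have "((\<lambda>(b, p). case p of (c, d) \<Rightarrow> G a b c d) has_sum c1 a z * z $ 1 powi a) (Sigma UNIV (\<lambda>_. UNIV))" for a
    by (rule has_sum_SigmaI[where g = "\<lambda>b. c2 a b z * z $ 2 powi b * z $ 1 powi a"])
       (use H2 S1 in \<open>auto simp: c2_def intro!: has_sum_cmult_left coeff_op_has_sum[OF s(1) z]\<close>)
  then have H1: "((\<lambda>(b, p). case p of (c, d) \<Rightarrow> G a b c d) has_sum c1 a z * z $ 1 powi a) UNIV" for a
    by simp
  have "((\<lambda>(a, p). case p of (b, c, d) \<Rightarrow> G a b c d) has_sum f z) (Sigma UNIV (\<lambda>_. UNIV))"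
    by (rule has_sum_SigmaI[where g = "\<lambda>a. c1 a z * z $ 1 powi a"])
       (use H1 S0 in \<open>auto simp: c1_def intro!: coeff_op_has_sum[OF f z]\<close>)
  then show ?thesis by (subst has_sum_vec4_iff) (simp add: G case_prod_unfold)
qed

text \<open>Summing over the second index first leaves a one-variable Laurent series that vanishes
  identically, and its coefficients are the inner sums.\<close>

lemma laurent_unique_pair:
  fixes a :: "int \<Rightarrow> 'b \<Rightarrow> complex"
  assumes "\<And>w. w \<noteq> 0 \<Longrightarrow> ((\<lambda>(n, y). a n y * w powi n) has_sum 0) UNIV"
  shows "((\<lambda>y. a n y) has_sum 0) UNIV"
proof -
  have sm: "a n summable_on UNIV" for n
  proof -
    have "(\<lambda>(n, y). a n y * 1 powi n) summable_on Sigma UNIV (\<lambda>_. UNIV)"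
      using has_sum_imp_summable[OF assms[of 1]] by simp
    from summable_on_SigmaD1[OF this, of n] show ?thesis by simp
  qed
  have "((\<lambda>n. infsum (a n) UNIV * w powi n) has_sum 0) UNIV" if "w \<noteq> 0" for w
  proof (rule has_sum_SigmaD[where f = "\<lambda>(n, y). a n y * w powi n" and B = "\<lambda>_. UNIV"])
    show "((\<lambda>(n, y). a n y * w powi n) has_sum 0) (Sigma UNIV (\<lambda>_. UNIV))"
      using assms[OF that] by simp
    show "((\<lambda>y. case (n, y) of (n, y) \<Rightarrow> a n y * w powi n) has_sum infsum (a n) UNIV * w powi n) UNIV" for n
      using has_sum_cmult_left[OF has_sum_infsum[OF sm]] by simp
  qed
  from laurent_unique[of "\<lambda>n. infsum (a n) UNIV", OF this] have "infsum (a n) UNIV = 0" by simp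
  then show ?thesis using has_sum_infsum[OF sm, of n] by simp
qed

section \<open>Laurent expansions of vector fields\<close>

text \<open>One variable is removed at a time, with the remaining coordinates held at arbitrary
  nonzero values.\<close>

theorem laurent_unique_4:
  assumes "\<And>z. z \<in> nzdom UNIV \<Longrightarrow> ((\<lambda>m. a m * monom_at m z) has_sum 0) UNIV"
  shows "a m = 0"
proof -
  define A where "A = (\<lambda>x y z w. a (vec4 (x, y, z, w)))"
  have 0: "((\<lambda>(x, y, z, w). A x y z w * z4 powi w * z3 powi z * z2 powi y * z1 powi x) has_sum 0) UNIV"
    if "z1 \<noteq> 0" "z2 \<noteq> 0" "z3 \<noteq> 0" "z4 \<noteq> 0" for z1 z2 z3 z4
  proof -
    define Z :: point where "Z = vector [z1, z2, z3, z4]"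
    have Z: "Z $ 1 = z1" "Z $ 2 = z2" "Z $ 3 = z3" "Z $ 4 = z4" by (simp_all add: Z_def vector_4)
    have "Z $ i \<noteq> 0" for i using exhaust_4[of i] that Z by auto
    then have "Z \<in> nzdom UNIV" by (simp add: nzdom_def)
    from assms[OF this] have "((\<lambda>x. a (vec4 x) * monom_at (vec4 x) Z) has_sum 0) UNIV"
      by (rule has_sum_vec4_iff[THEN iffD1])
    moreover have e: "a (vec4 (x, y, z, w)) * monom_at (vec4 (x, y, z, w)) Z
      = A x y z w * z4 powi w * z3 powi z * z2 powi y * z1 powi x" for x y z w
      by (simp only: A_def monom_at_4 Z vec4_nth mult_ac)
    have "(\<lambda>x. a (vec4 x) * monom_at (vec4 x) Z)
      = (\<lambda>(x, y, z, w). A x y z w * z4 powi w * z3 powi z * z2 powi y * z1 powi x)"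
    proof
      fix p show "a (vec4 p) * monom_at (vec4 p) Z
        = (case p of (x, y, z, w) \<Rightarrow> A x y z w * z4 powi w * z3 powi z * z2 powi y * z1 powi x)"
        by (cases p) (simp only: prod.case e)
    qed
    ultimately show ?thesis by simp
  qed
  have 1: "((\<lambda>(y, z, w). A x y z w * z4 powi w * z3 powi z * z2 powi y) has_sum 0) UNIV"
    if nz: "z2 \<noteq> 0" "z3 \<noteq> 0" "z4 \<noteq> 0" for z2 z3 z4 x
  proof (rule laurent_unique_pair[of "\<lambda>x (y, z, w). A x y z w * z4 powi w * z3 powi z * z2 powi y" x])
    fix z1 :: complex assume "z1 \<noteq> 0"
    from 0[OF this nz]
    show "((\<lambda>(x, p). (case p of (y, z, w) \<Rightarrow> A x y z w * z4 powi w * z3 powi z * z2 powi y) * z1 powi x) has_sum 0) UNIV"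
      by (simp add: case_prod_unfold)
  qed
  have 2: "((\<lambda>(z, w). A x y z w * z4 powi w * z3 powi z) has_sum 0) UNIV"
    if nz: "z3 \<noteq> 0" "z4 \<noteq> 0" for z3 z4 x y
  proof (rule laurent_unique_pair[of "\<lambda>y (z, w). A x y z w * z4 powi w * z3 powi z" y])
    fix z2 :: complex assume "z2 \<noteq> 0"
    from 1[OF this nz, of x]
    show "((\<lambda>(y, p). (case p of (z, w) \<Rightarrow> A x y z w * z4 powi w * z3 powi z) * z2 powi y) has_sum 0) UNIV"
      by (simp add: case_prod_unfold)
  qed
  have 3: "((\<lambda>w. A x y z w * z4 powi w) has_sum 0) UNIV" if nz: "z4 \<noteq> 0" for z4 x y z
  proof (rule laurent_unique_pair[of "\<lambda>z w. A x y z w * z4 powi w" z])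
    fix z3 :: complex assume "z3 \<noteq> 0"
    from 2[OF this nz, of x y]
    show "((\<lambda>(z, w). A x y z w * z4 powi w * z3 powi z) has_sum 0) UNIV" .
  qed
  have "A x y z w = 0" for x y z w by (rule laurent_unique[of "A x y z"]) (rule 3)
  then have "a (vec4 p) = 0" for p by (cases p) (simp add: A_def)
  then show ?thesis using bij_vec4 by (metis bij_pointE)
qed

section \<open>Termwise differentiation of Laurent series\<close>

definition dmonom :: "int ^ 4 \<Rightarrow> point \<Rightarrow> point \<Rightarrow> complex" where
  "dmonom m z h = (\<Sum>i\<in>UNIV. of_int (m $ i) * z $ i powi (m $ i - 1) * h $ i * (\<Prod>j\<in>UNIV - {i}. z $ j powi m $ j))"

lemma has_derivative_monom_at:
  assumes "z \<in> nzdom S" "neg_set m \<subseteq> S"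
  shows "(monom_at m has_derivative dmonom m z) (at z)"
proof -
  have "((\<lambda>z. z $ i powi m $ i) has_derivative (\<lambda>h. of_int (m $ i) * z $ i powi (m $ i - 1) * h $ i)) (at z)" for i
  proof -
    have "m $ i \<ge> 0 \<or> z $ i \<noteq> 0" using assms by (auto simp: nzdom_def neg_set_def not_le)
    then have "((\<lambda>w. w powi m $ i) has_field_derivative of_int (m $ i) * z $ i powi (m $ i - 1) * 1) (at (z $ i))"
      by (intro DERIV_power_int DERIV_ident) auto
    from has_derivative_compose[OF bounded_linear_imp_has_derivative[OF bounded_linear_vec_nth] this[unfolded has_field_derivative_def]]
    show ?thesis by simp
  qed
  then show ?thesis unfolding monom_at_def dmonom_def
    by (intro has_derivative_prod)
qed

text \<open>The factor |n| from differentiation is absorbed by 2^|n|, and the extra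
  \<open>\<rho>\<close> accounts for |n - 1| being at most |n| + 1.\<close>

lemma norm_dpowi_le:
  assumes "\<rho> \<ge> 1" "norm w \<le> \<rho>" "n < 0 \<Longrightarrow> norm (w :: complex) \<ge> 1 / \<rho>"
  shows "norm (of_int n * w powi (n - 1)) \<le> \<rho> * (2 * \<rho>) ^ nat \<bar>n\<bar>"
proof (cases "n = 0")
  case False
  have "norm (w powi (n - 1)) \<le> \<rho> ^ nat \<bar>n - 1\<bar>"
    by (rule norm_powi_le) (use assms False in auto)
  also have "\<dots> \<le> \<rho> ^ Suc (nat \<bar>n\<bar>)"
    using assms(1) by (intro power_increasing) auto
  finally have 1: "norm (w powi (n - 1)) \<le> \<rho> ^ Suc (nat \<bar>n\<bar>)" .
  have "real (nat \<bar>n\<bar>) \<le> 2 ^ nat \<bar>n\<bar>" by (rule less_imp_le[OF of_nat_less_two_power])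
  then have 2: "norm (of_int n :: complex) \<le> 2 ^ nat \<bar>n\<bar>" by simp
  have "norm (of_int n * w powi (n - 1)) \<le> 2 ^ nat \<bar>n\<bar> * \<rho> ^ Suc (nat \<bar>n\<bar>)"
    unfolding norm_mult by (intro mult_mono 1 2) auto
  then show ?thesis by (simp add: power_mult_distrib mult_ac)
qed (use assms in simp)

lemma norm_dmonom_le:
  assumes "\<rho> \<ge> 1" "z \<in> shell S \<rho>" "neg_set m \<subseteq> S"
  shows "norm (dmonom m z h) \<le> 4 * \<rho> * (2 * \<rho>) ^ deg1 m * norm h"
proof -
  have b: "norm (z $ i) \<le> \<rho>" "m $ i < 0 \<Longrightarrow> norm (z $ i) \<ge> 1 / \<rho>" for i
    using assms(2,3) by (auto simp: shell_def neg_set_def)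
  have "norm (of_int (m $ i) * z $ i powi (m $ i - 1) * h $ i * (\<Prod>j\<in>UNIV - {i}. z $ j powi m $ j))
      \<le> \<rho> * (2 * \<rho>) ^ deg1 m * norm h" for i
  proof -
    have "norm (\<Prod>j\<in>UNIV - {i}. z $ j powi m $ j) \<le> (\<Prod>j\<in>UNIV - {i}. (2 * \<rho>) ^ nat \<bar>m $ j\<bar>)"
      unfolding prod_norm[symmetric]
    proof (rule prod_mono, safe)
      fix j
      have "norm (z $ j powi m $ j) \<le> \<rho> ^ nat \<bar>m $ j\<bar>" by (rule norm_powi_le[OF assms(1) b])
      also have "\<dots> \<le> (2 * \<rho>) ^ nat \<bar>m $ j\<bar>" using assms(1) by (intro power_mono) auto
      finally show "norm (z $ j powi m $ j) \<le> (2 * \<rho>) ^ nat \<bar>m $ j\<bar>" .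
    qed simp
    then have "norm (of_int (m $ i) * z $ i powi (m $ i - 1) * h $ i * (\<Prod>j\<in>UNIV - {i}. z $ j powi m $ j))
      \<le> \<rho> * (2 * \<rho>) ^ nat \<bar>m $ i\<bar> * norm h * (\<Prod>j\<in>UNIV - {i}. (2 * \<rho>) ^ nat \<bar>m $ j\<bar>)"
      unfolding norm_mult[of _ "prod _ _"] norm_mult[of _ "h $ i"]
      using assms(1)
      by (intro mult_mono norm_dpowi_le[OF assms(1) b] Finite_Cartesian_Product.norm_nth_le) (auto intro!: mult_nonneg_nonneg prod_nonneg)
    also have "\<dots> = \<rho> * norm h * ((2 * \<rho>) ^ nat \<bar>m $ i\<bar> * (\<Prod>j\<in>UNIV - {i}. (2 * \<rho>) ^ nat \<bar>m $ j\<bar>))"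
      by (simp only: mult_ac)
    also have "(2 * \<rho>) ^ nat \<bar>m $ i\<bar> * (\<Prod>j\<in>UNIV - {i}. (2 * \<rho>) ^ nat \<bar>m $ j\<bar>) = (2 * \<rho>) ^ deg1 m"
      unfolding deg1_def power_sum by (rule prod.remove[symmetric]) auto
    finally show ?thesis by (simp only: mult_ac)
  qed
  then have "norm (dmonom m z h) \<le> (\<Sum>i\<in>(UNIV :: 4 set). \<rho> * (2 * \<rho>) ^ deg1 m * norm h)"
    unfolding dmonom_def by (intro sum_norm_le)
  then show ?thesis by simp
qed

lemma dmonom_scale: "dmonom m z (c *s h) = c * dmonom m z h"
  by (simp add: dmonom_def sum_distrib_left mult_ac)

text \<open>A displacement below half the lower bound \<open>1 / \<rho>\<close> costs at most a
  factor 2 in the shell parameter. Estimates on one shell thus hold on a whole ball, as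
  differentiation of a series requires.\<close>

lemma shell_neighbourhood:
  assumes "z \<in> shell S \<rho>" "\<rho> \<ge> 1"
  shows "ball z (1 / (2 * \<rho>)) \<subseteq> shell S (2 * \<rho>) \<inter> nzdom S"
proof
  fix w assume "w \<in> ball z (1 / (2 * \<rho>))"
  then have "norm (w - z) < 1 / (2 * \<rho>)" by (simp add: dist_norm norm_minus_commute)
  then have d: "norm (w $ i - z $ i) < 1 / (2 * \<rho>)" for i
    using Finite_Cartesian_Product.norm_nth_le[of "w - z" i] by simp
  have \<rho>: "1 / (2 * \<rho>) \<le> 1" "1 / (2 * \<rho>) > 0" "1 / \<rho> = 2 * (1 / (2 * \<rho>))" using assms(2) by auto
  have 1: "norm (w $ i) \<le> 2 * \<rho>" for i
  proof -
    have "norm (w $ i) \<le> norm (z $ i) + norm (w $ i - z $ i)" by (rule norm_triangle_sub)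
    moreover have "norm (z $ i) \<le> \<rho>" using assms(1) by (simp add: shell_def)
    ultimately show ?thesis using d[of i] \<rho> assms(2) by linarith
  qed
  have 2: "norm (w $ i) \<ge> 1 / (2 * \<rho>)" if "i \<in> S" for i
  proof -
    have "norm (z $ i) \<le> norm (w $ i) + norm (z $ i - w $ i)" by (rule norm_triangle_sub)
    moreover have "norm (z $ i) \<ge> 1 / \<rho>" using assms(1) that by (simp add: shell_def)
    ultimately show ?thesis using d[of i] \<rho>(3) unfolding norm_minus_commute[of "z $ i"] by linarith
  qed
  have "w $ i \<noteq> 0" if "i \<in> S" for i using 2[OF that] \<rho> by auto
  with 1 2 show "w \<in> shell S (2 * \<rho>) \<inter> nzdom S" by (simp add: shell_def nzdom_def)
qed

lemma open_nzdom: "open (nzdom S)"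
proof (rule openI)
  fix z assume "z \<in> nzdom S"
  then obtain \<rho> where \<rho>: "\<rho> \<ge> 1" "z \<in> shell S \<rho>" by (rule shell_exists)
  show "\<exists>e>0. ball z e \<subseteq> nzdom S"
    using shell_neighbourhood[OF \<rho>(2,1)] \<rho>(1) by (intro exI[of _ "1 / (2 * \<rho>)"]) auto
qed

text \<open>On a small ball the differentiated series is dominated by one summable numerical series,
  so the partial sums of the derivatives converge uniformly relative to the direction vector.
  Complex linearity passes to the sum from the individual monomials.\<close>

theorem laurent_sum_has_derivative:
  assumes a: "rapid a" "supported S a" and z: "z \<in> nzdom S"
  shows "\<exists>L. (laurent_sum a has_derivative L) (at z) \<and> (\<forall>c w. L (c *s w) = c * L w)"
proof -
  obtain \<rho>0 where \<rho>0: "\<rho>0 \<ge> 1" "z \<in> shell S \<rho>0" using shell_exists[OF z] .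
  define \<rho> where "\<rho> = 2 * \<rho>0"
  have \<rho>: "\<rho> \<ge> 1" using \<rho>0 by (simp add: \<rho>_def)
  define B where "B = ball z (1 / (2 * \<rho>0))"
  have B: "B \<subseteq> shell S \<rho>" "B \<subseteq> nzdom S" "z \<in> B" "open B" "convex B"
    using shell_neighbourhood[OF \<rho>0(2,1)] \<rho>0(1) by (auto simp: B_def \<rho>_def)
  \<comment> \<open>The rate \<open>2 * \<rho>\<close> instead of \<open>\<rho>\<close> pays for the
    loss in the estimate of the differential of a monomial.\<close>
  obtain C where C: "C \<ge> 0" "\<And>m. norm (a m) * (2 * \<rho>) ^ deg1 m \<le> C * (1 / 2) ^ deg1 m"
    using rapid_bound[OF a(1), of "2 * \<rho>"] \<rho> by auto
  have cnt: "countable (UNIV :: (int ^ 4) set)"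
    using countable_image[of "UNIV :: (int \<times> int \<times> int \<times> int) set" vec4] bij_vec4
    by (simp add: bij_is_surj)
  have inf: "infinite (UNIV :: (int ^ 4) set)"
    using bij_betw_finite[OF bij_vec4] by (simp add: finite_prod)
  \<comment> \<open>The exponent lattice is enumerated, since the series is differentiated as a
    sequence of functions.\<close>
  define e :: "nat \<Rightarrow> int ^ 4" where "e = from_nat_into UNIV"
  have e: "bij e" unfolding e_def by (rule bij_betw_from_nat_into[OF cnt inf])
  define b where "b = (\<lambda>n. 4 * \<rho> * C * (1 / 2) ^ deg1 (e n))"
  have "(\<lambda>n. (1 / 2 :: real) ^ deg1 (e n)) summable_on UNIV"
    by (rule summable_on_reindex_bij_betw[OF e, THEN iffD2, OF summable_deg1])
  then have "summable (\<lambda>n. (1 / 2 :: real) ^ deg1 (e n))"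
    by (rule summable_on_UNIV_nonneg_real_iff[THEN iffD1, rotated]) simp
  then have b: "summable b" unfolding b_def by (rule summable_mult)
  define f where "f = (\<lambda>n x. a (e n) * monom_at (e n) x)"
  define f' where "f' = (\<lambda>n x h. a (e n) * dmonom (e n) x h)"
  have f'_le: "norm (f' n x h) \<le> b n * norm h" if "x \<in> B" for n x h
  proof (cases "a (e n) = 0")
    case True
    then show ?thesis using \<rho> C(1) by (simp add: f'_def b_def)
  next
    case False
    then have "neg_set (e n) \<subseteq> S" using a(2) by (auto simp: supported_def)
    then have "norm (dmonom (e n) x h) \<le> 4 * \<rho> * (2 * \<rho>) ^ deg1 (e n) * norm h"
      using that B(1) by (intro norm_dmonom_le[OF \<rho>, of _ S]) blast
    then have "norm (f' n x h) \<le> norm (a (e n)) * (4 * \<rho> * (2 * \<rho>) ^ deg1 (e n) * norm h)"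
      unfolding f'_def norm_mult by (rule mult_left_mono) simp
    also have "\<dots> = 4 * \<rho> * norm h * (norm (a (e n)) * (2 * \<rho>) ^ deg1 (e n))" by (simp only: mult_ac)
    also have "\<dots> \<le> 4 * \<rho> * norm h * (C * (1 / 2) ^ deg1 (e n))"
      using \<rho> by (intro mult_left_mono C(2)) auto
    finally show ?thesis by (simp only: b_def mult_ac)
  qed
  have f'_sum: "summable (\<lambda>n. f' n x h)" if "x \<in> B" for x h
    by (rule summable_comparison_test'[OF summable_mult2[OF b, of "norm h"], of 0]) (use f'_le[OF that] in auto)
  define g' where "g' = (\<lambda>x h. suminf (\<lambda>n. f' n x h))"
  have sums: "(\<lambda>n. f n x) sums laurent_sum a x" if "x \<in> B" for x
  proof -
    have "((\<lambda>m. a m * monom_at m x) has_sum laurent_sum a x) UNIV"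
      by (rule laurent_sum_has_sum[OF a]) (use that B in auto)
    then have "((\<lambda>n. f n x) has_sum laurent_sum a x) UNIV"
      unfolding f_def using has_sum_reindex_bij_betw[OF e, of "\<lambda>m. a m * monom_at m x"] by simp
    then show ?thesis by (rule has_sum_imp_sums)
  qed
  have "\<exists>g. \<forall>x\<in>B. (\<lambda>n. f n x) sums g x \<and> (g has_derivative g' x) (at x within B)"
  proof (rule has_derivative_series[OF B(5)])
    show "(\<lambda>n. f n z) sums laurent_sum a z" by (rule sums) fact
    show "z \<in> B" by fact
    fix n x assume x: "x \<in> B"
    show "(f n has_derivative f' n x) (at x within B)"
    proof (cases "a (e n) = 0")
      case True
      then show ?thesis by (simp add: f_def f'_def)
    next
      case False
      then have "(monom_at (e n) has_derivative dmonom (e n) x) (at x)"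
        using a(2) x B by (intro has_derivative_monom_at[of _ S]) (auto simp: supported_def)
      from has_derivative_mult_right[OF has_derivative_at_withinI[OF this]]
      show ?thesis unfolding f_def f'_def .
    qed
  next
    fix \<epsilon> :: real assume "\<epsilon> > 0"
    have "(\<lambda>n. \<Sum>k. b (k + n)) \<longlonglongrightarrow> 0" by (rule suminf_exist_split2[OF b])
    then have "\<forall>\<^sub>F n in sequentially. (\<Sum>k. b (k + n)) < \<epsilon>"
      using \<open>\<epsilon> > 0\<close> by (rule order_tendstoD)
    then show "\<forall>\<^sub>F n in sequentially. \<forall>x\<in>B. \<forall>h. norm ((\<Sum>i<n. f' i x h) - g' x h) \<le> \<epsilon> * norm h"
    proof eventually_elim
      case (elim n)
      show ?case
      proof (intro ballI allI)
        fix x h assume x: "x \<in> B"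
        have "norm ((\<Sum>i<n. f' i x h) - g' x h) = norm (\<Sum>k. f' (k + n) x h)"
          unfolding g'_def by (subst suminf_split_initial_segment[OF f'_sum[OF x], of h n]) simp
        also have "\<dots> \<le> (\<Sum>k. b (k + n) * norm h)"
        proof (rule norm_suminf_le)
          show "summable (\<lambda>k. b (k + n) * norm h)"
            by (intro summable_mult2 summable_ignore_initial_segment b)
        qed (rule f'_le[OF x])
        also have "\<dots> = (\<Sum>k. b (k + n)) * norm h"
          by (rule suminf_mult2[symmetric]) (intro summable_ignore_initial_segment b)
        also have "\<dots> \<le> \<epsilon> * norm h" using elim by (intro mult_right_mono) auto
        finally show "norm ((\<Sum>i<n. f' i x h) - g' x h) \<le> \<epsilon> * norm h" .
      qed
    qed
  qed
  then obtain g where g: "\<And>x. x \<in> B \<Longrightarrow> (\<lambda>n. f n x) sums g x"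
    "\<And>x. x \<in> B \<Longrightarrow> (g has_derivative g' x) (at x within B)" by blast
  have "(g has_derivative g' z) (at z)"
    using g(2)[OF B(3)] at_within_open[OF B(3,4)] by simp
  then have "(laurent_sum a has_derivative g' z) (at z)"
    by (rule has_derivative_transform_within_open[OF _ B(4,3)]) (rule sums_unique2[OF g(1) sums])
  moreover have "g' z (c *s w) = c * g' z w" for c w
  proof -
    have "(\<lambda>n. f' n z (c *s w)) = (\<lambda>n. c * f' n z w)"
      by (simp only: f'_def dmonom_scale mult_ac)
    then show ?thesis unfolding g'_def by (simp only: suminf_mult[OF f'_sum[OF B(3)]])
  qed
  ultimately show ?thesis by blast
qed

section \<open>Holomorphic vector fields and their coefficient families\<close>

lemma bounded_linear_axis: "bounded_linear (axis k :: complex \<Rightarrow> point)"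
proof -
  have "linear (axis k :: complex \<Rightarrow> point)"
    by (intro linearI) (auto simp: vec_eq_iff axis_def)
  then show ?thesis by (simp add: linear_conv_bounded_linear)
qed

lemma has_derivative_vec_lambda:
  fixes f :: "4 \<Rightarrow> point \<Rightarrow> complex"
  assumes "\<And>k. (f k has_derivative L k) (at z)"
  shows "((\<lambda>z. \<chi> k. f k z) has_derivative (\<lambda>h. \<chi> k. L k h)) (at z)"
proof -
  have eq: "(\<chi> k. g k) = (\<Sum>k\<in>UNIV. axis k (g k))" for g :: "4 \<Rightarrow> complex"
    by (simp add: vec_eq_iff axis_def sum.delta)
  show ?thesis unfolding eq
    by (intro has_derivative_sum bounded_linear.has_derivative[OF bounded_linear_axis] assms)
qed

lemma laurent_sum_in_Theta:
  assumes "\<And>k. rapid (a k)" "\<And>k. supported S (a k)"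
  shows "(\<lambda>z. if z \<in> nzdom S then (\<chi> k. laurent_sum (a k) z) else 0) \<in> Theta (nzdom S)"
proof -
  have "\<exists>L. ((\<lambda>z. if z \<in> nzdom S then (\<chi> k. laurent_sum (a k) z) else 0) has_derivative L) (at z) \<and>
      (\<forall>c w. L (c *s w) = c *s L w)" if z: "z \<in> nzdom S" for z
  proof -
    have "\<exists>L. (laurent_sum (a k) has_derivative L) (at z) \<and> (\<forall>c w. L (c *s w) = c * L w)" for k
      by (rule laurent_sum_has_derivative[OF assms z])
    then obtain L where L: "\<And>k. (laurent_sum (a k) has_derivative L k) (at z)"
      "\<And>k c w. L k (c *s w) = c * L k w" by metis
    have "((\<lambda>z. if z \<in> nzdom S then (\<chi> k. laurent_sum (a k) z) else 0) has_derivative (\<lambda>h. \<chi> k. L k h)) (at z)"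
      by (rule has_derivative_transform_within_open[OF has_derivative_vec_lambda[OF L(1)] open_nzdom z]) simp
    moreover have "(\<chi> k. L k (c *s w)) = c *s (\<chi> k. L k w)" for c w
      by (simp add: vec_eq_iff L(2))
    ultimately show ?thesis by blast
  qed
  then show ?thesis by (simp add: Theta_def holomorphic_vf_def)
qed

text \<open>Along a coordinate line a complex-linear differential is multiplication by a number,
  hence a complex derivative; joint continuity follows from differentiability.\<close>

lemma Theta_component_sep_holomorphic:
  assumes "V \<in> Theta (nzdom S)"
  shows "sep_holomorphic S (\<lambda>z. V z $ k)"
  unfolding sep_holomorphic_def
proof (intro conjI ballI allI)
  have D: "\<exists>L. (V has_derivative L) (at z) \<and> (\<forall>c w. L (c *s w) = c *s L w)" if "z \<in> nzdom S" for z
    using assms that by (auto simp: Theta_def holomorphic_vf_def)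
  have "continuous_on (nzdom S) V"
    unfolding continuous_on_eq_continuous_at[OF open_nzdom]
  proof
    fix z assume "z \<in> nzdom S"
    then obtain L where "(V has_derivative L) (at z)" using D by blast
    then show "isCont V z" by (rule has_derivative_continuous)
  qed
  then show "continuous_on (nzdom S) (\<lambda>z. V z $ k)" by (intro continuous_intros)
  fix z i assume z: "z \<in> nzdom S"
  show "(\<lambda>w. V (upd z i w) $ k) holomorphic_on (if i \<in> S then - {0} else UNIV)"
    unfolding holomorphic_on_def
  proof
    fix w :: complex assume w: "w \<in> (if i \<in> S then - {0} else UNIV)"
    then have "upd z i w \<in> nzdom S" using z by (auto intro!: upd_in_nzdom split: if_splits)
    then obtain L where L: "(V has_derivative L) (at (upd z i w))" "\<And>c w. L (c *s w) = c *s L w"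
      using D by blast
    have upd: "((\<lambda>w :: complex. upd z i w) has_derivative axis i) (at w)"
    proof -
      have "((\<lambda>w. upd z i 0 + axis i w) has_derivative (\<lambda>h. 0 + axis i h)) (at w)"
        by (rule has_derivative_add[OF has_derivative_const bounded_linear_imp_has_derivative[OF bounded_linear_axis]])
      moreover have "(\<lambda>w. upd z i 0 + axis i w) = (\<lambda>w. upd z i w)"
        by (auto simp: fun_eq_iff vec_eq_iff axis_def)
      ultimately show ?thesis by (simp only: add_0)
    qed
    have "((\<lambda>w. V (upd z i w) $ k) has_derivative (\<lambda>h. L (axis i h) $ k)) (at w)"
      by (rule bounded_linear.has_derivative[OF bounded_linear_vec_nth has_derivative_compose[OF upd L(1)]])
    moreover have "(\<lambda>h. L (axis i h) $ k) = (*) (L (axis i 1) $ k)"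
    proof
      fix h
      have "axis i h = h *s axis i (1 :: complex)" by (auto simp: vec_eq_iff axis_def)
      then show "L (axis i h) $ k = L (axis i 1) $ k * h"
        by (simp only: L(2) vector_smult_component mult.commute)
    qed
    ultimately have "((\<lambda>w. V (upd z i w) $ k) has_field_derivative L (axis i 1) $ k) (at w)"
      by (simp only: has_field_derivative_def)
    then show "(\<lambda>w. V (upd z i w) $ k) field_differentiable at w within (if i \<in> S then - {0} else UNIV)"
      unfolding field_differentiable_def by (blast intro: has_field_derivative_at_within)
  qed
qed

definition vcoef :: "vfield \<Rightarrow> 4 \<Rightarrow> int ^ 4 \<Rightarrow> complex" where
  "vcoef V k = coef (\<lambda>z. V z $ k)"

lemma vcoef_has_sum:
  "V \<in> Theta (nzdom S) \<Longrightarrow> z \<in> nzdom S \<Longrightarrow> ((\<lambda>m. vcoef V k m * monom_at m z) has_sum V z $ k) UNIV"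
  unfolding vcoef_def by (rule coef_has_sum[OF Theta_component_sep_holomorphic])

lemma rapid_vcoef: "V \<in> Theta (nzdom S) \<Longrightarrow> rapid (vcoef V k)"
  unfolding vcoef_def
  by (rule rapid_coef[OF sep_holomorphic_subset[OF Theta_component_sep_holomorphic]]) auto

lemma supported_vcoef: "V \<in> Theta (nzdom S) \<Longrightarrow> supported S (vcoef V k)"
  unfolding vcoef_def by (rule supported_coef[OF Theta_component_sep_holomorphic])

lemma has_sum_coeffs_unique:
  assumes "\<And>z. z \<in> nzdom UNIV \<Longrightarrow> ((\<lambda>m. a m * monom_at m z) has_sum f z) UNIV"
    and "\<And>z. z \<in> nzdom UNIV \<Longrightarrow> ((\<lambda>m. b m * monom_at m z) has_sum f z) UNIV"
  shows "a = b"
proof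
  fix m
  have "((\<lambda>m. (a m - b m) * monom_at m z) has_sum 0) UNIV" if "z \<in> nzdom UNIV" for z
    using has_sum_add[OF assms(1)[OF that] has_sum_cmult_right[OF assms(2)[OF that], of "-1"]]
    by (simp add: left_diff_distrib)
  from laurent_unique_4[of "\<lambda>m. a m - b m", OF this] show "a m = b m" by simp
qed

lemma nzdom_UNIV_subset: "z \<in> nzdom UNIV \<Longrightarrow> z \<in> nzdom S"
  by (simp add: nzdom_def)

text \<open>The expansion has to be verified only where no coordinate vanishes, so one criterion
  serves all overlaps and fields on U alike.\<close>

lemma vcoef_unique:
  assumes "V \<in> Theta (nzdom S)"
    and "\<And>z. z \<in> nzdom UNIV \<Longrightarrow> ((\<lambda>m. b m * monom_at m z) has_sum V z $ k) UNIV"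
  shows "vcoef V k = b"
  by (rule has_sum_coeffs_unique[of _ "\<lambda>z. V z $ k"])
     (use assms vcoef_has_sum nzdom_UNIV_subset in blast)+

lemma vcoef_laurent_sum:
  assumes "\<And>k. rapid (a k)" "\<And>k. supported S (a k)"
  shows "vcoef (\<lambda>z. if z \<in> nzdom S then (\<chi> k. laurent_sum (a k) z) else 0) k = a k"
  by (rule vcoef_unique[OF laurent_sum_in_Theta[OF assms]])
     (use laurent_sum_has_sum[OF assms] nzdom_UNIV_subset in auto)

section \<open>The complex of a single monomial\<close>

declare One_nat_def [simp del]

text \<open>\<open>pullback \<mu>\<close> multiplies the field z^m d/dz_k by \<open>q0\<close> to
  this power; the subtracted term comes from the inverse differential.\<close>

definition wt :: "nat \<Rightarrow> 4 \<Rightarrow> int ^ 4 \<Rightarrow> int" where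
  "wt \<mu> k m = (\<Sum>i\<in>UNIV. int (deck_weight \<mu> $ i) * m $ i) - int (deck_weight \<mu> $ k)"

definition inverted :: "nat set \<Rightarrow> 4 set" where
  "inverted I = (\<Union>j\<in>I. - face j)"

definition pos_sign :: "nat \<Rightarrow> nat set \<Rightarrow> complex" where
  "pos_sign i I = (-1) ^ card {j \<in> I. j < i}"

text \<open>For a singleton the sum contains the value at the empty set. The families under
  consideration vanish there, so this is the ordinary and not the augmented differential.\<close>

definition cech :: "(nat set \<Rightarrow> complex) \<Rightarrow> nat set \<Rightarrow> complex" where
  "cech \<delta> I = (\<Sum>i\<in>I. pos_sign i I * \<delta> (I - {i}))"

definition koszul :: "4 \<Rightarrow> int ^ 4 \<Rightarrow> (nat set \<Rightarrow> complex) \<Rightarrow> nat set \<Rightarrow> complex" where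
  "koszul k m \<delta> K = (\<Sum>\<mu>\<in>K. pos_sign \<mu> K * ((q0 powi wt \<mu> k m - 1) * \<delta> (K - {\<mu>})))"

definition dmono :: "4 \<Rightarrow> int ^ 4 \<Rightarrow> (nat set \<Rightarrow> nat set \<Rightarrow> complex) \<Rightarrow> nat set \<Rightarrow> nat set \<Rightarrow> complex" where
  "dmono k m \<gamma> I K = cech (\<lambda>I. \<gamma> I K) I + (-1) ^ (card I - 1) * koszul k m (\<gamma> I) K"

text \<open>The families that can occur as the coefficients of the monomial \<open>m\<close> in a
  holomorphic cochain: every variable in the denominator must be inverted on the overlap. A homotopy
  is useful only if it preserves this.\<close>

definition adm :: "int ^ 4 \<Rightarrow> (nat set \<Rightarrow> nat set \<Rightarrow> complex) \<Rightarrow> bool" where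
  "adm m \<gamma> \<longleftrightarrow> (\<forall>I K. \<gamma> I K \<noteq> 0 \<longrightarrow> index_pair I K \<and> neg_set m \<subseteq> inverted I)"

definition invariant_exp :: "4 \<Rightarrow> int ^ 4 \<Rightarrow> bool" where
  "invariant_exp k m \<longleftrightarrow> wt 1 k m = 0 \<and> wt 2 k m = 0 \<and> neg_set m = {}"

text \<open>The exponent of v/(xy) in the coordinate order (x, u, y, v).\<close>

definition eta_exp :: "int ^ 4" where
  "eta_exp = vec4 (-1, 0, -1, 1)"

definition eta_coeff :: "nat set \<Rightarrow> complex" where
  "eta_coeff I = chart_scalar (Max I) - chart_scalar (Min I)"

text \<open>The part of a cocycle that survives in cohomology. Invariant fields are read off on
  chart 1, and the multiple of W on the overlap of charts 1 and 3, where \<open>eta_coeff\<close>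
  equals 1.\<close>

definition harmonic :: "4 \<Rightarrow> int ^ 4 \<Rightarrow> (nat set \<Rightarrow> nat set \<Rightarrow> complex) \<Rightarrow> nat set \<Rightarrow> nat set \<Rightarrow> complex" where
  "harmonic k m \<gamma> I K =
     (if card I = 1 \<and> invariant_exp k m then \<gamma> {1} K else 0)
     + (if card I = 2 \<and> k = 2 \<and> m = eta_exp then eta_coeff I * \<gamma> {1, 3} K else 0)"

lemma deck_weight_nth [simp]:
  "deck_weight 1 $ 1 = 1" "deck_weight 1 $ 2 = 0" "deck_weight 1 $ 3 = 1" "deck_weight 1 $ 4 = 2"
  "deck_weight 2 $ 1 = 0" "deck_weight 2 $ 2 = 1" "deck_weight 2 $ 3 = 0" "deck_weight 2 $ 4 = 1"
  by (simp_all add: deck_weight_def vector_4)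

lemma wt_1: "wt 1 k m = m $ 1 + m $ 3 + 2 * m $ 4 - int (deck_weight 1 $ k)"
  and wt_2: "wt 2 k m = m $ 2 + m $ 4 - int (deck_weight 2 $ k)"
  unfolding wt_def sum_4 deck_weight_nth by simp_all

section \<open>Deck multipliers and signs\<close>

lemma q0_bounds: "0 < exp (- 2 * pi)" "exp (- 2 * pi) \<le> 1 / 2"
proof -
  have "exp (- 2 * pi) \<le> exp (- ln 2)"
    using pi_gt3 ln_le_minus_one[of 2] by simp
  then show "exp (- 2 * pi) \<le> 1 / 2" by (simp add: exp_minus)
qed simp

lemma q0_neq_0 [simp]: "q0 \<noteq> 0"
  by (simp add: q0_def)

text \<open>The Koszul homotopy meets no small divisors.\<close>

lemma norm_q0_powi_minus_1_ge:
  assumes "n \<noteq> 0"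
  shows "norm (q0 powi n - 1) \<ge> 1 / 2"
proof -
  define q where "q = exp (- 2 * pi)"
  have q: "0 < q" "q \<le> 1 / 2" using q0_bounds by (simp_all only: q_def)
  have "q0 powi n - 1 = of_real (q powi n - 1)"
    by (simp add: q0_def q_def)
  then have *: "norm (q0 powi n - 1) = \<bar>q powi n - 1\<bar>" by (simp only: norm_of_real)
  have pow: "q ^ Suc l \<le> 1 / 2" for l
  proof -
    have "q * q ^ l \<le> q * 1" using q by (intro mult_left_mono power_le_one) auto
    then show ?thesis using q(2) unfolding power_Suc mult_1_right by (rule order_trans)
  qed
  show ?thesis
  proof (cases "n > 0")
    case True
    then obtain l where "n = int (Suc l)" by (metis gr0_conv_Suc zero_less_imp_eq_int)
    then have "q powi n = q ^ Suc l" by (simp only: power_int_of_nat)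
    then show ?thesis using pow[of l] unfolding * by linarith
  next
    case False
    then have "- n > 0" using assms by simp
    then obtain l where l: "- n = int (Suc l)" by (metis gr0_conv_Suc zero_less_imp_eq_int)
    then have "n = - int (Suc l)" by simp
    then have "q powi n = inverse (q ^ Suc l)" by (simp only: power_int_minus power_int_of_nat)
    moreover have "inverse (q ^ Suc l) \<ge> inverse (1 / 2)"
      by (rule le_imp_inverse_le[OF pow]) (use q in simp)
    ultimately show ?thesis unfolding * by simp
  qed
qed

lemma pos_sign_eq: "{j \<in> I. j < i} = A \<Longrightarrow> pos_sign i I = (-1) ^ card A"
  by (simp add: pos_sign_def)

lemma pos_sign_square [simp]: "pos_sign i I * pos_sign i I = 1" "pos_sign i I * (pos_sign i I * x) = x"
proof -
  show "pos_sign i I * pos_sign i I = 1" by (simp add: pos_sign_def flip: power_mult_distrib)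
  then show "pos_sign i I * (pos_sign i I * x) = x" by (metis mult.assoc mult_1)
qed

lemma pos_sign_simps [simp]:
  "pos_sign i {i} = 1" "a < b \<Longrightarrow> pos_sign a {a, b} = 1" "a < b \<Longrightarrow> pos_sign b {a, b} = -1"
proof -
  have "{j \<in> {i}. j < i} = {}" by auto
  from pos_sign_eq[OF this] show "pos_sign i {i} = 1" by simp
  show "pos_sign a {a, b} = 1" if "a < b"
  proof -
    have "{j \<in> {a, b}. j < a} = {}" using that by auto
    from pos_sign_eq[OF this] show ?thesis by simp
  qed
  show "pos_sign b {a, b} = -1" if "a < b"
  proof -
    have "{j \<in> {a, b}. j < b} = {a}" using that by auto
    from pos_sign_eq[OF this] show ?thesis by simp
  qed
qed

section \<open>The Koszul direction and its null homotopies\<close>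

lemma koszul_simps:
  "koszul k m \<delta> {} = 0"
  "koszul k m \<delta> {1} = (q0 powi wt 1 k m - 1) * \<delta> {}"
  "koszul k m \<delta> {2} = (q0 powi wt 2 k m - 1) * \<delta> {}"
  "koszul k m \<delta> {1, 2} = (q0 powi wt 1 k m - 1) * \<delta> {2} - (q0 powi wt 2 k m - 1) * \<delta> {1}"
proof -
  have *: "{1, 2} - {2} = {1 :: nat}" "{1, 2} - {1} = {2 :: nat}" by auto
  show "koszul k m \<delta> {} = 0"
  "koszul k m \<delta> {1} = (q0 powi wt 1 k m - 1) * \<delta> {}"
  "koszul k m \<delta> {2} = (q0 powi wt 2 k m - 1) * \<delta> {}"
    by (simp_all add: koszul_def)
  have "koszul k m \<delta> {1, 2} = pos_sign 1 {1, 2} * ((q0 powi wt 1 k m - 1) * \<delta> ({1, 2} - {1}))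
    + pos_sign 2 {1, 2} * ((q0 powi wt 2 k m - 1) * \<delta> ({1, 2} - {2}))"
    unfolding koszul_def by (subst sum.insert, simp, simp)+ simp
  then show "koszul k m \<delta> {1, 2} = (q0 powi wt 1 k m - 1) * \<delta> {2} - (q0 powi wt 2 k m - 1) * \<delta> {1}"
    unfolding * by simp
qed

lemma subset_12_cases:
  assumes "K \<subseteq> {1, 2 :: nat}"
  obtains "K = {}" | "K = {1}" | "K = {2}" | "K = {1, 2}"
  using assms by blast

text \<open>Removing an index flips the sign attached to the Cech degree, which makes the two
  differentials anticommute. The value at the empty set must vanish because truncated subtraction
  gives the empty set the same sign as a singleton.\<close>

lemma cech_alternate:
  assumes "finite I" "\<delta> {} = 0"
  shows "cech (\<lambda>I. (-1) ^ (card I - 1) * \<delta> I) I = - ((-1) ^ (card I - 1) * cech \<delta> I)"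
proof -
  have "(-1) ^ (card (I - {i}) - 1) * \<delta> (I - {i}) = - ((-1) ^ (card I - 1)) * \<delta> (I - {i})"
    if "i \<in> I" for i
  proof (cases "I - {i} = {}")
    case True
    show ?thesis by (simp only: True assms(2) mult_zero_right)
  next
    case False
    then have "card (I - {i}) > 0" using assms(1) by (simp add: card_gt_0_iff)
    then obtain l where "card (I - {i}) = Suc l" by (metis gr0_conv_Suc)
    moreover from this have "card I = Suc (Suc l)" using card_Suc_Diff1[OF assms(1) that] by simp
    ultimately show ?thesis by simp
  qed
  then have "pos_sign i I * ((-1) ^ (card (I - {i}) - 1) * \<delta> (I - {i}))
      = - ((-1) ^ (card I - 1)) * (pos_sign i I * \<delta> (I - {i}))" if "i \<in> I" for i
    using that by (simp only: mult_ac)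
  then have "cech (\<lambda>I. (-1) ^ (card I - 1) * \<delta> I) I
    = (\<Sum>i\<in>I. - ((-1) ^ (card I - 1)) * (pos_sign i I * \<delta> (I - {i})))"
    unfolding cech_def by (intro sum.cong refl)
  also have "\<dots> = - ((-1) ^ (card I - 1)) * cech \<delta> I"
    unfolding cech_def by (rule sum_distrib_left[symmetric])
  finally show ?thesis by simp
qed

lemma cech_cmult: "cech (\<lambda>I. c * \<delta> I) I = c * cech \<delta> I"
  by (simp add: cech_def sum_distrib_left mult_ac)

lemma cech_zero: "cech (\<lambda>I. 0) I = 0"
  by (simp add: cech_def)

lemma finite_index_pair: "index_pair I K \<Longrightarrow> finite I"
  unfolding index_pair_def by (meson finite_atLeastAtMost finite_subset)

lemma adm_empty: "adm m \<gamma> \<Longrightarrow> \<gamma> {} K = 0"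
  by (auto simp: adm_def index_pair_def)

lemma sign_square: "(-1 :: complex) ^ n * ((-1) ^ n * x) = x"
  by (simp flip: mult.assoc power_mult_distrib)

text \<open>Contraction with the first generator, divided by \<open>q0 powi wt 1 k m - 1\<close>, is
  a null homotopy of the Koszul complex. The sign in the Cech degree lets it anticommute with the
  Cech differential, so on a total cocycle it yields a primitive. The inverse factor is at most 2 in
  norm, independently of \<open>m\<close>.\<close>

lemma koszul_homotopy_1:
  assumes adm: "adm m \<gamma>" and wt: "wt 1 k m \<noteq> 0"
    and cocycle: "\<forall>I K. index_pair I K \<longrightarrow> dmono k m \<gamma> I K = 0"
  obtains \<beta> where "adm m \<beta>" "\<And>I K. \<exists>K'. norm (\<beta> I K) \<le> 2 * norm (\<gamma> I K')"
    "\<And>I K. index_pair I K \<Longrightarrow> dmono k m \<beta> I K = \<gamma> I K"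
proof
  define a where "a = q0 powi wt 1 k m - 1"
  define b where "b = q0 powi wt 2 k m - 1"
  have a: "norm a \<ge> 1 / 2" unfolding a_def by (rule norm_q0_powi_minus_1_ge[OF wt])
  then have a0: "a \<noteq> 0" by auto
  let ?\<beta> = "\<lambda>I (K :: nat set). (-1) ^ (card I - 1) *
    ((if K = {} then inverse a else 0) * \<gamma> I {1} + (if K = {2} then inverse a else 0) * \<gamma> I {1, 2})"
  show "adm m ?\<beta>"
    unfolding adm_def
  proof (intro allI impI)
    fix I K assume "?\<beta> I K \<noteq> 0"
    then have "(K = {} \<or> K = {2}) \<and> (\<exists>K'. \<gamma> I K' \<noteq> 0)" by (auto split: if_splits)
    then show "index_pair I K \<and> neg_set m \<subseteq> inverted I"
      using adm unfolding adm_def index_pair_def by blast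
  qed
  show "\<exists>K'. norm (?\<beta> I K) \<le> 2 * norm (\<gamma> I K')" for I K
  proof -
    have "norm (inverse a) \<le> 2" using le_imp_inverse_le[OF a] by (simp add: norm_inverse)
    then have le: "norm (inverse a * x) \<le> 2 * norm x" for x
      unfolding norm_mult by (rule mult_right_mono) simp
    consider "K = {}" | "K = {2}" | "K \<noteq> {}" "K \<noteq> {2}" by blast
    then show ?thesis
    proof cases
      case 1 then show ?thesis using le by (auto simp: norm_mult norm_power)
    next
      case 2 then show ?thesis using le by (auto simp: norm_mult norm_power)
    next
      case 3 then show ?thesis by simp
    qed
  qed
  fix I K assume IK: "index_pair I K"
  have c: "cech (\<lambda>I. (-1) ^ (card I - 1) * (inverse a * \<gamma> I K')) I
      = - ((-1) ^ (card I - 1) * (inverse a * cech (\<lambda>I. \<gamma> I K') I))" for K'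
    by (subst cech_alternate) (simp_all add: finite_index_pair[OF IK] adm_empty[OF adm] cech_cmult)
  \<comment> \<open>For a total cocycle the Cech differential can be traded for the Koszul
    differential; this substitution cancels the unwanted terms below.\<close>
  have d: "cech (\<lambda>I. \<gamma> I K') I = - ((-1) ^ (card I - 1) * koszul k m (\<gamma> I) K')" if "K' \<subseteq> {1, 2}" for K'
    using cocycle[rule_format, of I K'] IK that by (simp add: dmono_def index_pair_def eq_neg_iff_add_eq_0)
  have s: "(-1) ^ (card I - 1) * ((-1) ^ (card I - 1) * x) = x" for x :: complex by (rule sign_square)
  have K: "K \<subseteq> {1, 2}" using IK by (simp add: index_pair_def)
  from K show "dmono k m ?\<beta> I K = \<gamma> I K"
  proof (cases rule: subset_12_cases)
    case 1
    show ?thesis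
      unfolding dmono_def 1 using c[of "{1}"] d[of "{1}"] s a0
      by (simp add: koszul_simps flip: a_def b_def mult.assoc) (simp add: mult.assoc mult.left_commute)
  next
    case 2
    show ?thesis
      unfolding dmono_def 2 using s a0
      by (simp add: koszul_simps cech_zero flip: a_def b_def) (simp add: mult.left_commute[of a])
  next
    case 3
    have "dmono k m ?\<beta> I K
      = - ((-1) ^ (card I - 1) * (inverse a * cech (\<lambda>I. \<gamma> I {1, 2}) I))
        + (-1) ^ (card I - 1) * (b * ((-1) ^ (card I - 1) * (inverse a * \<gamma> I {1})))"
      unfolding dmono_def 3 using c[of "{1, 2}"] by (simp add: koszul_simps flip: a_def b_def)
    also have "cech (\<lambda>I. \<gamma> I {1, 2}) I = - ((-1) ^ (card I - 1) * (a * \<gamma> I {2} - b * \<gamma> I {1}))"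
      using d[of "{1, 2}"] by (simp add: koszul_simps flip: a_def b_def)
    also have "- ((-1) ^ (card I - 1) * (inverse a * - ((-1) ^ (card I - 1) * (a * \<gamma> I {2} - b * \<gamma> I {1}))))
        + (-1) ^ (card I - 1) * (b * ((-1) ^ (card I - 1) * (inverse a * \<gamma> I {1})))
      = (-1) ^ (card I - 1) * ((-1) ^ (card I - 1) *
          (inverse a * (a * \<gamma> I {2} - b * \<gamma> I {1}) + b * (inverse a * \<gamma> I {1})))"
      by (simp add: algebra_simps)
    also have "\<dots> = \<gamma> I {2}" unfolding s using a0 by (simp add: field_simps)
    finally show ?thesis unfolding 3 .
  next
    case 4
    show ?thesis
      unfolding dmono_def 4 using s a0
      by (simp add: koszul_simps cech_zero insert_commute flip: a_def b_def) (simp add: mult.left_commute[of a])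
  qed
qed

text \<open>The same contraction with the second generator; passing it across the first one causes
  the minus sign for \<open>K = {1}\<close>.\<close>

lemma koszul_homotopy_2:
  assumes adm: "adm m \<gamma>" and wt: "wt 2 k m \<noteq> 0"
    and cocycle: "\<forall>I K. index_pair I K \<longrightarrow> dmono k m \<gamma> I K = 0"
  obtains \<beta> where "adm m \<beta>" "\<And>I K. \<exists>K'. norm (\<beta> I K) \<le> 2 * norm (\<gamma> I K')"
    "\<And>I K. index_pair I K \<Longrightarrow> dmono k m \<beta> I K = \<gamma> I K"
proof
  define a where "a = q0 powi wt 1 k m - 1"
  define b where "b = q0 powi wt 2 k m - 1"
  have b: "norm b \<ge> 1 / 2" unfolding b_def by (rule norm_q0_powi_minus_1_ge[OF wt])
  then have b0: "b \<noteq> 0" by auto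
  let ?\<beta> = "\<lambda>I (K :: nat set). (-1) ^ (card I - 1) *
    ((if K = {} then inverse b else 0) * \<gamma> I {2} + (if K = {1} then - inverse b else 0) * \<gamma> I {1, 2})"
  show "adm m ?\<beta>"
    unfolding adm_def
  proof (intro allI impI)
    fix I K assume "?\<beta> I K \<noteq> 0"
    then have "(K = {} \<or> K = {1}) \<and> (\<exists>K'. \<gamma> I K' \<noteq> 0)" by (auto split: if_splits)
    then show "index_pair I K \<and> neg_set m \<subseteq> inverted I"
      using adm unfolding adm_def index_pair_def by blast
  qed
  show "\<exists>K'. norm (?\<beta> I K) \<le> 2 * norm (\<gamma> I K')" for I K
  proof -
    have "norm (inverse b) \<le> 2" using le_imp_inverse_le[OF b] by (simp add: norm_inverse)
    then have le: "norm (inverse b * x) \<le> 2 * norm x" for x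
      unfolding norm_mult by (rule mult_right_mono) simp
    consider "K = {}" | "K = {1}" | "K \<noteq> {}" "K \<noteq> {1}" by blast
    then show ?thesis
    proof cases
      case 1 then show ?thesis using le by (auto simp: norm_mult norm_power)
    next
      case 2 then show ?thesis using le by (auto simp: norm_mult norm_power)
    next
      case 3 then show ?thesis by simp
    qed
  qed
  fix I K assume IK: "index_pair I K"
  have c: "cech (\<lambda>I. (-1) ^ (card I - 1) * (r * \<gamma> I K')) I
      = - ((-1) ^ (card I - 1) * (r * cech (\<lambda>I. \<gamma> I K') I))" for K' r
    by (subst cech_alternate) (simp_all add: finite_index_pair[OF IK] adm_empty[OF adm] cech_cmult)
  have d: "cech (\<lambda>I. \<gamma> I K') I = - ((-1) ^ (card I - 1) * koszul k m (\<gamma> I) K')" if "K' \<subseteq> {1, 2}" for K'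
    using cocycle[rule_format, of I K'] IK that by (simp add: dmono_def index_pair_def eq_neg_iff_add_eq_0)
  have s: "(-1) ^ (card I - 1) * ((-1) ^ (card I - 1) * x) = x" for x :: complex by (rule sign_square)
  have K: "K \<subseteq> {1, 2}" using IK by (simp add: index_pair_def)
  from K show "dmono k m ?\<beta> I K = \<gamma> I K"
  proof (cases rule: subset_12_cases)
    case 1
    show ?thesis
      unfolding dmono_def 1 using c[of "inverse b" "{2}"] d[of "{2}"] s b0
      by (simp add: koszul_simps flip: a_def b_def mult.assoc) (simp add: mult.assoc mult.left_commute)
  next
    case 3
    show ?thesis
      unfolding dmono_def 3 using s b0
      by (simp add: koszul_simps cech_zero flip: a_def b_def) (simp add: mult.left_commute[of b])
  next
    case 2
    have "dmono k m ?\<beta> I K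
      = - ((-1) ^ (card I - 1) * (- inverse b * cech (\<lambda>I. \<gamma> I {1, 2}) I))
        + (-1) ^ (card I - 1) * (a * ((-1) ^ (card I - 1) * (inverse b * \<gamma> I {2})))"
      unfolding dmono_def 2 using c[of "- inverse b" "{1, 2}"] by (simp add: koszul_simps flip: a_def b_def)
    also have "cech (\<lambda>I. \<gamma> I {1, 2}) I = - ((-1) ^ (card I - 1) * (a * \<gamma> I {2} - b * \<gamma> I {1}))"
      using d[of "{1, 2}"] by (simp add: koszul_simps flip: a_def b_def)
    also have "- ((-1) ^ (card I - 1) * (- inverse b * - ((-1) ^ (card I - 1) * (a * \<gamma> I {2} - b * \<gamma> I {1}))))
        + (-1) ^ (card I - 1) * (a * ((-1) ^ (card I - 1) * (inverse b * \<gamma> I {2})))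
      = (-1) ^ (card I - 1) * ((-1) ^ (card I - 1) *
          (- inverse b * (a * \<gamma> I {2} - b * \<gamma> I {1}) + a * (inverse b * \<gamma> I {2})))"
      by (simp add: algebra_simps)
    also have "\<dots> = \<gamma> I {1}" unfolding s using b0 by (simp add: field_simps)
    finally show ?thesis unfolding 2 by simp
  next
    case 4
    show ?thesis
      unfolding dmono_def 4 using s b0
      by (simp add: koszul_simps cech_zero insert_commute flip: a_def b_def) (simp add: mult.left_commute[of b])
  qed
qed

section \<open>Contracting the Cech direction by a cone\<close>

definition cone :: "nat \<Rightarrow> (nat set \<Rightarrow> complex) \<Rightarrow> nat set \<Rightarrow> complex" where
  "cone p \<delta> I = (if p \<in> I \<or> I = {} then 0 else pos_sign p I * \<delta> (insert p I))"

text \<open>Joining every face with the vertex p contracts the Cech complex of a simplex. Because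
  the cone is cut off at the empty set, the constant value at p remains in degree zero.\<close>

lemma cech_cone:
  assumes fin: "finite I" and I: "I \<noteq> {}" and cocycle: "cech \<delta> (insert p I) = 0"
  shows "cech (cone p \<delta>) I = \<delta> I - (if card I = 1 then \<delta> {p} else 0)"
proof (cases "p \<in> I")
  case True
  have "pos_sign i I * cone p \<delta> (I - {i}) = 0" if "i \<in> I - {p}" for i
    using that True by (auto simp: cone_def)
  then have c: "cech (cone p \<delta>) I = pos_sign p I * cone p \<delta> (I - {p})"
    unfolding cech_def by (subst sum.remove[OF fin True]) (simp add: sum.neutral)
  show ?thesis
  proof (cases "I = {p}")
    case True
    then show ?thesis using c by (simp add: cone_def)
  next
    case False
    have "{j \<in> I - {p}. j < p} = {j \<in> I. j < p}" by auto
    then have "pos_sign p (I - {p}) = pos_sign p I" by (simp add: pos_sign_def)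
    moreover have "card I \<noteq> 1"
    proof
      assume "card I = 1"
      then obtain x where "I = {x}" by (rule card_1_singletonE)
      with True False show False by simp
    qed
    moreover have "I - {p} \<noteq> {}" "insert p (I - {p}) = I" using True False by auto
    ultimately show ?thesis using c by (simp add: cone_def)
  qed
next
  case False
  have fin': "finite (insert p I)" using fin by simp
  have "{j \<in> insert p I. j < p} = {j \<in> I. j < p}" by auto
  then have lt: "pos_sign p (insert p I) = pos_sign p I" by (simp add: pos_sign_def)
  have rm: "insert p I - {p} = I" using False by auto
  have "cech \<delta> (insert p I) = pos_sign p I * \<delta> I
      + (\<Sum>i\<in>I. pos_sign i (insert p I) * \<delta> (insert p I - {i}))"
    unfolding cech_def by (subst sum.remove[OF fin', of p]) (simp_all only: lt rm insertI1)
  with cocycle have "pos_sign p I * \<delta> I = - (\<Sum>i\<in>I. pos_sign i (insert p I) * \<delta> (insert p I - {i}))"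
    by (simp add: eq_neg_iff_add_eq_0)
  then have E: "\<delta> I = pos_sign p I * - (\<Sum>i\<in>I. pos_sign i (insert p I) * \<delta> (insert p I - {i}))"
    by (metis pos_sign_square(2))
  have ne: "insert p I - {i} = insert p (I - {i})" if "i \<in> I" for i using False that by auto
  \<comment> \<open>The incidence signs of i and p taken in the two possible orders are opposite, as
    in the proof that a boundary has no boundary.\<close>
  have sgn: "pos_sign i I * pos_sign p (I - {i}) = - (pos_sign p I * pos_sign i (insert p I))" if i: "i \<in> I" for i
  proof (cases "i < p")
    case True
    have e: "{j \<in> I. j < p} = insert i {j \<in> I - {i}. j < p}" using True i by auto
    have "card {j \<in> I. j < p} = Suc (card {j \<in> I - {i}. j < p})"
      unfolding e by (rule card_insert_disjoint) (use fin in auto)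
    then have "pos_sign p I = - pos_sign p (I - {i})" by (simp add: pos_sign_def)
    moreover have "{j \<in> insert p I. j < i} = {j \<in> I. j < i}" using True by auto
    then have "pos_sign i (insert p I) = pos_sign i I" by (simp add: pos_sign_def)
    ultimately show ?thesis by simp
  next
    case False
    then have "p < i" using i \<open>p \<notin> I\<close> by (metis nat_neq_iff)
    then have e: "{j \<in> insert p I. j < i} = insert p {j \<in> I. j < i}" by auto
    have "card {j \<in> insert p I. j < i} = Suc (card {j \<in> I. j < i})"
      unfolding e by (rule card_insert_disjoint) (use fin \<open>p \<notin> I\<close> in auto)
    then have "pos_sign i (insert p I) = - pos_sign i I" by (simp add: pos_sign_def)
    moreover have "{j \<in> I - {i}. j < p} = {j \<in> I. j < p}" using False by auto
    then have "pos_sign p (I - {i}) = pos_sign p I" by (simp add: pos_sign_def)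
    ultimately show ?thesis by simp
  qed
  show ?thesis
  proof (cases "card I = 1")
    case True
    then obtain i where Ii: "I = {i}" by (rule card_1_singletonE)
    have ip: "i \<noteq> p" using False Ii by auto
    have "cech (cone p \<delta>) I = 0" by (simp add: Ii cech_def cone_def)
    moreover have "\<delta> I = \<delta> {p}"
    proof -
      have "{} = {j \<in> I - {i}. j < p}" by (auto simp: Ii)
      from pos_sign_eq[OF this[symmetric]] have 1: "pos_sign p (I - {i}) = 1" by simp
      have 2: "pos_sign i I = 1" by (simp add: Ii)
      have 3: "pos_sign p I * pos_sign i (insert p I) = -1"
        using sgn[of i] unfolding 1 2 by (simp add: Ii equation_minus_iff)
      have "insert p I - {i} = {p}" using ip Ii by auto
      then have "\<delta> I = - (pos_sign p I * pos_sign i (insert p I)) * \<delta> {p}"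
        by (subst E) (simp add: Ii)
      then show ?thesis unfolding 3 by simp
    qed
    ultimately show ?thesis using True by simp
  next
    case card: False
    have "pos_sign i I * cone p \<delta> (I - {i}) = pos_sign p I * - (pos_sign i (insert p I) * \<delta> (insert p I - {i}))"
      if i: "i \<in> I" for i
    proof -
      have "I \<noteq> {i}" using card by auto
      then have "I - {i} \<noteq> {}" using i by blast
      then have "pos_sign i I * cone p \<delta> (I - {i}) = (pos_sign i I * pos_sign p (I - {i})) * \<delta> (insert p I - {i})"
        using False i by (simp add: cone_def ne)
      then show ?thesis unfolding sgn[OF i] by simp
    qed
    then have "cech (cone p \<delta>) I = (\<Sum>i\<in>I. pos_sign p I * - (pos_sign i (insert p I) * \<delta> (insert p I - {i})))"
      unfolding cech_def by (intro sum.cong refl)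
    also have "\<dots> = \<delta> I" by (subst E) (simp add: sum_negf sum_distrib_left)
    finally show ?thesis using card by simp
  qed
qed

lemma cech_pair: "a < b \<Longrightarrow> cech \<delta> {a, b} = \<delta> {b} - \<delta> {a}"
proof -
  assume ab: "a < b"
  have 1: "{a, b} - {a} = {b}" "{a, b} - {b} = {a}" using ab by auto
  have "cech \<delta> {a, b} = pos_sign a {a, b} * \<delta> ({a, b} - {a}) + pos_sign b {a, b} * \<delta> ({a, b} - {b})"
    unfolding cech_def using ab by (subst sum.insert, simp, simp)+ simp
  then show ?thesis unfolding 1 using ab by simp
qed

lemma cech_triple: "a < b \<Longrightarrow> b < c \<Longrightarrow> cech \<delta> {a, b, c} = \<delta> {b, c} - \<delta> {a, c} + \<delta> {a, b}"
proof -
  assume ab: "a < b" "b < c"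
  have 0: "{j \<in> {a, b, c}. j < a} = {}" "{j \<in> {a, b, c}. j < b} = {a}" "{j \<in> {a, b, c}. j < c} = {a, b}"
    using ab by auto
  have 1: "{a, b, c} - {a} = {b, c}" "{a, b, c} - {b} = {a, c}" "{a, b, c} - {c} = {a, b}"
    using ab by auto
  have 2: "pos_sign a {a, b, c} = 1" "pos_sign b {a, b, c} = -1" "pos_sign c {a, b, c} = 1"
    using pos_sign_eq[OF 0(1)] pos_sign_eq[OF 0(2)] pos_sign_eq[OF 0(3)] ab by simp_all
  have "cech \<delta> {a, b, c} = pos_sign a {a, b, c} * \<delta> ({a, b, c} - {a})
     + (pos_sign b {a, b, c} * \<delta> ({a, b, c} - {b}) + pos_sign c {a, b, c} * \<delta> ({a, b, c} - {c}))"
    unfolding cech_def using ab by (subst sum.insert, simp, simp)+ simp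
  then show ?thesis unfolding 1 2 by simp
qed

lemma cech_quadruple:
  "cech \<delta> {1, 2, 3, 4} = \<delta> {2, 3, 4} - \<delta> {1, 3, 4} + \<delta> {1, 2, 4} - \<delta> {1, 2, 3}"
proof -
  let ?I = "{1, 2, 3, 4 :: nat}"
  have 0: "{j \<in> ?I. j < 1} = {}" "{j \<in> ?I. j < 2} = {1}" "{j \<in> ?I. j < 3} = {1, 2}" "{j \<in> ?I. j < 4} = {1, 2, 3}"
    by auto
  have 1: "?I - {1} = {2, 3, 4}" "?I - {2} = {1, 3, 4}" "?I - {3} = {1, 2, 4}" "?I - {4} = {1, 2, 3}"
    by auto
  have 2: "pos_sign 1 ?I = 1" "pos_sign 2 ?I = -1" "pos_sign 3 ?I = 1" "pos_sign 4 ?I = -1"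
    using pos_sign_eq[OF 0(1)] pos_sign_eq[OF 0(2)] pos_sign_eq[OF 0(3)] pos_sign_eq[OF 0(4)] by simp_all
  have "cech \<delta> ?I = pos_sign 1 ?I * \<delta> (?I - {1}) + (pos_sign 2 ?I * \<delta> (?I - {2})
     + (pos_sign 3 ?I * \<delta> (?I - {3}) + pos_sign 4 ?I * \<delta> (?I - {4})))"
    unfolding cech_def by (subst sum.insert, simp, simp)+ simp
  then show ?thesis unfolding 1 2 by simp
qed

lemma subset_1234_cases:
  assumes "I \<subseteq> {1..4 :: nat}" "I \<noteq> {}"
  shows "I \<in> {{1}, {2}, {3}, {4}} \<or> I \<in> {{1, 2}, {1, 3}, {1, 4}, {2, 3}, {2, 4}, {3, 4}}
    \<or> I \<in> {{1, 2, 3}, {1, 2, 4}, {1, 3, 4}, {2, 3, 4}} \<or> I = {1, 2, 3, 4}"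
proof -
  define P where "P = (\<lambda>(j :: nat) b. if b then {j} else {})"
  have "{1..4 :: nat} = {1, 2, 3, 4}" by auto
  then have "I = P 1 (1 \<in> I) \<union> P 2 (2 \<in> I) \<union> P 3 (3 \<in> I) \<union> P 4 (4 \<in> I)"
    using assms(1) by (auto simp: P_def)
  then obtain b1 b2 b3 b4 where I: "I = P 1 b1 \<union> P 2 b2 \<union> P 3 b3 \<union> P 4 b4" by blast
  have P: "P j True = {j}" "P j False = {}" for j by (simp_all add: P_def)
  show ?thesis
    using assms(2) unfolding I
    by (cases b1; cases b2; cases b3; cases b4)
       (simp_all only: P Un_empty_left Un_empty_right Un_insert_left insert_iff simp_thms not_True_eq_False not_False_eq_True)
qed


lemma face_simps [simp]:
  "face 1 = {1, 2}" "face 2 = {1, 4}" "face 3 = {2, 3}" "face 4 = {3, 4}"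
  by (simp_all add: face_def)

lemma inverted_insert: "inverted (insert p I) = - face p \<union> inverted I"
  and inverted_empty: "inverted {} = {}"
  by (auto simp: inverted_def)

lemma in_inverted: "i \<in> inverted I \<longleftrightarrow> (\<exists>j\<in>I. i \<notin> face j)"
  by (auto simp: inverted_def)

lemma neg_set_iff: "i \<in> neg_set m \<longleftrightarrow> m $ i < 0"
  by (simp add: neg_set_def)

text \<open>Weight zero under the second generator gives m_2 + m_4 >= 0, so u and v are never both
  in the denominator. If x and y are not both there either, the poles lie along coordinates of a
  single face. Chart 1 is chosen when there are no poles because \<open>harmonic\<close> reads the
  value on chart 1.\<close>

lemma zero_weight_face:
  assumes "wt 1 k m = 0" "wt 2 k m = 0" "\<not> (1 \<in> neg_set m \<and> 3 \<in> neg_set m)"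
  obtains p where "p \<in> {1..4}" "neg_set m \<subseteq> face p" "neg_set m = {} \<Longrightarrow> p = 1"
proof -
  have 24: "\<not> (2 \<in> neg_set m \<and> 4 \<in> neg_set m)"
    using assms(2) unfolding wt_2 neg_set_iff by linarith
  have N: "i \<in> neg_set m \<Longrightarrow> i = 1 \<or> i = 2 \<or> i = 3 \<or> i = 4" for i
    using exhaust_4[of i] by blast
  consider "3 \<notin> neg_set m" "4 \<notin> neg_set m" | "3 \<notin> neg_set m" "4 \<in> neg_set m" "2 \<notin> neg_set m"
    | "1 \<notin> neg_set m" "3 \<in> neg_set m" "4 \<notin> neg_set m" | "1 \<notin> neg_set m" "3 \<in> neg_set m" "2 \<notin> neg_set m"
    using assms(3) 24 by blast
  then show ?thesis
  proof cases
    case 1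
    with N have "neg_set m \<subseteq> {1, 2}" by blast
    then show ?thesis by (intro that[of 1]) simp_all
  next
    case 2
    with N have "neg_set m \<subseteq> {1, 4}" by blast
    with 2 show ?thesis by (intro that[of 2]) auto
  next
    case 3
    with N have "neg_set m \<subseteq> {2, 3}" by blast
    with 3 show ?thesis by (intro that[of 3]) auto
  next
    case 4
    with N have "neg_set m \<subseteq> {3, 4}" by blast
    with 4 show ?thesis by (intro that[of 4]) auto
  qed
qed

text \<open>Negative exponents of x and y force at least one factor v under the first weight, while
  the second weight permits at most one and then no u. The component d/dv is excluded since its
  first weight would need the exponents of x and y to sum to 0.\<close>

lemma zero_weight_eta_exp:
  assumes "wt 1 k m = 0" "wt 2 k m = 0" "1 \<in> neg_set m" "3 \<in> neg_set m" "2 \<notin> neg_set m"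
  shows "k = 2" "m = eta_exp"
proof -
  have w: "m $ 1 + m $ 3 + 2 * m $ 4 = int (deck_weight 1 $ k)" "m $ 2 + m $ 4 = int (deck_weight 2 $ k)"
    and n: "m $ 1 < 0" "m $ 3 < 0" "m $ 2 \<ge> 0"
    using assms unfolding wt_1 wt_2 neg_set_iff by simp_all
  have "k = 1 \<or> k = 2 \<or> k = 3 \<or> k = 4" using exhaust_4[of k] by blast
  then show k: "k = 2" using w n
  proof (elim disjE)
    assume "k = 1" with w n show ?thesis by simp
  next
    assume "k = 3" with w n show ?thesis by simp
  next
    assume "k = 4" with w n show ?thesis by simp
  qed
  have w2: "m $ 1 + m $ 3 + 2 * m $ 4 = 0" "m $ 2 + m $ 4 = 1" using w unfolding k by simp_all
  have "m $ 4 = 1" "m $ 1 = -1" "m $ 3 = -1" "m $ 2 = 0" using w2 n by linarith+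
  then show "m = eta_exp" by (simp add: vec_eq_iff forall_4 eta_exp_def)
qed

lemma neg_set_eta_exp: "neg_set eta_exp = {1, 3}"
proof -
  have "i \<in> neg_set eta_exp \<longleftrightarrow> i = 1 \<or> i = 3" for i
    using exhaust_4[of i] by (elim disjE) (simp_all add: eta_exp_def neg_set_iff)
  then show ?thesis by blast
qed

lemma zero_weight_eta: "wt 1 2 eta_exp = 0" "wt 2 2 eta_exp = 0"
  unfolding wt_1 wt_2 by (simp_all add: eta_exp_def)

lemma koszul_zero:
  assumes "wt 1 k m = 0" "wt 2 k m = 0" "K \<subseteq> {1, 2}"
  shows "koszul k m \<delta> K = 0"
  unfolding koszul_def by (rule sum.neutral) (use assms in auto)

text \<open>Chart p inverts none of the coordinates of its own face. If the poles lie along that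
  face and the monomial is allowed on the overlap enlarged by p, it was therefore already allowed
  before the enlargement; this is why the cone preserves admissibility.\<close>

lemma cone_homotopy:
  assumes adm: "adm m \<gamma>" and wt: "wt 1 k m = 0" "wt 2 k m = 0"
    and p: "p \<in> {1..4}" "neg_set m \<subseteq> face p" "neg_set m = {} \<Longrightarrow> p = 1"
    and cocycle: "\<forall>I K. index_pair I K \<longrightarrow> dmono k m \<gamma> I K = 0"
  shows "adm m (\<lambda>I K. cone p (\<lambda>I. \<gamma> I K) I)"
    and "index_pair I K \<Longrightarrow> dmono k m (\<lambda>I K. cone p (\<lambda>I. \<gamma> I K) I) I K = \<gamma> I K - harmonic k m \<gamma> I K"
proof -
  show "adm m (\<lambda>I K. cone p (\<lambda>I. \<gamma> I K) I)"
    unfolding adm_def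
  proof (intro allI impI)
    fix I K assume "cone p (\<lambda>I. \<gamma> I K) I \<noteq> 0"
    then have "I \<noteq> {}" "\<gamma> (insert p I) K \<noteq> 0" by (auto simp: cone_def split: if_splits)
    with adm have "index_pair (insert p I) K" "neg_set m \<subseteq> inverted (insert p I)" "I \<noteq> {}"
      unfolding adm_def by blast+
    then show "index_pair I K \<and> neg_set m \<subseteq> inverted I"
      using p(2) unfolding index_pair_def inverted_insert by blast
  qed
  assume IK: "index_pair I K"
  have K: "K \<subseteq> {1, 2}" using IK by (simp add: index_pair_def)
  have "index_pair (insert p I) K" using IK p(1) by (simp add: index_pair_def)
  from cocycle[rule_format, OF this] have "cech (\<lambda>I. \<gamma> I K) (insert p I) = 0"
    by (simp add: dmono_def koszul_zero[OF wt K])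
  then have c: "cech (cone p (\<lambda>I. \<gamma> I K)) I = \<gamma> I K - (if card I = 1 then \<gamma> {p} K else 0)"
    using IK by (intro cech_cone finite_index_pair) (auto simp: index_pair_def)
  have "m \<noteq> eta_exp"
  proof
    assume "m = eta_exp"
    then have "{1, 3} \<subseteq> face p" using p(2) neg_set_eta_exp by simp
    then show False unfolding face_def by (auto split: if_splits)
  qed
  moreover have "\<gamma> {p} K = (if invariant_exp k m then \<gamma> {1} K else 0)"
  proof (cases "neg_set m = {}")
    case True
    then show ?thesis using p(3) wt by (simp add: invariant_exp_def)
  next
    case False
    \<comment> \<open>A genuine pole along the face of p is impossible on the single chart
      p.\<close>
    have "\<gamma> {p} K = 0"
    proof (rule ccontr)
      assume "\<gamma> {p} K \<noteq> 0"
      then have "neg_set m \<subseteq> - face p"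
        using adm unfolding adm_def by (metis inverted_insert inverted_empty Un_empty_right)
      with p(2) False show False by blast
    qed
    then show ?thesis using False by (simp add: invariant_exp_def)
  qed
  ultimately have "harmonic k m \<gamma> I K = (if card I = 1 then \<gamma> {p} K else 0)"
    by (simp add: harmonic_def)
  then show "dmono k m (\<lambda>I K. cone p (\<lambda>I. \<gamma> I K) I) I K = \<gamma> I K - harmonic k m \<gamma> I K"
    unfolding dmono_def koszul_zero[OF wt K] using c by simp
qed

section \<open>Monomials with x and y both in the denominator\<close>

lemma eta_coeff_simps:
  "eta_coeff {1, 2} = 0" "eta_coeff {1, 3} = 1" "eta_coeff {1, 4} = 1"
  "eta_coeff {2, 3} = 1" "eta_coeff {2, 4} = 1" "eta_coeff {3, 4} = 0"
  by (simp_all add: eta_coeff_def chart_scalar_def)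

text \<open>The equations on the triple overlaps are solved with the value 0 on {1, 2}, {3, 4} and
  {1, 3}. The first two do not invert both x and y; the third is the only other pair that does not
  invert u, so setting it to 0 keeps the primitive admissible when u is in the denominator.\<close>

definition square_homotopy :: "(nat set \<Rightarrow> complex) \<Rightarrow> nat set \<Rightarrow> complex" where
  "square_homotopy \<delta> I = (if I = {1, 4} then - \<delta> {1, 3, 4} else if I = {2, 3} then \<delta> {1, 2, 3}
     else if I = {2, 4} then \<delta> {1, 2, 4} - \<delta> {1, 3, 4} else 0)"

lemma square_homotopy_simps:
  "square_homotopy \<delta> {} = 0" "square_homotopy \<delta> {a} = 0"
  "square_homotopy \<delta> {1, 2} = 0" "square_homotopy \<delta> {1, 3} = 0" "square_homotopy \<delta> {1, 4} = - \<delta> {1, 3, 4}"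
  "square_homotopy \<delta> {2, 3} = \<delta> {1, 2, 3}" "square_homotopy \<delta> {2, 4} = \<delta> {1, 2, 4} - \<delta> {1, 3, 4}"
  "square_homotopy \<delta> {3, 4} = 0"
  "square_homotopy \<delta> {1, 2, 3} = 0" "square_homotopy \<delta> {1, 2, 4} = 0"
  "square_homotopy \<delta> {1, 3, 4} = 0" "square_homotopy \<delta> {2, 3, 4} = 0"
proof -
  have c: "square_homotopy \<delta> I = 0" if "card I \<noteq> 2" for I
  proof -
    have "I \<noteq> {1, 4}" "I \<noteq> {2, 3}" "I \<noteq> {2, 4}" using that by auto
    then show ?thesis by (simp only: square_homotopy_def if_False)
  qed
  show "square_homotopy \<delta> {} = 0" by (rule c) simp
  show "square_homotopy \<delta> {a} = 0" by (rule c) simp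
  show "square_homotopy \<delta> {1, 2, 3} = 0" by (rule c) simp
  show "square_homotopy \<delta> {1, 2, 4} = 0" by (rule c) simp
  show "square_homotopy \<delta> {1, 3, 4} = 0" by (rule c) simp
  show "square_homotopy \<delta> {2, 3, 4} = 0" by (rule c) simp
  have ne: "{1, 2} \<noteq> {1, 4 :: nat}" "{1, 2} \<noteq> {2, 3 :: nat}" "{1, 2} \<noteq> {2, 4 :: nat}"
    "{1, 3} \<noteq> {1, 4 :: nat}" "{1, 3} \<noteq> {2, 3 :: nat}" "{1, 3} \<noteq> {2, 4 :: nat}"
    "{3, 4} \<noteq> {1, 4 :: nat}" "{3, 4} \<noteq> {2, 3 :: nat}" "{3, 4} \<noteq> {2, 4 :: nat}"
    "{2, 3} \<noteq> {1, 4 :: nat}" "{2, 4} \<noteq> {1, 4 :: nat}" "{2, 4} \<noteq> {2, 3 :: nat}"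
    by (simp_all add: doubleton_eq_iff)
  show "square_homotopy \<delta> {1, 2} = 0" "square_homotopy \<delta> {1, 3} = 0" "square_homotopy \<delta> {1, 4} = - \<delta> {1, 3, 4}"
  "square_homotopy \<delta> {2, 3} = \<delta> {1, 2, 3}" "square_homotopy \<delta> {2, 4} = \<delta> {1, 2, 4} - \<delta> {1, 3, 4}"
  "square_homotopy \<delta> {3, 4} = 0"
    unfolding square_homotopy_def by (simp_all only: ne if_False if_True refl simp_thms)
qed

text \<open>No single chart, and neither {1, 2} nor {3, 4}, supports such a monomial. On the four
  remaining pairs the cocycle condition forces one common value. If u is in the denominator, it
  vanishes because charts 1 and 3 do not invert u; otherwise the weights leave only the monomial of
  W, which gives the harmonic part.\<close>

lemma square_homotopy:
  assumes adm: "adm m \<gamma>" and wt: "wt 1 k m = 0" "wt 2 k m = 0"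
    and N: "1 \<in> neg_set m" "3 \<in> neg_set m"
    and deg: "\<forall>I K. \<gamma> I K \<noteq> 0 \<longrightarrow> card I \<le> 3"
    and cocycle: "\<forall>I K. index_pair I K \<longrightarrow> dmono k m \<gamma> I K = 0"
  shows "adm m (\<lambda>I K. square_homotopy (\<lambda>I. \<gamma> I K) I)"
    and "index_pair I K \<Longrightarrow>
      dmono k m (\<lambda>I K. square_homotopy (\<lambda>I. \<gamma> I K) I) I K = \<gamma> I K - harmonic k m \<gamma> I K"
proof -
  \<comment> \<open>With x and y in the denominator, weight zero under the first generator forces a
    positive power of v.\<close>
  have N4: "4 \<notin> neg_set m"
    using wt(1) N unfolding wt_1 neg_set_iff by linarith
  show "adm m (\<lambda>I K. square_homotopy (\<lambda>I. \<gamma> I K) I)"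
    unfolding adm_def
  proof (intro allI impI)
    fix I K assume nz: "square_homotopy (\<lambda>I. \<gamma> I K) I \<noteq> 0"
    then have I: "I = {1, 4} \<or> I = {2, 3} \<or> I = {2, 4}"
      and "\<exists>I'. \<gamma> I' K \<noteq> 0" unfolding square_homotopy_def by (auto split: if_splits)
    then have "K \<subseteq> {1, 2}" using adm unfolding adm_def index_pair_def by blast
    moreover have "I \<noteq> {} \<and> I \<subseteq> {1..4}" using I by auto
    moreover have "neg_set m \<subseteq> inverted I"
    proof
      fix i assume i: "i \<in> neg_set m"
      have "i = 1 \<or> i = 2 \<or> i = 3 \<or> i = 4" using exhaust_4[of i] by blast
      with i N4 have "i = 1 \<or> i = 2 \<or> i = 3" by blast
      with I show "i \<in> inverted I" unfolding in_inverted by (elim disjE) simp_all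
    qed
    ultimately show "index_pair I K \<and> neg_set m \<subseteq> inverted I" by (simp add: index_pair_def)
  qed
  assume IK: "index_pair I K"
  have K: "K \<subseteq> {1, 2}" using IK by (simp add: index_pair_def)
  define \<delta> where "\<delta> = (\<lambda>I. \<gamma> I K)"
  have coc: "cech \<delta> I = 0" if "I \<subseteq> {1..4}" "I \<noteq> {}" for I
    using cocycle[rule_format, of I K] that K by (simp add: dmono_def koszul_zero[OF wt K] index_pair_def \<delta>_def)
  have zero: "\<delta> I = 0" if "1 \<notin> inverted I \<or> 3 \<notin> inverted I" for I
    using adm N that unfolding adm_def \<delta>_def by blast
  have z1: "\<delta> {1} = 0" "\<delta> {2} = 0" "\<delta> {3} = 0" "\<delta> {4} = 0" "\<delta> {1, 2} = 0" "\<delta> {3, 4} = 0"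
    by (rule zero, simp add: in_inverted)+
  have t: "\<delta> {2, 3} = \<delta> {1, 3}" "\<delta> {2, 4} = \<delta> {1, 4}" "\<delta> {1, 4} = \<delta> {1, 3}"
    using coc[of "{1, 2, 3}"] coc[of "{1, 2, 4}"] coc[of "{1, 3, 4}"] z1
    by (simp_all add: cech_triple)
  \<comment> \<open>The quadruple cocycle condition makes the fourth triple equation follow from the
    three used to define the primitive.\<close>
  have q: "\<delta> {2, 3, 4} = \<delta> {1, 3, 4} - \<delta> {1, 2, 4} + \<delta> {1, 2, 3}"
    using coc[of "{1, 2, 3, 4}"] by (simp add: cech_quadruple algebra_simps)
  have "\<delta> {1, 2, 3, 4} = 0" using deg[rule_format, of "{1, 2, 3, 4}" K] by (auto simp: \<delta>_def)
  have inv: "\<not> invariant_exp k m" using N by (auto simp: invariant_exp_def)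
  have s13: "\<delta> {1, 3} = (if k = 2 \<and> m = eta_exp then \<delta> {1, 3} else 0)"
  proof (cases "2 \<in> neg_set m")
    case True
    moreover have "2 \<notin> inverted {1, 3}" by (simp add: in_inverted)
    ultimately have "\<delta> {1, 3} = 0" using adm unfolding adm_def \<delta>_def by blast
    then show ?thesis by simp
  next
    case False
    then show ?thesis using zero_weight_eta_exp[OF wt N] by simp
  qed
  have "cech (square_homotopy \<delta>) I = \<delta> I - (if card I = 2 \<and> k = 2 \<and> m = eta_exp then eta_coeff I * \<delta> {1, 3} else 0)"
  proof -
    have single: "cech (square_homotopy \<delta>) {a} = 0" for a by (simp add: cech_def square_homotopy_simps)
    have pair: "cech (square_homotopy \<delta>) {a, b} = 0" if "a < b" for a b
      using that by (simp add: cech_pair square_homotopy_simps)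
    have "I \<subseteq> {1..4}" "I \<noteq> {}" using IK by (simp_all add: index_pair_def)
    from subset_1234_cases[OF this] show ?thesis
    proof (elim disjE)
      assume "I \<in> {{1}, {2}, {3}, {4}}"
      then show ?thesis using z1 single by auto
    next
      assume I: "I \<in> {{1, 2}, {1, 3}, {1, 4}, {2, 3}, {2, 4}, {3, 4}}"
      let ?c = "if k = 2 \<and> m = eta_exp then 1 else 0 :: complex"
      have s13': "\<delta> {1, 3} = ?c * \<delta> {1, 3}" by (subst s13) simp
      from I have "cech (square_homotopy \<delta>) I = 0 \<and> card I = 2 \<and> \<delta> I = eta_coeff I * \<delta> {1, 3}"
        unfolding insert_iff empty_iff
        by (elim disjE FalseE) (simp_all add: pair z1 t eta_coeff_simps)
      moreover from this s13' have "\<delta> I = ?c * (eta_coeff I * \<delta> {1, 3})"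
        by (metis mult.left_commute)
      ultimately show ?thesis by (cases "k = 2 \<and> m = eta_exp") auto
    next
      assume "I \<in> {{1, 2, 3}, {1, 2, 4}, {1, 3, 4}, {2, 3, 4}}"
      then show ?thesis
        unfolding insert_iff empty_iff
        by (elim disjE FalseE) (use q in \<open>simp_all add: cech_triple square_homotopy_simps\<close>)
    next
      assume "I = {1, 2, 3, 4}"
      then show ?thesis using \<open>\<delta> {1, 2, 3, 4} = 0\<close> by (simp add: cech_quadruple square_homotopy_simps)
    qed
  qed
  then show "dmono k m (\<lambda>I K. square_homotopy (\<lambda>I. \<gamma> I K) I) I K = \<gamma> I K - harmonic k m \<gamma> I K"
    unfolding dmono_def koszul_zero[OF wt K] harmonic_def using inv by (simp add: \<delta>_def)
qed

section \<open>The homotopy for an arbitrary monomial\<close>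

definition total_norm :: "(nat set \<Rightarrow> nat set \<Rightarrow> complex) \<Rightarrow> real" where
  "total_norm \<gamma> = (\<Sum>I\<in>Pow {1..4}. \<Sum>K\<in>Pow {1, 2}. norm (\<gamma> I K))"

lemma norm_le_total_norm:
  assumes "adm m \<gamma>"
  shows "norm (\<gamma> I K) \<le> total_norm \<gamma>"
proof (cases "\<gamma> I K = 0")
  case True
  then show ?thesis by (simp add: total_norm_def sum_nonneg)
next
  case False
  then have I: "I \<in> Pow {1..4}" and K: "K \<in> Pow {1, 2}"
    using assms by (auto simp: adm_def index_pair_def)
  have "norm (\<gamma> I K) \<le> (\<Sum>K\<in>Pow {1, 2}. norm (\<gamma> I K))"
    by (rule member_le_sum[OF K]) auto
  also have "\<dots> \<le> total_norm \<gamma>"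
    unfolding total_norm_def by (rule member_le_sum[OF I]) (auto intro: sum_nonneg)
  finally show ?thesis .
qed

text \<open>The factor 2 is the worst case over all homotopies: it bounds the inverse of
  \<open>q0 powi n - 1\<close> in the Koszul direction and the difference of two values in the
  square. The cone has factor 1.\<close>

theorem monomial_homotopy:
  assumes adm: "adm m \<gamma>" and deg: "\<forall>I K. \<gamma> I K \<noteq> 0 \<longrightarrow> card I \<le> 3"
    and cocycle: "\<forall>I K. index_pair I K \<longrightarrow> dmono k m \<gamma> I K = 0"
  shows "\<exists>\<beta>. adm m \<beta> \<and> (\<forall>I K. norm (\<beta> I K) \<le> 2 * total_norm \<gamma>) \<and>
    (\<forall>I K. index_pair I K \<longrightarrow> dmono k m \<beta> I K = \<gamma> I K - harmonic k m \<gamma> I K)"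
proof -
  note le = norm_le_total_norm[OF adm]
  have t0: "total_norm \<gamma> \<ge> 0" by (simp add: total_norm_def sum_nonneg)
  have harm0: "harmonic k m \<gamma> I K = 0" if "wt 1 k m \<noteq> 0 \<or> wt 2 k m \<noteq> 0" for I K
    using that zero_weight_eta by (auto simp: harmonic_def invariant_exp_def)
  consider (a) "wt 1 k m \<noteq> 0" | (b) "wt 2 k m \<noteq> 0"
    | (c) "wt 1 k m = 0" "wt 2 k m = 0" "1 \<in> neg_set m" "3 \<in> neg_set m"
    | (d) "wt 1 k m = 0" "wt 2 k m = 0" "\<not> (1 \<in> neg_set m \<and> 3 \<in> neg_set m)" by blast
  then show ?thesis
  proof cases
    case a
    show ?thesis
    proof (rule koszul_homotopy_1[OF adm a cocycle])
      fix \<beta>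
      assume \<beta>: "adm m \<beta>" "\<And>I K. \<exists>K'. norm (\<beta> I K) \<le> 2 * norm (\<gamma> I K')"
        "\<And>I K. index_pair I K \<Longrightarrow> dmono k m \<beta> I K = \<gamma> I K"
      have 1: "norm (\<beta> I K) \<le> 2 * total_norm \<gamma>" for I K
      proof -
        obtain K' where "norm (\<beta> I K) \<le> 2 * norm (\<gamma> I K')" using \<beta>(2) by blast
        then show ?thesis using le[of I K'] by linarith
      qed
      have 2: "harmonic k m \<gamma> I K = 0" for I K using harm0 a by blast
      show ?thesis
        by (intro exI[of _ \<beta>] conjI allI impI \<beta>(1) 1) (simp only: \<beta>(3) 2 diff_zero)
    qed
  next
    case b
    show ?thesis
    proof (rule koszul_homotopy_2[OF adm b cocycle])
      fix \<beta>
      assume \<beta>: "adm m \<beta>" "\<And>I K. \<exists>K'. norm (\<beta> I K) \<le> 2 * norm (\<gamma> I K')"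
        "\<And>I K. index_pair I K \<Longrightarrow> dmono k m \<beta> I K = \<gamma> I K"
      have 1: "norm (\<beta> I K) \<le> 2 * total_norm \<gamma>" for I K
      proof -
        obtain K' where "norm (\<beta> I K) \<le> 2 * norm (\<gamma> I K')" using \<beta>(2) by blast
        then show ?thesis using le[of I K'] by linarith
      qed
      have 2: "harmonic k m \<gamma> I K = 0" for I K using harm0 b by blast
      show ?thesis
        by (intro exI[of _ \<beta>] conjI allI impI \<beta>(1) 1) (simp only: \<beta>(3) 2 diff_zero)
    qed
  next
    case c
    have "norm (square_homotopy (\<lambda>I. \<gamma> I K) I) \<le> 2 * total_norm \<gamma>" for I K
    proof -
      have "norm (\<gamma> {1, 2, 4} K - \<gamma> {1, 3, 4} K) \<le> 2 * total_norm \<gamma>"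
        using norm_triangle_ineq4[of "\<gamma> {1, 2, 4} K" "\<gamma> {1, 3, 4} K"] le[of "{1, 2, 4}" K] le[of "{1, 3, 4}" K]
        by linarith
      moreover have "norm (\<gamma> I K) \<le> 2 * total_norm \<gamma>" for I using le[of I K] t0 by linarith
      ultimately show ?thesis using t0 by (simp add: square_homotopy_def)
    qed
    then show ?thesis
      by (intro exI[of _ "\<lambda>I K. square_homotopy (\<lambda>I. \<gamma> I K) I"] conjI allI impI
          square_homotopy[OF adm c deg cocycle])
  next
    case d
    obtain p where p: "p \<in> {1..4}" "neg_set m \<subseteq> face p" "neg_set m = {} \<Longrightarrow> p = 1"
      using zero_weight_face[OF d] by blast
    have "norm (cone p (\<lambda>I. \<gamma> I K) I) \<le> 2 * total_norm \<gamma>" for I K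
      using le[of "insert p I" K] t0 by (auto simp: cone_def norm_mult pos_sign_def norm_power)
    then show ?thesis
      by (intro exI[of _ "\<lambda>I K. cone p (\<lambda>I. \<gamma> I K) I"] conjI allI impI
          cone_homotopy[OF adm d(1,2) p cocycle])
  qed
qed

section \<open>Laurent coefficients of cochains\<close>

lemma has_sum_sum:
  fixes f :: "'i \<Rightarrow> 'a \<Rightarrow> complex"
  assumes "finite A" "\<And>i. i \<in> A \<Longrightarrow> ((f i) has_sum s i) B"
  shows "((\<lambda>x. \<Sum>i\<in>A. f i x) has_sum (\<Sum>i\<in>A. s i)) B"
  using assms by (induction A rule: finite_induct) (auto intro: has_sum_add)

text \<open>No face contains both x and y or both u and v, so the nonvanishing conditions of a
  single chart already place the point in U.\<close>

lemma overlap_eq_nzdom: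
  assumes "I \<noteq> {}"
  shows "overlap I = nzdom (inverted I)"
proof -
  have "nzdom (inverted I) \<subseteq> UU"
  proof
    fix z assume z: "z \<in> nzdom (inverted I)"
    obtain j where j: "j \<in> I" using assms by blast
    have nz: "z $ i \<noteq> 0" if "i \<notin> face j" for i
      using z j that by (auto simp: nzdom_def in_inverted)
    have "(1 \<notin> face j \<or> 3 \<notin> face j) \<and> (2 \<notin> face j \<or> 4 \<notin> face j)"
      by (simp add: face_def)
    then show "z \<in> UU" using nz by (auto simp: UU_def)
  qed
  then show ?thesis
    unfolding overlap_def chart_def nzdom_def inverted_def by blast
qed

lemma overlap_subset_UU: "overlap I \<subseteq> UU"
  by (auto simp: overlap_def)

lemma nzdom_UNIV_in_overlap: "z \<in> nzdom UNIV \<Longrightarrow> I \<noteq> {} \<Longrightarrow> z \<in> overlap I"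
  using overlap_eq_nzdom nzdom_UNIV_subset by blast

lemma nzdom_UNIV_in_UU: "z \<in> nzdom UNIV \<Longrightarrow> z \<in> UU"
  using nzdom_UNIV_in_overlap[of z "{1}"] overlap_subset_UU by blast

lemma deck_in_nzdom: "deck \<mu> z \<in> nzdom S \<longleftrightarrow> z \<in> nzdom S"
  by (simp add: nzdom_def deck_def)

lemma deck_in_overlap: "I \<noteq> {} \<Longrightarrow> deck \<mu> z \<in> overlap I \<longleftrightarrow> z \<in> overlap I"
  by (simp add: overlap_eq_nzdom deck_in_nzdom)

lemma deck_in_UU: "deck \<mu> z \<in> UU \<longleftrightarrow> z \<in> UU"
  by (simp add: UU_def deck_def)

lemma q0_pow_powi: "(q0 ^ a * w) powi n = q0 powi (int a * n) * w powi n"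
  by (simp add: power_int_mult_distrib power_int_mult)

text \<open>The index \<open>k\<close> is free: the weight of coordinate k is split off in advance
  to cancel the division in component k of the pullback.\<close>

lemma monom_at_deck:
  "monom_at m (deck \<mu> z) = q0 powi (wt \<mu> k m) * q0 ^ (deck_weight \<mu> $ k) * monom_at m z"
proof -
  have "monom_at m (deck \<mu> z) = q0 powi (\<Sum>i\<in>UNIV. int (deck_weight \<mu> $ i) * m $ i) * monom_at m z"
    unfolding monom_at_4 sum_4 deck_def vec_lambda_beta q0_pow_powi by (simp add: power_int_add mult_ac)
  moreover have "(\<Sum>i\<in>UNIV. int (deck_weight \<mu> $ i) * m $ i) = wt \<mu> k m + int (deck_weight \<mu> $ k)"
    by (simp add: wt_def)
  ultimately show ?thesis by (simp add: power_int_add)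
qed

lemma pullback_has_sum:
  assumes V: "V \<in> Theta (nzdom S)" and z: "z \<in> nzdom S"
  shows "((\<lambda>m. q0 powi wt \<mu> k m * vcoef V k m * monom_at m z) has_sum pullback \<mu> V z $ k) UNIV"
proof -
  have "((\<lambda>m. vcoef V k m * monom_at m (deck \<mu> z)) has_sum V (deck \<mu> z) $ k) UNIV"
    by (rule vcoef_has_sum[OF V]) (simp add: deck_in_nzdom z)
  from has_sum_cmult_left[OF this, of "inverse (q0 ^ (deck_weight \<mu> $ k))"]
  show ?thesis
    unfolding monom_at_deck[where k = k]
    by (simp add: pullback_def inv_deck_def divide_inverse mult_ac)
qed

lemma vcoef_lincomb:
  assumes "V \<in> Theta (nzdom S)" "W \<in> Theta (nzdom S)"
  shows "vcoef (\<lambda>z. a *s V z + b *s W z) k m = a * vcoef V k m + b * vcoef W k m"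
proof -
  have "vcoef (\<lambda>z. a *s V z + b *s W z) k = (\<lambda>m. a * vcoef V k m + b * vcoef W k m)"
  proof (rule vcoef_unique[OF Theta_lincomb[OF assms]])
    fix z assume "z \<in> nzdom UNIV"
    then have z: "z \<in> nzdom S" by (rule nzdom_UNIV_subset)
    from has_sum_add[OF has_sum_cmult_right[OF vcoef_has_sum[OF assms(1) z, of k], of a]
        has_sum_cmult_right[OF vcoef_has_sum[OF assms(2) z, of k], of b]]
    show "((\<lambda>m. (a * vcoef V k m + b * vcoef W k m) * monom_at m z) has_sum (a *s V z + b *s W z) $ k) UNIV"
      by (simp add: algebra_simps)
  qed
  then show ?thesis by simp
qed

lemma zero_in_Theta: "0 \<in> Theta D"
  by (auto simp: Theta_def holomorphic_vf_def zero_fun_def intro!: exI[of _ "\<lambda>_. 0"])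

lemma vcoef_0 [simp]: "vcoef 0 k m = 0"
proof -
  have "vcoef 0 k = (\<lambda>m. 0)"
    by (rule vcoef_unique[where S = UNIV, OF zero_in_Theta]) simp
  then show ?thesis by simp
qed

section \<open>Coefficient families of cochains\<close>

definition ccoef :: "cochain \<Rightarrow> 4 \<Rightarrow> int ^ 4 \<Rightarrow> nat set \<Rightarrow> nat set \<Rightarrow> complex" where
  "ccoef c k m I K = vcoef (c I K) k m"

lemma cochains_Theta:
  assumes "c \<in> cochains" "index_pair I K"
  shows "c I K \<in> Theta (nzdom (inverted I))"
proof -
  have "c I K \<in> Theta (overlap I)" using assms unfolding cochains_def by auto
  moreover have "I \<noteq> {}" using assms(2) by (simp add: index_pair_def)
  ultimately show ?thesis using overlap_eq_nzdom[of I] by simp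
qed

lemma cochains_zero: "c \<in> cochains \<Longrightarrow> \<not> index_pair I K \<Longrightarrow> c I K = 0"
  unfolding cochains_def by auto

lemma adm_ccoef:
  assumes "c \<in> cochains"
  shows "adm m (ccoef c k m)"
  unfolding adm_def
proof (intro allI impI)
  fix I K assume nz: "ccoef c k m I K \<noteq> 0"
  have IK: "index_pair I K"
  proof (rule ccontr)
    assume "\<not> index_pair I K"
    then have "c I K = 0" by (rule cochains_zero[OF assms])
    with nz show False by (simp add: ccoef_def)
  qed
  moreover have "neg_set m \<subseteq> inverted I"
    using nz supported_vcoef[OF cochains_Theta[OF assms IK]] by (auto simp: ccoef_def supported_def)
  ultimately show "index_pair I K \<and> neg_set m \<subseteq> inverted I" by blast
qed

lemma inverted_mono: "I \<subseteq> J \<Longrightarrow> inverted I \<subseteq> inverted J"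
  by (auto simp: inverted_def)

text \<open>The coefficients found on a larger overlap also expand the restriction to a smaller one,
  so the faces occurring in the Cech differential can be compared at one point. The empty index set
  is included because that differential reaches it.\<close>

lemma ccoef_has_sum:
  assumes c: "c \<in> cochains" and "I \<subseteq> J" "index_pair J K" "z \<in> overlap J"
  shows "((\<lambda>m. ccoef c k m I K * monom_at m z) has_sum c I K z $ k) UNIV"
proof (cases "I = {}")
  case True
  then have "c I K = 0" using cochains_zero[OF c] by (simp add: index_pair_def)
  then show ?thesis by (simp add: ccoef_def)
next
  case False
  then have "index_pair I K" using assms by (auto simp: index_pair_def)
  moreover have "z \<in> nzdom (inverted I)"
    using assms(2,4) False nzdom_antimono[OF inverted_mono[OF assms(2)]] overlap_eq_nzdom[of J] by blast
  ultimately show ?thesis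
    unfolding ccoef_def by (intro vcoef_has_sum[OF cochains_Theta[OF c]])
qed

lemma d_tot_has_sum:
  assumes c: "c \<in> cochains" and IK: "index_pair I K" and z: "z \<in> overlap I"
  shows "((\<lambda>m. dmono k m (ccoef c k m) I K * monom_at m z) has_sum d_tot c I K z $ k) UNIV"
proof -
  have I: "finite I" "I \<noteq> {}" and K: "finite K" "K \<subseteq> {1, 2}"
    using IK finite_subset[of K "{1, 2}"] finite_index_pair[OF IK] by (auto simp: index_pair_def)
  have zn: "z \<in> nzdom (inverted I)" using z overlap_eq_nzdom[OF I(2)] by simp
  have 1: "((\<lambda>m. \<Sum>i\<in>I. pos_sign i I * (ccoef c k m (I - {i}) K * monom_at m z))
      has_sum (\<Sum>i\<in>I. pos_sign i I * (c (I - {i}) K z $ k))) UNIV"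
    by (intro has_sum_sum I has_sum_cmult_right ccoef_has_sum[OF c _ IK z]) auto
  have 2: "((\<lambda>m. \<Sum>\<mu>\<in>K. pos_sign \<mu> K * ((q0 powi wt \<mu> k m - 1) * ccoef c k m I (K - {\<mu>}) * monom_at m z))
      has_sum (\<Sum>\<mu>\<in>K. pos_sign \<mu> K * (pullback \<mu> (c I (K - {\<mu>})) z $ k - c I (K - {\<mu>}) z $ k))) UNIV"
  proof (intro has_sum_sum K has_sum_cmult_right)
    fix \<mu>
    have "index_pair I (K - {\<mu>})" using IK by (auto simp: index_pair_def)
    note T = cochains_Theta[OF c this]
    from has_sum_add[OF pullback_has_sum[OF T zn, of \<mu> k] has_sum_cmult_right[OF vcoef_has_sum[OF T zn, of k], of "-1"]]
    show "((\<lambda>m. (q0 powi wt \<mu> k m - 1) * ccoef c k m I (K - {\<mu>}) * monom_at m z)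
      has_sum pullback \<mu> (c I (K - {\<mu>})) z $ k - c I (K - {\<mu>}) z $ k) UNIV"
      by (simp add: ccoef_def algebra_simps)
  qed
  have "d_tot c I K z $ k = (\<Sum>i\<in>I. pos_sign i I * (c (I - {i}) K z $ k))
      + (-1) ^ (card I - 1) * (\<Sum>\<mu>\<in>K. pos_sign \<mu> K * (pullback \<mu> (c I (K - {\<mu>})) z $ k - c I (K - {\<mu>}) z $ k))"
    using IK z by (simp add: d_tot_def pos_sign_def right_diff_distrib)
  moreover have "dmono k m (ccoef c k m) I K * monom_at m z
    = (\<Sum>i\<in>I. pos_sign i I * (ccoef c k m (I - {i}) K * monom_at m z))
      + (-1) ^ (card I - 1) * (\<Sum>\<mu>\<in>K. pos_sign \<mu> K * ((q0 powi wt \<mu> k m - 1) * ccoef c k m I (K - {\<mu>}) * monom_at m z))"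
    for m by (simp add: dmono_def cech_def koszul_def distrib_right sum_distrib_right mult.assoc)
  ultimately show ?thesis
    using has_sum_add[OF 1 has_sum_cmult_right[OF 2, of "(-1) ^ (card I - 1)"]] by simp
qed

lemma dmono_ccoef_unique:
  assumes c: "c \<in> cochains" and e: "e \<in> cochains" and IK: "index_pair I K"
    and "\<And>z. z \<in> overlap I \<Longrightarrow> d_tot c I K z = e I K z"
  shows "dmono k m (ccoef c k m) I K = ccoef e k m I K"
proof -
  have "(\<lambda>m. dmono k m (ccoef c k m) I K) = (\<lambda>m. ccoef e k m I K)"
  proof (rule has_sum_coeffs_unique[where f = "\<lambda>z. e I K z $ k"])
    fix z assume "z \<in> nzdom UNIV"
    then have z: "z \<in> overlap I" using IK by (intro nzdom_UNIV_in_overlap) (auto simp: index_pair_def)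
    show "((\<lambda>m. dmono k m (ccoef c k m) I K * monom_at m z) has_sum e I K z $ k) UNIV"
      using d_tot_has_sum[OF c IK z, of k] assms(4)[OF z] by simp
    show "((\<lambda>m. ccoef e k m I K * monom_at m z) has_sum e I K z $ k) UNIV"
      by (rule ccoef_has_sum[OF e subset_refl IK z])
  qed
  from fun_cong[OF this, of m] show ?thesis .
qed

text \<open>On an overlap both sides are sums of the same Laurent series; everywhere else both are
  zero by the extension convention.\<close>

lemma d_tot_eqI:
  assumes c: "c \<in> cochains" and e: "e \<in> cochains"
    and eq: "\<And>I K k m. index_pair I K \<Longrightarrow> dmono k m (ccoef c k m) I K = ccoef e k m I K"
  shows "d_tot c = e"
proof (intro ext)
  fix I K z
  show "d_tot c I K z = e I K z"
  proof (cases "index_pair I K \<and> z \<in> overlap I")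
    case True
    then have IK: "index_pair I K" and z: "z \<in> overlap I" by auto
    have "d_tot c I K z $ k = e I K z $ k" for k
      using d_tot_has_sum[OF c IK z, of k] ccoef_has_sum[OF e subset_refl IK z, of k]
      unfolding eq[OF IK] by (rule has_sum_unique)
    then show ?thesis by (simp add: vec_eq_iff)
  next
    case False
    have "e I K z = 0"
    proof (cases "index_pair I K")
      case True
      then have "e I K \<in> Theta (overlap I)" using e unfolding cochains_def by auto
      then show ?thesis using True False by (simp add: Theta_def)
    next
      case False
      then show ?thesis by (simp add: cochains_zero[OF e])
    qed
    then show ?thesis using False by (auto simp: d_tot_def)
  qed
qed

lemma ccoef_lincomb:
  assumes "c \<in> cochains" "e \<in> cochains"
  shows "ccoef (cscale a c + cscale b e) k m I K = a * ccoef c k m I K + b * ccoef e k m I K"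
proof (cases "index_pair I K")
  case True
  from vcoef_lincomb[OF cochains_Theta[OF assms(1) True] cochains_Theta[OF assms(2) True], of a b k m]
  show ?thesis by (simp add: ccoef_def cscale_def plus_fun_def)
next
  case False
  then have "c I K = 0" "e I K = 0" using assms cochains_zero by blast+
  then have "(cscale a c + cscale b e) I K = 0" by (simp add: cscale_def plus_fun_def zero_fun_def)
  then show ?thesis using \<open>c I K = 0\<close> \<open>e I K = 0\<close> by (simp add: ccoef_def)
qed

lemma cochains_diff: "c \<in> cochains \<Longrightarrow> e \<in> cochains \<Longrightarrow> c - e \<in> cochains"
  and ccoef_diff: "c \<in> cochains \<Longrightarrow> e \<in> cochains \<Longrightarrow>
    ccoef (c - e) k m I K = ccoef c k m I K - ccoef e k m I K"
proof -
  assume ce: "c \<in> cochains" "e \<in> cochains"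
  have eq: "cscale 1 c + cscale (-1) e = c - e" by (simp add: cscale_simps)
  show "c - e \<in> cochains" using cochains_lincomb[OF ce, of 1 "-1"] unfolding eq .
  show "ccoef (c - e) k m I K = ccoef c k m I K - ccoef e k m I K"
    using ccoef_lincomb[OF ce, of 1 "-1" k m I K] unfolding eq by simp
qed

text \<open>Primitives at one monomial are bounded by all components of the cocycle at that
  monomial, hence the finite sum of families on the right.\<close>

lemma rapid_bounded:
  assumes A: "finite A" "\<And>i. i \<in> A \<Longrightarrow> rapid (a i)"
    and le: "\<And>m. norm (b m) \<le> 2 * (\<Sum>i\<in>A. norm (a i m))"
  shows "rapid b"
  unfolding rapid_def
proof (intro allI impI)
  fix \<rho> :: real assume \<rho>: "\<rho> \<ge> 1"
  have "\<forall>i\<in>A. \<exists>C. \<forall>m. norm (a i m) * \<rho> ^ deg1 m \<le> C" using A(2) \<rho> by (auto simp: rapid_def)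
  then obtain C where C: "\<And>i m. i \<in> A \<Longrightarrow> norm (a i m) * \<rho> ^ deg1 m \<le> C i" by metis
  have "norm (b m) * \<rho> ^ deg1 m \<le> 2 * (\<Sum>i\<in>A. C i)" for m
  proof -
    have "norm (b m) * \<rho> ^ deg1 m \<le> 2 * (\<Sum>i\<in>A. norm (a i m)) * \<rho> ^ deg1 m"
      using le[of m] \<rho> by (intro mult_right_mono) auto
    also have "\<dots> = 2 * (\<Sum>i\<in>A. norm (a i m) * \<rho> ^ deg1 m)" by (simp add: sum_distrib_right mult.assoc)
    also have "\<dots> \<le> 2 * (\<Sum>i\<in>A. C i)" by (intro mult_left_mono sum_mono C) auto
    finally show ?thesis .
  qed
  then show "\<exists>C. \<forall>m. norm (b m) * \<rho> ^ deg1 m \<le> C" by blast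
qed

lemma rapid_zero: "rapid (\<lambda>m. 0)"
  by (auto simp: rapid_def)

lemma rapid_ccoef:
  assumes "c \<in> cochains"
  shows "rapid (\<lambda>m. ccoef c k m I K)"
proof (cases "index_pair I K")
  case True
  from rapid_vcoef[OF cochains_Theta[OF assms True]] show ?thesis by (simp add: ccoef_def)
next
  case False
  then show ?thesis using rapid_zero by (simp add: ccoef_def cochains_zero[OF assms])
qed

text \<open>Primitives are chosen independently for each monomial. Since the bound does not depend
  on the monomial, any choice decays rapidly, and the resulting Laurent sums form a holomorphic
  cochain whose differential is checked on coefficients.\<close>

theorem cocycle_homotopy:
  assumes c: "c \<in> cochains" and d: "d_tot c = 0" and deg: "\<And>I K. c I K \<noteq> 0 \<Longrightarrow> card I \<le> 3"
    and h: "h \<in> cochains" "\<And>I K k m. index_pair I K \<Longrightarrow> ccoef h k m I K = harmonic k m (ccoef c k m) I K"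
  shows "\<exists>b\<in>cochains. d_tot b = c - h"
proof -
  define P where "P = (\<lambda>k m \<beta>. adm m \<beta> \<and> (\<forall>I K. norm (\<beta> I K) \<le> 2 * total_norm (ccoef c k m)) \<and>
    (\<forall>I K. index_pair I K \<longrightarrow> dmono k m \<beta> I K = ccoef c k m I K - harmonic k m (ccoef c k m) I K))"
  have ex: "\<exists>\<beta>. P k m \<beta>" for k m
    unfolding P_def
  proof (rule monomial_homotopy[OF adm_ccoef[OF c]])
    show "\<forall>I K. ccoef c k m I K \<noteq> 0 \<longrightarrow> card I \<le> 3"
      using deg by (auto simp: ccoef_def) (metis vcoef_0)
    show "\<forall>I K. index_pair I K \<longrightarrow> dmono k m (ccoef c k m) I K = 0"
      using dmono_ccoef_unique[OF c zero_in_cochains] d by (simp add: ccoef_def)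
  qed
  define \<beta> where "\<beta> = (\<lambda>k m. SOME \<beta>. P k m \<beta>)"
  have "P k m (\<beta> k m)" for k m unfolding \<beta>_def by (rule someI_ex[OF ex])
  then have \<beta>: "\<And>k m. adm m (\<beta> k m)" "\<And>k m I K. norm (\<beta> k m I K) \<le> 2 * total_norm (ccoef c k m)"
    "\<And>k m I K. index_pair I K \<Longrightarrow> dmono k m (\<beta> k m) I K = ccoef c k m I K - harmonic k m (ccoef c k m) I K"
    by (simp_all add: P_def)
  define b :: cochain where "b = (\<lambda>I K. if index_pair I K then
      (\<lambda>z. if z \<in> nzdom (inverted I) then \<chi> k. laurent_sum (\<lambda>m. \<beta> k m I K) z else 0) else 0)"
  have rap: "rapid (\<lambda>m. \<beta> k m I K)" for k I K
  proof (rule rapid_bounded)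
    show "finite (Pow {1..4 :: nat} \<times> Pow {1, 2 :: nat})" by simp
    show "rapid (\<lambda>m. ccoef c k m (fst i) (snd i))" for i by (rule rapid_ccoef[OF c])
    show "norm (\<beta> k m I K) \<le> 2 * (\<Sum>i\<in>Pow {1..4} \<times> Pow {1, 2}. norm (ccoef c k m (fst i) (snd i)))" for m
      using \<beta>(2)[of k m I K] by (simp add: total_norm_def sum.cartesian_product case_prod_unfold)
  qed
  have sup: "supported (inverted I) (\<lambda>m. \<beta> k m I K)" for k I K
    using \<beta>(1) by (auto simp: supported_def adm_def)
  have b: "b \<in> cochains"
    unfolding cochains_def
  proof (intro CollectI allI)
    fix I K
    show "if index_pair I K then b I K \<in> Theta (overlap I) else b I K = 0"
    proof (cases "index_pair I K")
      case True
      then have "overlap I = nzdom (inverted I)" by (intro overlap_eq_nzdom) (auto simp: index_pair_def)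
      then show ?thesis using True laurent_sum_in_Theta[OF rap sup] by (simp add: b_def)
    qed (simp add: b_def)
  qed
  have cb: "ccoef b k m = \<beta> k m" for k m
  proof (intro ext)
    fix I K
    show "ccoef b k m I K = \<beta> k m I K"
    proof (cases "index_pair I K")
      case True
      then show ?thesis
        using fun_cong[OF vcoef_laurent_sum[where S = "inverted I" and a = "\<lambda>k m. \<beta> k m I K" and k = k, OF rap sup], of m] by (simp add: ccoef_def b_def)
    next
      case False
      then show ?thesis using \<beta>(1)[of m k] by (auto simp: ccoef_def b_def adm_def)
    qed
  qed
  have "d_tot b = c - h"
  proof (rule d_tot_eqI[OF b cochains_diff[OF c h(1)]])
    fix I K k m assume IK: "index_pair I K"
    show "dmono k m (ccoef b k m) I K = ccoef (c - h) k m I K"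
      unfolding ccoef_diff[OF c h(1)] cb \<beta>(3)[OF IK] h(2)[OF IK] ..
  qed
  with b show ?thesis by blast
qed

section \<open>Global fields\<close>

lemma coeff_op_cong:
  assumes "\<And>z. z \<in> nzdom UNIV \<Longrightarrow> f z = g z" "z \<in> nzdom UNIV"
  shows "coeff_op f i n z = coeff_op g i n z"
proof -
  have "contour_integral (circlepath 0 1) (\<lambda>w. f (upd z i w) * w powi (- n - 1))
    = contour_integral (circlepath 0 1) (\<lambda>w. g (upd z i w) * w powi (- n - 1))"
  proof (rule contour_integral_cong)
    fix w :: complex assume "w \<in> path_image (circlepath 0 1)"
    then have "w \<noteq> 0" by auto
    then show "f (upd z i w) * w powi (- n - 1) = g (upd z i w) * w powi (- n - 1)"
      using assms upd_in_nzdom by metis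
  qed simp
  then show ?thesis by (simp add: coeff_op_def laurent_coeff_def)
qed

text \<open>Only values on the torus enter the contour integrals, so restricting a field, or
  extending it by zero elsewhere, does not change its coefficients.\<close>

lemma coef_cong:
  assumes "\<And>z. z \<in> nzdom UNIV \<Longrightarrow> f z = g z"
  shows "coef f = coef g"
proof
  fix m
  have "vec 1 \<in> nzdom UNIV" by (simp add: nzdom_def)
  then show "coef f m = coef g m"
    unfolding coef_def by (intro coeff_op_cong assms)
qed

lemma vcoef_cong: "(\<And>z. z \<in> nzdom UNIV \<Longrightarrow> V z = W z) \<Longrightarrow> vcoef V k = vcoef W k"
  unfolding vcoef_def by (rule coef_cong) simp

section \<open>The cover of U and fields on U\<close>

lemma UU_eq: "UU = nzdom {1, 2} \<union> nzdom {1, 4} \<union> nzdom {3, 2} \<union> nzdom {3, 4}"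
  by (auto simp: UU_def nzdom_def)

lemma open_UU: "open UU"
  unfolding UU_eq by (intro open_Un open_nzdom)

lemma open_overlap: "I \<noteq> {} \<Longrightarrow> open (overlap I)"
  by (simp add: overlap_eq_nzdom open_nzdom)

lemma inverted_singleton [simp]:
  "inverted {1} = {3, 4}" "inverted {2} = {2, 3}" "inverted {3} = {1, 4}" "inverted {4} = {1, 2}"
proof -
  have "i \<in> inverted {1} \<longleftrightarrow> i \<in> {3, 4}" "i \<in> inverted {2} \<longleftrightarrow> i \<in> {2, 3}"
    "i \<in> inverted {3} \<longleftrightarrow> i \<in> {1, 4}" "i \<in> inverted {4} \<longleftrightarrow> i \<in> {1, 2}" for i
    unfolding in_inverted using exhaust_4[of i] by (elim disjE; simp)+
  then show "inverted {1} = {3, 4}" "inverted {2} = {2, 3}" "inverted {3} = {1, 4}" "inverted {4} = {1, 2}"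
    by blast+
qed

lemma UU_covered:
  assumes "z \<in> UU"
  obtains j where "j \<in> {1..4 :: nat}" "z \<in> overlap {j}"
proof -
  have "z \<in> nzdom (inverted {4}) \<or> z \<in> nzdom (inverted {3}) \<or> z \<in> nzdom (inverted {2}) \<or> z \<in> nzdom (inverted {1})"
    using assms unfolding UU_eq inverted_singleton by (auto simp: insert_commute)
  then have "z \<in> overlap {4} \<or> z \<in> overlap {3} \<or> z \<in> overlap {2} \<or> z \<in> overlap {1}"
    by (simp add: overlap_eq_nzdom)
  then show ?thesis using that[of 1] that[of 2] that[of 3] that[of 4] by auto
qed

lemma restrict_in_Theta:
  assumes V: "V \<in> Theta D" and "open D'" "D' \<subseteq> D"
  shows "restrict_vf D' V \<in> Theta D'"
proof -
  have "\<exists>L. (restrict_vf D' V has_derivative L) (at z) \<and> (\<forall>c w. L (c *s w) = c *s L w)" if z: "z \<in> D'" for z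
  proof -
    obtain L where L: "(V has_derivative L) (at z)" "\<forall>c w. L (c *s w) = c *s L w"
      using V z assms(3) unfolding Theta_def holomorphic_vf_def by blast
    have "(restrict_vf D' V has_derivative L) (at z)"
      by (rule has_derivative_transform_within_open[OF L(1) assms(2) z]) (simp add: restrict_vf_def)
    with L(2) show ?thesis by blast
  qed
  then show ?thesis by (simp add: Theta_def holomorphic_vf_def restrict_vf_def)
qed

lemma vcoef_restrict_overlap:
  "I \<noteq> {} \<Longrightarrow> vcoef (restrict_vf (overlap I) V) k = vcoef V k"
  by (rule vcoef_cong) (simp add: restrict_vf_def nzdom_UNIV_in_overlap)

lemma Theta_UU_restrict:
  "V \<in> Theta UU \<Longrightarrow> I \<noteq> {} \<Longrightarrow> restrict_vf (overlap I) V \<in> Theta (nzdom (inverted I))"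
  using restrict_in_Theta[OF _ open_overlap overlap_subset_UU, of V I] overlap_eq_nzdom[of I] by simp

lemma Theta_UU_has_sum:
  assumes "V \<in> Theta UU" "z \<in> UU"
  shows "((\<lambda>m. vcoef V k m * monom_at m z) has_sum V z $ k) UNIV"
proof -
  obtain j :: nat where j: "z \<in> overlap {j}" using UU_covered[OF assms(2)] .
  have "((\<lambda>m. vcoef (restrict_vf (overlap {j}) V) k m * monom_at m z) has_sum restrict_vf (overlap {j}) V z $ k) UNIV"
    by (rule vcoef_has_sum[OF Theta_UU_restrict[OF assms(1)]]) (use j in \<open>simp_all add: overlap_eq_nzdom\<close>)
  then show ?thesis using j by (simp add: vcoef_restrict_overlap) (simp add: restrict_vf_def)
qed

lemma vcoef_unique_UU:
  assumes "V \<in> Theta UU" "\<And>z. z \<in> UU \<Longrightarrow> ((\<lambda>m. b m * monom_at m z) has_sum V z $ k) UNIV"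
  shows "vcoef V k = b"
  by (rule has_sum_coeffs_unique[of _ "\<lambda>z. V z $ k"])
     (use assms Theta_UU_has_sum nzdom_UNIV_in_UU in blast)+

text \<open>Charts 1 and 4 invert disjoint sets of coordinates, and a pole would have to be allowed
  on both, so there is none. Comparing coefficients of the field and its pullback then forces
  \<open>q0\<close> to the weight to be 1, hence weight zero.\<close>

lemma global_fields_vcoef:
  assumes V: "V \<in> global_fields" and nz: "vcoef V k m \<noteq> 0"
  shows "invariant_exp k m"
proof -
  have T: "V \<in> Theta UU" and inv: "pullback 1 V = V" "pullback 2 V = V"
    using V by (auto simp: global_fields_def)
  have "neg_set m \<subseteq> inverted {j}" for j
    using supported_vcoef[OF Theta_UU_restrict[OF T, of "{j}"], of k] nz
    by (simp add: vcoef_restrict_overlap supported_def)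
  from this[of 1] this[of 4] have "neg_set m \<subseteq> {3, 4}" "neg_set m \<subseteq> {1, 2}" by simp_all
  moreover have "{3, 4} \<inter> {1, 2} = ({} :: 4 set)" by auto
  ultimately have N: "neg_set m = {}" by blast
  have "wt \<mu> k m = 0" if "\<mu> \<in> {1, 2}" for \<mu>
  proof -
    define V' where "V' = restrict_vf (overlap {1}) V"
    have T': "V' \<in> Theta (nzdom {3, 4})"
      using Theta_UU_restrict[OF T, of "{1}"] by (simp add: V'_def)
    have "(\<lambda>m. q0 powi wt \<mu> k m * vcoef V' k m) = vcoef V' k"
    proof (rule has_sum_coeffs_unique[where f = "\<lambda>z. V z $ k"])
      fix z :: point assume z: "z \<in> nzdom UNIV"
      then have z': "z \<in> nzdom {3, 4}" and zo: "z \<in> overlap {1}"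
        using nzdom_UNIV_subset nzdom_UNIV_in_overlap[of z "{1}"] by auto
      have "deck \<mu> z \<in> overlap {1}" using zo by (simp add: deck_in_overlap)
      then have "pullback \<mu> V' z = pullback \<mu> V z" by (simp add: pullback_def V'_def restrict_vf_def)
      also have "\<dots> = V z" using inv that by auto
      finally show "((\<lambda>m. q0 powi wt \<mu> k m * vcoef V' k m * monom_at m z) has_sum V z $ k) UNIV"
        using pullback_has_sum[OF T' z', of \<mu> k] by simp
      show "((\<lambda>m. vcoef V' k m * monom_at m z) has_sum V z $ k) UNIV"
        using vcoef_has_sum[OF T' z', of k] zo by (simp add: V'_def restrict_vf_def)
    qed
    from fun_cong[OF this, of m] have "q0 powi wt \<mu> k m * vcoef V k m = vcoef V k m"
      by (simp add: V'_def vcoef_restrict_overlap)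
    then have "q0 powi wt \<mu> k m = 1" using nz by simp
    then show ?thesis using norm_q0_powi_minus_1_ge[of "wt \<mu> k m"] by force
  qed
  then show ?thesis using N by (simp add: invariant_exp_def)
qed

section \<open>Invariant monomials and the normal form\<close>

lemma vec4_eq_iff [simp]: "vec4 p = vec4 q \<longleftrightarrow> p = q"
  using bij_vec4 by (metis bij_pointE)

lemma vec4_eqI: "m $ 1 = a \<Longrightarrow> m $ 2 = b \<Longrightarrow> m $ 3 = c \<Longrightarrow> m $ 4 = d \<Longrightarrow> m = vec4 (a, b, c, d)"
  by (simp add: vec_eq_iff forall_4)

text \<open>The monomials x and y for d/dx and d/dy, u for d/du, and v, x^2 u, xyu, y^2 u for d/dv:
  nine monomial fields altogether, which is the dimension of the Lie algebra.\<close>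

definition inv_exps :: "4 \<Rightarrow> (int ^ 4) set" where
  "inv_exps k = (if k = 1 \<or> k = 3 then {vec4 (1, 0, 0, 0), vec4 (0, 0, 1, 0)}
     else if k = 2 then {vec4 (0, 1, 0, 0)}
     else {vec4 (0, 0, 0, 1), vec4 (2, 1, 0, 0), vec4 (1, 1, 1, 0), vec4 (0, 1, 2, 0)})"

lemma invariant_exp_in_inv_exps:
  assumes "invariant_exp k m"
  shows "m \<in> inv_exps k"
proof -
  have w: "m $ 1 + m $ 3 + 2 * m $ 4 = int (deck_weight 1 $ k)" "m $ 2 + m $ 4 = int (deck_weight 2 $ k)"
    using assms unfolding invariant_exp_def wt_1 wt_2 by simp_all
  have n0: "m $ i \<ge> 0" for i
  proof -
    have "i \<notin> neg_set m" using assms by (simp add: invariant_exp_def)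
    then show ?thesis by (simp add: neg_set_iff)
  qed
  have n: "m $ 1 \<ge> 0" "m $ 2 \<ge> 0" "m $ 3 \<ge> 0" "m $ 4 \<ge> 0" by (rule n0)+
  have "k = 1 \<or> k = 2 \<or> k = 3 \<or> k = 4" using exhaust_4[of k] by blast
  then show ?thesis
  proof (elim disjE)
    assume k: "k = 1"
    with w have w': "m $ 1 + m $ 3 + 2 * m $ 4 = 1" "m $ 2 + m $ 4 = 0" by simp_all
    then have "m $ 2 = 0 \<and> m $ 4 = 0 \<and> (m $ 1 = 1 \<and> m $ 3 = 0 \<or> m $ 1 = 0 \<and> m $ 3 = 1)" using n by presburger
    then show ?thesis by (auto simp: inv_exps_def k intro: vec4_eqI)
  next
    assume k: "k = 3"
    with w have w': "m $ 1 + m $ 3 + 2 * m $ 4 = 1" "m $ 2 + m $ 4 = 0" by simp_all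
    then have "m $ 2 = 0 \<and> m $ 4 = 0 \<and> (m $ 1 = 1 \<and> m $ 3 = 0 \<or> m $ 1 = 0 \<and> m $ 3 = 1)" using n by presburger
    then show ?thesis by (auto simp: inv_exps_def k intro: vec4_eqI)
  next
    assume k: "k = 2"
    with w have w': "m $ 1 + m $ 3 + 2 * m $ 4 = 0" "m $ 2 + m $ 4 = 1" by simp_all
    then have "m $ 2 = 1 \<and> m $ 4 = 0 \<and> m $ 1 = 0 \<and> m $ 3 = 0" using n by presburger
    then show ?thesis by (auto simp: inv_exps_def k intro: vec4_eqI)
  next
    assume k: "k = 4"
    with w have w': "m $ 1 + m $ 3 + 2 * m $ 4 = 2" "m $ 2 + m $ 4 = 1" by simp_all
    then have "m $ 4 = 1 \<and> m $ 1 = 0 \<and> m $ 2 = 0 \<and> m $ 3 = 0 \<or>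
      m $ 4 = 0 \<and> m $ 2 = 1 \<and> (m $ 1 = 2 \<and> m $ 3 = 0 \<or> m $ 1 = 1 \<and> m $ 3 = 1 \<or> m $ 1 = 0 \<and> m $ 3 = 2)"
      using n by presburger
    then show ?thesis by (auto simp: inv_exps_def k intro: vec4_eqI)
  qed
qed

text \<open>Reassembles a field from its coefficients at the nine invariant exponents.\<close>

definition normal_field_of :: "(4 \<Rightarrow> int ^ 4 \<Rightarrow> complex) \<Rightarrow> vfield" where
  "normal_field_of a = normal_field
     (vector [vector [a 1 (vec4 (1, 0, 0, 0)), a 1 (vec4 (0, 0, 1, 0))],
              vector [a 3 (vec4 (1, 0, 0, 0)), a 3 (vec4 (0, 0, 1, 0))]])
     (a 2 (vec4 (0, 1, 0, 0))) (a 4 (vec4 (0, 0, 0, 1)))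
     (vector [a 4 (vec4 (2, 1, 0, 0)), a 4 (vec4 (1, 1, 1, 0)), a 4 (vec4 (0, 1, 2, 0))])"

lemma normal_field_nth:
  assumes "z \<in> UU"
  shows "normal_field M b c p z $ 1 = M $ 1 $ 1 * z $ 1 + M $ 1 $ 2 * z $ 3"
    "normal_field M b c p z $ 2 = b * z $ 2"
    "normal_field M b c p z $ 3 = M $ 2 $ 1 * z $ 1 + M $ 2 $ 2 * z $ 3"
    "normal_field M b c p z $ 4 = c * z $ 4
       + (p $ 1 * z $ 1 ^ 2 + p $ 2 * z $ 1 * z $ 3 + p $ 3 * z $ 3 ^ 2) * z $ 2"
  using assms by (simp_all add: normal_field_def restrict_vf_def Let_def vector_4)

lemma normal_field_of_has_sum:
  assumes a: "\<And>k m. a k m \<noteq> 0 \<Longrightarrow> invariant_exp k m" and z: "z \<in> UU"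
  shows "((\<lambda>m. a k m * monom_at m z) has_sum normal_field_of a z $ k) UNIV"
proof (rule has_sum_finite_neutralI)
  show "finite (inv_exps k)" by (simp add: inv_exps_def)
  show "a k m * monom_at m z = 0" if "m \<in> UNIV - inv_exps k" for m
    using that a invariant_exp_in_inv_exps by fastforce
  have "k = 1 \<or> k = 2 \<or> k = 3 \<or> k = 4" using exhaust_4[of k] by blast
  then show "normal_field_of a z $ k = (\<Sum>m\<in>inv_exps k. a k m * monom_at m z)"
    by (elim disjE)
       (simp_all add: inv_exps_def normal_field_of_def normal_field_nth[OF z] monom_at_4 algebra_simps)
qed simp

lemma vector4_eq: "vector [a, b, c, d] = ((\<chi> k. if k = 1 then a else if k = 2 then b else if k = 3 then c else d) :: point)"
  by (simp add: vec_eq_iff forall_4 vector_4)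

lemma has_derivative_vector4:
  fixes f1 f2 f3 f4 :: "point \<Rightarrow> complex"
  assumes "(f1 has_derivative g1) (at z)" "(f2 has_derivative g2) (at z)"
    "(f3 has_derivative g3) (at z)" "(f4 has_derivative g4) (at z)"
  shows "((\<lambda>z. vector [f1 z, f2 z, f3 z, f4 z] :: point) has_derivative (\<lambda>h. vector [g1 h, g2 h, g3 h, g4 h])) (at z)"
  unfolding vector4_eq
proof (rule has_derivative_vec_lambda)
  fix k :: 4
  show "((\<lambda>z. if k = 1 then f1 z else if k = 2 then f2 z else if k = 3 then f3 z else f4 z) has_derivative
    (\<lambda>h. if k = 1 then g1 h else if k = 2 then g2 h else if k = 3 then g3 h else g4 h)) (at z)"
    using assms by (cases "k = 1"; cases "k = 2"; cases "k = 3") simp_all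
qed

lemma has_derivative_nth: "((\<lambda>z :: point. z $ i) has_derivative (\<lambda>h. h $ i)) (at z)"
  by (rule bounded_linear_imp_has_derivative[OF bounded_linear_vec_nth])

definition dnormal :: "complex ^ 2 ^ 2 \<Rightarrow> complex \<Rightarrow> complex \<Rightarrow> complex ^ 3 \<Rightarrow> point \<Rightarrow> point \<Rightarrow> point" where
  "dnormal M b c p z h = vector
     [M $ 1 $ 1 * h $ 1 + M $ 1 $ 2 * h $ 3, b * h $ 2, M $ 2 $ 1 * h $ 1 + M $ 2 $ 2 * h $ 3,
      c * h $ 4 + (p $ 1 * z $ 1 ^ 2 + p $ 2 * z $ 1 * z $ 3 + p $ 3 * z $ 3 ^ 2) * h $ 2
       + (p $ 1 * (2 * z $ 1 * h $ 1) + p $ 2 * (z $ 1 * h $ 3 + h $ 1 * z $ 3) + p $ 3 * (2 * z $ 3 * h $ 3)) * z $ 2]"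

lemma has_derivative_normal_field:
  assumes "z \<in> UU"
  shows "(normal_field M b c p has_derivative dnormal M b c p z) (at z)"
proof -
  have 1: "((\<lambda>z. A * z $ i + B * z $ j) has_derivative (\<lambda>h. A * h $ i + B * h $ j)) (at z)" for A B i j
    by (intro has_derivative_add has_derivative_mult_right has_derivative_nth)
  have 2: "((\<lambda>z. A * z $ i) has_derivative (\<lambda>h. A * h $ i)) (at z)" for A i
    by (intro has_derivative_mult_right has_derivative_nth)
  have 3: "((\<lambda>z. z $ i * z $ j) has_derivative (\<lambda>h. z $ i * h $ j + h $ i * z $ j)) (at z)" for i j
    by (intro has_derivative_mult has_derivative_nth)
  have 4: "((\<lambda>z. p $ 1 * (z $ 1 * z $ 1) + p $ 2 * (z $ 1 * z $ 3) + p $ 3 * (z $ 3 * z $ 3)) has_derivative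
    (\<lambda>h. p $ 1 * (z $ 1 * h $ 1 + h $ 1 * z $ 1) + p $ 2 * (z $ 1 * h $ 3 + h $ 1 * z $ 3)
      + p $ 3 * (z $ 3 * h $ 3 + h $ 3 * z $ 3))) (at z)"
    by (intro has_derivative_add has_derivative_mult_right 3)
  note 5 = has_derivative_add[OF 2[of c 4] has_derivative_mult[OF 4 has_derivative_nth[of 2]]]
  have "((\<lambda>z. vector [M $ 1 $ 1 * z $ 1 + M $ 1 $ 2 * z $ 3, b * z $ 2, M $ 2 $ 1 * z $ 1 + M $ 2 $ 2 * z $ 3,
      c * z $ 4 + (p $ 1 * (z $ 1 * z $ 1) + p $ 2 * (z $ 1 * z $ 3) + p $ 3 * (z $ 3 * z $ 3)) * z $ 2])
     has_derivative dnormal M b c p z) (at z)"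
    by (rule has_derivative_eq_rhs[OF has_derivative_vector4[OF 1 2 1 5]])
       (simp add: fun_eq_iff dnormal_def power2_eq_square algebra_simps)
  then show ?thesis
    by (rule has_derivative_transform_within_open[OF _ open_UU assms])
       (simp add: normal_field_def restrict_vf_def Let_def power2_eq_square mult.assoc)
qed

lemma dnormal_scale: "dnormal M b c p z (a *s h) = a *s dnormal M b c p z h"
  by (simp add: dnormal_def vec_eq_iff forall_4 vector_4 algebra_simps)

lemma normal_field_in_Theta: "normal_field M b c p \<in> Theta UU"
proof -
  have "holomorphic_vf UU (normal_field M b c p)"
    unfolding holomorphic_vf_def using has_derivative_normal_field dnormal_scale by blast
  then show ?thesis by (simp add: Theta_def normal_field_def restrict_vf_def)
qed

lemma normal_field_global: "normal_field M b c p \<in> global_fields"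
proof -
  have "pullback \<mu> (normal_field M b c p) z = normal_field M b c p z" if \<mu>: "\<mu> \<in> {1, 2}" for \<mu> z
  proof (cases "z \<in> UU")
    case True
    then have d: "deck 1 z \<in> UU" "deck 2 z \<in> UU" by (simp_all add: deck_in_UU)
    have nth: "deck \<mu> z $ i = q0 ^ (deck_weight \<mu> $ i) * z $ i" for \<mu> i by (simp add: deck_def)
    have "pullback \<mu> (normal_field M b c p) z $ k = normal_field M b c p z $ k" for k
    proof -
      have k: "k = 1 \<or> k = 2 \<or> k = 3 \<or> k = 4" using exhaust_4[of k] by blast
      have "\<mu> = 1 \<or> \<mu> = 2" using \<mu> by blast
      then show ?thesis
        using k unfolding pullback_def inv_deck_def vec_lambda_beta
        by (elim disjE)
           (simp_all add: normal_field_nth[OF d(1)] normal_field_nth[OF d(2)] normal_field_nth[OF True] nth field_simps power2_eq_square)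
    qed
    then show ?thesis by (simp add: vec_eq_iff)
  next
    case False
    then show ?thesis
      by (simp add: pullback_def inv_deck_def normal_field_def restrict_vf_def deck_in_UU vec_eq_iff)
  qed
  then show ?thesis using normal_field_in_Theta by (auto simp: global_fields_def)
qed

lemma normal_field_of_global: "normal_field_of a \<in> global_fields"
  by (simp add: normal_field_of_def normal_field_global)

lemma vcoef_normal_field_of:
  "(\<And>k m. a k m \<noteq> 0 \<Longrightarrow> invariant_exp k m) \<Longrightarrow> vcoef (normal_field_of a) k = a k"
  by (rule vcoef_unique_UU[OF _ normal_field_of_has_sum]) (simp_all add: normal_field_of_def normal_field_in_Theta)

lemma Theta_UU_eqI:
  assumes "V \<in> Theta UU" "W \<in> Theta UU" "\<And>k m. vcoef V k m = vcoef W k m"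
  shows "V = W"
proof
  fix z
  show "V z = W z"
  proof (cases "z \<in> UU")
    case True
    have "V z $ k = W z $ k" for k
      using Theta_UU_has_sum[OF assms(1) True, of k] Theta_UU_has_sum[OF assms(2) True, of k]
      unfolding assms(3) by (rule has_sum_unique)
    then show ?thesis by (simp add: vec_eq_iff)
  qed (use assms in \<open>simp add: Theta_def\<close>)
qed

lemma global_fields_Theta: "V \<in> global_fields \<Longrightarrow> V \<in> Theta UU"
  by (simp add: global_fields_def)

text \<open>The given field and the one rebuilt from its coefficients have equal Laurent expansions
  on the charts, which cover U.\<close>

theorem global_field_normal_form:
  assumes "V \<in> global_fields"
  obtains M b c p where "V = normal_field M b c p"
proof -
  have "V = normal_field_of (vcoef V)"
  proof (rule Theta_UU_eqI[OF global_fields_Theta[OF assms] global_fields_Theta[OF normal_field_of_global]])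
    show "vcoef V k m = vcoef (normal_field_of (vcoef V)) k m" for k m
      using fun_cong[OF vcoef_normal_field_of[of "vcoef V" k], of m] global_fields_vcoef[OF assms] by simp
  qed
  then show ?thesis unfolding normal_field_of_def by (rule that)
qed

lemma normal_field_eq_iff:
  "normal_field M b c p = normal_field M' b' c' p' \<longleftrightarrow> M = M' \<and> b = b' \<and> c = c' \<and> p = p'"
proof
  assume eq: "normal_field M b c p = normal_field M' b' c' p'"
  define P :: "complex \<Rightarrow> complex \<Rightarrow> complex \<Rightarrow> complex \<Rightarrow> point" where "P = (\<lambda>a b c d. vector [a, b, c, d])"
  have P: "P a b c d $ 1 = a" "P a b c d $ 2 = b" "P a b c d $ 3 = c" "P a b c d $ 4 = d" for a b c d
    by (simp_all add: P_def vector_4)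
  \<comment> \<open>Coordinates are ordered (x, u, y, v). The first point gives the first column of
    M, b and p_1, the second gives the second column and c, the third gives p_3, and the last gives
    the sum of the p_i and with it p_2.\<close>
  have U: "P 1 1 0 0 \<in> UU" "P 0 0 1 1 \<in> UU" "P 0 1 1 0 \<in> UU" "P 1 1 1 0 \<in> UU" by (simp_all add: UU_def P)
  note n = normal_field_nth[OF U(1)] normal_field_nth[OF U(2)] normal_field_nth[OF U(3)] normal_field_nth[OF U(4)]
  have e: "normal_field M b c p z $ k = normal_field M' b' c' p' z $ k" for z k by (simp add: eq)
  have M: "M $ 1 $ 1 = M' $ 1 $ 1" "M $ 2 $ 1 = M' $ 2 $ 1" "M $ 1 $ 2 = M' $ 1 $ 2" "M $ 2 $ 2 = M' $ 2 $ 2"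
    using e[of "P 1 1 0 0" 1] e[of "P 1 1 0 0" 3] e[of "P 0 0 1 1" 1] e[of "P 0 0 1 1" 3]
    unfolding n by (simp_all add: P)
  have bc: "b = b'" "c = c'"
    using e[of "P 1 1 0 0" 2] e[of "P 0 0 1 1" 4] unfolding n by (simp_all add: P)
  have p: "p $ 1 = p' $ 1" "p $ 3 = p' $ 3"
    using e[of "P 1 1 0 0" 4] e[of "P 0 1 1 0" 4] unfolding n by (simp_all add: P)
  then have "p $ 2 = p' $ 2"
    using e[of "P 1 1 1 0" 4] unfolding n by (simp add: P)
  with M bc p show "M = M' \<and> b = b' \<and> c = c' \<and> p = p'"
    by (simp add: vec_eq_iff forall_2 forall_3)
qed simp

lemma ell_normal_field: "ell (normal_field M b c p) = - trace M - b + c"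
  unfolding ell_def by (rule the_equality) (auto simp: normal_field_eq_iff)

section \<open>The field W and its derivative\<close>

definition dWW :: "point \<Rightarrow> point \<Rightarrow> point" where
  "dWW z h = vector [0, h $ 4 / (z $ 1 * z $ 3) - z $ 4 * h $ 1 / (z $ 1 ^ 2 * z $ 3)
     - z $ 4 * h $ 3 / (z $ 1 * z $ 3 ^ 2), 0, 0]"

lemma has_derivative_WW:
  assumes "z $ 1 \<noteq> 0" "z $ 3 \<noteq> 0"
  shows "(WW has_derivative dWW z) (at z)"
proof -
  have nz: "z $ 1 * z $ 3 \<noteq> 0" using assms by simp
  have "((\<lambda>z :: point. z $ 4 / (z $ 1 * z $ 3)) has_derivative
    (\<lambda>h. (h $ 4 * (z $ 1 * z $ 3) - z $ 4 * (z $ 1 * h $ 3 + h $ 1 * z $ 3)) / (z $ 1 * z $ 3 * (z $ 1 * z $ 3)))) (at z)"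
    by (intro has_derivative_divide' has_derivative_mult has_derivative_nth nz)
  from has_derivative_vector4[OF has_derivative_const this has_derivative_const has_derivative_const, of 0 0 0]
  have "(WW has_derivative (\<lambda>h. vector [0,
     (h $ 4 * (z $ 1 * z $ 3) - z $ 4 * (z $ 1 * h $ 3 + h $ 1 * z $ 3)) / (z $ 1 * z $ 3 * (z $ 1 * z $ 3)), 0, 0])) (at z)"
    unfolding WW_def[abs_def] .
  moreover have "(h $ 4 * (z $ 1 * z $ 3) - z $ 4 * (z $ 1 * h $ 3 + h $ 1 * z $ 3)) / (z $ 1 * z $ 3 * (z $ 1 * z $ 3))
    = h $ 4 / (z $ 1 * z $ 3) - z $ 4 * h $ 1 / (z $ 1 ^ 2 * z $ 3) - z $ 4 * h $ 3 / (z $ 1 * z $ 3 ^ 2)" for h :: point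
    using assms by (simp add: field_simps power2_eq_square)
  ultimately show ?thesis unfolding dWW_def[abs_def] by simp
qed

lemma dWW_scale: "dWW z (a *s h) = a *s dWW z h"
  by (simp add: dWW_def vec_eq_iff forall_4 vector_4 algebra_simps)

lemma WW_in_Theta:
  assumes "{1, 3} \<subseteq> inverted I" "I \<noteq> {}"
  shows "restrict_vf (overlap I) (\<lambda>z. a *s WW z) \<in> Theta (overlap I)"
proof -
  have "\<exists>L. (restrict_vf (overlap I) (\<lambda>z. a *s WW z) has_derivative L) (at z) \<and> (\<forall>c w. L (c *s w) = c *s L w)"
    if z: "z \<in> overlap I" for z
  proof -
    have "z $ 1 \<noteq> 0" "z $ 3 \<noteq> 0"
      using z assms by (auto simp: overlap_eq_nzdom nzdom_def)
    from bounded_linear.has_derivative[OF bounded_linear_vec_scale has_derivative_WW[OF this]]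
    have "(restrict_vf (overlap I) (\<lambda>z. a *s WW z) has_derivative (\<lambda>h. a *s dWW z h)) (at z)"
      by (rule has_derivative_transform_within_open[OF _ open_overlap[OF assms(2)] z]) (simp add: restrict_vf_def)
    moreover have "a *s dWW z (c *s w) = c *s (a *s dWW z w)" for c w
      by (simp add: dWW_scale vec_eq_iff mult_ac)
    ultimately show ?thesis by blast
  qed
  then show ?thesis by (simp add: Theta_def holomorphic_vf_def restrict_vf_def)
qed

lemma monom_at_eta_exp: "monom_at eta_exp z = WW z $ 2"
  by (simp add: monom_at_4 eta_exp_def WW_def vector_4 power_int_minus divide_inverse)

section \<open>Cohomology in degrees one and two\<close>

text \<open>All representatives have this shape: one field on every chart plus a multiple of the
  cocycle of eta, for each set of deck generators. Treating all degrees at once lets injectivity and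
  surjectivity be proved only once.\<close>

definition harm :: "(nat set \<Rightarrow> vfield) \<Rightarrow> (nat set \<Rightarrow> complex) \<Rightarrow> cochain" where
  "harm A t = (\<lambda>I K.
     if index_pair I K \<and> card I = 1 then restrict_vf (overlap I) (A K)
     else if index_pair I K \<and> card I = 2 then restrict_vf (overlap I) (\<lambda>z. (t K * eta_coeff I) *s WW z)
     else 0)"

text \<open>Charts 1 and 2 invert y, charts 3 and 4 invert x. A pair taken from both groups inverts
  both; within one group the chart scalars agree and the coefficient of W is zero.\<close>

lemma eta_coeff_or_inverted:
  assumes "index_pair I K" "card I = 2"
  shows "eta_coeff I = 0 \<or> {1, 3} \<subseteq> inverted I"
proof -
  have "I \<subseteq> {1..4}" "I \<noteq> {}" using assms(1) by (simp_all add: index_pair_def)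
  from subset_1234_cases[OF this] show ?thesis
  proof (elim disjE)
    assume "I \<in> {{1}, {2}, {3}, {4}}"
    with assms(2) show ?thesis by auto
  next
    assume "I \<in> {{1, 2}, {1, 3}, {1, 4}, {2, 3}, {2, 4}, {3, 4}}"
    then show ?thesis
      unfolding insert_iff empty_iff by (elim disjE FalseE) (simp_all add: eta_coeff_simps in_inverted)
  next
    assume "I \<in> {{1, 2, 3}, {1, 2, 4}, {1, 3, 4}, {2, 3, 4}}"
    with assms(2) show ?thesis by auto
  next
    assume "I = {1, 2, 3, 4}"
    with assms(2) show ?thesis by simp
  qed
qed

lemma WW_in_Theta_pair:
  assumes "index_pair I K" "card I = 2"
  shows "restrict_vf (overlap I) (\<lambda>z. (t * eta_coeff I) *s WW z) \<in> Theta (overlap I)"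
proof -
  have "I \<noteq> {}" using assms(1) by (simp add: index_pair_def)
  show ?thesis
  proof (cases "eta_coeff I = 0")
    case True
    then have "restrict_vf (overlap I) (\<lambda>z. (t * eta_coeff I) *s WW z) = 0"
      by (simp add: restrict_vf_def fun_eq_iff)
    then show ?thesis by (simp add: zero_in_Theta)
  next
    case False
    then show ?thesis using eta_coeff_or_inverted[OF assms] by (intro WW_in_Theta \<open>I \<noteq> {}\<close>) blast
  qed
qed

lemma harm_cochains:
  assumes "\<And>K. A K \<in> Theta UU"
  shows "harm A t \<in> cochains"
  unfolding cochains_def
proof (intro CollectI allI)
  fix I K
  show "if index_pair I K then harm A t I K \<in> Theta (overlap I) else harm A t I K = 0"
  proof (cases "index_pair I K")
    case True
    then have "I \<noteq> {}" by (simp add: index_pair_def)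
    consider "card I = 1" | "card I = 2" | "card I \<noteq> 1" "card I \<noteq> 2" by blast
    then show ?thesis
    proof cases
      case 1
      then show ?thesis
        using restrict_in_Theta[OF assms open_overlap[OF \<open>I \<noteq> {}\<close>] overlap_subset_UU] True by (simp add: harm_def)
    next
      case 2
      then show ?thesis using WW_in_Theta_pair[OF True] True by (simp add: harm_def)
    next
      case 3
      then show ?thesis using True by (simp add: harm_def zero_in_Theta)
    qed
  qed (simp add: harm_def)
qed

lemma WW_nth: "k \<noteq> 2 \<Longrightarrow> WW z $ k = 0"
  using exhaust_4[of k] by (auto simp: WW_def vector_4)

lemma ccoef_harm:
  assumes IK: "index_pair I K"
  shows "ccoef (harm A t) k m I K =
    (if card I = 1 then vcoef (A K) k m else if card I = 2 \<and> k = 2 \<and> m = eta_exp then t K * eta_coeff I else 0)"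
proof -
  have I: "I \<noteq> {}" using IK by (simp add: index_pair_def)
  consider "card I = 1" | "card I = 2" | "card I \<noteq> 1" "card I \<noteq> 2" by blast
  then show ?thesis
  proof cases
    case 1
    then show ?thesis using IK by (simp add: ccoef_def harm_def vcoef_restrict_overlap[OF I])
  next
    case 2
    let ?a = "t K * eta_coeff I"
    have "vcoef (restrict_vf (overlap I) (\<lambda>z. ?a *s WW z)) k = (\<lambda>m. if k = 2 \<and> m = eta_exp then ?a else 0)"
    proof (rule vcoef_unique)
      show "restrict_vf (overlap I) (\<lambda>z. ?a *s WW z) \<in> Theta (nzdom (inverted I))"
        using WW_in_Theta_pair[OF IK 2] overlap_eq_nzdom[OF I] by simp
      fix z assume "z \<in> nzdom UNIV"
      then have z: "z \<in> overlap I" using I by (rule nzdom_UNIV_in_overlap)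
      show "((\<lambda>m. (if k = 2 \<and> m = eta_exp then ?a else 0) * monom_at m z)
        has_sum restrict_vf (overlap I) (\<lambda>z. ?a *s WW z) z $ k) UNIV"
        by (rule has_sum_finite_neutralI[of "{eta_exp}"])
           (use z in \<open>auto simp: restrict_vf_def monom_at_eta_exp WW_nth\<close>)
    qed
    from fun_cong[OF this, of m] show ?thesis using IK 2 by (simp add: ccoef_def harm_def)
  next
    case 3
    then show ?thesis by (simp add: ccoef_def harm_def)
  qed
qed

text \<open>Only monomials of weight zero occur, so the Koszul part vanishes. The Cech part vanishes
  because the field is the same on all charts and the coefficients of W are differences of chart
  scalars.\<close>

lemma dmono_harm:
  assumes A: "\<And>K. A K \<in> global_fields" and IK: "index_pair I K"
  shows "dmono k m (ccoef (harm A t) k m) I K = 0"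
proof -
  define \<gamma> where "\<gamma> = ccoef (harm A t) k m"
  have H: "harm A t \<in> cochains" by (rule harm_cochains) (rule global_fields_Theta[OF A])
  have \<gamma>0: "\<gamma> I K = 0" if "\<not> index_pair I K" for I K
    using cochains_zero[OF H that] by (simp add: \<gamma>_def ccoef_def)
  have \<gamma>: "\<gamma> I K = (if card I = 1 then vcoef (A K) k m else if card I = 2 \<and> k = 2 \<and> m = eta_exp then t K * eta_coeff I else 0)"
    if "index_pair I K" for I K unfolding \<gamma>_def by (rule ccoef_harm[OF that])
  have K: "K \<subseteq> {1, 2}" using IK by (simp add: index_pair_def)
  show ?thesis
  proof (cases "wt 1 k m = 0 \<and> wt 2 k m = 0")
    case False
    have z: "vcoef (A K) k m = 0" for K
    proof (rule ccontr)
      assume "vcoef (A K) k m \<noteq> 0"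
      then have "invariant_exp k m" by (rule global_fields_vcoef[OF A])
      with False show False by (simp add: invariant_exp_def)
    qed
    moreover have "\<not> (k = 2 \<and> m = eta_exp)" using False zero_weight_eta by blast
    ultimately have "\<gamma> I K = 0" for I K using \<gamma>0[of I K] \<gamma>[of I K] by (cases "index_pair I K") auto
    then show ?thesis unfolding \<gamma>_def[symmetric] by (simp add: dmono_def cech_def koszul_def)
  next
    case True
    then have wt: "wt 1 k m = 0" "wt 2 k m = 0" by auto
    define \<delta> where "\<delta> = (\<lambda>I. \<gamma> I K)"
    define v where "v = vcoef (A K) k m"
    define e where "e = (if k = 2 \<and> m = eta_exp then t K else 0)"
    have d0: "\<delta> {} = 0" using \<gamma>0[of "{}" K] by (simp add: \<delta>_def index_pair_def)
    have d1: "\<delta> {1} = v" "\<delta> {2} = v" "\<delta> {3} = v" "\<delta> {4} = v"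
      unfolding \<delta>_def using K by (subst \<gamma>, simp_all add: index_pair_def v_def)+
    have d2: "\<delta> {1, 2} = e * eta_coeff {1, 2}" "\<delta> {1, 3} = e * eta_coeff {1, 3}" "\<delta> {1, 4} = e * eta_coeff {1, 4}"
      "\<delta> {2, 3} = e * eta_coeff {2, 3}" "\<delta> {2, 4} = e * eta_coeff {2, 4}" "\<delta> {3, 4} = e * eta_coeff {3, 4}"
      unfolding \<delta>_def using K by (subst \<gamma>, simp_all add: index_pair_def e_def)+
    have d3: "\<delta> {1, 2, 3} = 0" "\<delta> {1, 2, 4} = 0" "\<delta> {1, 3, 4} = 0" "\<delta> {2, 3, 4} = 0"
      unfolding \<delta>_def using K by (subst \<gamma>, simp_all add: index_pair_def)+
    have "I \<subseteq> {1..4}" "I \<noteq> {}" using IK by (simp_all add: index_pair_def)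
    from subset_1234_cases[OF this] have "cech \<delta> I = 0"
    proof (elim disjE)
      assume "I \<in> {{1}, {2}, {3}, {4}}"
      then show ?thesis unfolding insert_iff empty_iff by (elim disjE FalseE) (simp_all add: cech_def d0)
    next
      assume "I \<in> {{1, 2}, {1, 3}, {1, 4}, {2, 3}, {2, 4}, {3, 4}}"
      then show ?thesis unfolding insert_iff empty_iff by (elim disjE FalseE) (simp_all add: cech_pair d1)
    next
      assume "I \<in> {{1, 2, 3}, {1, 2, 4}, {1, 3, 4}, {2, 3, 4}}"
      then show ?thesis unfolding insert_iff empty_iff
        by (elim disjE FalseE) (simp_all add: cech_triple d2 eta_coeff_simps)
    next
      assume "I = {1, 2, 3, 4}"
      then show ?thesis by (simp add: cech_quadruple d3)
    qed
    then show ?thesis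
      unfolding \<gamma>_def[symmetric] by (simp add: dmono_def koszul_zero[OF wt K] \<delta>_def)
  qed
qed

lemma d_tot_harm:
  assumes "\<And>K. A K \<in> global_fields"
  shows "d_tot (harm A t) = 0"
proof (rule d_tot_eqI[OF harm_cochains zero_in_cochains])
  show "A K \<in> Theta UU" for K by (rule global_fields_Theta[OF assms])
  show "dmono k m (ccoef (harm A t) k m) I K = ccoef 0 k m I K" if "index_pair I K" for I K k m
    using dmono_harm[OF assms that] by (simp add: ccoef_def)
qed

text \<open>At an invariant monomial a coboundary has zero component on chart 1: the weights kill
  the Koszul part and there is no Cech face below. At the monomial of W its component on charts 1
  and 3 is zero, because no single chart admits the pole. These are exactly the entries that
  determine the data of \<open>harm\<close>.\<close>

lemma harm_injective:
  assumes A: "\<And>K. A K \<in> global_fields" and A': "\<And>K. A' K \<in> global_fields"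
    and cob: "harm A t - harm A' t' \<in> coboundaries" and K: "K \<subseteq> {1, 2}"
  shows "A K = A' K" "t K = t' K"
proof -
  have H: "harm A t \<in> cochains" "harm A' t' \<in> cochains"
    by (rule harm_cochains, rule global_fields_Theta, rule A A')+
  obtain b where b: "b \<in> cochains" "d_tot b = harm A t - harm A' t'"
    using cob by (auto simp: coboundaries_def)
  have eq: "dmono k m (ccoef b k m) I K = ccoef (harm A t) k m I K - ccoef (harm A' t') k m I K"
    if "index_pair I K" for k m I
    unfolding ccoef_diff[OF H, symmetric]
    by (rule dmono_ccoef_unique[OF b(1) cochains_diff[OF H] that]) (simp add: b(2))
  have i1: "index_pair {1} K" and i13: "index_pair {1, 3} K" using K by (simp_all add: index_pair_def)
  show "A K = A' K"
  proof (rule Theta_UU_eqI[OF global_fields_Theta[OF A] global_fields_Theta[OF A']])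
    fix k m
    show "vcoef (A K) k m = vcoef (A' K) k m"
    proof (cases "invariant_exp k m")
      case True
      then have wt: "wt 1 k m = 0" "wt 2 k m = 0" by (auto simp: invariant_exp_def)
      have "dmono k m (ccoef b k m) {1} K = 0"
        using adm_empty[OF adm_ccoef[OF b(1)]]
        by (simp add: dmono_def koszul_zero[OF wt K] cech_def)
      then show ?thesis using eq[OF i1, of k m] by (simp add: ccoef_harm[OF i1])
    next
      case False
      then show ?thesis using global_fields_vcoef[OF A] global_fields_vcoef[OF A'] by metis
    qed
  qed
  have "ccoef b 2 eta_exp {j} K = 0" for j
  proof (rule ccontr)
    assume "ccoef b 2 eta_exp {j} K \<noteq> 0"
    then have "neg_set eta_exp \<subseteq> inverted {j}"
      using adm_ccoef[OF b(1), of eta_exp 2] unfolding adm_def by blast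
    then have "{1, 3} \<subseteq> inverted {j}" unfolding neg_set_eta_exp .
    then show False unfolding inverted_def by (auto simp: face_def split: if_splits)
  qed
  then have "dmono 2 eta_exp (ccoef b 2 eta_exp) {1, 3} K = 0"
    by (simp add: dmono_def koszul_zero[OF zero_weight_eta K] cech_pair)
  then show "t K = t' K" using eq[OF i13, of 2 eta_exp] by (simp add: ccoef_harm[OF i13] eta_coeff_simps)
qed

lemma normal_field_of_zero: "normal_field_of (\<lambda>k m. 0) = 0"
  by (rule Theta_UU_eqI[OF global_fields_Theta[OF normal_field_of_global] zero_in_Theta])
     (simp add: vcoef_normal_field_of)

lemma zero_global: "0 \<in> global_fields"
  using normal_field_of_global[of "\<lambda>k m. 0"] by (simp add: normal_field_of_zero)

text \<open>The last two conclusions carry the degree along: whatever is missing from the cocycle on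
  chart 1, or on charts 1 and 3, is also missing from its representative.\<close>

lemma harm_surjective:
  assumes c: "c \<in> cochains" "d_tot c = 0" "\<And>I K. c I K \<noteq> 0 \<Longrightarrow> card I \<le> 3"
  obtains A t where "\<And>K. A K \<in> global_fields" "c - harm A t \<in> coboundaries"
    "\<And>K. c {1} K = 0 \<Longrightarrow> A K = 0" "\<And>K. c {1, 3} K = 0 \<Longrightarrow> t K = 0"
proof
  \<comment> \<open>Exactly the entries selected by \<open>harmonic\<close> are kept.\<close>
  define a where "a = (\<lambda>K k m. if invariant_exp k m then ccoef c k m {1} K else 0)"
  define A where "A = (\<lambda>K. normal_field_of (a K))"
  define t where "t = (\<lambda>K. ccoef c 2 eta_exp {1, 3} K)"
  show G: "A K \<in> global_fields" for K by (simp add: A_def normal_field_of_global)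
  have "\<exists>b\<in>cochains. d_tot b = c - harm A t"
  proof (rule cocycle_homotopy[OF c])
    show "harm A t \<in> cochains" by (rule harm_cochains) (rule global_fields_Theta[OF G])
    fix I K k m assume IK: "index_pair I K"
    have "vcoef (A K) k m = a K k m"
      unfolding A_def by (subst vcoef_normal_field_of) (simp_all add: a_def split: if_splits)
    then show "ccoef (harm A t) k m I K = harmonic k m (ccoef c k m) I K"
      unfolding ccoef_harm[OF IK] by (auto simp: harmonic_def a_def t_def)
  qed
  then show "c - harm A t \<in> coboundaries" unfolding coboundaries_def by (auto intro: sym)
  show "A K = 0" if "c {1} K = 0" for K
  proof -
    have "ccoef c k m {1} K = 0" for k m by (simp add: ccoef_def that)
    then have "a K = (\<lambda>k m. 0)" by (intro ext) (simp add: a_def)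
    then show ?thesis by (simp add: A_def normal_field_of_zero)
  qed
  show "t K = 0" if "c {1, 3} K = 0" for K using that by (simp add: t_def ccoef_def)
qed

section \<open>Representatives in degrees one and two\<close>

lemma harm_cong:
  assumes "\<And>K. K \<subseteq> {1, 2} \<Longrightarrow> A K = A' K" "\<And>K. K \<subseteq> {1, 2} \<Longrightarrow> t K = t' K"
  shows "harm A t = harm A' t'"
proof (intro ext)
  fix I K z
  show "harm A t I K z = harm A' t' I K z"
  proof (cases "index_pair I K")
    case True
    then have "K \<subseteq> {1, 2}" by (simp add: index_pair_def)
    then show ?thesis by (simp only: harm_def assms)
  qed (simp add: harm_def)
qed

lemma harm_add: "harm A t + harm A' t' = harm (\<lambda>K. A K + A' K) (\<lambda>K. t K + t' K)"
  by (intro ext) (simp add: harm_def restrict_vf_def distrib_right vector_sadd_rdistrib)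

lemma harm_scale: "cscale a (harm A t) = harm (\<lambda>K z. a *s A K z) (\<lambda>K. a * t K)"
  by (intro ext) (simp add: harm_def restrict_vf_def cscale_def mult.assoc)

lemma vf_cochain_eq_harm:
  assumes "K' \<subseteq> {1, 2}"
  shows "vf_cochain V K' = harm (\<lambda>K. if K = K' then V else 0) (\<lambda>K. 0)"
proof -
  have "(K = K' \<and> (\<exists>j\<in>{1..4}. I = {j})) \<longleftrightarrow> K = K' \<and> index_pair I K \<and> card I = 1" for I K
  proof -
    have "(\<exists>j\<in>{1..4}. I = {j}) \<longleftrightarrow> I \<noteq> {} \<and> I \<subseteq> {1..4} \<and> card I = 1"
    proof
      assume "I \<noteq> {} \<and> I \<subseteq> {1..4} \<and> card I = 1"
      moreover from this obtain j where "I = {j}" by (auto elim: card_1_singletonE)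
      ultimately show "\<exists>j\<in>{1..4}. I = {j}" by blast
    qed auto
    then show ?thesis using assms by (auto simp only: index_pair_def)
  qed
  note eq = this
  show ?thesis
    unfolding vf_cochain_def harm_def eq
    by (intro ext) (auto simp: restrict_vf_def)
qed

lemma eta_cochain_eq_harm:
  assumes "K' \<subseteq> {1, 2}"
  shows "eta_cochain K' = harm (\<lambda>K. 0) (\<lambda>K. if K = K' then 1 else 0)"
proof -
  have "(K = K' \<and> I \<subseteq> {1..4} \<and> card I = 2) \<longleftrightarrow> K = K' \<and> index_pair I K \<and> card I = 2" for I K
    using assms by (auto simp: index_pair_def)
  note eq = this
  show ?thesis
    unfolding eta_cochain_def harm_def eq
    by (intro ext) (auto simp: restrict_vf_def eta_coeff_def)
qed

definition fields1 :: "vfield \<Rightarrow> vfield \<Rightarrow> nat set \<Rightarrow> vfield" where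
  "fields1 V1 V2 = (\<lambda>K. if K = {1} then V1 else if K = {2} then V2 else 0)"

definition scalars1 :: "complex \<Rightarrow> nat set \<Rightarrow> complex" where
  "scalars1 s = (\<lambda>K. if K = {} then s else 0)"

definition fields2 :: "vfield \<Rightarrow> nat set \<Rightarrow> vfield" where
  "fields2 V = (\<lambda>K. if K = {1, 2} then V else 0)"

definition scalars2 :: "complex \<Rightarrow> complex \<Rightarrow> nat set \<Rightarrow> complex" where
  "scalars2 t1 t2 = (\<lambda>K. if K = {1} then t1 else if K = {2} then t2 else 0)"

lemma alpha_cocycle_eq_harm: "alpha_cocycle V1 V2 s = harm (fields1 V1 V2) (scalars1 s)"
proof -
  have k: "{1} \<subseteq> {1, 2 :: nat}" "{2} \<subseteq> {1, 2 :: nat}" "{} \<subseteq> {1, 2 :: nat}" by auto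
  have "(if K = {1} then V1 else 0) + (if K = {2} then V2 else 0) + (\<lambda>z. s *s 0) = fields1 V1 V2 K" for K
    by (intro ext) (simp add: fields1_def)
  moreover have "0 + 0 + s * (if K = {} then 1 else 0) = scalars1 s K" for K
    by (simp add: scalars1_def)
  ultimately show ?thesis
    unfolding alpha_cocycle_def vf_cochain_eq_harm[OF k(1)] vf_cochain_eq_harm[OF k(2)] eta_cochain_eq_harm[OF k(3)]
      harm_scale harm_add zero_fun_def by presburger
qed

definition beta_cocycle :: "vfield \<Rightarrow> complex \<Rightarrow> complex \<Rightarrow> cochain" where
  "beta_cocycle V t1 t2 = vf_cochain V {1, 2} + (cscale t1 (eta_cochain {1}) + cscale t2 (eta_cochain {2}))"

lemma beta_cocycle_eq_harm: "beta_cocycle V t1 t2 = harm (fields2 V) (scalars2 t1 t2)"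
proof -
  have k: "{1} \<subseteq> {1, 2 :: nat}" "{2} \<subseteq> {1, 2 :: nat}" "{1, 2} \<subseteq> {1, 2 :: nat}" by auto
  have "(if K = {1, 2} then V else 0) + ((\<lambda>z. t1 *s 0) + (\<lambda>z. t2 *s 0)) = fields2 V K" for K
    by (intro ext) (simp add: fields2_def)
  moreover have "0 + (t1 * (if K = {1} then 1 else 0) + t2 * (if K = {2} then 1 else 0)) = scalars2 t1 t2 K" for K
    by (simp add: scalars2_def)
  ultimately show ?thesis
    unfolding beta_cocycle_def eta_cochain_eq_harm[OF k(1)] eta_cochain_eq_harm[OF k(2)] vf_cochain_eq_harm[OF k(3)]
      harm_scale harm_add zero_fun_def by presburger
qed

lemma cls_add: "cls c + cls e = cls (c + e)"
  by (rule plus_coh.abs_eq)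

lemma cls_scale: "a *\<^sub>H cls c = cls (cscale a c)"
  by (rule coh_scale.abs_eq)

lemma cls_eq_iff: "cls c = cls e \<longleftrightarrow> c - e \<in> coboundaries"
  by (rule coh.abs_eq_iff)

lemma cls_alpha: "cls (alpha_cocycle V1 V2 s) = vf_class V1 {1} + vf_class V2 {2} + s *\<^sub>H eta_class {}"
  by (simp add: alpha_cocycle_def vf_class_def eta_class_def cls_add cls_scale)

lemma cls_beta: "cls (beta_cocycle V t1 t2) = vf_class V {1, 2} + (t1 *\<^sub>H eta_class {1} + t2 *\<^sub>H eta_class {2})"
  by (simp add: beta_cocycle_def vf_class_def eta_class_def cls_add cls_scale)

lemma fields1_global: "V1 \<in> global_fields \<Longrightarrow> V2 \<in> global_fields \<Longrightarrow> fields1 V1 V2 K \<in> global_fields"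
  by (simp add: fields1_def zero_global)

lemma fields2_global: "V \<in> global_fields \<Longrightarrow> fields2 V K \<in> global_fields"
  by (simp add: fields2_def zero_global)

text \<open>Fields on single charts contribute only the group degree, while multiples of W
  contribute one more, their Cech degree.\<close>

lemma harm_cocycles:
  assumes "\<And>K. A K \<in> global_fields"
    and "\<And>K. A K \<noteq> 0 \<Longrightarrow> card K = p" "\<And>K. t K \<noteq> 0 \<Longrightarrow> Suc (card K) = p"
  shows "harm A t \<in> cocycles p"
proof -
  have "harm A t I K = 0" if "card I + card K \<noteq> p + 1" for I K
  proof -
    consider "card I = 1" | "card I = 2" | "card I \<noteq> 1" "card I \<noteq> 2" by blast
    then show ?thesis
    proof cases
      case 1
      then have "A K = 0" using assms(2)[of K] that by auto
      then show ?thesis using 1 by (auto simp: harm_def restrict_vf_def fun_eq_iff)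
    next
      case 2
      then have "t K = 0" using assms(3)[of K] that by auto
      then show ?thesis using 2 by (auto simp: harm_def restrict_vf_def fun_eq_iff)
    next
      case 3
      then show ?thesis by (simp add: harm_def)
    qed
  qed
  moreover have "harm A t \<in> cochains" by (rule harm_cochains) (rule global_fields_Theta[OF assms(1)])
  ultimately show ?thesis by (simp add: cocycles_def cochains_deg_def d_tot_harm[OF assms(1)])
qed

lemma alpha_cocycles:
  assumes "V1 \<in> global_fields" "V2 \<in> global_fields"
  shows "alpha_cocycle V1 V2 s \<in> cocycles 1"
  unfolding alpha_cocycle_eq_harm
  by (rule harm_cocycles[OF fields1_global[OF assms]])
     (auto simp: fields1_def scalars1_def split: if_splits)

lemma beta_cocycles:
  assumes "V \<in> global_fields"
  shows "beta_cocycle V t1 t2 \<in> cocycles 2"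
  unfolding beta_cocycle_eq_harm
  by (rule harm_cocycles[OF fields2_global[OF assms]])
     (auto simp: fields2_def scalars2_def split: if_splits)

lemma alpha_injective:
  assumes "V1 \<in> global_fields" "V2 \<in> global_fields" "V1' \<in> global_fields" "V2' \<in> global_fields"
    and "cls (alpha_cocycle V1 V2 s) = cls (alpha_cocycle V1' V2' s')"
  shows "V1 = V1' \<and> V2 = V2' \<and> s = s'"
proof -
  have cob: "harm (fields1 V1 V2) (scalars1 s) - harm (fields1 V1' V2') (scalars1 s') \<in> coboundaries"
    using assms(5) by (simp add: cls_eq_iff alpha_cocycle_eq_harm)
  note inj = harm_injective[OF fields1_global[OF assms(1,2)] fields1_global[OF assms(3,4)] cob]
  show ?thesis
    using inj(1)[of "{1}"] inj(1)[of "{2}"] inj(2)[of "{}"] by (simp add: fields1_def scalars1_def)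
qed

lemma beta_injective:
  assumes "V \<in> global_fields" "V' \<in> global_fields"
    and "cls (beta_cocycle V t1 t2) = cls (beta_cocycle V' t1' t2')"
  shows "V = V' \<and> t1 = t1' \<and> t2 = t2'"
proof -
  have cob: "harm (fields2 V) (scalars2 t1 t2) - harm (fields2 V') (scalars2 t1' t2') \<in> coboundaries"
    using assms(3) by (simp add: cls_eq_iff beta_cocycle_eq_harm)
  note inj = harm_injective[OF fields2_global[OF assms(1)] fields2_global[OF assms(2)] cob]
  show ?thesis
    using inj(1)[of "{1, 2}"] inj(2)[of "{1}"] inj(2)[of "{2}"] by (simp add: fields2_def scalars2_def)
qed

text \<open>By degree, the fields of the representative survive only for a single deck generator,
  and its scalar only for the empty set of generators.\<close>

lemma HH1_cases:
  assumes "x \<in> HH 1"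
  obtains V1 V2 s where "V1 \<in> global_fields" "V2 \<in> global_fields" "x = cls (alpha_cocycle V1 V2 s)"
proof -
  obtain c where x: "x = cls c" and c: "c \<in> cocycles 1" using assms by (auto simp: HH_def)
  have deg: "c I K = 0" if "card I + card K \<noteq> 2" for I K
    using c that by (simp add: cocycles_def cochains_deg_def)
  have c1: "c \<in> cochains" "d_tot c = 0" using c by (simp_all add: cocycles_def cochains_deg_def)
  have c3: "card I \<le> 3" if "c I K \<noteq> 0" for I K
  proof -
    have "card I + card K = 2" using deg[of I K] that by blast
    then show ?thesis by simp
  qed
  show ?thesis
  proof (rule harm_surjective[OF c1 c3])
    fix A t
    assume A: "\<And>K. A K \<in> global_fields" and cob: "c - harm A t \<in> coboundaries"
      and zero: "\<And>K. c {1} K = 0 \<Longrightarrow> A K = 0" "\<And>K. c {1, 3} K = 0 \<Longrightarrow> t K = 0"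
    have A0: "A K = 0" if "card K \<noteq> 1" for K using zero(1)[of K] deg[of "{1}" K] that by simp
    have t0: "t K = 0" if "card K \<noteq> 0" for K using zero(2)[of K] deg[of "{1, 3}" K] that by simp
    have "harm A t = harm (fields1 (A {1}) (A {2})) (scalars1 (t {}))"
    proof (rule harm_cong)
      fix K :: "nat set" assume K: "K \<subseteq> {1, 2}"
      from K show "A K = fields1 (A {1}) (A {2}) K"
      proof (cases rule: subset_12_cases)
        case 1 then show ?thesis using A0[of K] by (simp add: fields1_def)
      next
        case 2 then show ?thesis using A0[of K] by (simp add: fields1_def)
      next
        case 3 then show ?thesis using A0[of K] by (simp add: fields1_def)
      next
        case 4 then show ?thesis using A0[of K] by (simp add: fields1_def)
      qed
      from K show "t K = scalars1 (t {}) K"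
      proof (cases rule: subset_12_cases)
        case 1 then show ?thesis using t0[of K] by (simp add: scalars1_def)
      next
        case 2 then show ?thesis using t0[of K] by (simp add: scalars1_def)
      next
        case 3 then show ?thesis using t0[of K] by (simp add: scalars1_def)
      next
        case 4 then show ?thesis using t0[of K] by (simp add: scalars1_def)
      qed
    qed
    then have "x = cls (alpha_cocycle (A {1}) (A {2}) (t {}))"
      using cob by (simp add: x cls_eq_iff alpha_cocycle_eq_harm)
    then show thesis by (rule that[rotated -1]) (rule A)+
  qed
qed

text \<open>By degree, the field survives only for both generators together and the scalars only for
  one of them.\<close>

lemma HH2_cases:
  assumes "x \<in> HH 2"
  obtains V t1 t2 where "V \<in> global_fields" "x = cls (beta_cocycle V t1 t2)"
proof -
  obtain c where x: "x = cls c" and c: "c \<in> cocycles 2" using assms by (auto simp: HH_def)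
  have deg: "c I K = 0" if "card I + card K \<noteq> 3" for I K
    using c that by (simp add: cocycles_def cochains_deg_def)
  have c1: "c \<in> cochains" "d_tot c = 0" using c by (simp_all add: cocycles_def cochains_deg_def)
  have c3: "card I \<le> 3" if "c I K \<noteq> 0" for I K
  proof -
    have "card I + card K = 3" using deg[of I K] that by blast
    then show ?thesis by simp
  qed
  show ?thesis
  proof (rule harm_surjective[OF c1 c3])
    fix A t
    assume A: "\<And>K. A K \<in> global_fields" and cob: "c - harm A t \<in> coboundaries"
      and zero: "\<And>K. c {1} K = 0 \<Longrightarrow> A K = 0" "\<And>K. c {1, 3} K = 0 \<Longrightarrow> t K = 0"
    have A0: "A K = 0" if "card K \<noteq> 2" for K using zero(1)[of K] deg[of "{1}" K] that by simp
    have t0: "t K = 0" if "card K \<noteq> 1" for K using zero(2)[of K] deg[of "{1, 3}" K] that by simp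
    have "harm A t = harm (fields2 (A {1, 2})) (scalars2 (t {1}) (t {2}))"
    proof (rule harm_cong)
      fix K :: "nat set" assume K: "K \<subseteq> {1, 2}"
      from K show "A K = fields2 (A {1, 2}) K"
      proof (cases rule: subset_12_cases)
        case 1 then show ?thesis using A0[of K] by (simp add: fields2_def)
      next
        case 2 then show ?thesis using A0[of K] by (simp add: fields2_def)
      next
        case 3 then show ?thesis using A0[of K] by (simp add: fields2_def)
      next
        case 4 then show ?thesis using A0[of K] by (simp add: fields2_def)
      qed
      from K show "t K = scalars2 (t {1}) (t {2}) K"
      proof (cases rule: subset_12_cases)
        case 1 then show ?thesis using t0[of K] by (simp add: scalars2_def)
      next
        case 2 then show ?thesis using t0[of K] by (simp add: scalars2_def)
      next
        case 3 then show ?thesis using t0[of K] by (simp add: scalars2_def)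
      next
        case 4 then show ?thesis using t0[of K] by (simp add: scalars2_def)
      qed
    qed
    then have "x = cls (beta_cocycle (A {1, 2}) (t {1}) (t {2}))"
      using cob by (simp add: x cls_eq_iff beta_cocycle_eq_harm)
    then show thesis by (rule that[rotated -1]) (rule A)+
  qed
qed

theorem HH1_bij:
  "bij_betw (\<lambda>(V1, V2, s). vf_class V1 {1} + vf_class V2 {2} + s *\<^sub>H eta_class {})
     (global_fields \<times> global_fields \<times> UNIV) (HH 1)"
  unfolding cls_alpha[symmetric]
proof (rule bij_betwI')
  fix x y assume xy: "x \<in> global_fields \<times> global_fields \<times> (UNIV :: complex set)" "y \<in> global_fields \<times> global_fields \<times> (UNIV :: complex set)"
  show "((case x of (V1, V2, s) \<Rightarrow> cls (alpha_cocycle V1 V2 s)) = (case y of (V1, V2, s) \<Rightarrow> cls (alpha_cocycle V1 V2 s))) = (x = y)"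
  proof -
    obtain V1 V2 s where x: "x = (V1, V2, s)" by (cases x)
    obtain V1' V2' s' where y: "y = (V1', V2', s')" by (cases y)
    have "V1 \<in> global_fields" "V2 \<in> global_fields" "V1' \<in> global_fields" "V2' \<in> global_fields"
      using xy by (simp_all add: x y)
    from alpha_injective[OF this, of s s'] show ?thesis unfolding x y prod.case by blast
  qed
next
  fix x assume "x \<in> global_fields \<times> global_fields \<times> (UNIV :: complex set)"
  then show "(case x of (V1, V2, s) \<Rightarrow> cls (alpha_cocycle V1 V2 s)) \<in> HH 1"
    unfolding HH_def by (cases x) (simp add: imageI alpha_cocycles)
next
  fix y assume "y \<in> HH 1"
  then obtain V1 V2 s where "V1 \<in> global_fields" "V2 \<in> global_fields" "y = cls (alpha_cocycle V1 V2 s)"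
    by (rule HH1_cases)
  then show "\<exists>x\<in>global_fields \<times> global_fields \<times> UNIV. y = (case x of (V1, V2, s) \<Rightarrow> cls (alpha_cocycle V1 V2 s))"
    by (intro bexI[of _ "(V1, V2, s)"]) auto
qed

theorem HH2_bij:
  "bij_betw (\<lambda>(V, t1, t2). vf_class V {1, 2} + (t1 *\<^sub>H eta_class {1} + t2 *\<^sub>H eta_class {2}))
     (global_fields \<times> UNIV \<times> UNIV) (HH 2)"
  unfolding cls_beta[symmetric]
proof (rule bij_betwI')
  fix x y assume xy: "x \<in> global_fields \<times> (UNIV :: complex set) \<times> (UNIV :: complex set)" "y \<in> global_fields \<times> (UNIV :: complex set) \<times> (UNIV :: complex set)"
  show "((case x of (V, t1, t2) \<Rightarrow> cls (beta_cocycle V t1 t2)) = (case y of (V, t1, t2) \<Rightarrow> cls (beta_cocycle V t1 t2))) = (x = y)"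
  proof -
    obtain V t1 t2 where x: "x = (V, t1, t2)" by (cases x)
    obtain V' t1' t2' where y: "y = (V', t1', t2')" by (cases y)
    have "V \<in> global_fields" "V' \<in> global_fields"
      using xy by (simp_all add: x y)
    from beta_injective[OF this, of t1 t2 t1' t2'] show ?thesis unfolding x y prod.case by blast
  qed
next
  fix x assume "x \<in> global_fields \<times> (UNIV :: complex set) \<times> (UNIV :: complex set)"
  then show "(case x of (V, t1, t2) \<Rightarrow> cls (beta_cocycle V t1 t2)) \<in> HH 2"
    unfolding HH_def by (cases x) (simp add: imageI beta_cocycles)
next
  fix y assume "y \<in> HH 2"
  then obtain V t1 t2 where "V \<in> global_fields" "y = cls (beta_cocycle V t1 t2)"
    by (rule HH2_cases)
  then show "\<exists>x\<in>global_fields \<times> UNIV \<times> UNIV. y = (case x of (V, t1, t2) \<Rightarrow> cls (beta_cocycle V t1 t2))"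
    by (intro bexI[of _ "(V, t1, t2)"]) auto
qed

section \<open>The normalized diagonal family\<close>

text \<open>The indices 0 to 3 are the diagonal coefficients of x, u, y, v in the order of the
  coordinates z_1 to z_4, so the diagonal family occupies the first four places; 4 and 5 are the
  off-diagonal entries and 6 to 8 the quadratic part.\<close>

definition nfv :: "(nat \<Rightarrow> complex) \<Rightarrow> vfield" where
  "nfv a = normal_field (vector [vector [a 0, a 4], vector [a 5, a 2]]) (a 1) (a 3) (vector [a 6, a 7, a 8])"

text \<open>Nine coordinates for each generator and one for eta, which gives the 19 dimensions of
  the first cohomology.\<close>

definition coords :: "(nat \<Rightarrow> complex) \<Rightarrow> coh" where
  "coords a = cls (alpha_cocycle (nfv a) (nfv (\<lambda>i. a (i + 9))) (a 18))"

lemma nfv_global: "nfv a \<in> global_fields"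
  by (simp add: nfv_def normal_field_global)

lemma nfv_nth:
  assumes "z \<in> UU"
  shows "nfv a z $ 1 = a 0 * z $ 1 + a 4 * z $ 3" "nfv a z $ 2 = a 1 * z $ 2"
    "nfv a z $ 3 = a 5 * z $ 1 + a 2 * z $ 3"
    "nfv a z $ 4 = a 3 * z $ 4 + (a 6 * z $ 1 ^ 2 + a 7 * z $ 1 * z $ 3 + a 8 * z $ 3 ^ 2) * z $ 2"
  unfolding nfv_def normal_field_nth[OF assms] by simp_all

lemma normal_field_outside: "z \<notin> UU \<Longrightarrow> normal_field M b c p z = 0"
  by (simp add: normal_field_def restrict_vf_def)

lemma nfv_lincomb: "nfv (\<lambda>i. r * a i + q * a' i) = (\<lambda>z. r *s nfv a z + q *s nfv a' z)"
proof
  fix z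
  show "nfv (\<lambda>i. r * a i + q * a' i) z = r *s nfv a z + q *s nfv a' z"
  proof (cases "z \<in> UU")
    case True
    show ?thesis by (simp add: vec_eq_iff forall_4 nfv_nth[OF True] algebra_simps)
  qed (simp add: nfv_def normal_field_outside)
qed

lemma nfv_eq_iff: "nfv a = nfv a' \<longleftrightarrow> (\<forall>i<9. a i = a' i)"
proof -
  have "(\<forall>i<9. a i = a' i) \<longleftrightarrow> a 0 = a' 0 \<and> a 1 = a' 1 \<and> a 2 = a' 2 \<and> a 3 = a' 3 \<and> a 4 = a' 4
      \<and> a 5 = a' 5 \<and> a 6 = a' 6 \<and> a 7 = a' 7 \<and> a 8 = a' 8"
  proof -
    have "{..<9 :: nat} = {0, 1, 2, 3, 4, 5, 6, 7, 8}" by auto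
    then have "(\<forall>i\<in>{..<9}. a i = a' i) \<longleftrightarrow> (\<forall>i\<in>{0, 1, 2, 3, 4, 5, 6, 7, 8}. a i = a' i)" by (simp only:)
    then show ?thesis by (simp only: Ball_def lessThan_iff insert_iff empty_iff) blast
  qed
  then show ?thesis
    unfolding nfv_def normal_field_eq_iff by (auto simp: vec_eq_iff forall_2 forall_3)
qed

lemma coords_lincomb: "coords (\<lambda>i. r * a i + q * a' i) = r *\<^sub>H coords a + q *\<^sub>H coords a'"
proof -
  have "cscale r (harm A t) + cscale q (harm A' t') = harm (\<lambda>K. (\<lambda>z. r *s A K z) + (\<lambda>z. q *s A' K z)) (\<lambda>K. r * t K + q * t' K)"
    for A A' t t' by (simp only: harm_scale harm_add)
  moreover have "fields1 (nfv (\<lambda>i. r * a i + q * a' i)) (nfv (\<lambda>i. r * a (i + 9) + q * a' (i + 9)))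
    = (\<lambda>K. (\<lambda>z. r *s fields1 (nfv a) (nfv (\<lambda>i. a (i + 9))) K z) + (\<lambda>z. q *s fields1 (nfv a') (nfv (\<lambda>i. a' (i + 9))) K z))"
    unfolding nfv_lincomb by (intro ext) (simp add: fields1_def)
  moreover have "scalars1 (r * a 18 + q * a' 18) = (\<lambda>K. r * scalars1 (a 18) K + q * scalars1 (a' 18) K)"
    by (simp add: scalars1_def fun_eq_iff)
  ultimately show ?thesis
    unfolding coords_def alpha_cocycle_eq_harm cls_scale cls_add by simp
qed

lemma coords_eq_iff: "coords a = coords a' \<longleftrightarrow> (\<forall>i<19. a i = a' i)"
proof
  assume "coords a = coords a'"
  then have *: "nfv a = nfv a' \<and> nfv (\<lambda>i. a (i + 9)) = nfv (\<lambda>i. a' (i + 9)) \<and> a 18 = a' 18"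
    unfolding coords_def by (intro alpha_injective nfv_global)
  show "\<forall>i<19. a i = a' i"
  proof (intro allI impI)
    fix i :: nat assume "i < 19"
    then consider "i < 9" | "i - 9 < 9" "i = (i - 9) + 9" | "i = 18" by linarith
    then show "a i = a' i"
    proof cases
      case 1
      then show ?thesis using * by (simp add: nfv_eq_iff)
    next
      case 2
      from * have "\<forall>j<9. a (j + 9) = a' (j + 9)" by (simp add: nfv_eq_iff)
      with 2 show ?thesis by metis
    next
      case 3
      then show ?thesis using * by simp
    qed
  qed
next
  assume *: "\<forall>i<19. a i = a' i"
  then have "nfv a = nfv a'" "nfv (\<lambda>i. a (i + 9)) = nfv (\<lambda>i. a' (i + 9))" "a 18 = a' 18"
    by (simp_all add: nfv_eq_iff)
  then show "coords a = coords a'" by (simp add: coords_def)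
qed

section \<open>A basis of the first cohomology and its coordinate subspaces\<close>

definition unit_class :: "nat \<Rightarrow> coh" where
  "unit_class i = coords (\<lambda>j. if j = i then 1 else 0)"

lemma coords_sum:
  assumes "finite S"
  shows "coords (\<lambda>j. if j \<in> S then a j else 0) = (\<Sum>i\<in>S. a i *\<^sub>H unit_class i)"
  using assms
proof (induction S rule: finite_induct)
  case empty
  have "coords (\<lambda>j. 0) = 0" using coords_lincomb[of 0 a 0 a] by simp
  then show ?case by simp
next
  case (insert x S)
  have "(\<lambda>j. if j \<in> insert x S then a j else 0)
    = (\<lambda>j. a x * (if j = x then 1 else 0) + 1 * (if j \<in> S then a j else 0))"
    using insert.hyps by (auto simp: fun_eq_iff)
  then have "coords (\<lambda>j. if j \<in> insert x S then a j else 0)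
    = a x *\<^sub>H unit_class x + 1 *\<^sub>H coords (\<lambda>j. if j \<in> S then a j else 0)"
    unfolding unit_class_def by (simp only: coords_lincomb)
  then show ?case using insert by simp
qed

lemma unit_class_inj: "inj_on unit_class {..<19}"
proof (rule inj_onI)
  fix i j :: nat assume ij: "i \<in> {..<19}" "j \<in> {..<19}" "unit_class i = unit_class j"
  then have "\<forall>k<19. (if k = i then 1 else 0 :: complex) = (if k = j then 1 else 0)"
    by (simp add: unit_class_def coords_eq_iff)
  then show "i = j" using ij(1) by (metis lessThan_iff one_neq_zero)
qed

text \<open>Distinct indices below 19 give distinct classes, so linear combinations of classes are
  the same as coordinate vectors supported in \<open>S\<close>.\<close>

lemma span_unit_class:
  assumes S: "S \<subseteq> {..<19}"
  shows "coh.span (unit_class ` S) = {coords a | a. \<forall>i. i \<notin> S \<longrightarrow> a i = 0}"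
proof -
  have fin: "finite S" using S finite_subset by blast
  have inj: "inj_on unit_class S" using unit_class_inj S inj_on_subset by blast
  have sum: "(\<Sum>v\<in>unit_class ` S. u v *\<^sub>H v) = coords (\<lambda>j. if j \<in> S then u (unit_class j) else 0)" for u
    unfolding sum.reindex[OF inj] coords_sum[OF fin] by simp
  show ?thesis
    unfolding coh.span_finite[OF finite_imageI[OF fin]]
  proof (intro equalityI subsetI)
    fix x assume "x \<in> range (\<lambda>u. \<Sum>v\<in>unit_class ` S. u v *\<^sub>H v)"
    then obtain u where "x = coords (\<lambda>j. if j \<in> S then u (unit_class j) else 0)" unfolding sum by blast
    then show "x \<in> {coords a | a. \<forall>i. i \<notin> S \<longrightarrow> a i = 0}" by force
  next
    fix x assume "x \<in> {coords a | a. \<forall>i. i \<notin> S \<longrightarrow> a i = 0}"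
    then obtain a where a: "x = coords a" "\<forall>i. i \<notin> S \<longrightarrow> a i = 0" by blast
    define u where "u = (\<lambda>v. a (the_inv_into S unit_class v))"
    have "(\<lambda>j. if j \<in> S then u (unit_class j) else 0) = a"
      using a(2) the_inv_into_f_f[OF inj] by (auto simp: u_def fun_eq_iff)
    then have "x = (\<Sum>v\<in>unit_class ` S. u v *\<^sub>H v)" unfolding sum a(1) by simp
    then show "x \<in> range (\<lambda>u. \<Sum>v\<in>unit_class ` S. u v *\<^sub>H v)" by blast
  qed
qed

lemma independent_unit_class:
  assumes S: "S \<subseteq> {..<19}"
  shows "coh.independent (unit_class ` S)"
proof -
  have fin: "finite S" using S finite_subset by blast
  have inj: "inj_on unit_class S" using unit_class_inj S inj_on_subset by blast
  show ?thesis
    unfolding coh.dependent_finite[OF finite_imageI[OF fin]]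
  proof safe
    fix u i assume nz: "u (unit_class i) \<noteq> 0" "i \<in> S" and z: "(\<Sum>v\<in>unit_class ` S. u v *\<^sub>H v) = 0"
    have "coords (\<lambda>j. if j \<in> S then u (unit_class j) else 0) = 0"
      using z unfolding sum.reindex[OF inj] coords_sum[OF fin] by simp
    also have "0 = coords (\<lambda>j. 0)" using coords_lincomb[of 0 u' 0 u' for u'] by simp
    finally have "\<forall>j<19. (if j \<in> S then u (unit_class j) else 0) = 0" by (simp add: coords_eq_iff)
    then show False using nz S by auto
  qed
qed

definition components :: "complex ^ 2 ^ 2 \<Rightarrow> complex \<Rightarrow> complex \<Rightarrow> complex ^ 3 \<Rightarrow> nat \<Rightarrow> complex" where
  "components M b c p i = (if i = 0 then M $ 1 $ 1 else if i = 1 then b else if i = 2 then M $ 2 $ 2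
     else if i = 3 then c else if i = 4 then M $ 1 $ 2 else if i = 5 then M $ 2 $ 1
     else if i = 6 then p $ 1 else if i = 7 then p $ 2 else p $ 3)"

lemma nfv_components: "nfv (components M b c p) = normal_field M b c p"
  unfolding nfv_def normal_field_eq_iff by (simp add: components_def vec_eq_iff forall_2 forall_3)

lemma HH1_eq_span: "HH 1 = coh.span (unit_class ` {..<19})"
  unfolding span_unit_class[OF subset_refl]
proof (intro equalityI subsetI)
  fix x assume "x \<in> HH 1"
  then obtain V1 V2 s where V: "V1 \<in> global_fields" "V2 \<in> global_fields" "x = cls (alpha_cocycle V1 V2 s)"
    by (rule HH1_cases)
  obtain M b c p where V1: "V1 = normal_field M b c p" using global_field_normal_form[OF V(1)] .
  obtain M' b' c' p' where V2: "V2 = normal_field M' b' c' p'" using global_field_normal_form[OF V(2)] .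
  define a where "a = (\<lambda>i. if i < 9 then components M b c p i else if i < 18 then components M' b' c' p' (i - 9)
    else if i = 18 then s else 0)"
  have "nfv a = V1" unfolding V1 nfv_components[symmetric] nfv_eq_iff by (simp add: a_def)
  moreover have "nfv (\<lambda>i. a (i + 9)) = V2" unfolding V2 nfv_components[symmetric] nfv_eq_iff by (simp add: a_def)
  moreover have "a 18 = s" by (simp add: a_def)
  ultimately have "x = coords a" by (simp add: coords_def V(3))
  moreover have "\<forall>i. i \<notin> {..<19} \<longrightarrow> a i = 0" by (simp add: a_def)
  ultimately show "x \<in> {coords a | a. \<forall>i. i \<notin> {..<19} \<longrightarrow> a i = 0}" by blast
next
  fix x assume "x \<in> {coords a | a. \<forall>i. i \<notin> {..<19} \<longrightarrow> a i = 0}"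
  then show "x \<in> HH 1" by (auto simp: coords_def HH_def intro!: imageI alpha_cocycles nfv_global)
qed

text \<open>The multiplier is an exponential, so its logarithmic derivative is 2 pi i C', whatever
  C0 is; the minus sign comes from the convention exp(- epsilon V) for deck maps.\<close>

lemma KS_field_nth:
  assumes "\<mu> \<in> {1, 2}"
  shows "KS_field C' \<mu> z $ i = - (2 * pi * \<i>) * C' $ i $ of_nat \<mu> * z $ i"
proof -
  let ?c = "2 * pi * \<i> :: complex"
  let ?E = "exp (?c * C0 $ i $ of_nat \<mu>)"
  have "((\<lambda>\<epsilon>. exp (?c * (C0 $ i $ of_nat \<mu> + \<epsilon> * C' $ i $ of_nat \<mu>)) * z $ i)
    has_field_derivative (?E * (?c * C' $ i $ of_nat \<mu>) * z $ i)) (at 0)"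
    by (auto intro!: derivative_eq_intros)
  then have "deriv (\<lambda>\<epsilon>. family_deck (\<chi> k l. C0 $ k $ l + \<epsilon> * C' $ k $ l) \<mu> z $ i) 0
    = ?E * (?c * C' $ i $ of_nat \<mu>) * z $ i"
    by (simp add: family_deck_def DERIV_imp_deriv)
  moreover have "?E = q0 ^ (deck_weight \<mu> $ i)"
    using fun_cong[OF family_deck_C0[OF assms], of "vec 1"] by (simp add: family_deck_def deck_def vec_eq_iff)
  ultimately show ?thesis by (simp add: KS_field_def inv_deck_def)
qed

text \<open>Index i below 4 stands for coordinate z_(i+1) and the first generator; the second
  generator starts at 9, whence the shift by 8.\<close>

definition ks_coords :: "complex ^ 2 ^ 4 \<Rightarrow> nat \<Rightarrow> complex" where
  "ks_coords C i = - (2 * pi * \<i>) * (if i < 4 then C $ of_nat (i + 1) $ 1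
     else if 9 \<le> i \<and> i < 13 then C $ of_nat (i - 8) $ 2 else 0)"

text \<open>The Kodaira-Spencer fields are linear on all of C^4, whereas normal fields are extended
  by zero; only the values on U enter the cochains.\<close>

lemma vf_cochain_cong: "(\<And>z. z \<in> UU \<Longrightarrow> V z = W z) \<Longrightarrow> vf_cochain V K = vf_cochain W K"
  unfolding vf_cochain_def restrict_vf_def using overlap_subset_UU
  by (intro ext) (auto simp: subset_iff)

lemma KS_eq_coords: "KS C = coords (ks_coords C)"
proof -
  have "vf_cochain (KS_field C 1) {1} = vf_cochain (nfv (ks_coords C)) {1}"
    by (rule vf_cochain_cong)
       (simp add: vec_eq_iff forall_4 nfv_nth KS_field_nth ks_coords_def)
  moreover have "vf_cochain (KS_field C 2) {2} = vf_cochain (nfv (\<lambda>i. ks_coords C (i + 9))) {2}"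
    by (rule vf_cochain_cong)
       (simp add: vec_eq_iff forall_4 nfv_nth KS_field_nth ks_coords_def)
  moreover have "ks_coords C 18 = 0" by (simp add: ks_coords_def)
  ultimately show ?thesis by (simp add: KS_def coords_def cls_alpha vf_class_def)
qed

definition diagonal_indices :: "nat set" where
  "diagonal_indices = {0, 1, 2, 3, 9, 10, 11, 12}"

lemma range_KS_eq_span: "range KS = coh.span (unit_class ` diagonal_indices)"
proof -
  have D: "diagonal_indices \<subseteq> {..<19}" by (auto simp: diagonal_indices_def)
  show ?thesis unfolding span_unit_class[OF D]
  proof (intro equalityI subsetI)
    fix x assume "x \<in> range KS"
    then obtain C where C: "x = coords (ks_coords C)" by (auto simp: KS_eq_coords)
    have "ks_coords C i = 0" if "i \<notin> diagonal_indices" for i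
    proof -
      have "\<not> i < 4" "\<not> (9 \<le> i \<and> i < 13)" using that by (auto simp: diagonal_indices_def)
      then show ?thesis by (auto simp: ks_coords_def)
    qed
    then show "x \<in> {coords a | a. \<forall>i. i \<notin> diagonal_indices \<longrightarrow> a i = 0}" using C by blast
  next
    fix x assume "x \<in> {coords a | a. \<forall>i. i \<notin> diagonal_indices \<longrightarrow> a i = 0}"
    then obtain a where a: "x = coords a" "\<And>i. i \<notin> diagonal_indices \<Longrightarrow> a i = 0" by blast
    \<comment> \<open>The inverse of the factor - 2 pi i, used to prescribe arbitrary diagonal
      coordinates.\<close>
    define r :: complex where "r = inverse (- (2 * pi * \<i>))"
    define C :: "complex ^ 2 ^ 4" where "C = vector [vector [r * a 0, r * a 9], vector [r * a 1, r * a 10],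
      vector [r * a 2, r * a 11], vector [r * a 3, r * a 12]]"
    have r: "- (2 * pi * \<i>) * (r * y) = y" for y :: complex by (simp add: r_def field_simps)
    have "ks_coords C i = a i" for i
    proof (cases "i \<in> diagonal_indices")
      case True
      then have "i = 0 \<or> i = 1 \<or> i = 2 \<or> i = 3 \<or> i = 9 \<or> i = 10 \<or> i = 11 \<or> i = 12"
        by (simp add: diagonal_indices_def)
      then have "(if i < 4 then C $ of_nat (i + 1) $ 1
          else if 9 \<le> i \<and> i < 13 then C $ of_nat (i - 8) $ 2 else 0) = r * a i"
        by (elim disjE) (simp_all add: C_def vector_4)
      then show ?thesis unfolding ks_coords_def by (simp only: r)
    next
      case False
      then have "\<not> i < 4" "\<not> (9 \<le> i \<and> i < 13)" by (auto simp: diagonal_indices_def)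
      then show ?thesis using a(2)[OF False] by (auto simp: ks_coords_def)
    qed
    then have "ks_coords C = a" by (rule ext)
    then have "x = KS C" by (simp add: a(1) KS_eq_coords)
    then show "x \<in> range KS" by blast
  qed
qed

text \<open>The image is the coordinate subspace of the eight diagonal directions, four per
  generator; the other 11 of the 19 basis classes form a basis of the quotient.\<close>

theorem KS_rank:
  "range KS \<subseteq> HH 1" "coh.dim (range KS) = 8" "quotient_dim (HH 1) (range KS) 11"
proof -
  have D: "diagonal_indices \<subseteq> {..<19}" by (auto simp: diagonal_indices_def)
  define N where "N = {..<19} - diagonal_indices"
  have N: "N \<subseteq> {..<19}" by (auto simp: N_def)
  have fin: "finite diagonal_indices" "finite N" by (simp_all add: diagonal_indices_def N_def)
  have cardD: "card diagonal_indices = 8" by (simp add: diagonal_indices_def)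
  have cardN: "card N = 11" unfolding N_def by (subst card_Diff_subset[OF fin(1) D]) (simp add: cardD)
  have card_im: "card (unit_class ` S) = card S" if "S \<subseteq> {..<19}" for S
    using that by (intro card_image inj_on_subset[OF unit_class_inj])
  show sub: "range KS \<subseteq> HH 1"
    unfolding range_KS_eq_span HH1_eq_span using D by (intro coh.span_mono image_mono)
  show "coh.dim (range KS) = 8"
    unfolding range_KS_eq_span coh.dim_span coh.dim_eq_card_independent[OF independent_unit_class[OF D]]
      card_im[OF D] cardD ..
  show "quotient_dim (HH 1) (range KS) 11"
    unfolding quotient_dim_def
  proof (intro conjI exI[of _ "unit_class ` N"])
    show "coh.subspace (HH 1)" unfolding HH1_eq_span by (rule coh.subspace_span)
    show "coh.subspace (range KS)" unfolding range_KS_eq_span by (rule coh.subspace_span)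
    show "range KS \<subseteq> HH 1" by (rule sub)
    show "finite (unit_class ` N)" using fin by simp
    show "card (unit_class ` N) = 11" using card_im[OF N] cardN by simp
    show B: "unit_class ` N \<subseteq> HH 1"
      unfolding HH1_eq_span using N by (intro subset_trans[OF image_mono coh.span_superset])
    show "HH 1 = coh.span (range KS \<union> unit_class ` N)"
    proof
      have "unit_class ` {..<19} \<subseteq> range KS \<union> unit_class ` N"
        unfolding range_KS_eq_span using coh.span_superset[of "unit_class ` diagonal_indices"]
        by (auto simp: N_def)
      then show "HH 1 \<subseteq> coh.span (range KS \<union> unit_class ` N)"
        unfolding HH1_eq_span by (rule coh.span_mono)
      show "coh.span (range KS \<union> unit_class ` N) \<subseteq> HH 1"
        by (rule coh.span_minimal) (use sub B in \<open>simp_all add: HH1_eq_span coh.subspace_span\<close>)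
    qed
    show "\<forall>a. (\<Sum>h\<in>unit_class ` N. a h *\<^sub>H h) \<in> range KS \<longrightarrow> (\<forall>h\<in>unit_class ` N. a h = 0)"
    proof (intro allI impI ballI)
      fix a h assume W: "(\<Sum>h\<in>unit_class ` N. a h *\<^sub>H h) \<in> range KS" and h: "h \<in> unit_class ` N"
      have "(\<Sum>h\<in>unit_class ` N. a h *\<^sub>H h) = coords (\<lambda>j. if j \<in> N then a (unit_class j) else 0)"
        unfolding sum.reindex[OF inj_on_subset[OF unit_class_inj N]] coords_sum[OF fin(2)] by simp
      with W obtain a' where a': "coords (\<lambda>j. if j \<in> N then a (unit_class j) else 0) = coords a'"
        "\<forall>i. i \<notin> diagonal_indices \<longrightarrow> a' i = 0"
        unfolding range_KS_eq_span span_unit_class[OF D] by auto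
      from h obtain i where i: "i \<in> N" "h = unit_class i" by blast
      then have "a' i = 0" "i < 19" using a'(2) by (auto simp: N_def)
      moreover have "(if i \<in> N then a (unit_class i) else 0) = a' i"
        using a'(1) \<open>i < 19\<close> unfolding coords_eq_iff by blast
      ultimately show "a h = 0" using i by simp
    qed
  qed
qed

section \<open>Second-order expansions\<close>

lemma norm_vscale: "norm (c *s v) = norm c * norm (v :: point)"
  by (simp add: norm_vec_def norm_mult L2_set_right_distrib)

definition ord_eps :: "nat \<Rightarrow> (complex \<Rightarrow> point) \<Rightarrow> bool" where
  "ord_eps n f \<longleftrightarrow> (\<lambda>\<epsilon>. norm (f \<epsilon>)) \<in> O[at 0](\<lambda>\<epsilon>. norm \<epsilon> ^ n)"

lemma ord_epsI:
  assumes "\<forall>\<^sub>F \<epsilon> in at 0. norm (f \<epsilon>) \<le> C * norm \<epsilon> ^ n"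
  shows "ord_eps n f"
  unfolding ord_eps_def by (rule bigoI[of _ C]) (use assms in simp)

lemma ord_epsE:
  assumes "ord_eps n f"
  obtains C where "C > 0" "\<forall>\<^sub>F \<epsilon> in at 0. norm (f \<epsilon>) \<le> C * norm \<epsilon> ^ n"
proof -
  obtain C where C: "C > 0" "\<forall>\<^sub>F \<epsilon> in at 0. norm (norm (f \<epsilon>)) \<le> C * norm (norm \<epsilon> ^ n)"
    using assms unfolding ord_eps_def by (rule landau_o.bigE)
  then have "\<forall>\<^sub>F \<epsilon> in at 0. norm (f \<epsilon>) \<le> C * norm \<epsilon> ^ n" by (simp add: norm_power)
  with C(1) show ?thesis by (rule that)
qed

lemma ord_eps_add:
  assumes "ord_eps n f" "ord_eps n g"
  shows "ord_eps n (\<lambda>\<epsilon>. f \<epsilon> + g \<epsilon>)"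
proof -
  obtain C where C: "\<forall>\<^sub>F \<epsilon> in at 0. norm (f \<epsilon>) \<le> C * norm \<epsilon> ^ n" using assms(1) by (rule ord_epsE)
  obtain D where D: "\<forall>\<^sub>F \<epsilon> in at 0. norm (g \<epsilon>) \<le> D * norm \<epsilon> ^ n" using assms(2) by (rule ord_epsE)
  from C D have "\<forall>\<^sub>F \<epsilon> in at 0. norm (f \<epsilon> + g \<epsilon>) \<le> (C + D) * norm \<epsilon> ^ n"
  proof eventually_elim
    case (elim \<epsilon>)
    then show ?case using norm_triangle_ineq[of "f \<epsilon>" "g \<epsilon>"] by (simp add: distrib_right)
  qed
  then show ?thesis by (rule ord_epsI)
qed

lemma ord_eps_scale:
  assumes "ord_eps n f"
  shows "ord_eps (k + n) (\<lambda>\<epsilon>. (c * \<epsilon> ^ k) *s f \<epsilon>)"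
proof -
  obtain C where "\<forall>\<^sub>F \<epsilon> in at 0. norm (f \<epsilon>) \<le> C * norm \<epsilon> ^ n" using assms by (rule ord_epsE)
  then have "\<forall>\<^sub>F \<epsilon> in at 0. norm ((c * \<epsilon> ^ k) *s f \<epsilon>) \<le> (norm c * C) * norm \<epsilon> ^ (k + n)"
  proof eventually_elim
    case (elim \<epsilon>)
    have "norm ((c * \<epsilon> ^ k) *s f \<epsilon>) = norm c * norm \<epsilon> ^ k * norm (f \<epsilon>)"
      by (simp add: norm_vscale norm_mult norm_power)
    also have "\<dots> \<le> norm c * norm \<epsilon> ^ k * (C * norm \<epsilon> ^ n)"
      using elim by (intro mult_left_mono) auto
    finally show ?case by (simp add: power_add mult_ac)
  qed
  then show ?thesis by (rule ord_epsI)
qed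

lemma ord_eps_uminus: "ord_eps n f \<Longrightarrow> ord_eps n (\<lambda>\<epsilon>. - f \<epsilon>)"
  by (simp add: ord_eps_def)

lemma ord_eps_diff: "ord_eps n f \<Longrightarrow> ord_eps n g \<Longrightarrow> ord_eps n (\<lambda>\<epsilon>. f \<epsilon> - g \<epsilon>)"
  using ord_eps_add[OF _ ord_eps_uminus] by simp

lemma ord_eps_cong:
  assumes "ord_eps n f" "\<forall>\<^sub>F \<epsilon> in at 0. f \<epsilon> = g \<epsilon>"
  shows "ord_eps n g"
proof -
  obtain C where "\<forall>\<^sub>F \<epsilon> in at 0. norm (f \<epsilon>) \<le> C * norm \<epsilon> ^ n" using assms(1) by (rule ord_epsE)
  then have "\<forall>\<^sub>F \<epsilon> in at 0. norm (g \<epsilon>) \<le> C * norm \<epsilon> ^ n"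
    using assms(2) by eventually_elim simp
  then show ?thesis by (rule ord_epsI)
qed

lemma ord_eps_bounded_linear:
  assumes "bounded_linear T" "ord_eps n f"
  shows "ord_eps n (\<lambda>\<epsilon>. T (f \<epsilon>))"
proof -
  obtain K where K: "K \<ge> 0" "\<And>x. norm (T x) \<le> norm x * K"
    using bounded_linear.nonneg_bounded[OF assms(1)] by blast
  obtain C where "\<forall>\<^sub>F \<epsilon> in at 0. norm (f \<epsilon>) \<le> C * norm \<epsilon> ^ n" using assms(2) by (rule ord_epsE)
  then have "\<forall>\<^sub>F \<epsilon> in at 0. norm (T (f \<epsilon>)) \<le> (C * K) * norm \<epsilon> ^ n"
  proof eventually_elim
    case (elim \<epsilon>)
    have "norm (T (f \<epsilon>)) \<le> norm (f \<epsilon>) * K" by (rule K)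
    also have "\<dots> \<le> C * norm \<epsilon> ^ n * K" using elim K(1) by (rule mult_right_mono)
    finally show ?case by (simp add: mult_ac)
  qed
  then show ?thesis by (rule ord_epsI)
qed

text \<open>Dividing by the square of the parameter and letting it tend to 0 shows that a quadratic
  coefficient is detected modulo third order. This turns relations between point maps into equations
  between vectors.\<close>

lemma ord_eps_square_iff: "ord_eps 3 (\<lambda>\<epsilon>. \<epsilon>\<^sup>2 *s v) \<longleftrightarrow> v = 0"
proof
  assume "ord_eps 3 (\<lambda>\<epsilon>. \<epsilon>\<^sup>2 *s v)"
  then obtain C where C: "C > 0" "\<forall>\<^sub>F \<epsilon> in at 0. norm (\<epsilon>\<^sup>2 *s v) \<le> C * norm \<epsilon> ^ 3" by (rule ord_epsE)
  have "\<forall>\<^sub>F \<epsilon> in at (0 :: complex). \<epsilon> \<noteq> 0" by (simp add: eventually_at_filter)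
  with C(2) have le: "\<forall>\<^sub>F \<epsilon> in at (0 :: complex). norm v \<le> C * norm \<epsilon>"
  proof eventually_elim
    case (elim \<epsilon>)
    have "norm \<epsilon> ^ 2 * norm v \<le> norm \<epsilon> ^ 2 * (C * norm \<epsilon>)"
      using elim(1) by (simp add: norm_vscale norm_power norm_mult power3_eq_cube power2_eq_square mult_ac)
    then show ?case using elim(2) by simp
  qed
  have "((\<lambda>\<epsilon> :: complex. C * norm \<epsilon>) \<longlongrightarrow> C * norm (0 :: complex)) (at 0)"
    by (rule tendsto_mult[OF tendsto_const tendsto_norm[OF tendsto_ident_at]])
  from tendsto_lowerbound[OF this le] have "norm v \<le> 0" by simp
  then show "v = 0" by simp
next
  assume "v = 0"
  then show "ord_eps 3 (\<lambda>\<epsilon>. \<epsilon>\<^sup>2 *s v)" by (intro ord_epsI[of _ 0]) simp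
qed

lemma has_derivative_ord_eps:
  assumes "(f has_derivative D) (at (0 :: complex))"
  shows "ord_eps 1 (\<lambda>\<epsilon>. f \<epsilon> - f 0)"
proof -
  interpret D: bounded_linear D using assms by (rule has_derivative_bounded_linear)
  obtain K where K: "\<And>x. norm (D x) \<le> norm x * K" using D.bounded by blast
  obtain d where d: "d > 0" "\<And>y. norm (y - 0) < d \<Longrightarrow> norm (f y - f 0 - D (y - 0)) \<le> 1 * norm (y - 0)"
    using assms[unfolded has_derivative_at_alt] by (metis zero_less_one)
  have "\<forall>\<^sub>F \<epsilon> in at 0. norm (f \<epsilon> - f 0) \<le> (1 + K) * norm \<epsilon> ^ 1"
  proof -
    have "norm (f \<epsilon> - f 0) \<le> (1 + K) * norm \<epsilon> ^ 1" if "norm \<epsilon> < d" for \<epsilon>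
    proof -
      have "norm (f \<epsilon> - f 0) \<le> norm (f \<epsilon> - f 0 - D \<epsilon>) + norm (D \<epsilon>)"
        using norm_triangle_ineq[of "f \<epsilon> - f 0 - D \<epsilon>" "D \<epsilon>"] by simp
      also have "\<dots> \<le> norm \<epsilon> + norm \<epsilon> * K" using d(2)[of \<epsilon>] that K[of \<epsilon>] by (intro add_mono) auto
      finally show ?thesis by (simp add: algebra_simps)
    qed
    then show ?thesis using d(1) unfolding eventually_at by (intro exI[of _ d]) (auto simp: dist_norm)
  qed
  then show ?thesis by (rule ord_epsI)
qed

section \<open>Fields along quadratic curves\<close>

definition quad_curve :: "point \<Rightarrow> point \<Rightarrow> point \<Rightarrow> complex \<Rightarrow> point" where
  "quad_curve z P Q \<epsilon> = z - \<epsilon> *s P + \<epsilon>\<^sup>2 *s Q"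

lemma quad_curve_0 [simp]: "quad_curve z P Q 0 = z"
  by (simp add: quad_curve_def)

lemma has_derivative_quad_curve:
  "(quad_curve z P Q has_derivative (\<lambda>h. h *s (- P + (2 * \<epsilon>) *s Q))) (at \<epsilon>)"
proof -
  have "((\<lambda>\<epsilon>. \<chi> k. z $ k - \<epsilon> * P $ k + \<epsilon>\<^sup>2 * Q $ k) has_derivative
      (\<lambda>h. \<Sum>k\<in>UNIV. axis k ((- P $ k + 2 * \<epsilon> * Q $ k) * h))) (at \<epsilon>)"
  proof -
    have eq: "(\<chi> k. g k) = (\<Sum>k\<in>UNIV. axis k (g k))" for g :: "4 \<Rightarrow> complex"
      by (simp add: vec_eq_iff axis_def sum.delta)
    have "((\<lambda>\<epsilon>. z $ k - \<epsilon> * P $ k + \<epsilon>\<^sup>2 * Q $ k) has_derivative (*) (- P $ k + 2 * \<epsilon> * Q $ k)) (at \<epsilon>)" for k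
      unfolding has_field_derivative_def[symmetric] by (auto intro!: derivative_eq_intros)
    then show ?thesis unfolding eq
      by (intro has_derivative_sum bounded_linear.has_derivative[OF bounded_linear_axis])
  qed
  moreover have "(\<Sum>k\<in>UNIV. axis k ((- P $ k + 2 * \<epsilon> * Q $ k) * h)) = h *s (- P + (2 * \<epsilon>) *s Q)" for h
    by (simp add: vec_eq_iff axis_def sum.delta algebra_simps)
  moreover have "(\<lambda>\<epsilon>. \<chi> k. z $ k - \<epsilon> * P $ k + \<epsilon>\<^sup>2 * Q $ k) = quad_curve z P Q"
    by (simp add: fun_eq_iff quad_curve_def vec_eq_iff)
  ultimately show ?thesis by simp
qed

lemma quad_curve_tendsto: "(quad_curve z P Q \<longlongrightarrow> z) (at 0)"
  using has_derivative_continuous[OF has_derivative_quad_curve[of z P Q 0]]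
  by (simp add: continuous_within)

lemma quad_curve_eventually_in:
  assumes "open U" "z \<in> U"
  shows "\<forall>\<^sub>F \<epsilon> in at 0. quad_curve z P Q \<epsilon> \<in> U"
  using topological_tendstoD[OF quad_curve_tendsto assms] .

lemma differentiable_ord_eps:
  assumes "(F has_derivative D) (at z)"
  shows "ord_eps 1 (\<lambda>\<epsilon>. F (quad_curve z P Q \<epsilon>) - F z)"
proof -
  have "((\<lambda>\<epsilon>. F (quad_curve z P Q \<epsilon>)) has_derivative (\<lambda>h. D (h *s (- P + (2 * 0) *s Q)))) (at 0)"
    by (rule has_derivative_compose[OF has_derivative_quad_curve]) (simp add: assms)
  from has_derivative_ord_eps[OF this] show ?thesis by simp
qed

text \<open>The restriction of a holomorphic field to a polynomial curve is a holomorphic function of one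
  variable, so its first-order Taylor remainder is quadratic without any bound on second
  derivatives.\<close>

lemma holomorphic_curve_taylor:
  assumes "open U" "z \<in> U"
    and V: "\<And>w. w \<in> U \<Longrightarrow> (V has_derivative L w) (at w)"
    and lin: "\<And>w c h. w \<in> U \<Longrightarrow> L w (c *s h) = c *s L w h"
  shows "ord_eps 2 (\<lambda>\<epsilon>. V (quad_curve z P Q \<epsilon>) - V z + \<epsilon> *s L z P)"
proof -
  let ?w = "quad_curve z P Q"
  have "open (?w -` U)"
  proof (rule open_vimage[OF assms(1)])
    show "continuous_on UNIV ?w"
      by (intro continuous_at_imp_continuous_on ballI has_derivative_continuous[OF has_derivative_quad_curve])
  qed
  then have N: "open (?w -` U)" "0 \<in> ?w -` U" using assms(2) by auto
  have comp: "\<exists>C d. d > 0 \<and> (\<forall>\<epsilon>. norm \<epsilon> < d \<longrightarrow> norm (V (?w \<epsilon>) $ k - V z $ k + \<epsilon> * L z P $ k) \<le> C * norm \<epsilon> ^ 2)" for k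
  proof -
    let ?f = "\<lambda>\<epsilon>. V (?w \<epsilon>) $ k"
    have der: "(?f has_field_derivative L (?w \<epsilon>) (- P + (2 * \<epsilon>) *s Q) $ k) (at \<epsilon>)" if "\<epsilon> \<in> ?w -` U" for \<epsilon>
    proof -
      have U: "?w \<epsilon> \<in> U" using that by simp
      have "(?f has_derivative (\<lambda>h. L (?w \<epsilon>) (h *s (- P + (2 * \<epsilon>) *s Q)) $ k)) (at \<epsilon>)"
        by (rule bounded_linear.has_derivative[OF bounded_linear_vec_nth has_derivative_compose[OF has_derivative_quad_curve V[OF U]]])
      moreover have "(\<lambda>h. L (?w \<epsilon>) (h *s (- P + (2 * \<epsilon>) *s Q)) $ k) = (*) (L (?w \<epsilon>) (- P + (2 * \<epsilon>) *s Q) $ k)"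
        by (intro ext) (simp only: lin[OF U] vector_smult_component mult.commute)
      ultimately show ?thesis by (simp only: has_field_derivative_def)
    qed
    have hol: "?f holomorphic_on ?w -` U"
      unfolding holomorphic_on_open[OF N(1)] using der by blast
    \<comment> \<open>The difference quotient is holomorphic across 0. Its own increment is
      therefore linear in the parameter, and multiplying back gives the quadratic remainder.\<close>
    let ?g = "\<lambda>\<epsilon>. if \<epsilon> = 0 then deriv ?f 0 else (?f \<epsilon> - ?f 0) / (\<epsilon> - 0)"
    have "?g holomorphic_on ?w -` U" by (rule pole_lemma_open[OF hol N(1)])
    then obtain D where D: "(?g has_field_derivative D) (at 0)"
      using N unfolding holomorphic_on_open[OF N(1)] by blast
    have "L z (- P) = - L z P" using lin[OF assms(2), of "-1" P] by simp
    then have d0: "deriv ?f 0 = - L z P $ k"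
      using DERIV_imp_deriv[OF der[OF N(2)]] by simp
    obtain d where d: "d > 0" "\<And>y. norm (y - 0) < d \<Longrightarrow> norm (?g y - ?g 0 - D * (y - 0)) \<le> 1 * norm (y - 0)"
      using D[unfolded has_field_derivative_def has_derivative_at_alt] by (metis zero_less_one)
    have "norm (?f \<epsilon> - V z $ k + \<epsilon> * L z P $ k) \<le> (1 + norm D) * norm \<epsilon> ^ 2" if "norm \<epsilon> < d" for \<epsilon>
    proof (cases "\<epsilon> = 0")
      case False
      have "norm (?g \<epsilon> - ?g 0) \<le> norm (?g \<epsilon> - ?g 0 - D * \<epsilon>) + norm (D * \<epsilon>)"
        using norm_triangle_ineq[of "?g \<epsilon> - ?g 0 - D * \<epsilon>" "D * \<epsilon>"] by simp
      also have "\<dots> \<le> norm \<epsilon> + norm D * norm \<epsilon>"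
        using d(2)[of \<epsilon>] that by (intro add_mono) (auto simp: norm_mult)
      finally have "norm (?g \<epsilon> - ?g 0) \<le> (1 + norm D) * norm \<epsilon>" by (simp add: distrib_right)
      then have "norm \<epsilon> * norm (?g \<epsilon> - ?g 0) \<le> norm \<epsilon> * ((1 + norm D) * norm \<epsilon>)"
        by (rule mult_left_mono) simp
      moreover have "?f \<epsilon> - V z $ k + \<epsilon> * L z P $ k = \<epsilon> * (?g \<epsilon> - ?g 0)"
        using False by (simp add: d0 field_simps)
      ultimately show ?thesis by (simp add: norm_mult power2_eq_square mult_ac)
    qed simp
    with d(1) show ?thesis by blast
  qed
  then obtain C d where Cd: "\<And>k. d k > 0" "\<And>k \<epsilon>. norm \<epsilon> < d k \<Longrightarrow>
      norm (V (?w \<epsilon>) $ k - V z $ k + \<epsilon> * L z P $ k) \<le> C k * norm \<epsilon> ^ 2" by metis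
  have "\<forall>\<^sub>F \<epsilon> in at 0. norm \<epsilon> < d k" for k :: 4
    using Cd(1)[of k] unfolding eventually_at by (auto simp: dist_norm)
  then have "\<forall>\<^sub>F \<epsilon> in at 0. \<forall>k. norm \<epsilon> < d k" by (rule eventually_all_finite)
  then have "\<forall>\<^sub>F \<epsilon> in at 0. norm (V (?w \<epsilon>) - V z + \<epsilon> *s L z P) \<le> (\<Sum>k\<in>UNIV. C k) * norm \<epsilon> ^ 2"
  proof eventually_elim
    case (elim \<epsilon>)
    have "norm (V (?w \<epsilon>) - V z + \<epsilon> *s L z P) \<le> (\<Sum>k\<in>UNIV. norm ((V (?w \<epsilon>) - V z + \<epsilon> *s L z P) $ k))"
      unfolding norm_vec_def by (rule L2_set_le_sum) simp
    also have "\<dots> \<le> (\<Sum>k\<in>UNIV. C k * norm \<epsilon> ^ 2)"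
      using Cd(2) elim by (intro sum_mono) simp
    finally show ?case by (simp add: sum_distrib_right)
  qed
  then show ?thesis by (rule ord_epsI)
qed

lemma exp2_eq_quad_curve:
  "exp2 V Y \<epsilon> z = quad_curve z (V z) ((1 / 2) *s frechet_derivative V (at z) (V z) - Y z) \<epsilon>"
  by (simp add: exp2_def quad_curve_def vec_eq_iff algebra_simps)

text \<open>The coefficient of \<open>\<epsilon>\<^sup>2\<close> in the composition of two
  second-order exponentials. The mixed derivative term carries no factor 1/2, and this asymmetry
  produces the bracket later on.\<close>

definition comp_coeff :: "(point \<Rightarrow> point \<Rightarrow> point) \<Rightarrow> vfield \<Rightarrow> vfield \<Rightarrow> vfield \<Rightarrow> vfield \<Rightarrow> point \<Rightarrow> point" where
  "comp_coeff L V Y V' Y' z = L z (V' z) - Y z - Y' z + (1 / 2) *s L z (V z)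
     + (1 / 2) *s frechet_derivative V' (at z) (V' z)"

text \<open>The inner map is a quadratic curve through z. Only the linear term of the outer map
  needs a Taylor expansion with quadratic remainder. In the terms already carrying
  \<open>\<epsilon>\<^sup>2\<close> the point on the curve may be replaced by z at the price of a
  third-order error.\<close>

theorem exp2_comp:
  assumes U: "open U" "z \<in> U"
    and V: "\<And>w. w \<in> U \<Longrightarrow> (V has_derivative L w) (at w)"
    and lin: "\<And>w c h. w \<in> U \<Longrightarrow> L w (c *s h) = c *s L w h"
    and Y: "(Y has_derivative DY) (at z)"
    and G: "((\<lambda>w. L w (V w)) has_derivative DG) (at z)"
  shows "ord_eps 3 (\<lambda>\<epsilon>. exp2 V Y \<epsilon> (exp2 V' Y' \<epsilon> z)
    - (z - \<epsilon> *s (V z + V' z) + \<epsilon>\<^sup>2 *s comp_coeff L V Y V' Y' z))"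
proof -
  define Q where "Q = (1 / 2) *s frechet_derivative V' (at z) (V' z) - Y' z"
  define w where "w = quad_curve z (V' z) Q"
  have w: "exp2 V' Y' \<epsilon> z = w \<epsilon>" for \<epsilon> by (simp add: exp2_eq_quad_curve w_def Q_def)
  have r1: "ord_eps (1 + 2) (\<lambda>\<epsilon>. ((-1) * \<epsilon> ^ 1) *s (V (w \<epsilon>) - V z + \<epsilon> *s L z (V' z)))"
    unfolding w_def by (rule ord_eps_scale[OF holomorphic_curve_taylor[OF U V lin]])
  have r2: "ord_eps (2 + 1) (\<lambda>\<epsilon>. ((-1) * \<epsilon> ^ 2) *s (Y (w \<epsilon>) - Y z))"
    unfolding w_def by (rule ord_eps_scale[OF differentiable_ord_eps[OF Y]])
  have r3: "ord_eps (2 + 1) (\<lambda>\<epsilon>. ((1 / 2) * \<epsilon> ^ 2) *s (L (w \<epsilon>) (V (w \<epsilon>)) - L z (V z)))"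
    unfolding w_def by (rule ord_eps_scale[OF differentiable_ord_eps[OF G]])
  have "ord_eps 3 (\<lambda>\<epsilon>. ((-1) * \<epsilon> ^ 1) *s (V (w \<epsilon>) - V z + \<epsilon> *s L z (V' z))
      + ((-1) * \<epsilon> ^ 2) *s (Y (w \<epsilon>) - Y z) + ((1 / 2) * \<epsilon> ^ 2) *s (L (w \<epsilon>) (V (w \<epsilon>)) - L z (V z)))"
    using ord_eps_add[OF ord_eps_add[OF r1[simplified] r2[simplified]] r3[simplified]] by (simp add: numeral_3_eq_3)
  then show ?thesis
  proof (rule ord_eps_cong)
    have "\<forall>\<^sub>F \<epsilon> in at 0. w \<epsilon> \<in> U" unfolding w_def by (rule quad_curve_eventually_in[OF U])
    then show "\<forall>\<^sub>F \<epsilon> in at 0. ((-1) * \<epsilon> ^ 1) *s (V (w \<epsilon>) - V z + \<epsilon> *s L z (V' z))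
      + ((-1) * \<epsilon> ^ 2) *s (Y (w \<epsilon>) - Y z) + ((1 / 2) * \<epsilon> ^ 2) *s (L (w \<epsilon>) (V (w \<epsilon>)) - L z (V z))
      = exp2 V Y \<epsilon> (exp2 V' Y' \<epsilon> z) - (z - \<epsilon> *s (V z + V' z) + \<epsilon>\<^sup>2 *s comp_coeff L V Y V' Y' z)"
    proof eventually_elim
      case (elim \<epsilon>)
      have "frechet_derivative V (at (w \<epsilon>)) = L (w \<epsilon>)" by (rule frechet_derivative_at[OF V[OF elim], symmetric])
      then show ?case
        unfolding w exp2_def[of V Y] comp_coeff_def
        by (simp add: vec_eq_iff w_def quad_curve_def Q_def algebra_simps power2_eq_square)
    qed
  qed
qed

section \<open>Deck maps and second-order exponentials\<close>

lemma bounded_linear_deck: "bounded_linear (deck \<mu>)"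
proof -
  have "linear (deck \<mu>)"
    by (intro linearI) (simp_all add: deck_def vec_eq_iff algebra_simps)
  then show ?thesis by (simp add: linear_conv_bounded_linear)
qed

lemma bounded_linear_inv_deck: "bounded_linear (inv_deck \<mu>)"
proof -
  have "linear (inv_deck \<mu>)"
    by (intro linearI) (simp_all add: inv_deck_def vec_eq_iff add_divide_distrib scaleR_conv_of_real)
  then show ?thesis by (simp add: linear_conv_bounded_linear)
qed

lemma inv_deck_deck [simp]: "inv_deck \<mu> (deck \<mu> w) = w" "deck \<mu> (inv_deck \<mu> w) = w"
  by (simp_all add: deck_def inv_deck_def vec_eq_iff)

lemma deck_commute: "deck \<mu> (deck \<nu> z) = deck \<nu> (deck \<mu> z)"
  by (simp add: deck_def vec_eq_iff)

lemma deck_linear: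
  "deck \<mu> (x + y) = deck \<mu> x + deck \<mu> y" "deck \<mu> (x - y) = deck \<mu> x - deck \<mu> y" "deck \<mu> (c *s x) = c *s deck \<mu> x"
  by (simp_all add: deck_def vec_eq_iff algebra_simps)

text \<open>An equivariant field has an equivariant derivative, so moving a deck map to the left
  past a second-order exponential changes only the second-order datum, which is pulled back.\<close>

lemma exp2_deck:
  assumes U: "open U" "w \<in> U" "deck \<mu> w \<in> U"
    and V: "\<And>w. w \<in> U \<Longrightarrow> (V has_derivative L w) (at w)"
    and equiv: "\<And>w. w \<in> U \<Longrightarrow> V (deck \<mu> w) = deck \<mu> (V w)"
  shows "exp2 V Y \<epsilon> (deck \<mu> w) = deck \<mu> (exp2 V (pullback \<mu> Y) \<epsilon> w)"
proof -
  have D: "(deck \<mu> has_derivative deck \<mu>) (at w)"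
    by (rule bounded_linear_imp_has_derivative[OF bounded_linear_deck])
  have 1: "((\<lambda>w. V (deck \<mu> w)) has_derivative (\<lambda>h. L (deck \<mu> w) (deck \<mu> h))) (at w)"
    by (rule has_derivative_compose[OF D V[OF U(3)]])
  have "((\<lambda>w. deck \<mu> (V w)) has_derivative (\<lambda>h. deck \<mu> (L w h))) (at w)"
    by (rule bounded_linear.has_derivative[OF bounded_linear_deck V[OF U(2)]])
  then have 2: "((\<lambda>w. V (deck \<mu> w)) has_derivative (\<lambda>h. deck \<mu> (L w h))) (at w)"
    by (rule has_derivative_transform_within_open[OF _ U(1,2)]) (simp add: equiv)
  have eq: "L (deck \<mu> w) (deck \<mu> h) = deck \<mu> (L w h)" for h
    using has_derivative_unique[OF 1 2] by (rule fun_cong)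
  have f: "frechet_derivative V (at w) = L w" "frechet_derivative V (at (deck \<mu> w)) = L (deck \<mu> w)"
    by (rule frechet_derivative_at[OF V[OF U(2)], symmetric], rule frechet_derivative_at[OF V[OF U(3)], symmetric])
  have "Y (deck \<mu> w) = deck \<mu> (pullback \<mu> Y w)" by (simp add: pullback_def)
  then show ?thesis
    unfolding exp2_def f equiv[OF U(2)] eq deck_linear by simp
qed

section \<open>Complex differentiability of components\<close>

definition cdiff :: "(point \<Rightarrow> complex) \<Rightarrow> point \<Rightarrow> bool" where
  "cdiff f z \<longleftrightarrow> (\<exists>L. (f has_derivative L) (at z) \<and> (\<forall>c w. L (c *s w) = c * L w))"

lemma cdiff_const: "cdiff (\<lambda>z. c) z"
  unfolding cdiff_def by (rule exI[of _ "\<lambda>h. 0"]) simp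

lemma cdiff_nth: "cdiff (\<lambda>z. z $ i) z"
  unfolding cdiff_def by (rule exI[of _ "\<lambda>h. h $ i"]) (simp add: has_derivative_nth)

lemma cdiff_add: "cdiff f z \<Longrightarrow> cdiff g z \<Longrightarrow> cdiff (\<lambda>z. f z + g z) z"
  unfolding cdiff_def
proof (elim exE conjE)
  fix L M assume *: "(f has_derivative L) (at z)" "(g has_derivative M) (at z)"
    "\<forall>c w. L (c *s w) = c * L w" "\<forall>c w. M (c *s w) = c * M w"
  show "\<exists>L. ((\<lambda>z. f z + g z) has_derivative L) (at z) \<and> (\<forall>c w. L (c *s w) = c * L w)"
    using has_derivative_add[OF *(1,2)] *(3,4) by (intro exI[of _ "\<lambda>h. L h + M h"]) (simp add: algebra_simps)
qed

lemma cdiff_mult: "cdiff f z \<Longrightarrow> cdiff g z \<Longrightarrow> cdiff (\<lambda>z. f z * g z) z"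
  unfolding cdiff_def
proof (elim exE conjE)
  fix L M assume *: "(f has_derivative L) (at z)" "(g has_derivative M) (at z)"
    "\<forall>c w. L (c *s w) = c * L w" "\<forall>c w. M (c *s w) = c * M w"
  show "\<exists>L. ((\<lambda>z. f z * g z) has_derivative L) (at z) \<and> (\<forall>c w. L (c *s w) = c * L w)"
    using has_derivative_mult[OF *(1,2)] *(3,4)
    by (intro exI[of _ "\<lambda>h. f z * M h + L h * g z"]) (simp add: algebra_simps)
qed

lemma cdiff_inverse: "cdiff f z \<Longrightarrow> f z \<noteq> 0 \<Longrightarrow> cdiff (\<lambda>z. inverse (f z)) z"
  unfolding cdiff_def
proof (elim exE conjE)
  fix L assume *: "(f has_derivative L) (at z)" "\<forall>c w. L (c *s w) = c * L w" and nz: "f z \<noteq> 0"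
  show "\<exists>L. ((\<lambda>z. inverse (f z)) has_derivative L) (at z) \<and> (\<forall>c w. L (c *s w) = c * L w)"
    using Deriv.has_derivative_inverse[OF nz *(1)] *(2)
    by (intro exI[of _ "\<lambda>h. - (inverse (f z) * L h * inverse (f z))"]) (simp add: mult_ac)
qed

lemma Theta_if_cdiff:
  assumes D: "open D" and f: "\<And>z k. z \<in> D \<Longrightarrow> cdiff (\<lambda>z. V z $ k) z"
  shows "restrict_vf D V \<in> Theta D"
proof -
  have "\<exists>L. (restrict_vf D V has_derivative L) (at z) \<and> (\<forall>c w. L (c *s w) = c *s L w)" if z: "z \<in> D" for z
  proof -
    have "\<forall>k. \<exists>L. ((\<lambda>z. V z $ k) has_derivative L) (at z) \<and> (\<forall>c w. L (c *s w) = c * L w)"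
      using f[OF z] by (simp add: cdiff_def)
    then obtain L where L: "\<And>k. ((\<lambda>z. V z $ k) has_derivative L k) (at z)" "\<And>k c w. L k (c *s w) = c * L k w"
      by metis
    have "((\<lambda>z. \<chi> k. V z $ k) has_derivative (\<lambda>h. \<chi> k. L k h)) (at z)"
      by (rule has_derivative_vec_lambda[OF L(1)])
    then have "(restrict_vf D V has_derivative (\<lambda>h. \<chi> k. L k h)) (at z)"
      by (rule has_derivative_transform_within_open[OF _ D z]) (simp add: restrict_vf_def)
    moreover have "(\<chi> k. L k (c *s w)) = c *s (\<chi> k. L k w)" for c w by (simp add: vec_eq_iff L(2))
    ultimately show ?thesis by blast
  qed
  then show ?thesis by (simp add: Theta_def holomorphic_vf_def restrict_vf_def)
qed

text \<open>Bundles what the expansion needs of a first-order field: an explicit complex-linear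
  derivative, differentiability of DV(V) as the coefficient of the quadratic term, and equivariance.
  Naming the derivative \<open>L\<close> avoids carrying \<open>frechet_derivative\<close> through
  the computations.\<close>

definition tame :: "point set \<Rightarrow> vfield \<Rightarrow> (point \<Rightarrow> point \<Rightarrow> point) \<Rightarrow> bool" where
  "tame U V L \<longleftrightarrow> (\<forall>w\<in>U. (V has_derivative L w) (at w) \<and> (\<forall>c h. L w (c *s h) = c *s L w h) \<and>
     (\<exists>D. ((\<lambda>w. L w (V w)) has_derivative D) (at w)) \<and>
     (\<forall>\<mu>\<in>{1, 2}. V (deck \<mu> w) = deck \<mu> (V w)))"

lemma tameD:
  assumes "tame U V L" "w \<in> U"
  shows "(V has_derivative L w) (at w)" "L w (c *s h) = c *s L w h"
    "\<exists>D. ((\<lambda>w. L w (V w)) has_derivative D) (at w)" "\<mu> \<in> {1, 2} \<Longrightarrow> V (deck \<mu> w) = deck \<mu> (V w)"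
    "frechet_derivative V (at w) = L w"
  using assms frechet_derivative_at[of V "L w" w] unfolding tame_def by auto

lemma tame_mono: "tame U V L \<Longrightarrow> U' \<subseteq> U \<Longrightarrow> tame U' V L"
  unfolding tame_def by blast

section \<open>Relations modulo third order as vector equations\<close>

lemma eq_mod_eps3_iff: "eq_mod_eps3 F F' z \<longleftrightarrow> ord_eps 3 (\<lambda>\<epsilon>. F \<epsilon> z - F' \<epsilon> z)"
  by (simp add: eq_mod_eps3_def ord_eps_def)

lemma ord_eps_deck_iff: "ord_eps n (\<lambda>\<epsilon>. deck \<mu> (f \<epsilon>)) \<longleftrightarrow> ord_eps n f"
  using ord_eps_bounded_linear[OF bounded_linear_deck, of n f \<mu>]
    ord_eps_bounded_linear[OF bounded_linear_inv_deck, of n "\<lambda>\<epsilon>. deck \<mu> (f \<epsilon>)" \<mu>] by auto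

text \<open>The linear terms cancel by assumption, so only the difference of the quadratic
  coefficients remains to be tested.\<close>

lemma ord_eps_expansion_iff:
  assumes "ord_eps 3 (\<lambda>\<epsilon>. f \<epsilon> - (z - \<epsilon> *s p + \<epsilon>\<^sup>2 *s q))" "ord_eps 3 (\<lambda>\<epsilon>. f' \<epsilon> - (z - \<epsilon> *s p' + \<epsilon>\<^sup>2 *s q'))" "p = p'"
  shows "ord_eps 3 (\<lambda>\<epsilon>. f \<epsilon> - f' \<epsilon>) \<longleftrightarrow> q = q'"
proof -
  have d: "ord_eps 3 (\<lambda>\<epsilon>. (f \<epsilon> - f' \<epsilon>) - \<epsilon>\<^sup>2 *s (q - q'))"
    using ord_eps_diff[OF assms(1,2)] assms(3) by (simp add: algebra_simps vector_ssub_ldistrib)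
  have "ord_eps 3 (\<lambda>\<epsilon>. f \<epsilon> - f' \<epsilon>) \<longleftrightarrow> ord_eps 3 (\<lambda>\<epsilon>. \<epsilon>\<^sup>2 *s (q - q'))"
    using ord_eps_add[OF d, of "\<lambda>\<epsilon>. \<epsilon>\<^sup>2 *s (q - q')"] ord_eps_diff[OF _ d, of "\<lambda>\<epsilon>. f \<epsilon> - f' \<epsilon>"] by auto
  then show ?thesis by (simp only: ord_eps_square_iff right_minus_eq)
qed

lemma exp2_eventually_in:
  assumes "open U" "z \<in> U"
  shows "\<forall>\<^sub>F \<epsilon> in at 0. exp2 V Y \<epsilon> z \<in> U"
  unfolding exp2_eq_quad_curve by (rule quad_curve_eventually_in[OF assms])

lemma Theta_has_derivative:
  "Y \<in> Theta D \<Longrightarrow> z \<in> D \<Longrightarrow> \<exists>L. (Y has_derivative L) (at z)"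
  unfolding Theta_def holomorphic_vf_def by blast

lemma pullback_has_derivative:
  assumes "Y \<in> Theta D" "deck \<mu> z \<in> D"
  shows "\<exists>L. (pullback \<mu> Y has_derivative L) (at z)"
proof -
  obtain L where L: "(Y has_derivative L) (at (deck \<mu> z))" using Theta_has_derivative[OF assms] by blast
  have "((\<lambda>z. inv_deck \<mu> (Y (deck \<mu> z))) has_derivative (\<lambda>h. inv_deck \<mu> (L (deck \<mu> h)))) (at z)"
    by (rule bounded_linear.has_derivative[OF bounded_linear_inv_deck
          has_derivative_compose[OF bounded_linear_imp_has_derivative[OF bounded_linear_deck] L]])
  then show ?thesis unfolding pullback_def by blast
qed

lemma tame_exp2_comp:
  assumes "open U" "z \<in> U" "tame U V L" "tame U V' L'" "\<exists>D. (Y has_derivative D) (at z)"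
  shows "ord_eps 3 (\<lambda>\<epsilon>. exp2 V Y \<epsilon> (exp2 V' Y' \<epsilon> z) - (z - \<epsilon> *s (V z + V' z)
    + \<epsilon>\<^sup>2 *s (L z (V' z) - Y z - Y' z + (1 / 2) *s L z (V z) + (1 / 2) *s L' z (V' z))))"
proof -
  obtain DY where DY: "(Y has_derivative DY) (at z)" using assms(5) by blast
  obtain DG where DG: "((\<lambda>w. L w (V w)) has_derivative DG) (at z)" using tameD(3)[OF assms(3,2)] by blast
  from exp2_comp[OF assms(1,2) tameD(1)[OF assms(3)] tameD(2)[OF assms(3)] DY DG, of V' Y']
  show ?thesis unfolding comp_coeff_def tameD(5)[OF assms(4,2)] .
qed

lemma deck_in_overlap_eventually:
  assumes "I \<noteq> {}" "z \<in> overlap I" "tame (overlap I) V L" "\<mu> \<in> {1, 2}"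
  shows "\<forall>\<^sub>F \<epsilon> in at 0. exp2 V Y \<epsilon> (deck \<mu> (exp2 V' Y' \<epsilon> z)) = deck \<mu> (exp2 V (pullback \<mu> Y) \<epsilon> (exp2 V' Y' \<epsilon> z))"
  using exp2_eventually_in[OF open_overlap[OF assms(1)] assms(2), of V' Y']
proof eventually_elim
  case (elim \<epsilon>)
  then have "deck \<mu> (exp2 V' Y' \<epsilon> z) \<in> overlap I" by (simp add: deck_in_overlap[OF assms(1)])
  from exp2_deck[OF open_overlap[OF assms(1)] elim this tameD(1)[OF assms(3)] tameD(4)[OF assms(3) _ assms(4)]]
  show ?case by blast
qed

text \<open>On both sides the deck maps are moved to the left, which pulls back the second-order
  datum of the outer factor, and are then cancelled. The terms DV(V)/2 occur equally on both sides;
  the two mixed derivatives do not, and their difference is the bracket.\<close>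

lemma deck_relation_iff:
  assumes z: "z \<in> overlap {j}"
    and X: "tame (overlap {j}) (a {j} {1}) L1" "tame (overlap {j}) (a {j} {2}) L2"
    and Y: "A {j} {1} \<in> Theta (overlap {j})" "A {j} {2} \<in> Theta (overlap {j})"
  shows "deck_relation a A j z \<longleftrightarrow>
    (pullback 1 (A {j} {2}) z - A {j} {2} z) - (pullback 2 (A {j} {1}) z - A {j} {1} z)
    = L2 z (a {j} {1} z) - L1 z (a {j} {2} z)"
proof -
  have ne: "{j} \<noteq> {}" by simp
  note op = open_overlap[OF ne]
  have dz: "deck \<mu> z \<in> overlap {j}" for \<mu> using z by (simp add: deck_in_overlap)
  let ?f = "\<lambda>\<epsilon>. exp2 (a {j} {1}) (pullback 2 (A {j} {1})) \<epsilon> (exp2 (a {j} {2}) (A {j} {2}) \<epsilon> z)"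
  let ?f' = "\<lambda>\<epsilon>. exp2 (a {j} {2}) (pullback 1 (A {j} {2})) \<epsilon> (exp2 (a {j} {1}) (A {j} {1}) \<epsilon> z)"
  let ?F = "\<lambda>\<epsilon>. (deck_lift a A 1 j \<epsilon> \<circ> deck_lift a A 2 j \<epsilon>) z"
  let ?F' = "\<lambda>\<epsilon>. (deck_lift a A 2 j \<epsilon> \<circ> deck_lift a A 1 j \<epsilon>) z"
  have m: "1 \<in> {1, 2 :: nat}" "2 \<in> {1, 2 :: nat}" by auto
  have 1: "\<forall>\<^sub>F \<epsilon> in at 0. ?F \<epsilon> = deck 1 (deck 2 (?f \<epsilon>))"
    using deck_in_overlap_eventually[OF ne z X(1) m(2), of "A {j} {1}" "a {j} {2}" "A {j} {2}"]
    by eventually_elim (simp only: deck_lift_def comp_apply)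
  have 2: "\<forall>\<^sub>F \<epsilon> in at 0. ?F' \<epsilon> = deck 1 (deck 2 (?f' \<epsilon>))"
    using deck_in_overlap_eventually[OF ne z X(2) m(1), of "A {j} {2}" "a {j} {1}" "A {j} {1}"]
    by eventually_elim (simp only: deck_lift_def comp_apply deck_commute[of 2 1])
  have ev: "\<forall>\<^sub>F \<epsilon> in at 0. ?F \<epsilon> - ?F' \<epsilon> = deck 1 (deck 2 (?f \<epsilon> - ?f' \<epsilon>))"
    using 1 2 by eventually_elim (simp only: deck_linear)
  then have ev': "\<forall>\<^sub>F \<epsilon> in at 0. deck 1 (deck 2 (?f \<epsilon> - ?f' \<epsilon>)) = ?F \<epsilon> - ?F' \<epsilon>"
    by eventually_elim simp
  have "deck_relation a A j z \<longleftrightarrow> ord_eps 3 (\<lambda>\<epsilon>. ?F \<epsilon> - ?F' \<epsilon>)"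
    by (simp add: deck_relation_def eq_mod_eps3_iff)
  also have "\<dots> \<longleftrightarrow> ord_eps 3 (\<lambda>\<epsilon>. deck 1 (deck 2 (?f \<epsilon> - ?f' \<epsilon>)))"
    using ord_eps_cong[OF _ ev, of 3] ord_eps_cong[OF _ ev', of 3] by blast
  also have "\<dots> \<longleftrightarrow> ord_eps 3 (\<lambda>\<epsilon>. ?f \<epsilon> - ?f' \<epsilon>)"
    unfolding ord_eps_deck_iff ..
  also have "\<dots> \<longleftrightarrow> L1 z (a {j} {2} z) - pullback 2 (A {j} {1}) z - A {j} {2} z + (1 / 2) *s L1 z (a {j} {1} z) + (1 / 2) *s L2 z (a {j} {2} z)
     = L2 z (a {j} {1} z) - pullback 1 (A {j} {2}) z - A {j} {1} z + (1 / 2) *s L2 z (a {j} {2} z) + (1 / 2) *s L1 z (a {j} {1} z)"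
    by (rule ord_eps_expansion_iff[OF
          tame_exp2_comp[OF op z X pullback_has_derivative[OF Y(1) dz]]
          tame_exp2_comp[OF op z X(2,1) pullback_has_derivative[OF Y(2) dz]]])
       (rule add.commute)
  also have "\<dots> \<longleftrightarrow> (pullback 1 (A {j} {2}) z - A {j} {2} z) - (pullback 2 (A {j} {1}) z - A {j} {1} z)
    = L2 z (a {j} {1} z) - L1 z (a {j} {2} z)" (is "?E = ?E' \<longleftrightarrow> ?G = ?G'")
  proof -
    have "?E - ?E' = ?G - ?G'" by (simp add: algebra_simps)
    then have "(?E - ?E' = 0) = (?G - ?G' = 0)" by (rule arg_cong)
    then show ?thesis by (simp only: right_minus_eq)
  qed
  finally show ?thesis .
qed

text \<open>Only the transition has to be moved across the deck map, so only its second-order datum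
  is pulled back. The first-order fields of the two charts agree at z, which makes the quadratic
  self-terms cancel.\<close>

lemma mixed_relation_iff:
  assumes \<mu>: "\<mu> \<in> {1, 2}" and z: "z \<in> overlap {i, j}"
    and X: "tame (overlap {i, j}) (a {i} {\<mu>}) L" "tame (overlap {i, j}) (a {j} {\<mu>}) L" "a {i} {\<mu>} z = a {j} {\<mu>} z"
    and T: "tame (overlap {i, j}) (a {i, j} {}) LW"
    and Y: "A {j} {\<mu>} \<in> Theta (overlap {j})" "A {i, j} {} \<in> Theta (overlap {i, j})"
  shows "mixed_relation a A \<mu> i j z \<longleftrightarrow>
    A {j} {\<mu>} z - A {i} {\<mu>} z - (pullback \<mu> (A {i, j} {}) z - A {i, j} {} z)
    = L z (a {i, j} {} z) - LW z (a {j} {\<mu>} z)"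
proof -
  have ne: "{i, j} \<noteq> {}" by simp
  note op = open_overlap[OF ne]
  have dz: "deck \<mu> z \<in> overlap {i, j}" using z deck_in_overlap[OF ne] by blast
  have zj: "z \<in> overlap {j}" using z by (auto simp: overlap_def)
  let ?f = "\<lambda>\<epsilon>. exp2 (a {j} {\<mu>}) (A {j} {\<mu>}) \<epsilon> (exp2 (a {i, j} {}) (A {i, j} {}) \<epsilon> z)"
  let ?f' = "\<lambda>\<epsilon>. exp2 (a {i, j} {}) (pullback \<mu> (A {i, j} {})) \<epsilon> (exp2 (a {i} {\<mu>}) (A {i} {\<mu>}) \<epsilon> z)"
  let ?F = "\<lambda>\<epsilon>. (deck_lift a A \<mu> j \<epsilon> \<circ> transition_lift a A i j \<epsilon>) z"
  let ?F' = "\<lambda>\<epsilon>. (transition_lift a A i j \<epsilon> \<circ> deck_lift a A \<mu> i \<epsilon>) z"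
  have 1: "?F \<epsilon> = deck \<mu> (?f \<epsilon>)" for \<epsilon> by (simp add: deck_lift_def transition_lift_def)
  have 2: "\<forall>\<^sub>F \<epsilon> in at 0. ?F' \<epsilon> = deck \<mu> (?f' \<epsilon>)"
    using deck_in_overlap_eventually[OF ne z T \<mu>, of "A {i, j} {}" "a {i} {\<mu>}" "A {i} {\<mu>}"]
    by (simp add: deck_lift_def transition_lift_def)
  have ev: "\<forall>\<^sub>F \<epsilon> in at 0. ?F \<epsilon> - ?F' \<epsilon> = deck \<mu> (?f \<epsilon> - ?f' \<epsilon>)"
    using 2 by eventually_elim (simp only: deck_linear 1)
  then have ev': "\<forall>\<^sub>F \<epsilon> in at 0. deck \<mu> (?f \<epsilon> - ?f' \<epsilon>) = ?F \<epsilon> - ?F' \<epsilon>"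
    by eventually_elim simp
  have "mixed_relation a A \<mu> i j z \<longleftrightarrow> ord_eps 3 (\<lambda>\<epsilon>. ?F \<epsilon> - ?F' \<epsilon>)"
    by (simp add: mixed_relation_def eq_mod_eps3_iff)
  also have "\<dots> \<longleftrightarrow> ord_eps 3 (\<lambda>\<epsilon>. deck \<mu> (?f \<epsilon> - ?f' \<epsilon>))"
    using ord_eps_cong[OF _ ev, of 3] ord_eps_cong[OF _ ev', of 3] by blast
  also have "\<dots> \<longleftrightarrow> ord_eps 3 (\<lambda>\<epsilon>. ?f \<epsilon> - ?f' \<epsilon>)"
    unfolding ord_eps_deck_iff ..
  also have "\<dots> \<longleftrightarrow> L z (a {i, j} {} z) - A {j} {\<mu>} z - A {i, j} {} z + (1 / 2) *s L z (a {j} {\<mu>} z) + (1 / 2) *s LW z (a {i, j} {} z)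
     = LW z (a {i} {\<mu>} z) - pullback \<mu> (A {i, j} {}) z - A {i} {\<mu>} z + (1 / 2) *s LW z (a {i, j} {} z) + (1 / 2) *s L z (a {i} {\<mu>} z)"
    by (rule ord_eps_expansion_iff[OF
          tame_exp2_comp[OF op z X(2) T Theta_has_derivative[OF Y(1) zj]]
          tame_exp2_comp[OF op z T X(1) pullback_has_derivative[OF Y(2) dz]]])
       (simp add: X(3) add.commute)
  also have "\<dots> \<longleftrightarrow> A {j} {\<mu>} z - A {i} {\<mu>} z - (pullback \<mu> (A {i, j} {}) z - A {i, j} {} z)
    = L z (a {i, j} {} z) - LW z (a {j} {\<mu>} z)"
    unfolding X(3) by (auto simp: algebra_simps)
  finally show ?thesis .
qed

text \<open>The hypotheses \<open>L\<close> remove every derivative term, as will be the case for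
  multiples of W, and what is left is the Cech differential of the second-order data.\<close>

lemma triple_relation_iff:
  assumes z: "z \<in> overlap {i, j, k}"
    and T: "tame (overlap {i, j, k}) (a {i, j} {}) L1" "tame (overlap {i, j, k}) (a {j, k} {}) L2"
      "tame (overlap {i, j, k}) (a {i, k} {}) L3"
    and L: "L2 z (a {i, j} {} z) = 0" "L1 z (a {i, j} {} z) = 0" "L2 z (a {j, k} {} z) = 0" "L3 z (a {i, k} {} z) = 0"
    and first: "a {j, k} {} z + a {i, j} {} z = a {i, k} {} z"
    and Y: "A {j, k} {} \<in> Theta (overlap {j, k})"
  shows "triple_relation a A i j k z \<longleftrightarrow> A {j, k} {} z - A {i, k} {} z + A {i, j} {} z = 0"
proof -
  have ne: "{i, j, k} \<noteq> {}" by simp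
  note op = open_overlap[OF ne]
  have zjk: "z \<in> overlap {j, k}" using z by (auto simp: overlap_def)
  have 2: "ord_eps 3 (\<lambda>\<epsilon>. transition_lift a A i k \<epsilon> z - (z - \<epsilon> *s a {i, k} {} z + \<epsilon>\<^sup>2 *s (- A {i, k} {} z)))"
    by (rule ord_epsI[of _ 0]) (simp add: transition_lift_def exp2_def tameD(5)[OF T(3) z] L)
  have "triple_relation a A i j k z \<longleftrightarrow>
     ord_eps 3 (\<lambda>\<epsilon>. exp2 (a {j, k} {}) (A {j, k} {}) \<epsilon> (exp2 (a {i, j} {}) (A {i, j} {}) \<epsilon> z) - transition_lift a A i k \<epsilon> z)"
    by (simp add: triple_relation_def eq_mod_eps3_iff transition_lift_def)
  also have "\<dots> \<longleftrightarrow> L2 z (a {i, j} {} z) - A {j, k} {} z - A {i, j} {} z + (1 / 2) *s L2 z (a {j, k} {} z) + (1 / 2) *s L1 z (a {i, j} {} z)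
     = - A {i, k} {} z"
    by (rule ord_eps_expansion_iff[OF
          tame_exp2_comp[OF op z T(2,1) Theta_has_derivative[OF Y zjk]] 2 first])
  also have "\<dots> \<longleftrightarrow> A {j, k} {} z - A {i, k} {} z + A {i, j} {} z = 0"
  proof -
    have "A {j, k} {} z - A {i, k} {} z + A {i, j} {} z
      = - (L2 z (a {i, j} {} z) - A {j, k} {} z - A {i, j} {} z + (1 / 2) *s L2 z (a {j, k} {} z)
        + (1 / 2) *s L1 z (a {i, j} {} z) - - A {i, k} {} z)"
      unfolding L by simp
    then show ?thesis by (simp only: neg_equal_0_iff_equal right_minus_eq)
  qed
  finally show ?thesis .
qed

section \<open>The total differential in total degree two\<close>

lemma d_tot_nth:
  assumes "index_pair I K" "z \<in> overlap I"
  shows "d_tot c I K z $ k = cech (\<lambda>I. c I K z $ k) I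
    + (-1) ^ (card I - 1) * (\<Sum>\<mu>\<in>K. pos_sign \<mu> K * (pullback \<mu> (c I (K - {\<mu>})) z $ k - c I (K - {\<mu>}) z $ k))"
  using assms by (simp add: d_tot_def pos_sign_def cech_def right_diff_distrib)

lemma d_tot_deck:
  assumes c: "c \<in> cochains" and j: "j \<in> {1..4}" and z: "z \<in> overlap {j}"
  shows "d_tot c {j} {1, 2} z = (pullback 1 (c {j} {2}) z - c {j} {2} z) - (pullback 2 (c {j} {1}) z - c {j} {1} z)"
proof -
  have ip: "index_pair {j} {1, 2}" using j by (simp add: index_pair_def)
  have c0: "c {} K = 0" for K by (rule cochains_zero[OF c]) (simp add: index_pair_def)
  have s: "{1, 2} - {1} = {2 :: nat}" "{1, 2} - {2} = {1 :: nat}" by auto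
  have two: "(\<Sum>\<mu>\<in>{1, 2}. f \<mu>) = f 1 + f 2" for f :: "nat \<Rightarrow> complex" by simp
  have "cech (\<lambda>I. c I {1, 2} z $ k) {j} = 0" for k by (simp add: cech_def c0)
  then show ?thesis
    unfolding vec_eq_iff d_tot_nth[OF ip z] two s by simp
qed

lemma d_tot_mixed:
  assumes ij: "i \<in> {1..4}" "j \<in> {1..4}" "i < j" and \<mu>: "\<mu> \<in> {1, 2}" and z: "z \<in> overlap {i, j}"
  shows "d_tot c {i, j} {\<mu>} z = c {j} {\<mu>} z - c {i} {\<mu>} z - (pullback \<mu> (c {i, j} {}) z - c {i, j} {} z)"
proof -
  have ip: "index_pair {i, j} {\<mu>}" using ij \<mu> by (auto simp: index_pair_def)
  show ?thesis using ij(3)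
    by (simp add: vec_eq_iff d_tot_nth[OF ip z] cech_pair)
qed

lemma d_tot_triple:
  assumes ijk: "i \<in> {1..4}" "j \<in> {1..4}" "k \<in> {1..4}" "i < j" "j < k" and z: "z \<in> overlap {i, j, k}"
  shows "d_tot c {i, j, k} {} z = c {j, k} {} z - c {i, k} {} z + c {i, j} {} z"
proof -
  have ip: "index_pair {i, j, k} {}" using ijk by (auto simp: index_pair_def)
  show ?thesis using ijk(4,5)
    by (simp add: vec_eq_iff d_tot_nth[OF ip z] cech_triple)
qed

lemma d_tot_degree:
  assumes c: "c \<in> cochains_deg p" and "card I + card K \<noteq> p + 2"
  shows "d_tot c I K = 0"
proof (cases "index_pair I K")
  case True
  have K: "finite K" using True by (auto simp: index_pair_def intro: finite_subset)
  have I: "finite I" using True by (rule finite_index_pair)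
  have z: "c I' K' = 0" if "card I' + card K' \<noteq> p + 1" for I' K'
    using c that by (simp add: cochains_deg_def)
  have 1: "c (I - {i}) K = 0" if "i \<in> I" for i
  proof (rule z)
    have "Suc (card (I - {i})) = card I" by (rule card_Suc_Diff1[OF I that])
    with assms(2) show "card (I - {i}) + card K \<noteq> p + 1" by linarith
  qed
  have 2: "c I (K - {\<mu>}) = 0" if "\<mu> \<in> K" for \<mu>
  proof (rule z)
    have "Suc (card (K - {\<mu>})) = card K" by (rule card_Suc_Diff1[OF K that])
    with assms(2) show "card I + card (K - {\<mu>}) \<noteq> p + 1" by linarith
  qed
  have pb: "pullback \<mu> 0 z = 0" for \<mu> z by (simp add: pullback_def inv_deck_def vec_eq_iff)
  have "(\<Sum>i\<in>I. (-1) ^ card {j \<in> I. j < i} *s c (I - {i}) K z) = 0" for z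
    by (rule sum.neutral) (simp add: 1)
  moreover have "(\<Sum>\<mu>\<in>K. (-1) ^ card {\<nu> \<in> K. \<nu> < \<mu>} *s (pullback \<mu> (c I (K - {\<mu>})) z - c I (K - {\<mu>}) z)) = 0" for z
    by (rule sum.neutral) (simp add: 2 pb)
  ultimately show ?thesis unfolding d_tot_def by (intro ext) simp
qed (simp add: d_tot_def fun_eq_iff)

lemma degree_two_cases:
  assumes "index_pair I K" "card I + card K = 3"
  obtains j where "j \<in> {1..4}" "I = {j}" "K = {1, 2}"
  | i j \<mu> where "i \<in> {1..4}" "j \<in> {1..4}" "i < j" "\<mu> \<in> {1, 2}" "I = {i, j}" "K = {\<mu>}"
  | i j k where "i \<in> {1..4}" "j \<in> {1..4}" "k \<in> {1..4}" "i < j" "j < k" "I = {i, j, k}" "K = {}"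
proof -
  note cases = that
  have I: "I \<subseteq> {1..4}" "I \<noteq> {}" and K: "K \<subseteq> {1, 2}" using assms(1) by (simp_all add: index_pair_def)
  have K0: "K = {}" if "card K = 0" using that finite_subset[OF K] by (simp add: card_eq_0_iff)
  have K2: "K = {1, 2}" if "card K = 2"
    using K that by (intro card_subset_eq) simp_all
  have K1: "\<exists>\<mu>\<in>{1, 2}. K = {\<mu>}" if "card K = 1"
  proof -
    obtain \<mu> where "K = {\<mu>}" using \<open>card K = 1\<close> by (rule card_1_singletonE)
    then show ?thesis using K by auto
  qed
  have single: thesis if "a \<in> {1..4}" "I = {a}" for a
  proof -
    have "K = {1, 2}" using assms(2) by (intro K2) (simp add: that(2))
    with \<open>a \<in> {1..4}\<close> \<open>I = {a}\<close> show thesis by (rule cases(1))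
  qed
  have pair: thesis if ab: "a \<in> {1..4}" "b \<in> {1..4}" "a < b" "I = {a, b}" for a b
  proof -
    have "card K = 1" using assms(2) ab(3) by (simp add: ab(4))
    from K1[OF this] obtain \<mu> where "\<mu> \<in> {1, 2}" "K = {\<mu>}" by (rule bexE)
    then show thesis by (intro cases(2)[OF ab(1-3) _ ab(4)])
  qed
  have triple: thesis if abc: "a \<in> {1..4}" "b \<in> {1..4}" "c \<in> {1..4}" "a < b" "b < c" "I = {a, b, c}" for a b c
  proof -
    have "K = {}" using assms(2) abc(4,5) by (intro K0) (simp add: abc(6))
    then show thesis by (intro cases(3)[OF abc])
  qed
  from subset_1234_cases[OF I] show ?thesis
  proof (elim disjE)
    assume "I \<in> {{1}, {2}, {3}, {4}}"
    then show ?thesis unfolding insert_iff empty_iff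
      by (elim disjE FalseE) (rule single[rotated], assumption, simp)+
  next
    assume "I \<in> {{1, 2}, {1, 3}, {1, 4}, {2, 3}, {2, 4}, {3, 4}}"
    then show ?thesis unfolding insert_iff empty_iff
      by (elim disjE FalseE) (rule pair[rotated 3], assumption, simp, simp, simp)+
  next
    assume "I \<in> {{1, 2, 3}, {1, 2, 4}, {1, 3, 4}, {2, 3, 4}}"
    then show ?thesis unfolding insert_iff empty_iff
      by (elim disjE FalseE) (rule triple[rotated 5], assumption, simp, simp, simp, simp, simp)+
  next
    assume "I = {1, 2, 3, 4}"
    then show ?thesis using assms(2) by simp
  qed
qed

section \<open>Derivatives of the fields and their brackets\<close>

lemma cdiff_component:
  assumes "(V has_derivative L) (at z)" "\<And>c h. L (c *s h) = c *s L h"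
  shows "cdiff (\<lambda>z. V z $ k) z"
  unfolding cdiff_def
proof (intro exI conjI allI)
  show "((\<lambda>z. V z $ k) has_derivative (\<lambda>h. L h $ k)) (at z)"
    by (rule bounded_linear.has_derivative[OF bounded_linear_vec_nth assms(1)])
  show "L (c *s h) $ k = c * L h $ k" for c h by (simp add: assms(2))
qed

lemma cdiff_normal_field: "z \<in> UU \<Longrightarrow> cdiff (\<lambda>z. normal_field M b c p z $ k) z"
  using cdiff_component[OF has_derivative_normal_field dnormal_scale] .

lemma cdiff_WW: "z $ 1 \<noteq> 0 \<Longrightarrow> z $ 3 \<noteq> 0 \<Longrightarrow> cdiff (\<lambda>z. WW z $ k) z"
  using cdiff_component[OF has_derivative_WW dWW_scale] .

lemma dnormal_nth:
  "dnormal M b c p z h $ 1 = M $ 1 $ 1 * h $ 1 + M $ 1 $ 2 * h $ 3"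
  "dnormal M b c p z h $ 2 = b * h $ 2"
  "dnormal M b c p z h $ 3 = M $ 2 $ 1 * h $ 1 + M $ 2 $ 2 * h $ 3"
  "dnormal M b c p z h $ 4 =
     c * h $ 4 + (p $ 1 * (z $ 1 * z $ 1) + p $ 2 * (z $ 1 * z $ 3) + p $ 3 * (z $ 3 * z $ 3)) * h $ 2
       + (p $ 1 * (2 * (z $ 1 * h $ 1)) + p $ 2 * (z $ 1 * h $ 3 + h $ 1 * z $ 3) + p $ 3 * (2 * (z $ 3 * h $ 3))) * z $ 2"
  by (simp_all add: dnormal_def vector_4 power2_eq_square mult.assoc)

lemma cdiff_dnormal:
  assumes "\<And>k. cdiff (\<lambda>z. V z $ k) z"
  shows "cdiff (\<lambda>z. dnormal M b c p z (V z) $ k) z"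
proof -
  have "k = 1 \<or> k = 2 \<or> k = 3 \<or> k = 4" using exhaust_4[of k] by blast
  then show ?thesis
    by (elim disjE) (simp_all only: dnormal_nth, (intro cdiff_const cdiff_nth cdiff_add cdiff_mult assms)+)
qed

lemma cdiff_has_derivative:
  fixes V :: vfield
  assumes "\<And>k. cdiff (\<lambda>z. V z $ k) z"
  shows "\<exists>L. (V has_derivative L) (at z)"
proof -
  have "\<forall>k. \<exists>L. ((\<lambda>z. V z $ k) has_derivative L) (at z)" using assms unfolding cdiff_def by blast
  then obtain L where L: "\<And>k. ((\<lambda>z. V z $ k) has_derivative L k) (at z)" by metis
  have "((\<lambda>z. \<chi> k. V z $ k) has_derivative (\<lambda>h. \<chi> k. L k h)) (at z)"
    by (rule has_derivative_vec_lambda[OF L])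
  then show ?thesis by auto
qed

lemma has_derivative_restrict:
  assumes "(V has_derivative L) (at z)" "open U" "z \<in> U"
  shows "(restrict_vf U V has_derivative L) (at z)"
  by (rule has_derivative_transform_within_open[OF assms]) (simp add: restrict_vf_def)

lemma tame_normal_field:
  assumes "I \<noteq> {}"
  shows "tame (overlap I) (restrict_vf (overlap I) (normal_field M b c p)) (dnormal M b c p)"
  unfolding tame_def
proof (intro ballI conjI allI)
  fix w assume w: "w \<in> overlap I"
  note op = open_overlap[OF assms]
  have U: "w \<in> UU" using w overlap_subset_UU by blast
  show "(restrict_vf (overlap I) (normal_field M b c p) has_derivative dnormal M b c p w) (at w)"
    by (rule has_derivative_restrict[OF has_derivative_normal_field[OF U] op w])
  show "dnormal M b c p w (r *s h) = r *s dnormal M b c p w h" for r h by (rule dnormal_scale)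
  obtain D where "((\<lambda>w. dnormal M b c p w (normal_field M b c p w)) has_derivative D) (at w)"
    using cdiff_has_derivative[OF cdiff_dnormal[OF cdiff_normal_field[OF U]]] by blast
  then have "((\<lambda>w. dnormal M b c p w (restrict_vf (overlap I) (normal_field M b c p) w)) has_derivative D) (at w)"
    by (rule has_derivative_transform_within_open[OF _ op w]) (simp add: restrict_vf_def)
  then show "\<exists>D. ((\<lambda>w. dnormal M b c p w (restrict_vf (overlap I) (normal_field M b c p) w)) has_derivative D) (at w)"
    by blast
  fix \<mu> :: nat assume \<mu>: "\<mu> \<in> {1, 2}"
  have "pullback \<mu> (normal_field M b c p) = normal_field M b c p"
    using normal_field_global[of M b c p] \<mu> unfolding global_fields_def by blast
  from fun_cong[OF this, of w] have "normal_field M b c p (deck \<mu> w) = deck \<mu> (normal_field M b c p w)"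
    unfolding pullback_def by (metis inv_deck_deck(2))
  then show "restrict_vf (overlap I) (normal_field M b c p) (deck \<mu> w)
    = deck \<mu> (restrict_vf (overlap I) (normal_field M b c p) w)"
    using w by (simp add: restrict_vf_def deck_in_overlap[OF assms])
qed

lemma WW_4: "WW z $ 1 = 0" "WW z $ 2 = z $ 4 / (z $ 1 * z $ 3)" "WW z $ 3 = 0" "WW z $ 4 = 0"
  by (simp_all add: WW_def vector_4)

lemma dWW_4: "dWW z h $ 1 = 0" "dWW z h $ 3 = 0" "dWW z h $ 4 = 0"
  "dWW z h $ 2 = h $ 4 / (z $ 1 * z $ 3) - z $ 4 * h $ 1 / (z $ 1 ^ 2 * z $ 3) - z $ 4 * h $ 3 / (z $ 1 * z $ 3 ^ 2)"
  by (simp_all add: dWW_def vector_4)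

text \<open>W points in the direction of u while its coefficient does not involve u, so W is
  constant along its own flow and the exponential of W has no quadratic term.\<close>

lemma dWW_scaled_WW: "dWW z (t *s WW w) = 0"
  by (simp add: vec_eq_iff forall_4 dWW_4 WW_4)

lemma deck_nth: "deck \<mu> z $ i = q0 ^ (deck_weight \<mu> $ i) * z $ i"
  by (simp add: deck_def)

lemma WW_deck: "\<mu> \<in> {1, 2} \<Longrightarrow> WW (deck \<mu> w) = deck \<mu> (WW w)"
  by (auto simp: vec_eq_iff forall_4 WW_4 deck_nth power2_eq_square)

lemma tame_WW:
  assumes I: "I \<noteq> {}" and t: "t = 0 \<or> {1, 3} \<subseteq> inverted I"
  shows "tame (overlap I) (restrict_vf (overlap I) (\<lambda>z. t *s WW z)) (\<lambda>z h. t *s dWW z h)"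
  unfolding tame_def
proof (intro ballI conjI allI)
  fix w assume w: "w \<in> overlap I"
  note op = open_overlap[OF I]
  show "(restrict_vf (overlap I) (\<lambda>z. t *s WW z) has_derivative (\<lambda>h. t *s dWW w h)) (at w)"
  proof (cases "t = 0")
    case True
    have "(restrict_vf (overlap I) (\<lambda>z. t *s WW z)) = (\<lambda>z. 0)" by (simp add: restrict_vf_def True fun_eq_iff)
    then show ?thesis by (simp add: True)
  next
    case False
    then have "w $ 1 \<noteq> 0" "w $ 3 \<noteq> 0"
      using w t by (auto simp: overlap_eq_nzdom[OF I] nzdom_def)
    from bounded_linear.has_derivative[OF bounded_linear_vec_scale has_derivative_WW[OF this]]
    show ?thesis by (rule has_derivative_restrict[OF _ op w])
  qed
  show "t *s dWW w (c *s h) = c *s (t *s dWW w h)" for c h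
    by (simp add: dWW_scale vec_eq_iff mult_ac)
  have "(\<lambda>w. t *s dWW w (restrict_vf (overlap I) (\<lambda>z. t *s WW z) w)) = (\<lambda>w. 0)"
  proof
    fix w
    have "dWW w 0 = 0" using dWW_scaled_WW[of w 0] by simp
    then show "t *s dWW w (restrict_vf (overlap I) (\<lambda>z. t *s WW z) w) = 0"
      by (simp add: restrict_vf_def dWW_scaled_WW)
  qed
  then show "\<exists>D. ((\<lambda>w. t *s dWW w (restrict_vf (overlap I) (\<lambda>z. t *s WW z) w)) has_derivative D) (at w)"
    using has_derivative_const by metis
  fix \<mu> :: nat assume \<mu>: "\<mu> \<in> {1, 2}"
  show "restrict_vf (overlap I) (\<lambda>z. t *s WW z) (deck \<mu> w) = deck \<mu> (restrict_vf (overlap I) (\<lambda>z. t *s WW z) w)"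
    using w by (simp add: restrict_vf_def deck_in_overlap[OF I] WW_deck[OF \<mu>] deck_linear)
qed

section \<open>Brackets of normal fields with each other and with W\<close>

lemma lie_bracket_normal_field:
  assumes "z \<in> UU"
  shows "lie_bracket (normal_field M b c p) (normal_field M' b' c' p') z
    = dnormal M' b' c' p' z (normal_field M b c p z) - dnormal M b c p z (normal_field M' b' c' p' z)"
  using assms frechet_derivative_at[OF has_derivative_normal_field[OF assms], symmetric]
  by (simp add: lie_bracket_def restrict_vf_def)

text \<open>The coefficients of the derivative of the quadratic polynomial p along the linear field
  of M.\<close>

definition bracket_poly :: "complex ^ 2 ^ 2 \<Rightarrow> complex ^ 3 \<Rightarrow> complex ^ 3" where
  "bracket_poly M p = vector [2 * p $ 1 * M $ 1 $ 1 + p $ 2 * M $ 2 $ 1,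
     2 * p $ 1 * M $ 1 $ 2 + p $ 2 * (M $ 1 $ 1 + M $ 2 $ 2) + 2 * p $ 3 * M $ 2 $ 1,
     p $ 2 * M $ 1 $ 2 + 2 * p $ 3 * M $ 2 $ 2]"

text \<open>With the convention DW(V) - DV(W) the linear parts give M'M - MM'. The diagonal
  coefficients of u and v commute, and they act on the quadratic part through c - b.\<close>

lemma lie_bracket_normal_form:
  "lie_bracket (normal_field M b c p) (normal_field M' b' c' p')
    = normal_field (M' ** M - M ** M') 0 0
        ((c' - b') *s p - (c - b) *s p' + bracket_poly M p' - bracket_poly M' p)"
proof
  fix z
  show "lie_bracket (normal_field M b c p) (normal_field M' b' c' p') z
    = normal_field (M' ** M - M ** M') 0 0
        ((c' - b') *s p - (c - b) *s p' + bracket_poly M p' - bracket_poly M' p) z"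
  proof (cases "z \<in> UU")
    case True
    show ?thesis
      unfolding lie_bracket_normal_field[OF True] vec_eq_iff forall_4 vector_minus_component
        dnormal_nth normal_field_nth[OF True]
      by (simp add: matrix_matrix_mult_def sum_2 bracket_poly_def algebra_simps power2_eq_square)
  next
    case False
    then show ?thesis by (simp add: lie_bracket_def restrict_vf_def normal_field_outside)
  qed
qed

lemma lie_bracket_global:
  assumes "V \<in> global_fields" "W \<in> global_fields"
  shows "lie_bracket V W \<in> global_fields"
proof -
  obtain M b c p where V: "V = normal_field M b c p" using global_field_normal_form[OF assms(1)] .
  obtain M' b' c' p' where W: "W = normal_field M' b' c' p'" using global_field_normal_form[OF assms(2)] .
  show ?thesis unfolding V W lie_bracket_normal_form by (rule normal_field_global)
qed

text \<open>Comes from splitting P/(xy) = p_1 x/y + p_2 + p_3 y/x by its poles; the pole-free p_2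
  part is placed here. Products with \<open>inverse\<close> instead of quotients fit the closure
  rules for \<open>cdiff\<close>.\<close>

definition remainder_x :: "complex ^ 2 ^ 2 \<Rightarrow> complex ^ 3 \<Rightarrow> vfield" where
  "remainder_x M p z = vector [0,
     M $ 1 $ 2 * (z $ 4 * (inverse (z $ 1) * inverse (z $ 1))) + (- p $ 2 * z $ 2 + - p $ 3 * (z $ 3 * (inverse (z $ 1) * z $ 2))),
     0, p $ 2 * z $ 4 + p $ 3 * (z $ 3 * (inverse (z $ 1) * z $ 4))]"

definition remainder_y :: "complex ^ 2 ^ 2 \<Rightarrow> complex ^ 3 \<Rightarrow> vfield" where
  "remainder_y M p z = vector [0,
     M $ 2 $ 1 * (z $ 4 * (inverse (z $ 3) * inverse (z $ 3))) + - p $ 1 * (z $ 1 * (inverse (z $ 3) * z $ 2)),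
     0, p $ 1 * (z $ 1 * (inverse (z $ 3) * z $ 4))]"

lemma remainder_nth:
  "remainder_x M p z $ 1 = 0" "remainder_x M p z $ 3 = 0"
  "remainder_x M p z $ 2 = M $ 1 $ 2 * (z $ 4 * (inverse (z $ 1) * inverse (z $ 1))) + (- p $ 2 * z $ 2 + - p $ 3 * (z $ 3 * (inverse (z $ 1) * z $ 2)))"
  "remainder_x M p z $ 4 = p $ 2 * z $ 4 + p $ 3 * (z $ 3 * (inverse (z $ 1) * z $ 4))"
  "remainder_y M p z $ 1 = 0" "remainder_y M p z $ 3 = 0"
  "remainder_y M p z $ 2 = M $ 2 $ 1 * (z $ 4 * (inverse (z $ 3) * inverse (z $ 3))) + - p $ 1 * (z $ 1 * (inverse (z $ 3) * z $ 2))"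
  "remainder_y M p z $ 4 = p $ 1 * (z $ 1 * (inverse (z $ 3) * z $ 4))"
  by (simp_all add: remainder_x_def remainder_y_def vector_4)

lemma cdiff_remainder_x: "z $ 1 \<noteq> 0 \<Longrightarrow> cdiff (\<lambda>z. remainder_x M p z $ k) z"
proof -
  assume z: "z $ 1 \<noteq> 0"
  have "k = 1 \<or> k = 2 \<or> k = 3 \<or> k = 4" using exhaust_4[of k] by blast
  then show ?thesis
    by (elim disjE) (simp_all only: remainder_nth, (intro cdiff_const cdiff_nth cdiff_add cdiff_mult cdiff_inverse z)+)
qed

lemma cdiff_remainder_y: "z $ 3 \<noteq> 0 \<Longrightarrow> cdiff (\<lambda>z. remainder_y M p z $ k) z"
proof -
  assume z: "z $ 3 \<noteq> 0"
  have "k = 1 \<or> k = 2 \<or> k = 3 \<or> k = 4" using exhaust_4[of k] by blast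
  then show ?thesis
    by (elim disjE) (simp_all only: remainder_nth, (intro cdiff_const cdiff_nth cdiff_add cdiff_mult cdiff_inverse z)+)
qed

text \<open>All monomials in the two remainders have weight zero under both generators.\<close>

lemma remainder_deck:
  assumes "\<mu> \<in> {1, 2}"
  shows "remainder_x M p (deck \<mu> z) = deck \<mu> (remainder_x M p z)"
    "remainder_y M p (deck \<mu> z) = deck \<mu> (remainder_y M p z)"
proof -
  have "\<mu> = 1 \<or> \<mu> = 2" using assms by blast
  then show "remainder_x M p (deck \<mu> z) = deck \<mu> (remainder_x M p z)"
    "remainder_y M p (deck \<mu> z) = deck \<mu> (remainder_y M p z)"
    by (elim disjE; simp add: vec_eq_iff forall_4 remainder_nth deck_nth field_simps power2_eq_square)+
qed

text \<open>The multiples of W collect b from DV(W), - c from the derivative of v and tr M from the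
  derivative of 1/(xy), in total - ell. The off-diagonal entries of M raise one pole to second order
  and cancel the other; the quadratic part P contributes the remaining terms.\<close>

lemma bracket_WW:
  assumes z: "z \<in> UU" "z $ 1 \<noteq> 0" "z $ 3 \<noteq> 0"
  shows "dnormal M b c p z (WW z) - dWW z (normal_field M b c p z)
    = (- ell (normal_field M b c p)) *s WW z + remainder_x M p z + remainder_y M p z"
  unfolding vec_eq_iff forall_4 vector_minus_component vector_add_component vector_smult_component
    dnormal_nth dWW_4 WW_4 remainder_nth normal_field_nth[OF z(1)] ell_normal_field
  using z(2,3) by (simp add: trace_def sum_2 field_simps power2_eq_square)

section \<open>Second-order lifts as cochains\<close>

definition const_cochain :: "(nat set \<Rightarrow> nat set \<Rightarrow> point) \<Rightarrow> cochain" where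
  "const_cochain v = (\<lambda>I K. if index_pair I K \<and> card I + card K = 2 then restrict_vf (overlap I) (\<lambda>_. v I K) else 0)"

lemma const_cochain_cochains: "const_cochain v \<in> cochains_deg 1"
proof -
  have "restrict_vf (overlap I) (\<lambda>_. v I K) \<in> Theta (overlap I)" if "index_pair I K" for I K
  proof (rule Theta_if_cdiff)
    show "open (overlap I)" using that by (intro open_overlap) (simp add: index_pair_def)
    show "cdiff (\<lambda>z. v I K $ k) z" for z k by (rule cdiff_const)
  qed
  then show ?thesis
    by (simp add: cochains_deg_def cochains_def const_cochain_def zero_in_Theta)
qed

lemma const_cochain_single:
  assumes "j \<in> {1..4}" "\<mu> \<in> {1, 2}" "z \<in> overlap {j}"
  shows "const_cochain v {j} {\<mu>} z = v {j} {\<mu>}"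
  using assms by (auto simp: const_cochain_def index_pair_def restrict_vf_def)

lemma const_cochain_pair:
  assumes "i \<in> {1..4}" "j \<in> {1..4}" "i < j" "z \<in> overlap {i, j}"
  shows "const_cochain v {i, j} {} z = v {i, j} {}"
  using assms by (simp add: const_cochain_def index_pair_def restrict_vf_def)

lemma q0_power_neq_1: "n \<noteq> 0 \<Longrightarrow> q0 ^ n \<noteq> 1"
proof
  assume n: "n \<noteq> 0" and q: "q0 ^ n = 1"
  have "1 / 2 \<le> norm (q0 powi int n - 1)" by (rule norm_q0_powi_minus_1_ge) (use n in simp)
  with q show False by simp
qed

lemma inv_deck_nth: "inv_deck \<mu> w $ i = w $ i / q0 ^ (deck_weight \<mu> $ i)"
  by (simp add: inv_deck_def)

text \<open>Constant fields suffice to prescribe the value of the differential at one point and one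
  index. This is what separates obstruction cochains, which are tested against all second-order
  data.\<close>

lemma d_tot_degree_two_onto:
  assumes IK: "index_pair I K" "card I + card K = 3" and z: "z \<in> overlap I"
  obtains A where "A \<in> cochains_deg 1" "d_tot A I K z = y"
  using IK
proof (cases rule: degree_two_cases)
  case (1 j)
  \<comment> \<open>The factor by which \<open>pullback - 1\<close> acts on a constant coordinate
    field of weight n. Generator 1 has nonzero weights on x, y and v, so these components are
    reached from \<open>v2\<close>; u needs generator 2 and enters through \<open>v1\<close> with
    the opposite sign.\<close>
  define r :: "nat \<Rightarrow> complex" where "r n = 1 / q0 ^ n - 1" for n
  define v1 :: point where "v1 = vector [0, - y $ 2 / r 1, 0, 0]"
  define v2 :: point where "v2 = vector [y $ 1 / r 1, 0, y $ 3 / r 1, y $ 4 / r 2]"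
  define A where "A = const_cochain (\<lambda>I K. if K = {1} then v1 else v2)"
  have A: "A \<in> cochains_deg 1" unfolding A_def by (rule const_cochain_cochains)
  have zj: "z \<in> overlap {j}" "\<And>\<mu>. deck \<mu> z \<in> overlap {j}" using z 1(2) by (simp_all add: deck_in_overlap)
  have val: "A {j} {1} w = v1" "A {j} {2} w = v2" if "w \<in> overlap {j}" for w
    using const_cochain_single[OF 1(1) _ that] by (simp_all add: A_def)
  have q: "r 1 \<noteq> 0" "r 2 \<noteq> 0" "r 0 = 0"
    using q0_power_neq_1[of 1] q0_power_neq_1[of 2] by (auto simp: r_def)
  have e: "x / q0 ^ n - x = x * r n" for x n by (simp add: r_def algebra_simps)
  have "d_tot A {j} {1, 2} z = (inv_deck 1 v2 - v2) - (inv_deck 2 v1 - v1)"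
    using A by (subst d_tot_deck[OF _ 1(1) zj(1)]) (simp_all add: cochains_deg_def pullback_def val zj)
  also have "\<dots> = y"
    unfolding vec_eq_iff forall_4 vector_minus_component inv_deck_nth deck_weight_nth e
    using q by (simp add: v1_def v2_def vector_4)
  finally show thesis using that[OF A] 1(2,3) by simp
next
  case (2 i j \<mu>)
  define A where "A = const_cochain (\<lambda>I K. if I = {j} then y else 0)"
  have A: "A \<in> cochains_deg 1" unfolding A_def by (rule const_cochain_cochains)
  have zij: "z \<in> overlap {i, j}" "deck \<mu> z \<in> overlap {i, j}" using z 2(5) by (simp_all add: deck_in_overlap)
  have zi: "z \<in> overlap {i}" and zj: "z \<in> overlap {j}" using zij(1) by (auto simp: overlap_def)
  have ne: "{i, j} \<noteq> {j}" "i \<noteq> j" using 2(3) by auto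
  have "A {i, j} {} w = 0" if "w \<in> overlap {i, j}" for w
    unfolding A_def const_cochain_pair[OF 2(1-3) that] using ne by simp
  moreover have "A {j} {\<mu>} z = y" "A {i} {\<mu>} z = 0"
    unfolding A_def const_cochain_single[OF 2(2,4) zj] const_cochain_single[OF 2(1,4) zi] using ne by simp_all
  ultimately have "d_tot A {i, j} {\<mu>} z = y"
    unfolding d_tot_mixed[OF 2(1-4) zij(1)] by (simp add: pullback_def zij inv_deck_def vec_eq_iff)
  then show thesis using that[OF A] 2(5,6) by simp
next
  case (3 i j k)
  define A where "A = const_cochain (\<lambda>I K. if I = {j, k} then y else 0)"
  have A: "A \<in> cochains_deg 1" unfolding A_def by (rule const_cochain_cochains)
  have zz: "z \<in> overlap {i, j, k}" using z 3(6) by simp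
  have z2: "z \<in> overlap {i, j}" "z \<in> overlap {j, k}" "z \<in> overlap {i, k}" using zz by (auto simp: overlap_def)
  have ik: "i < k" using 3(4,5) by simp
  have ne: "{i, k} \<noteq> {j, k}" "{i, j} \<noteq> {j, k}" using 3(4,5) by (auto simp: doubleton_eq_iff)
  have "A {j, k} {} z = y" "A {i, k} {} z = 0" "A {i, j} {} z = 0"
    unfolding A_def const_cochain_pair[OF 3(2,3,5) z2(2)] const_cochain_pair[OF 3(1,3) ik z2(3)]
      const_cochain_pair[OF 3(1,2,4) z2(1)] using ne by simp_all
  then have "d_tot A {i, j, k} {} z = y"
    unfolding d_tot_triple[OF 3(1-5) zz] by simp
  then show thesis using that[OF A] 3(6,7) by simp
qed

lemma cochains_outside:
  assumes c: "c \<in> cochains" and "\<not> (index_pair I K \<and> z \<in> overlap I)"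
  shows "c I K z = 0"
proof (cases "index_pair I K")
  case True
  then have "c I K \<in> Theta (overlap I)" using c by (simp add: cochains_def)
  then show ?thesis using True assms(2) by (simp add: Theta_def)
qed (simp add: cochains_zero[OF c])

lemma cochain_eqI:
  assumes "c \<in> cochains_deg p" "e \<in> cochains_deg p"
    and "\<And>I K z. index_pair I K \<Longrightarrow> card I + card K = p + 1 \<Longrightarrow> z \<in> overlap I \<Longrightarrow> c I K z = e I K z"
  shows "c = e"
proof (intro ext)
  fix I K z
  show "c I K z = e I K z"
  proof (cases "index_pair I K \<and> card I + card K = p + 1")
    case True
    then have "c I K \<in> Theta (overlap I)" "e I K \<in> Theta (overlap I)"
      using assms(1,2) by (simp_all add: cochains_deg_def cochains_def)
    then show ?thesis using True assms(3)[of I K z] by (cases "z \<in> overlap I") (simp_all add: Theta_def)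
  next
    case False
    then have "c I K = 0" "e I K = 0"
      using assms(1,2) unfolding cochains_deg_def cochains_def by auto
    then show ?thesis by simp
  qed
qed

section \<open>Uniqueness of the obstruction cochain and existence of lifts\<close>

definition second_order_data :: "cochain \<Rightarrow> cochain \<Rightarrow> bool" where
  "second_order_data a A \<longleftrightarrow>
     (\<forall>j\<in>{1..4}. \<forall>z\<in>overlap {j}. deck_relation a A j z) \<and>
     (\<forall>\<mu>\<in>{1, 2}. \<forall>i\<in>{1..4}. \<forall>j\<in>{1..4}. i < j \<longrightarrow>
        (\<forall>z\<in>overlap {i, j}. mixed_relation a A \<mu> i j z)) \<and>
     (\<forall>i\<in>{1..4}. \<forall>j\<in>{1..4}. \<forall>k\<in>{1..4}. i < j \<and> j < k \<longrightarrow>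
        (\<forall>z\<in>overlap {i, j, k}. triple_relation a A i j k z))"

lemma obstruction_cochainD:
  assumes "obstruction_cochain a Ob" "A \<in> cochains_deg 1"
  shows "j \<in> {1..4} \<Longrightarrow> z \<in> overlap {j} \<Longrightarrow>
      deck_relation a A j z \<longleftrightarrow> d_tot A {j} {1, 2} z = Ob {j} {1, 2} z"
    and "\<mu> \<in> {1, 2} \<Longrightarrow> i \<in> {1..4} \<Longrightarrow> j \<in> {1..4} \<Longrightarrow> i < j \<Longrightarrow> z \<in> overlap {i, j} \<Longrightarrow>
      mixed_relation a A \<mu> i j z \<longleftrightarrow> d_tot A {i, j} {\<mu>} z = Ob {i, j} {\<mu>} z"
    and "i \<in> {1..4} \<Longrightarrow> j \<in> {1..4} \<Longrightarrow> k \<in> {1..4} \<Longrightarrow> i < j \<Longrightarrow> j < k \<Longrightarrow> z \<in> overlap {i, j, k} \<Longrightarrow>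
      triple_relation a A i j k z \<longleftrightarrow> d_tot A {i, j, k} {} z = Ob {i, j, k} {} z"
  using assms unfolding obstruction_cochain_def by blast+

text \<open>At a given point, second-order data are chosen whose differential equals the first
  candidate; the relation then holds there, and the second candidate must have the same
  value.\<close>

lemma obstruction_cochain_unique:
  assumes Ob: "obstruction_cochain a Ob" and Ob': "obstruction_cochain a Ob'"
  shows "Ob = Ob'"
proof (rule cochain_eqI[of _ 2])
  show "Ob \<in> cochains_deg 2" "Ob' \<in> cochains_deg 2"
    using assms by (simp_all add: obstruction_cochain_def)
  fix I K z assume IK: "index_pair I K" "card I + card K = 2 + 1" and z: "z \<in> overlap I"
  have IK3: "card I + card K = 3" using IK(2) by simp
  obtain A where A: "A \<in> cochains_deg 1" "d_tot A I K z = Ob I K z"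
    using d_tot_degree_two_onto[OF IK(1) IK3 z] .
  note D = obstruction_cochainD[OF Ob A(1)] and D' = obstruction_cochainD[OF Ob' A(1)]
  from IK(1) IK3 show "Ob I K z = Ob' I K z"
  proof (cases rule: degree_two_cases)
    case (1 j)
    note z = z[unfolded 1(2)]
    show ?thesis using A(2) D(1)[OF 1(1) z] D'(1)[OF 1(1) z] unfolding 1(2,3) by simp
  next
    case (2 i j \<mu>)
    note z = z[unfolded 2(5)]
    show ?thesis using A(2) D(2)[OF 2(4,1,2,3) z] D'(2)[OF 2(4,1,2,3) z] unfolding 2(5,6) by simp
  next
    case (3 i j k)
    note z = z[unfolded 3(6)]
    show ?thesis using A(2) D(3)[OF 3(1-5) z] D'(3)[OF 3(1-5) z] unfolding 3(6,7) by simp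
  qed
qed

lemma ob2_eq: "obstruction_cochain a Ob \<Longrightarrow> ob2 a = cls Ob"
  unfolding ob2_def using obstruction_cochain_unique by (metis the_equality)

lemma d_tot_eq_iff:
  assumes Ob: "Ob \<in> cochains_deg 2" and A: "A \<in> cochains_deg 1"
  shows "d_tot A = Ob \<longleftrightarrow>
    (\<forall>I K z. index_pair I K \<and> card I + card K = 3 \<and> z \<in> overlap I \<longrightarrow> d_tot A I K z = Ob I K z)"
proof (intro iffI)
  assume R: "\<forall>I K z. index_pair I K \<and> card I + card K = 3 \<and> z \<in> overlap I \<longrightarrow> d_tot A I K z = Ob I K z"
  show "d_tot A = Ob"
  proof (intro ext)
    fix I K z
    show "d_tot A I K z = Ob I K z"
    proof (cases "card I + card K = 3")
      case True
      show ?thesis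
      proof (cases "index_pair I K \<and> z \<in> overlap I")
        case True
        with R \<open>card I + card K = 3\<close> show ?thesis by blast
      next
        case False
        then have "Ob I K z = 0"
          using Ob by (intro cochains_outside) (simp_all add: cochains_deg_def)
        then show ?thesis using False by (auto simp: d_tot_def)
      qed
    next
      case False
      then have "Ob I K = 0" using Ob by (simp add: cochains_deg_def)
      moreover have "d_tot A I K = 0" using False by (intro d_tot_degree[OF A]) simp
      ultimately show ?thesis by simp
    qed
  qed
qed simp

lemma second_order_data_iff:
  assumes Ob: "obstruction_cochain a Ob" and A: "A \<in> cochains_deg 1"
  shows "second_order_data a A \<longleftrightarrow> d_tot A = Ob"
proof -
  note D = obstruction_cochainD[OF Ob A]
  have Ob2: "Ob \<in> cochains_deg 2" using Ob by (simp add: obstruction_cochain_def)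
  show ?thesis
  proof
    assume S: "second_order_data a A"
    show "d_tot A = Ob" unfolding d_tot_eq_iff[OF Ob2 A]
    proof (intro allI impI, elim conjE)
      fix I K z assume IK: "index_pair I K" "card I + card K = 3" and z: "z \<in> overlap I"
      from IK show "d_tot A I K z = Ob I K z"
      proof (cases rule: degree_two_cases)
        case (1 j)
        note z = z[unfolded 1(2)]
        have "deck_relation a A j z" using S 1(1) z unfolding second_order_data_def by blast
        then show ?thesis unfolding D(1)[OF 1(1) z] 1(2,3) .
      next
        case (2 i j \<mu>)
        note z = z[unfolded 2(5)]
        have "mixed_relation a A \<mu> i j z" using S 2(1-4) z unfolding second_order_data_def by blast
        then show ?thesis unfolding D(2)[OF 2(4,1,2,3) z] 2(5,6) .
      next
        case (3 i j k)
        note z = z[unfolded 3(6)]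
        have "triple_relation a A i j k z" using S 3(1-5) z unfolding second_order_data_def by blast
        then show ?thesis unfolding D(3)[OF 3(1-5) z] 3(6,7) .
      qed
    qed
  next
    assume "d_tot A = Ob"
    then show "second_order_data a A" unfolding second_order_data_def
      by (intro conjI ballI impI) (simp_all only: D)
  qed
qed

text \<open>A lift is a degree-one primitive of the obstruction cochain, while
  \<open>coboundaries\<close> allows primitives with components in all degrees; the two agree
  because the differential is homogeneous.\<close>

lemma lifts_iff_coboundary:
  assumes Ob: "obstruction_cochain a Ob"
  shows "lifts_to_second_order a \<longleftrightarrow> Ob \<in> coboundaries"
proof -
  have Ob2: "Ob \<in> cochains_deg 2" using Ob by (simp add: obstruction_cochain_def)
  have "lifts_to_second_order a \<longleftrightarrow> (\<exists>A\<in>cochains_deg 1. second_order_data a A)"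
    unfolding lifts_to_second_order_def second_order_data_def ..
  also have "\<dots> \<longleftrightarrow> (\<exists>A\<in>cochains_deg 1. d_tot A = Ob)"
    by (rule bex_cong[OF refl second_order_data_iff[OF Ob]])
  also have "\<dots> \<longleftrightarrow> Ob \<in> coboundaries"
  proof
    assume "\<exists>A\<in>cochains_deg 1. d_tot A = Ob"
    then show "Ob \<in> coboundaries" unfolding coboundaries_def cochains_deg_def by blast
  next
    assume "Ob \<in> coboundaries"
    then obtain e where e: "e \<in> cochains" "Ob = d_tot e" unfolding coboundaries_def by blast
    \<comment> \<open>Truncation to total degree one, that is \<open>card I + card K = 2\<close>
      because the Cech degree is one less than \<open>card I\<close>.\<close>
    define A where "A = (\<lambda>I K. if card I + card K = 2 then e I K else 0)"
    have A: "A \<in> cochains_deg 1"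
      using e(1) by (simp add: A_def cochains_deg_def cochains_def zero_in_Theta)
    have "d_tot A = Ob" unfolding d_tot_eq_iff[OF Ob2 A]
    proof (intro allI impI, elim conjE)
      fix I K z assume IK: "index_pair I K" "card I + card K = 3" and z: "z \<in> overlap I"
      have fin: "finite I" "finite K" using IK(1) by (auto simp: index_pair_def intro: finite_subset)
      have 1: "A (I - {i}) K = e (I - {i}) K" if "i \<in> I" for i
        using card_Suc_Diff1[OF fin(1) that] IK(2) by (simp add: A_def)
      have 2: "A I (K - {\<mu>}) = e I (K - {\<mu>})" if "\<mu> \<in> K" for \<mu>
        using card_Suc_Diff1[OF fin(2) that] IK(2) by (simp add: A_def)
      show "d_tot A I K z = Ob I K z" unfolding e(2) d_tot_def by (simp add: 1 2)
    qed
    with A show "\<exists>A\<in>cochains_deg 1. d_tot A = Ob" by blast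
  qed
  finally show ?thesis .
qed

section \<open>The primary obstruction\<close>

text \<open>The data of the two fields are indexed by the generator, so that one computation covers
  both mixed relations.\<close>

locale square_class =
  fixes M :: "nat \<Rightarrow> complex ^ 2 ^ 2" and b c :: "nat \<Rightarrow> complex" and p :: "nat \<Rightarrow> complex ^ 3" and s :: complex
begin

definition N :: "nat \<Rightarrow> vfield" where
  "N \<mu> = normal_field (M \<mu>) (b \<mu>) (c \<mu>) (p \<mu>)"

abbreviation a :: cochain where
  "a \<equiv> alpha_cocycle (N 1) (N 2) s"

definition bracket_term :: "nat \<Rightarrow> vfield" where
  "bracket_term \<mu> z = (- ell (N \<mu>)) *s WW z + remainder_x (M \<mu>) (p \<mu>) z + remainder_y (M \<mu>) (p \<mu>) z"

definition Ob :: cochain where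
  "Ob = (\<lambda>I K. if index_pair I K \<and> card I = 1 \<and> K = {1, 2} then restrict_vf (overlap I) (lie_bracket (N 1) (N 2))
     else if index_pair I K \<and> card I = 2 \<and> card K = 1
     then restrict_vf (overlap I) (\<lambda>z. (s * eta_coeff I) *s bracket_term (the_elem K) z)
     else 0)"

definition corr :: cochain where
  "corr = (\<lambda>I K. if index_pair I K \<and> card I = 1 \<and> card K = 1
     then restrict_vf (overlap I) (\<lambda>z.
       (s * chart_scalar (the_elem I)) *s remainder_x (M (the_elem K)) (p (the_elem K)) z
       + (s * (chart_scalar (the_elem I) - 1)) *s remainder_y (M (the_elem K)) (p (the_elem K)) z)
     else 0)"

lemma a_single:
  assumes "j \<in> {1..4}" "\<mu> \<in> {1, 2}"
  shows "a {j} {\<mu>} = restrict_vf (overlap {j}) (N \<mu>)"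
proof -
  have "index_pair {j} {\<mu>}" using assms by (auto simp: index_pair_def)
  then show ?thesis using assms(2) by (auto simp: alpha_cocycle_eq_harm harm_def fields1_def)
qed

lemma a_pair:
  assumes "i \<in> {1..4}" "j \<in> {1..4}" "i < j"
  shows "a {i, j} {} = restrict_vf (overlap {i, j}) (\<lambda>z. (s * eta_coeff {i, j}) *s WW z)"
proof -
  have "index_pair {i, j} {}" using assms by (auto simp: index_pair_def)
  then show ?thesis using assms(3) by (simp add: alpha_cocycle_eq_harm harm_def scalars1_def)
qed

lemma N_global: "N \<mu> \<in> global_fields"
  unfolding N_def by (rule normal_field_global)

lemma nonzero_if_inverted:
  assumes "{1, 3} \<subseteq> inverted I" "I \<noteq> {}" "z \<in> overlap I"
  shows "z $ 1 \<noteq> 0" "z $ 3 \<noteq> 0"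
  using assms by (auto simp: overlap_eq_nzdom[OF assms(2)] nzdom_def)

lemma Ob_cochains: "Ob \<in> cochains_deg 2"
proof -
  have "Ob I K \<in> Theta (overlap I)" if IK: "index_pair I K" for I K
  proof -
    have I: "I \<noteq> {}" using IK by (simp add: index_pair_def)
    have 1: "restrict_vf (overlap I) (lie_bracket (N 1) (N 2)) \<in> Theta (overlap I)"
      by (rule restrict_in_Theta[OF global_fields_Theta[OF lie_bracket_global[OF N_global N_global]]
            open_overlap[OF I] overlap_subset_UU])
    have 2: "restrict_vf (overlap I) (\<lambda>z. (s * eta_coeff I) *s bracket_term \<mu> z) \<in> Theta (overlap I)"
      if "card I = 2" for \<mu>
      using eta_coeff_or_inverted[OF IK that]
    proof
      assume "eta_coeff I = 0"
      then have "restrict_vf (overlap I) (\<lambda>z. (s * eta_coeff I) *s bracket_term \<mu> z) = 0"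
        by (simp add: restrict_vf_def fun_eq_iff)
      then show ?thesis by (simp only: zero_in_Theta)
    next
      assume inv: "{1, 3} \<subseteq> inverted I"
      show ?thesis
      proof (rule Theta_if_cdiff[OF open_overlap[OF I]])
        fix z k assume "z \<in> overlap I"
        note nz = nonzero_if_inverted[OF inv I this]
        show "cdiff (\<lambda>z. ((s * eta_coeff I) *s bracket_term \<mu> z) $ k) z"
          unfolding bracket_term_def vector_smult_component vector_add_component
          by (intro cdiff_mult cdiff_add cdiff_const cdiff_WW cdiff_remainder_x cdiff_remainder_y nz)
      qed
    qed
    show ?thesis unfolding Ob_def using 1 2 by (simp add: zero_in_Theta)
  qed
  moreover have "Ob I K = 0" if "\<not> index_pair I K" for I K using that by (simp add: Ob_def)
  moreover have "Ob I K = 0" if "card I + card K \<noteq> 3" for I K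
    using that by (auto simp: Ob_def)
  ultimately show ?thesis unfolding cochains_deg_def cochains_def by simp
qed

text \<open>On charts 1 and 2 the scalar is 0, so only the remainder in y survives, and y is
  invertible there; on charts 3 and 4 only the remainder in x survives, with x invertible.\<close>

lemma corr_cochains: "corr \<in> cochains_deg 1"
proof -
  have "corr I K \<in> Theta (overlap I)" if IK: "index_pair I K" for I K
  proof (cases "card I = 1 \<and> card K = 1")
    case True
    then obtain j where j: "I = {j}" by (auto elim: card_1_singletonE)
    have j4: "j \<in> {1, 2, 3, 4}" using IK by (auto simp: index_pair_def j)
    have "restrict_vf (overlap {j}) (\<lambda>z. (s * chart_scalar j) *s remainder_x (M \<mu>) (p \<mu>) z
       + (s * (chart_scalar j - 1)) *s remainder_y (M \<mu>) (p \<mu>) z) \<in> Theta (overlap {j})" for \<mu>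
    proof (rule Theta_if_cdiff)
      show "open (overlap {j})" by (rule open_overlap) simp
      fix z k assume z: "z \<in> overlap {j}"
      show "cdiff (\<lambda>z. ((s * chart_scalar j) *s remainder_x (M \<mu>) (p \<mu>) z
       + (s * (chart_scalar j - 1)) *s remainder_y (M \<mu>) (p \<mu>) z) $ k) z"
      proof (cases "j = 1 \<or> j = 2")
        case True
        then have cs: "chart_scalar j = 0" by (auto simp: chart_scalar_def)
        have nz: "z $ 3 \<noteq> 0" using z True by (auto simp: overlap_eq_nzdom nzdom_def)
        show ?thesis unfolding cs vector_smult_component vector_add_component mult_zero_right mult_zero_left
          by (intro cdiff_mult cdiff_add cdiff_const cdiff_remainder_y nz)
      next
        case False
        then have cs: "chart_scalar j = 1" by (auto simp: chart_scalar_def)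
        have nz: "z $ 1 \<noteq> 0" using z False j4 by (auto simp: overlap_eq_nzdom nzdom_def)
        show ?thesis unfolding cs vector_smult_component vector_add_component diff_self mult_zero_right mult_zero_left
          by (intro cdiff_mult cdiff_add cdiff_const cdiff_remainder_x nz)
      qed
    qed
    then show ?thesis using True IK by (simp add: corr_def j)
  next
    case False
    then show ?thesis by (auto simp: corr_def zero_in_Theta)
  qed
  moreover have "corr I K = 0" if "\<not> index_pair I K" for I K using that by (simp add: corr_def)
  moreover have "corr I K = 0" if "card I + card K \<noteq> 2" for I K
    using that by (auto simp: corr_def)
  ultimately show ?thesis unfolding cochains_deg_def cochains_def by simp
qed

lemma corr_single:
  assumes "j \<in> {1..4}" "\<mu> \<in> {1, 2}" "z \<in> overlap {j}"
  shows "corr {j} {\<mu>} z = (s * chart_scalar j) *s remainder_x (M \<mu>) (p \<mu>) z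
       + (s * (chart_scalar j - 1)) *s remainder_y (M \<mu>) (p \<mu>) z"
proof -
  have "index_pair {j} {\<mu>}" using assms(1,2) by (auto simp: index_pair_def)
  then show ?thesis using assms(3) by (simp add: corr_def restrict_vf_def)
qed

lemma pullback_corr:
  assumes "j \<in> {1..4}" "\<mu> \<in> {1, 2}" "\<nu> \<in> {1, 2}" "z \<in> overlap {j}"
  shows "pullback \<nu> (corr {j} {\<mu>}) z = corr {j} {\<mu>} z"
proof -
  have d: "deck \<nu> z \<in> overlap {j}" using assms(4) by (simp add: deck_in_overlap)
  have "corr {j} {\<mu>} (deck \<nu> z) = deck \<nu> (corr {j} {\<mu>} z)"
    unfolding corr_single[OF assms(1,2,4)] corr_single[OF assms(1,2) d]
    by (simp only: remainder_deck[OF assms(3)] deck_linear)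
  then show ?thesis by (simp add: pullback_def)
qed

lemma eta_coeff_pair: "i < j \<Longrightarrow> eta_coeff {i, j} = chart_scalar j - chart_scalar i"
  by (simp add: eta_coeff_def)

lemma Ob_single:
  "j \<in> {1..4} \<Longrightarrow> z \<in> overlap {j} \<Longrightarrow> Ob {j} {1, 2} z = lie_bracket (N 1) (N 2) z"
  by (simp add: Ob_def index_pair_def restrict_vf_def)

lemma Ob_pair:
  assumes "i \<in> {1..4}" "j \<in> {1..4}" "i < j" "\<mu> \<in> {1, 2}" "z \<in> overlap {i, j}"
  shows "Ob {i, j} {\<mu>} z = (s * eta_coeff {i, j}) *s bracket_term \<mu> z"
proof -
  have "index_pair {i, j} {\<mu>}" using assms by (auto simp: index_pair_def)
  then show ?thesis using assms(3,5) by (simp add: Ob_def restrict_vf_def)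
qed

lemma Ob_triple: "i < j \<Longrightarrow> j < k \<Longrightarrow> Ob {i, j, k} {} z = 0"
  by (simp add: Ob_def)

abbreviation beta :: cochain where
  "beta \<equiv> beta_cocycle (lie_bracket (N 1) (N 2)) (- (s * ell (N 1))) (- (s * ell (N 2)))"

lemma beta_single: "j \<in> {1..4} \<Longrightarrow> z \<in> overlap {j} \<Longrightarrow> beta {j} {1, 2} z = lie_bracket (N 1) (N 2) z"
  by (simp add: beta_cocycle_eq_harm harm_def fields2_def index_pair_def restrict_vf_def)

lemma beta_pair:
  assumes "i \<in> {1..4}" "j \<in> {1..4}" "i < j" "\<mu> \<in> {1, 2}" "z \<in> overlap {i, j}"
  shows "beta {i, j} {\<mu>} z = (- (s * ell (N \<mu>)) * eta_coeff {i, j}) *s WW z"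
proof -
  have "index_pair {i, j} {\<mu>}" using assms by (auto simp: index_pair_def)
  then show ?thesis using assms(3-5)
    by (auto simp: beta_cocycle_eq_harm harm_def scalars2_def restrict_vf_def)
qed

lemma beta_triple: "i < j \<Longrightarrow> j < k \<Longrightarrow> beta {i, j, k} {} z = 0"
  by (simp add: beta_cocycle_eq_harm harm_def)

lemma beta_deg: "beta \<in> cochains_deg 2"
  using beta_cocycles[OF lie_bracket_global[OF N_global N_global]] unfolding cocycles_def by blast

lemma diff_deg: "Ob - beta \<in> cochains_deg 2"
  using Ob_cochains beta_deg cochains_diff[of Ob beta]
  unfolding cochains_deg_def by simp

text \<open>The deck component vanishes by invariance of the remainders. In the difference over a
  pair of charts the shift by - 1 in front of the y-remainder cancels, so both remainders appear
  with the same factor, the difference of the chart scalars.\<close>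

lemma d_tot_corr: "d_tot corr = Ob - beta"
  unfolding d_tot_eq_iff[OF diff_deg corr_cochains]
proof (intro allI impI, elim conjE)
  fix I K z assume IK: "index_pair I K" "card I + card K = 3" and z: "z \<in> overlap I"
  have cc: "corr \<in> cochains" using corr_cochains by (simp add: cochains_deg_def)
  have z0: "corr I' K' = 0" if "card I' \<noteq> 1" for I' K' using that by (simp add: corr_def)
  have pb: "pullback \<mu> 0 z = 0" for \<mu> z by (simp add: pullback_def inv_deck_def vec_eq_iff)
  have m: "1 \<in> {1, 2 :: nat}" "2 \<in> {1, 2 :: nat}" by auto
  from IK show "d_tot corr I K z = (Ob - beta) I K z"
  proof (cases rule: degree_two_cases)
    case (1 j)
    note z = z[unfolded 1(2)]
    show ?thesis unfolding 1(2,3) d_tot_deck[OF cc 1(1) z] fun_diff_def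
      unfolding pullback_corr[OF 1(1) m z] pullback_corr[OF 1(1) m(2,1) z] Ob_single[OF 1(1) z] beta_single[OF 1(1) z]
      by simp
  next
    case (2 i j \<mu>)
    note z = z[unfolded 2(5)]
    have zi: "z \<in> overlap {i}" and zj: "z \<in> overlap {j}" using z by (auto simp: overlap_def)
    have c2: "corr {i, j} {} = 0" using 2(3) by (intro z0) simp
    show ?thesis
      unfolding 2(5,6) d_tot_mixed[OF 2(1-4) z] fun_diff_def c2 pb corr_single[OF 2(1,4) zi] corr_single[OF 2(2,4) zj]
        Ob_pair[OF 2(1-4) z] beta_pair[OF 2(1-4) z] eta_coeff_pair[OF 2(3)] bracket_term_def
      by (simp add: vec_eq_iff algebra_simps)
  next
    case (3 i j k)
    note z = z[unfolded 3(6)]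
    have "corr {j, k} {} = 0" "corr {i, k} {} = 0" "corr {i, j} {} = 0" using 3(4,5) by (auto intro!: z0)
    then show ?thesis
      unfolding 3(6,7) d_tot_triple[OF 3(1-5) z] fun_diff_def Ob_triple[OF 3(4,5)] beta_triple[OF 3(4,5)] by simp
  qed
qed

lemma cls_Ob: "cls Ob = cls beta"
proof -
  have "Ob - beta \<in> coboundaries"
    unfolding coboundaries_def d_tot_corr[symmetric] using corr_cochains by (simp add: cochains_deg_def)
  then show ?thesis by (simp add: cls_eq_iff)
qed

lemma tame_a_single:
  assumes "j \<in> {1..4}" "\<mu> \<in> {1, 2}"
  shows "tame (overlap {j}) (a {j} {\<mu>}) (dnormal (M \<mu>) (b \<mu>) (c \<mu>) (p \<mu>))"
  unfolding a_single[OF assms] unfolding N_def by (rule tame_normal_field) simp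

lemma tame_a_pair:
  assumes "i \<in> {1..4}" "j \<in> {1..4}" "i < j"
  shows "tame (overlap {i, j}) (a {i, j} {}) (\<lambda>z h. (s * eta_coeff {i, j}) *s dWW z h)"
  unfolding a_pair[OF assms]
proof (rule tame_WW)
  have ip: "index_pair {i, j} {}" using assms by (auto simp: index_pair_def)
  have "card {i, j} = 2" using assms(3) by simp
  from eta_coeff_or_inverted[OF ip this] show "s * eta_coeff {i, j} = 0 \<or> {1, 3} \<subseteq> inverted {i, j}" by auto
qed simp

lemma cochains_deg_Theta:
  assumes "A \<in> cochains_deg q" "index_pair I K"
  shows "A I K \<in> Theta (overlap I)"
  using assms by (simp add: cochains_deg_def cochains_def)

text \<open>Each relation has been converted into an equation for arbitrary second-order data, so
  the right-hand sides assemble to the obstruction cochain without any lift having to exist.\<close>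

lemma obstruction: "obstruction_cochain a Ob"
  unfolding obstruction_cochain_def
proof (intro conjI ballI impI Ob_cochains, goal_cases deck mixed triple)
  case (deck A j z)
  have m: "1 \<in> {1, 2 :: nat}" "2 \<in> {1, 2 :: nat}" by auto
  have ip: "index_pair {j} {1}" "index_pair {j} {2}" using deck(2) by (auto simp: index_pair_def)
  have U: "z \<in> UU" using deck(3) overlap_subset_UU by blast
  have val: "a {j} {1} z = N 1 z" "a {j} {2} z = N 2 z"
    unfolding a_single[OF deck(2) m(1)] a_single[OF deck(2) m(2)] using deck(3) by (simp_all add: restrict_vf_def)
  have A: "A \<in> cochains" using deck(1) by (simp add: cochains_deg_def)
  show ?case
    unfolding deck_relation_iff[where a = a and A = A, OF deck(3) tame_a_single[OF deck(2) m(1)] tame_a_single[OF deck(2) m(2)]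
        cochains_deg_Theta[OF deck(1) ip(1)] cochains_deg_Theta[OF deck(1) ip(2)]]
      d_tot_deck[OF A deck(2,3)] Ob_single[OF deck(2,3)] val
    unfolding N_def lie_bracket_normal_field[OF U] ..
next
  case (mixed A \<mu> i j z)
  note i = mixed(3) and j = mixed(4) and ij = mixed(5) and \<mu> = mixed(2) and z = mixed(6)
  have ip: "index_pair {j} {\<mu>}" "index_pair {i, j} {\<mu>}" "index_pair {i, j} {}" using i j \<mu> by (auto simp: index_pair_def)
  have zi: "z \<in> overlap {i}" and zj: "z \<in> overlap {j}" using z by (auto simp: overlap_def)
  have U: "z \<in> UU" using z overlap_subset_UU by blast
  let ?L = "dnormal (M \<mu>) (b \<mu>) (c \<mu>) (p \<mu>)"
  have ti: "tame (overlap {i, j}) (a {i} {\<mu>}) ?L"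
    by (rule tame_mono[OF tame_a_single[OF i \<mu>]]) (auto simp: overlap_def)
  have tj: "tame (overlap {i, j}) (a {j} {\<mu>}) ?L"
    by (rule tame_mono[OF tame_a_single[OF j \<mu>]]) (auto simp: overlap_def)
  have val: "a {i} {\<mu>} z = N \<mu> z" "a {j} {\<mu>} z = N \<mu> z" "a {i, j} {} z = (s * eta_coeff {i, j}) *s WW z"
    unfolding a_single[OF i \<mu>] a_single[OF j \<mu>] a_pair[OF i j ij] using zi zj z by (simp_all add: restrict_vf_def)
  have eq: "a {i} {\<mu>} z = a {j} {\<mu>} z" by (simp only: val)
  have card2: "card {i, j} = 2" using ij by simp
  have "?L z ((s * eta_coeff {i, j}) *s WW z) - (s * eta_coeff {i, j}) *s dWW z (N \<mu> z)
    = (s * eta_coeff {i, j}) *s bracket_term \<mu> z"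
    using eta_coeff_or_inverted[OF ip(2) card2]
  proof
    \<comment> \<open>W may be singular at this point, but it enters only with coefficient zero, and
      both sides vanish.\<close>
    assume "eta_coeff {i, j} = 0"
    then show ?thesis unfolding dnormal_scale by simp
  next
    assume "{1, 3} \<subseteq> inverted {i, j}"
    note nz = nonzero_if_inverted[OF this _ z, simplified]
    have "?L z (WW z) - dWW z (N \<mu> z) = bracket_term \<mu> z"
      unfolding N_def bracket_term_def by (rule bracket_WW[OF U nz])
    then show ?thesis unfolding dnormal_scale by (simp add: vector_ssub_ldistrib[symmetric])
  qed
  then show ?case
    unfolding mixed_relation_iff[where a = a and A = A, OF \<mu> z ti tj eq tame_a_pair[OF i j ij]
        cochains_deg_Theta[OF mixed(1) ip(1)] cochains_deg_Theta[OF mixed(1) ip(3)]]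
      d_tot_mixed[OF i j ij \<mu> z] Ob_pair[OF i j ij \<mu> z] val
    by simp
next
  case (triple A i j k z)
  note i = triple(2) and j = triple(3) and k = triple(4) and z = triple(6)
  have ij: "i < j" and jk: "j < k" using triple(5) by auto
  have ik: "i < k" using ij jk by simp
  have zz: "z \<in> overlap {i, j}" "z \<in> overlap {j, k}" "z \<in> overlap {i, k}" using z by (auto simp: overlap_def)
  have ip: "index_pair {j, k} {}" using j k by (auto simp: index_pair_def)
  have t: "tame (overlap {i, j, k}) (a {i, j} {}) (\<lambda>z h. (s * eta_coeff {i, j}) *s dWW z h)"
    "tame (overlap {i, j, k}) (a {j, k} {}) (\<lambda>z h. (s * eta_coeff {j, k}) *s dWW z h)"
    "tame (overlap {i, j, k}) (a {i, k} {}) (\<lambda>z h. (s * eta_coeff {i, k}) *s dWW z h)"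
    by (rule tame_mono[OF tame_a_pair[OF i j ij]], force simp: overlap_def,
        rule tame_mono[OF tame_a_pair[OF j k jk]], force simp: overlap_def,
        rule tame_mono[OF tame_a_pair[OF i k ik]], force simp: overlap_def)
  have val: "a {i, j} {} z = (s * eta_coeff {i, j}) *s WW z" "a {j, k} {} z = (s * eta_coeff {j, k}) *s WW z"
    "a {i, k} {} z = (s * eta_coeff {i, k}) *s WW z"
    unfolding a_pair[OF i j ij] a_pair[OF j k jk] a_pair[OF i k ik] using zz by (simp_all add: restrict_vf_def)
  have first: "a {j, k} {} z + a {i, j} {} z = a {i, k} {} z"
    unfolding val eta_coeff_pair[OF ij] eta_coeff_pair[OF jk] eta_coeff_pair[OF ik]
    by (simp add: vec_eq_iff algebra_simps)
  have L: "(s * eta_coeff {j, k}) *s dWW z (a {i, j} {} z) = 0" "(s * eta_coeff {i, j}) *s dWW z (a {i, j} {} z) = 0"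
    "(s * eta_coeff {j, k}) *s dWW z (a {j, k} {} z) = 0" "(s * eta_coeff {i, k}) *s dWW z (a {i, k} {} z) = 0"
    unfolding val dWW_scaled_WW by simp_all
  show ?case
    unfolding triple_relation_iff[where a = a and A = A, OF z t L first cochains_deg_Theta[OF triple(1) ip]]
      d_tot_triple[OF i j k ij jk z] Ob_triple[OF ij jk] ..
qed

lemma ob2_alpha: "ob2 a = cls beta"
  unfolding ob2_eq[OF obstruction] by (rule cls_Ob)

lemma beta_cocycle_zero: "beta_cocycle 0 0 0 = 0"
  by (simp add: beta_cocycle_eq_harm harm_def fields2_def scalars2_def restrict_vf_def fun_eq_iff)

text \<open>The decomposition of the second cohomology is direct, so the obstruction class vanishes
  exactly when each of its components does. Zero is written as a class with zero data to bring it
  under \<open>beta_injective\<close>.\<close>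

lemma lifts_alpha_iff:
  "lifts_to_second_order a \<longleftrightarrow> lie_bracket (N 1) (N 2) = 0 \<and> s * ell (N 1) = 0 \<and> s * ell (N 2) = 0"
proof -
  have "lifts_to_second_order a \<longleftrightarrow> cls Ob = cls (beta_cocycle 0 0 0)"
    unfolding lifts_iff_coboundary[OF obstruction] cls_eq_iff beta_cocycle_zero by simp
  also have "\<dots> \<longleftrightarrow> cls beta = cls (beta_cocycle 0 0 0)" by (simp only: cls_Ob)
  also have "\<dots> \<longleftrightarrow> lie_bracket (N 1) (N 2) = 0 \<and> - (s * ell (N 1)) = 0 \<and> - (s * ell (N 2)) = 0"
    (is "?P \<longleftrightarrow> ?Q")
  proof
    assume ?P
    then show ?Q by (rule beta_injective[OF lie_bracket_global[OF N_global N_global] zero_global])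
  next
    assume ?Q
    then show ?P by (elim conjE) (simp only:)
  qed
  finally show ?thesis by simp
qed

end

section \<open>Transfer to arbitrary global fields\<close>

lemma global_pair_normal_form:
  assumes "V1 \<in> global_fields" "V2 \<in> global_fields"
  obtains M b c p where "V1 = square_class.N M b c p 1" "V2 = square_class.N M b c p 2"
proof -
  obtain M1 b1 c1 p1 where 1: "V1 = normal_field M1 b1 c1 p1" using global_field_normal_form[OF assms(1)] .
  obtain M2 b2 c2 p2 where 2: "V2 = normal_field M2 b2 c2 p2" using global_field_normal_form[OF assms(2)] .
  show thesis
    by (rule that[of "\<lambda>\<mu>. if \<mu> = 1 then M1 else M2" "\<lambda>\<mu>. if \<mu> = 1 then b1 else b2"
          "\<lambda>\<mu>. if \<mu> = 1 then c1 else c2" "\<lambda>\<mu>. if \<mu> = 1 then p1 else p2"])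
      (simp_all add: square_class.N_def 1 2)
qed

lemma ob2_alpha_cocycle:
  assumes "V1 \<in> global_fields" "V2 \<in> global_fields"
  shows "ob2 (alpha_cocycle V1 V2 s) = vf_class (lie_bracket V1 V2) {1, 2}
        - s *\<^sub>H (ell V1 *\<^sub>H eta_class {1} + ell V2 *\<^sub>H eta_class {2})"
proof -
  obtain M b c p where V: "V1 = square_class.N M b c p 1" "V2 = square_class.N M b c p 2"
    using global_pair_normal_form[OF assms] .
  show ?thesis
    unfolding V square_class.ob2_alpha cls_beta coh.scale_right_distrib coh.scale_scale coh.scale_minus_left
    by simp
qed

lemma lifts_to_second_order_alpha_iff:
  assumes "V1 \<in> global_fields" "V2 \<in> global_fields"
  shows "lifts_to_second_order (alpha_cocycle V1 V2 s) \<longleftrightarrow>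
         lie_bracket V1 V2 = 0 \<and> s * ell V1 = 0 \<and> s * ell V2 = 0"
proof -
  obtain M b c p where V: "V1 = square_class.N M b c p 1" "V2 = square_class.N M b c p 2"
    using global_pair_normal_form[OF assms] .
  show ?thesis unfolding V by (rule square_class.lifts_alpha_iff)
qed

lemma ex_not_lifts:
  "\<exists>V1\<in>global_fields. \<exists>V2\<in>global_fields. \<exists>s. \<not> lifts_to_second_order (alpha_cocycle V1 V2 s)"
proof (intro bexI exI)
  \<comment> \<open>The witness is u d/du on the first generator and 0 on the second, with s = 1:
    the bracket vanishes, but ell(u d/du) = - 1.\<close>
  show "\<not> lifts_to_second_order (alpha_cocycle (normal_field 0 1 0 0) 0 1)"
    unfolding lifts_to_second_order_alpha_iff[OF normal_field_global zero_global] ell_normal_field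
    by (simp add: trace_def)
qed (rule zero_global normal_field_global)+

theorem theorem21p5:
  "bij_betw (\<lambda>(V1, V2, s). vf_class V1 {1} + vf_class V2 {2} + s *\<^sub>H eta_class {})
     (global_fields \<times> global_fields \<times> UNIV) (HH 1) \<and>
   bij_betw (\<lambda>(V, t1, t2). vf_class V {1, 2} + (t1 *\<^sub>H eta_class {1} + t2 *\<^sub>H eta_class {2}))
     (global_fields \<times> UNIV \<times> UNIV) (HH 2) \<and>
   (\<forall>V1\<in>global_fields. \<forall>V2\<in>global_fields. \<forall>s.
      alpha_cocycle V1 V2 s \<in> cocycles 1 \<and>
      cls (alpha_cocycle V1 V2 s) =
        vf_class V1 {1} + vf_class V2 {2} + s *\<^sub>H eta_class {} \<and>
      lie_bracket V1 V2 \<in> global_fields \<and>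
      ob2 (alpha_cocycle V1 V2 s) =
        vf_class (lie_bracket V1 V2) {1, 2}
        - s *\<^sub>H (ell V1 *\<^sub>H eta_class {1} + ell V2 *\<^sub>H eta_class {2}) \<and>
      (lifts_to_second_order (alpha_cocycle V1 V2 s) \<longleftrightarrow>
         lie_bracket V1 V2 = 0 \<and> s * ell V1 = 0 \<and> s * ell V2 = 0)) \<and>
   (\<exists>V1\<in>global_fields. \<exists>V2\<in>global_fields. \<exists>s.
      \<not> lifts_to_second_order (alpha_cocycle V1 V2 s)) \<and>
   range KS \<subseteq> HH 1 \<and>
   coh.dim (range KS) = 8 \<and>
   quotient_dim (HH 1) (range KS) 11"
proof (intro conjI ballI allI HH1_bij HH2_bij alpha_cocycles cls_alpha lie_bracket_global
    ob2_alpha_cocycle lifts_to_second_order_alpha_iff ex_not_lifts KS_rank)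
qed

end
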